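(* Let $R$ be a finite group and let $N$ be a non-identity proper normal subgroup of $R$. Then the set $$\{S\subseteq R \mid S=S^{-1},\ R=\mathbf{N}_{\mathrm{Aut}(\Gamma(R,S))}(R),\ \exists f\in \mathbf{N}_{\mathrm{Aut}(\Gamma(R,S))}(N)\text{ with } f\ne 1,\ 1^f=1,\ f\text{ fixes each }N\text{-orbit setwise}\}$$ has cardinality at most $2^{\mathbf{c}(R)-\frac{|R|}{192|N|}+(\log_2|R|)^2+3}$. Moreover, if $R$ is neither abelian of exponent greater than $2$ nor generalised dicyclic, then the same upper bound holds for the set obtained by dropping the condition $R=\mathbf{N}_{\mathrm{Aut}(\Gamma(R,S))}(R)$ from the definition of the set.
   Context: For a finite group $R$ and an inverse-closed subset $S=S^{-1}\subseteq R$, the Cayley graph $\Gamma(R,S)$ has vertex set $R$ and $\{r,t\}$ is an edge if and only if $tr^{-1}\in S$. $\mathrm{Aut}(\Gamma(R,S))$ is the group of permutations of $R$ preserving the edge set. $R$ is identified with its right regular representation, a regular subgroup of $\mathrm{Aut}(\Gamma(R,S))$; correspondingly a subgroup $N\le R$ is identified with a subgroup of $\mathrm{Aut}(\Gamma(R,S))$ (acting by right multiplication), and the $N$-orbits on $R$ are the cosets of $N$. $\mathbf{N}_G(H)$ denotes the normaliser of $H$ in $G$. For a permutation $f$ of $R$ and $x\in R$, $x^f$ is the image of $x$ under $f$; in "$1^f=1$", $1$ is the vertex given by the identity element of $R$. Let $\mathbf{I}(R)=\{x\in R\mid o(x)\le 2\}$, where $o(x)$ is the order of $x$, and $\mathbf{c}(R)=\frac{|R|+|\mathbf{I}(R)|}{2}$.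 A group is generalised dicyclic if it is isomorphic to $\mathrm{Dic}(A,y,x)=\langle A,x\mid x^2=y,\ a^x=a^{-1}\ \forall a\in A\rangle$ for some abelian group $A$ of even order and exponent greater than $2$ and some involution $y\in A$. *)

theory Defs
  imports Complex_Main "HOL-Algebra.Group_Action" "HOL-Algebra.Multiplicative_Group"
begin

section \<open>Cayley graphs and their automorphism groups\<close>

text \<open>The connection set may contain the identity; this puts a loop, represented by the
  singleton edge \<open>{r}\<close>, at every vertex and does not change the automorphism group.\<close>

definition cayley_edges :: "('a, 'b) monoid_scheme \<Rightarrow> 'a set \<Rightarrow> 'a set set" where
  "cayley_edges R S =
     {{r, t} | r t. r \<in> carrier R \<and> t \<in> carrier R \<and> t \<otimes>\<^bsub>R\<^esub> inv\<^bsub>R\<^esub> r \<in> S}"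

definition cayley_aut :: "('a, 'b) monoid_scheme \<Rightarrow> 'a set \<Rightarrow> ('a \<Rightarrow> 'a) monoid" where
  "cayley_aut R S = BijGroup (carrier R)
     \<lparr>carrier := {f \<in> Bij (carrier R). (`) f ` cayley_edges R S = cayley_edges R S}\<rparr>"

text \<open>The permutations \<open>x \<mapsto> x g\<close> for \<open>g \<in> H\<close>.  Since \<^const>\<open>BijGroup\<close> composes
  functions from right to left, \<open>g \<mapsto> (x \<mapsto> x g)\<close> is an antihomomorphism; its image, and hence
  the normaliser of the image, do not depend on this convention.\<close>

definition right_regular :: "('a, 'b) monoid_scheme \<Rightarrow> 'a set \<Rightarrow> ('a \<Rightarrow> 'a) set" where
  "right_regular R H = (\<lambda>g. \<lambda>x \<in> carrier R. x \<otimes>\<^bsub>R\<^esub> g) ` H"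

definition right_orbits :: "('a, 'b) monoid_scheme \<Rightarrow> 'a set \<Rightarrow> 'a set set" where
  "right_orbits R H =
     orbits (BijGroup (carrier R)\<lparr>carrier := right_regular R H\<rparr>) (carrier R) (\<lambda>f. f)"

section \<open>Numerical invariants\<close>

definition invol_set :: "('a, 'b) monoid_scheme \<Rightarrow> 'a set" where
  "invol_set R = {x \<in> carrier R. group.ord R x \<le> 2}"

definition c_num :: "('a, 'b) monoid_scheme \<Rightarrow> real" where
  "c_num R = (real (order R) + real (card (invol_set R))) / 2"

definition group_exponent :: "('a, 'b) monoid_scheme \<Rightarrow> nat" where
  "group_exponent R = Lcm (group.ord R ` carrier R)"

section \<open>Group presentations\<close>

text \<open>A word is a list of signed generators: \<open>(g, True)\<close> stands for \<open>g\<close> and \<open>(g, False)\<close> for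
  its formal inverse.  A relation \<open>l = r\<close> is given as the pair \<open>(l, r)\<close> of words.\<close>

type_synonym 'g word = "('g \<times> bool) list"

abbreviation words :: "'g set \<Rightarrow> 'g word set" where
  "words Gs \<equiv> lists (Gs \<times> UNIV)"

inductive_set pres_rel :: "'g set \<Rightarrow> ('g word \<times> 'g word) set \<Rightarrow> ('g word \<times> 'g word) set"
  for Gs :: "'g set" and E :: "('g word \<times> 'g word) set" where
  refl: "w \<in> words Gs \<Longrightarrow> (w, w) \<in> pres_rel Gs E"
| sym: "(v, w) \<in> pres_rel Gs E \<Longrightarrow> (w, v) \<in> pres_rel Gs E"
| trans: "(u, v) \<in> pres_rel Gs E \<Longrightarrow> (v, w) \<in> pres_rel Gs E \<Longrightarrow> (u, w) \<in> pres_rel Gs E"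
| cancel: "u \<in> words Gs \<Longrightarrow> v \<in> words Gs \<Longrightarrow> g \<in> Gs \<Longrightarrow>
    (u @ [(g, e), (g, \<not> e)] @ v, u @ v) \<in> pres_rel Gs E"
| relation: "u \<in> words Gs \<Longrightarrow> v \<in> words Gs \<Longrightarrow> l \<in> words Gs \<Longrightarrow> r \<in> words Gs \<Longrightarrow> (l, r) \<in> E \<Longrightarrow>
    (u @ l @ v, u @ r @ v) \<in> pres_rel Gs E"

definition presented_group :: "'g set \<Rightarrow> ('g word \<times> 'g word) set \<Rightarrow> 'g word set monoid" where
  "presented_group Gs E =
     \<lparr>carrier = words Gs // pres_rel Gs E,
      mult = \<lambda>P Q. \<Union>u \<in> P. \<Union>v \<in> Q. pres_rel Gs E `` {u @ v},
      one = pres_rel Gs E `` {[]}\<rparr>"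

section \<open>Generalised dicyclic groups\<close>

text \<open>The presentation \<open>\<langle>A, x | x\<^sup>2 = y, x\<^sup>-\<^sup>1 a x = a\<^sup>-\<^sup>1 (a \<in> A)\<rangle>\<close>, where the relations of \<open>A\<close> are
  those of its multiplication table.  The generator \<open>x\<close> is \<^const>\<open>None\<close>, and \<open>a \<in> A\<close> is
  \<open>Some a\<close>.\<close>

definition Dic :: "('a, 'b) monoid_scheme \<Rightarrow> 'a \<Rightarrow> 'a option word set monoid" where
  "Dic A y = presented_group (insert None (Some ` carrier A))
     ({([(Some a, True), (Some b, True)], [(Some (a \<otimes>\<^bsub>A\<^esub> b), True)]) | a b.
          a \<in> carrier A \<and> b \<in> carrier A}
      \<union> {([(None, True), (None, True)], [(Some y, True)])}
      \<union> {([(None, False), (Some a, True), (None, True)], [(Some a, False)]) | a.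
          a \<in> carrier A})"

text \<open>It is no restriction to take the elements of \<open>A\<close> in the same type as those of \<open>R\<close>,
  because \<open>A\<close> embeds into \<open>Dic A y\<close>.\<close>

definition generalised_dicyclic :: "('a, 'b) monoid_scheme \<Rightarrow> bool" where
  "generalised_dicyclic R \<longleftrightarrow>
     (\<exists>(A :: 'a monoid) y. comm_group A \<and> finite (carrier A) \<and> even (order A) \<and>
        group_exponent A > 2 \<and> y \<in> carrier A \<and> group.ord A y = 2 \<and> R \<cong> Dic A y)"

section \<open>The sets of connection sets to be counted\<close>

definition has_nontrivial_normalising_aut ::
    "('a, 'b) monoid_scheme \<Rightarrow> 'a set \<Rightarrow> 'a set \<Rightarrow> bool" where
  "has_nontrivial_normalising_aut R N S \<longleftrightarrow>
     (\<exists>f \<in> normalizer (cayley_aut R S) (right_regular R N).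
        f \<noteq> \<one>\<^bsub>cayley_aut R S\<^esub> \<and> f \<one>\<^bsub>R\<^esub> = \<one>\<^bsub>R\<^esub> \<and> (\<forall>B \<in> right_orbits R N. f ` B = B))"

end

(* Let f be a nontrivial automorphism of the Cayley graph of S that normalises N and fixes 1 and
   every coset of N.  As f(1) = 1, normalising N means f(x n) = f(x) f(n) for n in N.  Conjugating f
   by right translations gives maps y |-> f(y u) f(u)^-1 with the same properties, which depend on
   the coset N u only; f is an automorphism of R if and only if all of them equal f.

   Such an S is determined up to few possibilities by a guess and by local data.  The guess is an
   endomorphism of R, an endomorphism of N together with at most two elements, or a proper subgroup
   of R together with at most one element; there are at most 2^((log |R|)^2) of each kind.  Given
   the guess, on a positive proportion of the blocks (unions of N x and N x^-1) only a fraction less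
   than 1 of the inverse-closed subsets can be the trace of S, and multiplying over the blocks gives
   the saving |R| / (192 |N|).

   If all squares lie in N, then the 2-group R/N acts on the group of all f by the above
   conjugation.  If that group has even order, some f is an automorphism of R.  If it has odd
   order, no f swaps two vertices, which again restricts the traces of S.
   If some square lies outside N, then this is true for at least a quarter of the elements, and S is
   restricted on their blocks, each of which consists of two cosets.

   An automorphism of R saves less than claimed only if it maps more than 95/96 of the elements to
   themselves or to their inverses.  This forces R to be abelian of exponent greater than 2 or
   generalised dicyclic, and then some nontrivial automorphism of R preserves every inverse-closed S,
   so that the normaliser of R is never R and the first set is empty. *)

theory Submission
  imports Defs
begin

text \<open>The obstacle: f need not be an automorphism of R, and its values on different cosets of
  N are a priori unrelated. But on one coset f is determined by its restriction to N and one value,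
  so after guessing this restriction a union bound over |N| maps is affordable in every coset
  separately. It needs |N| >= 7; for smaller N one excludes explicit traces instead, singletons or
  pairs {y, inv y}, among the at most 2^6 subsets of a coset. If all squares lie in N, cosets are
  closed under inversion, a moved point saves only a quarter of a bit instead of half a bit, and the
  union bound in one coset need not suffice. Therefore f is replaced by the composite h of f^-1 with
  a conjugate of f by a translation x, which is tied down by one value on two cosets at once. The
  constant 192 = 12 * 2 * 8 is dictated by \<open>noninvolutory_family_le\<close>: a twelfth of the
  elements is usable, a block has two cosets, and eight factors 29/32 are needed to gain a factor
  1/2. The summand 3 absorbs a union of three families.\<close>

section \<open>Subsets forced to agree on pairs of points\<close>

text \<open>\<open>cls x\<close> is the atom of x: the points that no member of the family separates
  from x. Every member is a union of atoms, so the family has at most 2^(number of atoms) members,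
  and a weight that is at least 1 on each atom bounds that number. The next two lemmas only choose
  the weight.\<close>

lemma card_saturated_le:
  fixes X :: "'a set" and \<U> :: "'a set set" and w :: "'a \<Rightarrow> real"
  defines "cls \<equiv> \<lambda>x. {y \<in> X. \<forall>T\<in>\<U>. y \<in> T \<longleftrightarrow> x \<in> T}"
  assumes fin: "finite X" and sub: "\<U> \<subseteq> Pow X"
    and big: "\<And>x. x \<in> X \<Longrightarrow> 1 \<le> (\<Sum>y\<in>cls x. w y)"
  shows "real (card \<U>) \<le> 2 powr (\<Sum>x\<in>X. w x)"
proof -
  let ?C = "cls ` X"
  have self: "x \<in> cls x" if "x \<in> X" for x using that by (auto simp: cls_def)
  have eq: "cls y = cls x" if "y \<in> cls x" for x y using that by (auto simp: cls_def)
  have finC: "finite ?C" using fin by simp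
  have inj: "inj_on (\<lambda>T. {c\<in>?C. c \<subseteq> T}) \<U>"
  proof (rule inj_onI)
    fix T T' assume T: "T \<in> \<U>" "T' \<in> \<U>" and e: "{c\<in>?C. c \<subseteq> T} = {c\<in>?C. c \<subseteq> T'}"
    have *: "x \<in> A \<longleftrightarrow> (x \<in> X \<and> cls x \<subseteq> A)" if "A \<in> \<U>" for x A
      using that sub self[of x] by (auto simp: cls_def)
    have "x \<in> T \<longleftrightarrow> x \<in> T'" for x
    proof (cases "x \<in> X")
      case True
      then have c: "cls x \<in> ?C" by (rule imageI)
      have "cls x \<in> {c\<in>?C. c \<subseteq> T} \<longleftrightarrow> cls x \<in> {c\<in>?C. c \<subseteq> T'}" by (simp only: e)
      then have "cls x \<subseteq> T \<longleftrightarrow> cls x \<subseteq> T'" using c by simp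
      then show ?thesis using *[OF T(1), of x] *[OF T(2), of x] by simp
    next
      case False
      then show ?thesis using T sub by auto
    qed
    then show "T = T'" by auto
  qed
  have "card \<U> = card ((\<lambda>T. {c\<in>?C. c \<subseteq> T}) ` \<U>)" using card_image[OF inj] by simp
  also have "\<dots> \<le> card (Pow ?C)" by (rule card_mono) (use finC in auto)
  also have "\<dots> = 2 ^ card ?C" by (simp add: card_Pow finC)
  finally have 1: "real (card \<U>) \<le> 2 powr real (card ?C)"
    by (metis of_nat_le_iff of_nat_numeral of_nat_power powr_realpow zero_less_numeral)
  have un: "\<Union>?C = X" using self by (auto simp: cls_def)
  have dis: "A \<inter> B = {}" if "A \<in> ?C" "B \<in> ?C" "A \<noteq> B" for A B
    using that eq by blast
  have "real (card ?C) = (\<Sum>c\<in>?C. 1)" by simp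
  also have "\<dots> \<le> (\<Sum>c\<in>?C. \<Sum>y\<in>c. w y)" by (rule sum_mono) (use big in auto)
  also have "\<dots> = sum w (\<Union>?C)"
    by (subst sum.Union_disjoint) (use dis fin in \<open>auto simp: cls_def\<close>)
  also have "\<dots> = (\<Sum>x\<in>X. w x)" by (simp only: un)
  finally have 2: "real (card ?C) \<le> (\<Sum>x\<in>X. w x)" .
  show ?thesis by (rule order_trans[OF 1 powr_mono[OF 2]]) simp
qed

text \<open>Weight 1 off D and 1/2 on D: an atom that meets D has at least two points, so its weight
  is still at least 1.\<close>

lemma card_invariant_subsets_le:
  assumes fin: "finite X" and sub: "\<U> \<subseteq> Pow X" and D: "D \<subseteq> X"
    and moved: "\<And>x. x \<in> D \<Longrightarrow> \<exists>y\<in>X. y \<noteq> x \<and> (\<forall>T\<in>\<U>. y \<in> T \<longleftrightarrow> x \<in> T)"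
  shows "real (card \<U>) \<le> 2 powr (real (card X) - real (card D) / 2)"
proof -
  let ?cls = "\<lambda>x. {y \<in> X. \<forall>T\<in>\<U>. y \<in> T \<longleftrightarrow> x \<in> T}"
  let ?w = "\<lambda>y. 1 - (if y \<in> D then 1/2 else 0) :: real"
  have "real (card \<U>) \<le> 2 powr (\<Sum>x\<in>X. ?w x)"
  proof (rule card_saturated_le[where w = ?w, OF fin sub])
    fix x assume x: "x \<in> X"
    have fc: "finite (?cls x)" using fin by simp
    show "1 \<le> (\<Sum>y\<in>?cls x. ?w y)"
    proof (cases "?cls x \<inter> D = {}")
      case True
      have "(\<Sum>y\<in>{x}. ?w y) \<le> (\<Sum>y\<in>?cls x. ?w y)"
        by (rule sum_mono2) (use fc x in auto)
      moreover have "x \<notin> D" using True x by auto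
      ultimately show ?thesis by simp
    next
      case False
      then obtain z where z: "z \<in> ?cls x" "z \<in> D" by blast
      from moved[OF z(2)] obtain y where y: "y \<in> X" "y \<noteq> z" "\<forall>T\<in>\<U>. y \<in> T \<longleftrightarrow> z \<in> T" by blast
      have "(\<Sum>y\<in>{z,y}. ?w y) \<le> (\<Sum>y\<in>?cls x. ?w y)"
        by (rule sum_mono2) (use fc y z in auto)
      moreover have "1 \<le> (\<Sum>y\<in>{z,y}. ?w y)" using y(2) by simp
      ultimately show ?thesis by linarith
    qed
  qed
  also have "(\<Sum>x\<in>X. ?w x) = real (card X) - (\<Sum>x\<in>X. if x \<in> D then 1/2 else 0)"
    by (simp add: sum_subtractf)
  also have "(\<Sum>x\<in>X. if x \<in> D then 1/2 else 0 :: real) = (\<Sum>x\<in>D. 1/2)"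
    by (rule sum.mono_neutral_cong_right) (use fin D in auto)
  also have "(\<Sum>x\<in>D. 1/2 :: real) = real (card D) / 2" by simp
  finally show ?thesis .
qed

text \<open>The weight \<open>?v\<close> gives every orbit of i total weight 1. An atom that meets D
  contains two orbits, hence has weight at least 2, and since \<open>?v\<close> is nowhere below
  1/2, taking 1/4 off the points of D at most halves it. So a moved point saves 1/4 here, against
  1/2 without i.\<close>

lemma card_involution_invariant_subsets_le:
  assumes fin: "finite X" and sub: "\<U> \<subseteq> Pow X" and D: "D \<subseteq> X"
    and inv: "\<And>x. x \<in> X \<Longrightarrow> i x \<in> X" "\<And>x. x \<in> X \<Longrightarrow> i (i x) = x"
    and closed: "\<And>x T. T \<in> \<U> \<Longrightarrow> x \<in> T \<Longrightarrow> i x \<in> T"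
    and moved: "\<And>x. x \<in> D \<Longrightarrow> \<exists>y\<in>X. y \<noteq> x \<and> y \<noteq> i x \<and> (\<forall>T\<in>\<U>. y \<in> T \<longleftrightarrow> x \<in> T)"
  shows "real (card \<U>)
    \<le> 2 powr ((real (card X) + real (card {x\<in>X. i x = x})) / 2 - real (card D) / 4)"
proof -
  let ?cls = "\<lambda>x. {y \<in> X. \<forall>T\<in>\<U>. y \<in> T \<longleftrightarrow> x \<in> T}"
  let ?v = "\<lambda>y. 1/2 + (if i y = y then 1/2 else 0) :: real"
  let ?d = "\<lambda>y. (if y \<in> D then 1/4 else 0) :: real"
  let ?w = "\<lambda>y. ?v y - ?d y"
  have memi: "i y \<in> ?cls x" if "y \<in> ?cls x" for x y
  proof -
    have y: "y \<in> X" using that by simp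
    have "i y \<in> T \<longleftrightarrow> y \<in> T" if "T \<in> \<U>" for T
      using closed[OF that, of y] closed[OF that, of "i y"] inv(2)[OF y] by auto
    then show ?thesis using that inv(1)[OF y] by auto
  qed
  have "real (card \<U>) \<le> 2 powr (\<Sum>x\<in>X. ?w x)"
  proof (rule card_saturated_le[where w = ?w, OF fin sub])
    fix x assume x: "x \<in> X"
    have fc: "finite (?cls x)" using fin by simp
    have pair: "(\<Sum>y\<in>{z, i z}. ?v y) = 1" if "z \<in> X" for z
      using inv(2)[OF that] by (cases "i z = z") auto
    show "1 \<le> (\<Sum>y\<in>?cls x. ?w y)"
    proof (cases "?cls x \<inter> D = {}")
      case True
      have "(\<Sum>y\<in>{x, i x}. ?w y) \<le> (\<Sum>y\<in>?cls x. ?w y)"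
      proof (rule sum_mono2[OF fc])
        show "{x, i x} \<subseteq> ?cls x" using memi[of x x] x by blast
        show "0 \<le> ?w b" for b by simp
      qed
      moreover have "(\<Sum>y\<in>{x, i x}. ?w y) = (\<Sum>y\<in>{x, i x}. ?v y)"
      proof (rule sum.cong[OF HOL.refl])
        fix y assume "y \<in> {x, i x}"
        then have "y \<in> ?cls x" using memi[of x x] x by blast
        then have "y \<notin> D" using True by blast
        then show "?w y = ?v y" by simp
      qed
      ultimately show ?thesis using pair[OF x] by simp
    next
      case False
      then obtain z where z: "z \<in> ?cls x" "z \<in> D" by blast
      from moved[OF z(2)] obtain y
        where y: "y \<in> X" "y \<noteq> z" "y \<noteq> i z" "\<forall>T\<in>\<U>. y \<in> T \<longleftrightarrow> z \<in> T"
        by blast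
      have yc: "y \<in> ?cls x" using y z by auto
      have zX: "z \<in> X" using z by auto
      have dj: "{z, i z} \<inter> {y, i y} = {}"
      proof -
        have "i y \<noteq> i z" using y(2) inv(2)[OF zX] inv(2)[OF y(1)] by metis
        moreover have "i y \<noteq> z" using y(3) inv(2)[OF y(1)] by metis
        ultimately show ?thesis using y(2,3) by auto
      qed
      have "2 = (\<Sum>y\<in>{z, i z}. ?v y) + (\<Sum>y\<in>{y, i y}. ?v y)"
        using pair[OF zX] pair[OF y(1)] by linarith
      also have "\<dots> = (\<Sum>y\<in>{z, i z} \<union> {y, i y}. ?v y)"
        by (rule sum.union_disjoint[symmetric]) (use dj in auto)
      also have "\<dots> \<le> (\<Sum>y\<in>?cls x. ?v y)"
      proof (rule sum_mono2[OF fc])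
        show "{z, i z} \<union> {y, i y} \<subseteq> ?cls x"
          by (simp only: Un_subset_iff insert_subset empty_subsetI simp_thms
              z(1) yc memi[OF z(1)] memi[OF yc])
      qed simp
      finally have 2: "2 \<le> (\<Sum>y\<in>?cls x. ?v y)" .
      have "(\<Sum>y\<in>?cls x. ?v y) / 2 = (\<Sum>y\<in>?cls x. ?v y / 2)" by (rule sum_divide_distrib)
      also have "\<dots> \<le> (\<Sum>y\<in>?cls x. ?w y)" by (rule sum_mono) auto
      finally show ?thesis using 2 by linarith
    qed
  qed
  also have "(\<Sum>x\<in>X. ?w x) = real (card X) / 2 + (\<Sum>x\<in>X. if i x = x then 1/2 else 0)
      - (\<Sum>x\<in>X. ?d x)"
    by (simp add: sum_subtractf sum.distrib)
  also have "(\<Sum>x\<in>X. if i x = x then 1/2 else 0 :: real) = (\<Sum>x\<in>{x\<in>X. i x = x}. 1/2)"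
    by (rule sum.mono_neutral_cong_right) (use fin in auto)
  also have "(\<Sum>x\<in>X. ?d x) = (\<Sum>x\<in>D. 1/4)"
    by (rule sum.mono_neutral_cong_right) (use fin D in auto)
  also have "real (card X) / 2 + (\<Sum>x\<in>{x\<in>X. i x = x}. 1/2) - (\<Sum>x\<in>D. 1/4)
      = (real (card X) + real (card {x\<in>X. i x = x})) / 2 - real (card D) / 4"
    by (simp add: add_divide_distrib)
  finally show ?thesis .
qed

section \<open>Automorphisms inverting many elements\<close>

context group
begin

lemma card_r_coset:
  assumes "H \<subseteq> carrier G" "x \<in> carrier G"
  shows "card (H #> x) = card H"
  using card_rcosets_equal[OF rcosetsI[OF assms] assms(1)] by simp

lemma commutes_inv:
  assumes "a \<in> carrier G" "b \<in> carrier G" "a \<otimes> b = b \<otimes> a"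
  shows "inv b \<otimes> a = a \<otimes> inv b"
proof -
  have "inv b \<otimes> a = inv b \<otimes> (a \<otimes> b) \<otimes> inv b" using assms(1,2) by (simp add: m_assoc)
  also have "\<dots> = inv b \<otimes> (b \<otimes> a) \<otimes> inv b" by (simp only: assms(3))
  also have "\<dots> = a \<otimes> inv b" using assms(1,2) by (simp add: m_assoc[symmetric])
  finally show ?thesis .
qed

text \<open>Otherwise H would contain two disjoint cosets of K, with more than |H| elements
  together.\<close>

lemma subgroup_eq_if_majority:
  assumes K: "subgroup K G" and H: "subgroup H G" and sub: "K \<subseteq> H" and fin: "finite H"
    and big: "card H < 2 * card K"
  shows "K = H"
proof (rule ccontr)
  assume "K \<noteq> H"
  then obtain h where h: "h \<in> H" "h \<notin> K" using sub by blast
  have hc: "h \<in> carrier G" using h subgroup.mem_carrier[OF H] by blast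
  have KH: "K #> h \<subseteq> H"
    using h sub subgroup.m_closed[OF H] by (auto simp: r_coset_def)
  have "K \<inter> (K #> h) = {}"
  proof (rule ccontr)
    assume "K \<inter> (K #> h) \<noteq> {}"
    then obtain k where k: "k \<in> K" "k \<otimes> h \<in> K" by (auto simp: r_coset_def)
    then have "inv k \<otimes> (k \<otimes> h) \<in> K" using K by (meson subgroup_def)
    then show False
      using h k hc subgroup.mem_carrier[OF K] by (simp add: m_assoc[symmetric])
  qed
  then have "card (K \<union> (K #> h)) = card K + card (K #> h)"
    by (intro card_Un_disjoint) (use fin sub KH finite_subset in auto)
  also have "\<dots> = 2 * card K" using card_r_coset[OF subgroup.subset[OF K] hc] by simp
  finally have "2 * card K \<le> card H"
    using card_mono[OF fin, of "K \<union> (K #> h)"] sub KH by simp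
  then show False using big by simp
qed

text \<open>In an abelian group the elements that a homomorphism inverts form a subgroup, and a
  subgroup with more than half of the elements is everything.\<close>

lemma hom_inverting_majority_comm:
  assumes H: "subgroup H G" and fin: "finite H"
    and hom: "\<And>a b. a \<in> H \<Longrightarrow> b \<in> H \<Longrightarrow> \<theta> (a \<otimes> b) = \<theta> a \<otimes> \<theta> b"
    and comm: "\<And>a b. a \<in> H \<Longrightarrow> b \<in> H \<Longrightarrow> a \<otimes> b = b \<otimes> a"
    and closed: "\<And>a. a \<in> H \<Longrightarrow> \<theta> a \<in> carrier G"
    and big: "card H < 2 * card {a\<in>H. \<theta> a = inv a}"
    and a: "a \<in> H"
  shows "\<theta> a = inv a"
proof -
  let ?A = "{a\<in>H. \<theta> a = inv a}"
  have c: "x \<in> carrier G" if "x \<in> H" for x using that subgroup.mem_carrier[OF H] by blast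
  have one: "\<one> \<in> H" using subgroup.one_closed[OF H] .
  have "\<theta> \<one> \<otimes> \<theta> \<one> = \<theta> \<one>" using hom[OF one one] by simp
  then have t1: "\<theta> \<one> = \<one>" using closed[OF one] by (simp add: l_cancel_one')
  have "subgroup ?A G"
  proof (rule subgroupI)
    show "?A \<subseteq> carrier G" using c by auto
    show "?A \<noteq> {}" using one t1 by auto
    fix a assume a: "a \<in> ?A"
    have ia: "inv a \<in> H" using a subgroup.m_inv_closed[OF H] by simp
    have "\<theta> a \<otimes> \<theta> (inv a) = \<one>" using hom[of a "inv a"] a ia t1 c by simp
    then have "inv a \<otimes> \<theta> (inv a) = \<one>" using a by simp
    then have "a \<otimes> (inv a \<otimes> \<theta> (inv a)) = a" using a c by simp
    then have "\<theta> (inv a) = a" using a c closed[OF ia] by (simp add: m_assoc[symmetric])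
    then show "inv a \<in> ?A" using ia a c by simp
    fix b assume b: "b \<in> ?A"
    have ab: "a \<otimes> b \<in> H" using a b subgroup.m_closed[OF H] by simp
    have "\<theta> (a \<otimes> b) = inv a \<otimes> inv b" using hom a b by simp
    also have "\<dots> = inv (b \<otimes> a)" using a b c by (simp add: inv_mult_group)
    also have "\<dots> = inv (a \<otimes> b)" using a b comm by simp
    finally show "a \<otimes> b \<in> ?A" using ab by simp
  qed
  then have "?A = H" by (rule subgroup_eq_if_majority[OF _ H _ fin big]) simp
  then show ?thesis using a by blast
qed

text \<open>For an inverted element a, more than half of the b in H are such that b and a b are both
  inverted, and comparing \<theta> (a b) with the inverse of a b shows that these b commute with a.
  So every inverted element is central, the centre is a majority and hence H, and the abelian case
  applies.\<close>

lemma hom_inverting_three_quarters: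
  assumes H: "subgroup H G" and fin: "finite H"
    and hom: "\<And>a b. a \<in> H \<Longrightarrow> b \<in> H \<Longrightarrow> \<theta> (a \<otimes> b) = \<theta> a \<otimes> \<theta> b"
    and closed: "\<And>a. a \<in> H \<Longrightarrow> \<theta> a \<in> carrier G"
    and big: "3 * card H < 4 * card {a\<in>H. \<theta> a = inv a}"
  shows "\<forall>a\<in>H. \<theta> a = inv a" "\<forall>a\<in>H. \<forall>b\<in>H. a \<otimes> b = b \<otimes> a"
proof -
  let ?A = "{a\<in>H. \<theta> a = inv a}"
  have c: "x \<in> carrier G" if "x \<in> H" for x using that subgroup.mem_carrier[OF H] by blast
  have finA: "finite ?A" using fin by simp
  have central: "a \<otimes> h = h \<otimes> a" if a: "a \<in> ?A" and h: "h \<in> H" for a h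
  proof -
    have aH: "a \<in> H" using a by simp
    let ?B = "{b\<in>?A. a \<otimes> b \<in> ?A}" and ?C = "{b\<in>H. a \<otimes> b = b \<otimes> a}"
    let ?A' = "(\<lambda>b. inv a \<otimes> b) ` ?A"
    have A': "?A' \<subseteq> H" using aH subgroup.m_closed[OF H] subgroup.m_inv_closed[OF H] by auto
    have "inj_on (\<lambda>b. inv a \<otimes> b) ?A" using aH c by (auto intro!: inj_onI)
    then have cA': "card ?A' = card ?A" by (rule card_image)
    have "card (?A \<union> ?A') + card (?A \<inter> ?A') = card ?A + card ?A'"
      using card_Un_Int[of ?A ?A'] finA by simp
    moreover have "card (?A \<union> ?A') \<le> card H" by (rule card_mono[OF fin]) (use A' in auto)
    moreover have "?A \<inter> ?A' \<subseteq> ?C"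
    proof
      fix b assume "b \<in> ?A \<inter> ?A'"
      then obtain d where b: "b \<in> ?A" and d: "d \<in> ?A" "b = inv a \<otimes> d" by auto
      have "a \<otimes> b = d" using d aH c by (simp add: m_assoc[symmetric])
      then have ab: "a \<otimes> b \<in> ?A" using d by simp
      have "inv a \<otimes> inv b = \<theta> (a \<otimes> b)" using hom a b by simp
      also have "\<dots> = inv (a \<otimes> b)" using ab by simp
      also have "\<dots> = inv b \<otimes> inv a" using aH b c by (simp add: inv_mult_group)
      finally have "inv (b \<otimes> a) = inv (a \<otimes> b)" using aH b c by (simp add: inv_mult_group)
      then have "inv (inv (b \<otimes> a)) = inv (inv (a \<otimes> b))" by (simp only:)
      then have "b \<otimes> a = a \<otimes> b" using aH b c by simp
      then show "b \<in> ?C" using b by simp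
    qed
    then have "card (?A \<inter> ?A') \<le> card ?C" by (rule card_mono[rotated]) (use fin in simp)
    ultimately have big2: "card H < 2 * card ?C" using big cA' by linarith
    have "subgroup ?C G"
    proof (rule subgroupI)
      show "?C \<subseteq> carrier G" using c by auto
      show "?C \<noteq> {}" using aH subgroup.one_closed[OF H] c by auto
      fix b assume b: "b \<in> ?C"
      have "inv b \<otimes> a = a \<otimes> inv b" by (rule commutes_inv) (use b aH c in auto)
      then show "inv b \<in> ?C" using b subgroup.m_inv_closed[OF H] by simp
      fix d assume d: "d \<in> ?C"
      have "a \<otimes> (b \<otimes> d) = b \<otimes> a \<otimes> d" using b d aH c by (simp add: m_assoc[symmetric])
      also have "\<dots> = b \<otimes> d \<otimes> a" using b d aH c by (simp add: m_assoc)
      finally show "b \<otimes> d \<in> ?C" using b d subgroup.m_closed[OF H] by simp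
    qed
    then have "?C = H" by (rule subgroup_eq_if_majority[OF _ H _ fin big2]) simp
    then show ?thesis using h by blast
  qed
  let ?Z = "{z\<in>H. \<forall>h\<in>H. z \<otimes> h = h \<otimes> z}"
  have "subgroup ?Z G"
  proof (rule subgroupI)
    show "?Z \<subseteq> carrier G" using c by auto
    show "?Z \<noteq> {}" using subgroup.one_closed[OF H] c by auto
    fix b assume b: "b \<in> ?Z"
    have "inv b \<otimes> h = h \<otimes> inv b" if h: "h \<in> H" for h
    proof (rule commutes_inv)
      show "h \<in> carrier G" "b \<in> carrier G" using b h c by auto
      show "h \<otimes> b = b \<otimes> h" using b h by auto
    qed
    moreover have "inv b \<in> H" using b subgroup.m_inv_closed[OF H] by blast
    ultimately show "inv b \<in> ?Z" by blast
    fix d assume d: "d \<in> ?Z"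
    have "b \<otimes> d \<otimes> h = h \<otimes> (b \<otimes> d)" if h: "h \<in> H" for h
    proof -
      have bc: "b \<in> carrier G" "d \<in> carrier G" "h \<in> carrier G" using b d h c by auto
      have bh: "b \<otimes> h = h \<otimes> b" and dh: "d \<otimes> h = h \<otimes> d" using b d h by auto
      have "b \<otimes> d \<otimes> h = b \<otimes> (d \<otimes> h)" using bc by (simp add: m_assoc)
      also have "\<dots> = b \<otimes> h \<otimes> d" using bc by (simp add: dh m_assoc)
      also have "\<dots> = h \<otimes> (b \<otimes> d)" using bc by (simp add: bh m_assoc)
      finally show ?thesis .
    qed
    moreover have "b \<otimes> d \<in> H" using b d subgroup.m_closed[OF H] by blast
    ultimately show "b \<otimes> d \<in> ?Z" by blast
  qed
  moreover have "card H < 2 * card ?Z"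
  proof -
    have "card ?A \<le> card ?Z"
    proof (rule card_mono)
      show "finite ?Z" using fin by simp
      show "?A \<subseteq> ?Z" using central by blast
    qed
    then show ?thesis using big by linarith
  qed
  ultimately have Z: "?Z = H" by (intro subgroup_eq_if_majority[OF _ H _ fin]) auto
  then show comm: "\<forall>a\<in>H. \<forall>b\<in>H. a \<otimes> b = b \<otimes> a" by blast
  have "card H < 2 * card ?A" using big by linarith
  then show "\<forall>a\<in>H. \<theta> a = inv a"
    using hom_inverting_majority_comm[OF H fin hom _ closed] comm by blast
qed

text \<open>Double counting of the pairs (x, y) with x in W and y in X \<inter> (H #> x): a given y
  lies in \<open>H #> x\<close> for at most |H| elements x. This turns a density estimate in each
  coset into one in the whole group.\<close>

lemma card_coset_intersections_le:
  assumes H: "subgroup H G" and fin: "finite (carrier G)"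
    and W: "W \<subseteq> carrier G" and X: "X \<subseteq> carrier G"
    and est: "\<And>x. x \<in> W \<Longrightarrow> m \<le> k * card (X \<inter> (H #> x))"
  shows "card W * m \<le> k * card X * card H"
proof -
  have fW: "finite W" and fX: "finite X" using W X fin finite_subset by auto
  have HC: "H \<subseteq> carrier G" using subgroup.subset[OF H] .
  have "card W * m = (\<Sum>x\<in>W. m)" by simp
  also have "\<dots> \<le> (\<Sum>x\<in>W. k * card (X \<inter> (H #> x)))" by (rule sum_mono) (rule est)
  also have "\<dots> = k * (\<Sum>x\<in>W. card {y\<in>X. y \<in> H #> x})"
    by (simp add: sum_distrib_left Int_def)
  also have "(\<Sum>x\<in>W. card {y\<in>X. y \<in> H #> x}) = (\<Sum>y\<in>X. card {x\<in>W. y \<in> H #> x})"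
  proof -
    have "(\<Sum>x\<in>W. card {y\<in>X. y \<in> H #> x}) = (\<Sum>x\<in>W. \<Sum>y\<in>X. if y \<in> H #> x then 1 else 0)"
      using fX by (simp add: sum.If_cases Int_def)
    also have "\<dots> = (\<Sum>y\<in>X. \<Sum>x\<in>W. if y \<in> H #> x then 1 else 0)" by (rule sum.swap)
    also have "\<dots> = (\<Sum>y\<in>X. card {x\<in>W. y \<in> H #> x})"
      using fW by (simp add: sum.If_cases Int_def)
    finally show ?thesis .
  qed
  also have "\<dots> \<le> (\<Sum>y\<in>X. card H)"
  proof (rule sum_mono)
    fix y assume y: "y \<in> X"
    have "{x\<in>W. y \<in> H #> x} \<subseteq> H #> y"
    proof
      fix x assume "x \<in> {x\<in>W. y \<in> H #> x}"
      then have x: "x \<in> carrier G" "y \<in> H #> x" using W by auto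
      then have "H #> y = H #> x" using repr_independence[OF _ _ H] by simp
      then show "x \<in> H #> y" using rcos_self[OF x(1) H] by simp
    qed
    moreover have yc: "y \<in> carrier G" using y X by auto
    moreover have "finite (H #> y)"
      by (rule finite_subset[OF r_coset_subset_G[OF HC yc] fin])
    ultimately show "card {x\<in>W. y \<in> H #> x} \<le> card H"
      using card_mono[of "H #> y" "{x\<in>W. y \<in> H #> x}"] card_r_coset[OF HC yc] by simp
  qed
  also have "\<dots> = card X * card H" by simp
  finally show ?thesis by (simp add: mult.assoc)
qed

text \<open>The groups in which fixing \<open>C\<close> pointwise and inverting its complement is a nontrivial
  automorphism.\<close>

definition twisted_dihedral :: "'a set \<Rightarrow> 'a \<Rightarrow> bool" where
  "twisted_dihedral C y \<longleftrightarrow> subgroup C G \<and> y \<in> carrier G \<and> y \<notin> C \<and>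
     (\<forall>x\<in>carrier G. x \<notin> C \<longrightarrow> inv y \<otimes> x \<in> C) \<and>
     (\<forall>a\<in>C. inv y \<otimes> a \<otimes> y = inv a) \<and> y \<otimes> y \<noteq> \<one>"

lemma conj_hom:
  assumes "y \<in> carrier G" "a \<in> carrier G" "b \<in> carrier G"
  shows "inv y \<otimes> (a \<otimes> b) \<otimes> y = (inv y \<otimes> a \<otimes> y) \<otimes> (inv y \<otimes> b \<otimes> y)"
proof -
  have "y \<otimes> (inv y \<otimes> (b \<otimes> y)) = b \<otimes> y" using assms by (simp add: m_assoc[symmetric])
  then show ?thesis using assms by (simp add: m_assoc)
qed

text \<open>The equation \<open>eq\<close> is what f (y \<otimes> a) = inv (y \<otimes> a) says for
  an endomorphism f that inverts y and fixes a.\<close>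

lemma aut_inverts_conj:
  assumes c: "y \<in> carrier G" "a \<in> carrier G" and eq: "inv y \<otimes> a = inv (y \<otimes> a)"
  shows "inv y \<otimes> a \<otimes> y = inv a"
proof -
  have "inv y \<otimes> a \<otimes> y = inv a \<otimes> inv y \<otimes> y" using c eq by (simp add: inv_mult_group)
  also have "\<dots> = inv a" using c by (simp add: m_assoc)
  finally show ?thesis .
qed

text \<open>Let C be the fixed points, I the inverted elements and B the rest. If I exceeds three
  quarters, f is inversion and the group is abelian. Otherwise C is so much larger than B that in
  each coset x C other than C almost all elements are inverted; then conjugation by such an element
  inverts most of C, hence all of it. If C has index 2, this is the twisted dihedral structure. If
  not, an element of C is inverted by x, by y and by inv y \<otimes> x for suitable x and y, so it
  equals its own inverse; then C \<subseteq> I, and I is too large.\<close>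

lemma aut_mostly_fixing_or_inverting:
  assumes fin: "finite (carrier G)"
    and hom: "\<And>a b. a \<in> carrier G \<Longrightarrow> b \<in> carrier G \<Longrightarrow> f (a \<otimes> b) = f a \<otimes> f b"
    and closed: "\<And>a. a \<in> carrier G \<Longrightarrow> f a \<in> carrier G"
    and nontriv: "\<exists>x\<in>carrier G. f x \<noteq> x"
    and bad: "96 * card {x\<in>carrier G. f x \<noteq> x \<and> f x \<noteq> inv x} < card (carrier G)"
  shows "(comm_group G \<and> (\<exists>x\<in>carrier G. x \<otimes> x \<noteq> \<one>)) \<or> (\<exists>C y. twisted_dihedral C y)"
proof -
  let ?C = "{x\<in>carrier G. f x = x}" and ?I = "{x\<in>carrier G. f x = inv x}"
  let ?B = "{x\<in>carrier G. f x \<noteq> x \<and> f x \<noteq> inv x}"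
  \<comment> \<open>So an inverted element outside C has nontrivial square.\<close>
  have sq: "f x = x" if "x \<in> carrier G" "x \<otimes> x = \<one>" "f x = inv x" for x
    using that inv_equality[of x x] by simp
  have sgC: "subgroup ?C G"
  proof (rule subgroupI)
    have "f \<one> \<otimes> f \<one> = f \<one>" using hom[of \<one> \<one>] by simp
    then have f1: "f \<one> = \<one>" using closed[of \<one>] by (simp add: l_cancel_one')
    then show "?C \<noteq> {}" by auto
    fix a assume a: "a \<in> ?C"
    have "f (inv a) \<otimes> f a = \<one>" using hom[of "inv a" a] a f1 by simp
    then have "f (inv a) \<otimes> a = \<one>" using a by simp
    then have "inv a = f (inv a)" using a closed[of "inv a"] by (intro inv_equality) auto
    then show "inv a \<in> ?C" using a by simp
    fix b assume b: "b \<in> ?C"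
    show "a \<otimes> b \<in> ?C" using a b hom by simp
  qed auto
  have mC: "a \<otimes> b \<in> ?C" if "a \<in> ?C" "b \<in> ?C" for a b
    using subgroup.m_closed[OF sgC that] .
  have iC: "inv a \<in> ?C" if "a \<in> ?C" for a
    using subgroup.m_inv_closed[OF sgC that] .
  have finC: "finite ?C" using fin by simp
  show ?thesis
  proof (cases "3 * card (carrier G) < 4 * card ?I")
    case True
    have all: "\<forall>a\<in>carrier G. f a = inv a" "\<forall>a\<in>carrier G. \<forall>b\<in>carrier G. a \<otimes> b = b \<otimes> a"
      using hom_inverting_three_quarters[OF subgroup_self fin hom closed True] by blast+
    obtain x where x: "x \<in> carrier G" "f x \<noteq> x" using nontriv by blast
    then have "x \<otimes> x \<noteq> \<one>" using sq all by blast
    moreover have "comm_group G" by (rule group_comm_groupI) (use all in blast)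
    ultimately show ?thesis using x by blast
  next
    case False
    have "carrier G \<subseteq> ?C \<union> ?I \<union> ?B" by blast
    then have "card (carrier G) \<le> card (?C \<union> ?I \<union> ?B)" by (rule card_mono[rotated]) (use fin in simp)
    also have "\<dots> \<le> card ?C + card ?I + card ?B"
      using card_Un_le[of "?C \<union> ?I" ?B] card_Un_le[of ?C ?I] by linarith
    finally have cover: "card (carrier G) \<le> card ?C + card ?I + card ?B" .
    \<comment> \<open>Cut the group into 96 parts: at most 72 lie in I and less than one in B, so
      more than 23 lie in C.\<close>
    then have big: "23 * card ?B < card ?C" using False bad by linarith
    have key: "\<exists>y. y \<in> ?I \<and> y \<in> x <# ?C \<and> (\<forall>a\<in>?C. inv y \<otimes> a \<otimes> y = inv a) \<and>
        (\<forall>a\<in>?C. \<forall>b\<in>?C. a \<otimes> b = b \<otimes> a)"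
      if x: "x \<in> carrier G" "x \<notin> ?C" for x
    proof -
      have part: "card ?C \<le> card {a\<in>?C. y \<otimes> a \<in> ?I} + card ?B"
        if y: "y \<in> carrier G" "y \<notin> ?C" for y
      proof -
        have "?C \<subseteq> {a\<in>?C. y \<otimes> a \<in> ?I} \<union> {a\<in>?C. y \<otimes> a \<in> ?B}"
        proof
          fix a assume a: "a \<in> ?C"
          have "y \<otimes> a \<notin> ?C"
          proof
            assume "y \<otimes> a \<in> ?C"
            then have "y \<otimes> a \<otimes> inv a \<in> ?C" by (rule mC[OF _ iC[OF a]])
            then show False using a y by (simp add: m_assoc)
          qed
          then show "a \<in> {a\<in>?C. y \<otimes> a \<in> ?I} \<union> {a\<in>?C. y \<otimes> a \<in> ?B}" using a y by auto
        qed
        then have "card ?C \<le> card ({a\<in>?C. y \<otimes> a \<in> ?I} \<union> {a\<in>?C. y \<otimes> a \<in> ?B})"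
          by (rule card_mono[rotated]) (use fin in auto)
        also have "\<dots> \<le> card {a\<in>?C. y \<otimes> a \<in> ?I} + card {a\<in>?C. y \<otimes> a \<in> ?B}" by (rule card_Un_le)
        also have "card {a\<in>?C. y \<otimes> a \<in> ?B} \<le> card ?B"
        proof (rule card_inj_on_le[where f = "\<lambda>a. y \<otimes> a"])
          show "inj_on (\<lambda>a. y \<otimes> a) {a\<in>?C. y \<otimes> a \<in> ?B}" using y by (auto intro!: inj_onI)
        qed (use fin in auto)
        finally show ?thesis by simp
      qed
      have "card {a\<in>?C. x \<otimes> a \<in> ?I} > 0" using part[OF x] big by linarith
      then have "{a\<in>?C. x \<otimes> a \<in> ?I} \<noteq> {}" by (metis card.empty less_irrefl)
      then obtain a where a: "a \<in> ?C" "x \<otimes> a \<in> ?I" by blast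
      let ?y = "x \<otimes> a"
      have yc: "?y \<in> carrier G" using a by simp
      have yx: "?y \<in> x <# ?C" using a by (auto simp: l_coset_def)
      have yC: "?y \<notin> ?C"
      proof
        assume "?y \<in> ?C"
        then have "?y \<otimes> inv a \<in> ?C" by (rule mC[OF _ iC[OF a(1)]])
        then show False using a x by (simp add: m_assoc)
      qed
      let ?A = "{a\<in>?C. inv ?y \<otimes> a \<otimes> ?y = inv a}"
      have "{a\<in>?C. ?y \<otimes> a \<in> ?I} \<subseteq> ?A"
      proof
        fix b assume b: "b \<in> {a\<in>?C. ?y \<otimes> a \<in> ?I}"
        have "inv ?y \<otimes> b = f (?y \<otimes> b)" using b a hom[of ?y b] yc by simp
        also have "\<dots> = inv (?y \<otimes> b)" using b by blast
        finally have "inv ?y \<otimes> b \<otimes> ?y = inv b"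
          by (intro aut_inverts_conj) (use b yc in auto)
        then show "b \<in> ?A" using b by blast
      qed
      then have "card {a\<in>?C. ?y \<otimes> a \<in> ?I} \<le> card ?A" by (rule card_mono[rotated]) (use fin in auto)
      then have "3 * card ?C < 4 * card ?A" using part[OF yc yC] big by linarith
      then have "\<forall>a\<in>?C. inv ?y \<otimes> a \<otimes> ?y = inv a" "\<forall>a\<in>?C. \<forall>b\<in>?C. a \<otimes> b = b \<otimes> a"
      proof -
        assume big3: "3 * card ?C < 4 * card ?A"
        have hm: "inv ?y \<otimes> (b \<otimes> d) \<otimes> ?y = (inv ?y \<otimes> b \<otimes> ?y) \<otimes> (inv ?y \<otimes> d \<otimes> ?y)"
          if "b \<in> ?C" "d \<in> ?C" for b d by (rule conj_hom[OF yc]) (use that in auto)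
        have cl: "inv ?y \<otimes> b \<otimes> ?y \<in> carrier G" if "b \<in> ?C" for b
          using yc that by simp
        show "\<forall>a\<in>?C. inv ?y \<otimes> a \<otimes> ?y = inv a"
          by (rule hom_inverting_three_quarters(1)[OF sgC finC _ _ big3]) (rule hm cl, assumption+)+
        show "\<forall>a\<in>?C. \<forall>b\<in>?C. a \<otimes> b = b \<otimes> a"
          by (rule hom_inverting_three_quarters(2)[OF sgC finC _ _ big3]) (rule hm cl, assumption+)+
      qed
      then show ?thesis using yx a(2) by (intro exI[of _ ?y] conjI)
    qed
    obtain x0 where x0: "x0 \<in> carrier G" "x0 \<notin> ?C" using nontriv by blast
    have comm: "a \<otimes> b = b \<otimes> a" if "a \<in> ?C" "b \<in> ?C" for a b using key[OF x0] that by blast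
    \<comment> \<open>x differs from an element that inverts C only by a factor in C, which is
      abelian; so x inverts C as well.\<close>
    have inverts: "inv x \<otimes> c \<otimes> x = inv c" if x: "x \<in> carrier G" "x \<notin> ?C" and c: "c \<in> ?C" for x c
    proof -
      obtain y where y: "y \<in> ?I" "y \<in> x <# ?C" "\<forall>a\<in>?C. inv y \<otimes> a \<otimes> y = inv a"
        using key[OF x] by blast
      then obtain a where a: "a \<in> ?C" "y = x \<otimes> a" by (auto simp: l_coset_def)
      have cc: "x \<in> carrier G" "a \<in> carrier G" "c \<in> carrier G" using x a c by auto
      have ic: "inv c \<in> ?C" by (rule iC[OF c])
      have ac: "a \<otimes> inv c = inv c \<otimes> a" using comm[OF a(1) ic] .
      have "inv a \<otimes> (inv x \<otimes> c \<otimes> x) \<otimes> a = inv c"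
        using y(3) c a(2) cc by (simp add: inv_mult_group m_assoc)
      then have "a \<otimes> (inv a \<otimes> (inv x \<otimes> c \<otimes> x) \<otimes> a) \<otimes> inv a = a \<otimes> inv c \<otimes> inv a" by simp
      also have "\<dots> = inv c \<otimes> (a \<otimes> inv a)" using cc by (simp only: ac m_assoc inv_closed)
      finally have "a \<otimes> (inv a \<otimes> (inv x \<otimes> c \<otimes> x) \<otimes> a) \<otimes> inv a = inv c" using cc by simp
      moreover have "a \<otimes> (inv a \<otimes> (inv x \<otimes> c \<otimes> x) \<otimes> a) \<otimes> inv a = inv x \<otimes> c \<otimes> x"
      proof -
        have "a \<otimes> (inv a \<otimes> z \<otimes> a) \<otimes> inv a = z" if "z \<in> carrier G" for z
        proof -
          have "a \<otimes> (inv a \<otimes> z \<otimes> a) \<otimes> inv a = (a \<otimes> inv a) \<otimes> z \<otimes> (a \<otimes> inv a)"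
            using that cc by (simp only: m_assoc inv_closed m_closed)
          then show ?thesis using that cc by simp
        qed
        then show ?thesis using cc by simp
      qed
      ultimately show ?thesis by simp
    qed
    show ?thesis
    proof (cases "\<forall>x\<in>carrier G. \<forall>y\<in>carrier G. x \<notin> ?C \<longrightarrow> y \<notin> ?C \<longrightarrow> inv y \<otimes> x \<in> ?C")
      case True
      obtain y where y: "y \<in> ?I" "y \<in> x0 <# ?C" "\<forall>a\<in>?C. inv y \<otimes> a \<otimes> y = inv a"
        using key[OF x0] by blast
      then obtain a where a: "a \<in> ?C" "y = x0 \<otimes> a" by (auto simp: l_coset_def)
      have yC: "y \<notin> ?C"
      proof
        assume "y \<in> ?C"
        then have "y \<otimes> inv a \<in> ?C" by (rule mC[OF _ iC[OF a(1)]])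
        then show False using a x0 by (simp add: m_assoc)
      qed
      have yc: "y \<in> carrier G" using y by simp
      have "y \<otimes> y \<noteq> \<one>" using sq[OF yc] y(1) yC by blast
      moreover have "\<forall>x\<in>carrier G. x \<notin> ?C \<longrightarrow> inv y \<otimes> x \<in> ?C" using True yc yC by blast
      ultimately have "twisted_dihedral ?C y"
        using sgC yc yC y(3) unfolding twisted_dihedral_def by blast
      then show ?thesis by blast
    next
      case F: False
      then obtain x y where xy: "x \<in> carrier G" "y \<in> carrier G" "x \<notin> ?C" "y \<notin> ?C" "inv y \<otimes> x \<notin> ?C"
        by blast
      have iy: "inv y \<notin> ?C"
      proof
        assume "inv y \<in> ?C"
        then have "inv (inv y) \<in> ?C" by (rule iC)
        then show False using xy by simp
      qed
      have "?C \<subseteq> ?I"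
      proof
        fix c assume c: "c \<in> ?C"
        have cc: "c \<in> carrier G" using c by simp
        have 1: "inv (inv y) \<otimes> c \<otimes> inv y = inv c" using inverts[OF _ iy c] xy by simp
        have ic: "inv c \<in> ?C" by (rule iC[OF c])
        have 2: "inv x \<otimes> inv c \<otimes> x = c" using inverts[OF xy(1) xy(3) ic] cc by simp
        have "inv c = inv (inv y \<otimes> x) \<otimes> c \<otimes> (inv y \<otimes> x)"
          using inverts[OF _ xy(5) c] xy by simp
        also have "\<dots> = inv x \<otimes> (inv (inv y) \<otimes> c \<otimes> inv y) \<otimes> x"
          using xy cc by (simp add: inv_mult_group m_assoc)
        also have "\<dots> = c" using 1 2 by simp
        finally show "c \<in> ?I" using c by simp
      qed
      then have "carrier G \<subseteq> ?I \<union> ?B" by blast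
      then have "card (carrier G) \<le> card (?I \<union> ?B)" by (rule card_mono[rotated]) (use fin in simp)
      then have "card (carrier G) \<le> card ?I + card ?B" using card_Un_le[of ?I ?B] by linarith
      then show ?thesis using False bad by linarith
    qed
  qed
qed

text \<open>If y and y a both have square d, then a y a = y, so y inverts a. If this holds for more
  than 3/4 of J, it holds on all of J. The equation y \<otimes> y = d describes the elements that
  right translation by inv d maps to their inverses.\<close>

lemma constant_square_coset_twisted_dihedral:
  assumes fin: "finite (carrier G)" and J: "subgroup J G"
    and idx: "\<And>x y. x \<in> carrier G \<Longrightarrow> y \<in> carrier G \<Longrightarrow> x \<notin> J \<Longrightarrow> y \<notin> J \<Longrightarrow> inv y \<otimes> x \<in> J"
    and d: "d \<noteq> \<one>" and big: "3 * card J < 4 * card {y\<in>carrier G. y \<notin> J \<and> y \<otimes> y = d}"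
  shows "\<exists>C y. twisted_dihedral C y"
proof -
  let ?E = "{y\<in>carrier G. y \<notin> J \<and> y \<otimes> y = d}"
  have Jc: "a \<in> carrier G" if "a \<in> J" for a using that subgroup.mem_carrier[OF J] by blast
  have finJ: "finite J" using fin subgroup.subset[OF J] finite_subset by blast
  have "card ?E > 0" using big by linarith
  then have "?E \<noteq> {}" by (metis card.empty less_irrefl)
  then obtain y where y: "y \<in> carrier G" "y \<notin> J" "y \<otimes> y = d" by blast
  let ?A = "{a\<in>J. inv y \<otimes> a \<otimes> y = inv a}"
  have "card ?E \<le> card ?A"
  proof (rule card_inj_on_le[where f = "\<lambda>x. inv y \<otimes> x"])
    show "inj_on (\<lambda>x. inv y \<otimes> x) ?E" using y by (auto intro!: inj_onI)
    show "finite ?A" using finJ by simp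
    show "(\<lambda>x. inv y \<otimes> x) ` ?E \<subseteq> ?A"
    proof
      fix a assume "a \<in> (\<lambda>x. inv y \<otimes> x) ` ?E"
      then obtain x where x: "x \<in> carrier G" "x \<notin> J" "x \<otimes> x = d" "a = inv y \<otimes> x" by blast
      have aJ: "a \<in> J" using idx x y by blast
      have ac: "a \<in> carrier G" using aJ Jc by blast
      have xa: "x = y \<otimes> a" using x y by (simp add: m_assoc[symmetric])
      have "y \<otimes> (a \<otimes> y \<otimes> a) = y \<otimes> y" using x(3) y ac by (simp add: xa m_assoc)
      then have "a \<otimes> y \<otimes> a = y" by (subst (asm) Units_l_cancel) (use y ac in auto)
      then have "inv y \<otimes> (a \<otimes> y \<otimes> a) = \<one>" using y by simp
      then have "(inv y \<otimes> a \<otimes> y) \<otimes> a = \<one>" using y ac by (simp add: m_assoc)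
      then have "inv a = inv y \<otimes> a \<otimes> y" using y ac by (intro inv_equality) auto
      then have "inv y \<otimes> a \<otimes> y = inv a" by simp
      then show "a \<in> ?A" using aJ by blast
    qed
  qed
  then have "3 * card J < 4 * card ?A" using big by linarith
  then have "\<forall>a\<in>J. inv y \<otimes> a \<otimes> y = inv a"
  proof -
    assume big3: "3 * card J < 4 * card ?A"
    have hm: "inv y \<otimes> (b \<otimes> d) \<otimes> y = (inv y \<otimes> b \<otimes> y) \<otimes> (inv y \<otimes> d \<otimes> y)"
      if "b \<in> J" "d \<in> J" for b d by (rule conj_hom) (use that y Jc in auto)
    have cl: "inv y \<otimes> b \<otimes> y \<in> carrier G" if "b \<in> J" for b
      using y Jc that by simp
    show "\<forall>a\<in>J. inv y \<otimes> a \<otimes> y = inv a"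
      by (rule hom_inverting_three_quarters(1)[OF J finJ _ _ big3]) (rule hm cl, assumption+)+
  qed
  then have "twisted_dihedral J y" unfolding twisted_dihedral_def using J y d idx by auto
  then show ?thesis by blast
qed

end

section \<open>Counting non-involutions, subgroups and endomorphisms\<close>

context group
begin

text \<open>The identity map inverts exactly the elements with trivial square; if these exceed three
  quarters, they are everything. The dihedral group of order 8 shows that the constant 4 is
  sharp.\<close>

lemma card_noninvolutions_ge:
  assumes fin: "finite (carrier G)" and ex: "\<exists>x\<in>carrier G. x \<otimes> x \<noteq> \<one>"
  shows "card (carrier G) \<le> 4 * card {x\<in>carrier G. x \<otimes> x \<noteq> \<one>}"
proof (rule ccontr)
  let ?N = "{x\<in>carrier G. x \<otimes> x \<noteq> \<one>}" and ?A = "{x\<in>carrier G. x = inv x}"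
  assume "\<not> ?thesis"
  moreover have "carrier G \<subseteq> ?N \<union> ?A" using inv_equality by fastforce
  then have "card (carrier G) \<le> card (?N \<union> ?A)" by (rule card_mono[rotated]) (use fin in simp)
  then have "card (carrier G) \<le> card ?N + card ?A" using card_Un_le[of ?N ?A] by linarith
  ultimately have "3 * card (carrier G) < 4 * card ?A" by linarith
  then have *: "\<forall>a\<in>carrier G. a = inv a"
    using hom_inverting_three_quarters(1)[OF subgroup_self fin, of "\<lambda>a. a"] by blast
  have "x \<otimes> x = \<one>" if x: "x \<in> carrier G" for x
  proof -
    have "inv x = x" using * x by simp
    then show ?thesis using r_inv[OF x] by simp
  qed
  then show False using ex by blast
qed

text \<open>If no element of the coset has trivial square, X contains the coset. Otherwise choose y
  = b x with y^2 = 1. Then (c y)^2 = c (y c y), so c y has trivial square exactly when conjugation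
  by y inverts c, and the three-quarters criterion, or the majority criterion for abelian H, applies
  to this conjugation. If x inverts H, the coset consists of involutions or contains none.\<close>

lemma card_coset_noninvolutions_ge:
  assumes fin: "finite (carrier G)" and H: "subgroup H G" and x: "x \<in> carrier G" "x \<notin> H"
  defines "X \<equiv> {x\<in>carrier G. x \<notin> H \<and> x \<otimes> x \<noteq> \<one>}"
  shows "card H \<le> 4 * card (X \<inter> (H #> x)) \<or>
    (\<forall>a\<in>H. x \<otimes> a \<otimes> inv x = inv a) \<and> (\<forall>a\<in>H. \<forall>b\<in>H. a \<otimes> b = b \<otimes> a)"
    and "\<forall>a\<in>H. \<forall>b\<in>H. a \<otimes> b = b \<otimes> a \<Longrightarrow>
      card H \<le> 2 * card (X \<inter> (H #> x)) \<or> (\<forall>a\<in>H. x \<otimes> a \<otimes> inv x = inv a)"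
    and "\<forall>a\<in>H. x \<otimes> a \<otimes> inv x = inv a \<Longrightarrow> card H \<le> card (X \<inter> (H #> x)) \<or> X \<inter> (H #> x) = {}"
proof -
  have Hc: "a \<in> carrier G" if "a \<in> H" for a using that subgroup.mem_carrier[OF H] by blast
  have finH: "finite H" using fin subgroup.subset[OF H] finite_subset by blast
  have out: "a \<otimes> x \<notin> H" if a: "a \<in> H" for a
  proof
    assume "a \<otimes> x \<in> H"
    then have "inv a \<otimes> (a \<otimes> x) \<in> H"
      by (rule subgroup.m_closed[OF H subgroup.m_inv_closed[OF H a]])
    then show False using a x Hc by (simp add: m_assoc[symmetric])
  qed
  have img: "X \<inter> (H #> x) = (\<lambda>a. a \<otimes> x) ` {a\<in>H. (a \<otimes> x) \<otimes> (a \<otimes> x) \<noteq> \<one>}"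
    using out Hc x by (auto simp: X_def r_coset_def)
  have "inj_on (\<lambda>a. a \<otimes> x) {a\<in>H. (a \<otimes> x) \<otimes> (a \<otimes> x) \<noteq> \<one>}"
    using Hc x by (auto intro!: inj_onI)
  then have cX: "card (X \<inter> (H #> x)) = card {a\<in>H. (a \<otimes> x) \<otimes> (a \<otimes> x) \<noteq> \<one>}"
    unfolding img by (rule card_image)
  have "X \<inter> (H #> x) = H #> x \<or> (\<exists>b\<in>H. (b \<otimes> x) \<otimes> (b \<otimes> x) = \<one>)"
    using out Hc x by (auto simp: X_def r_coset_def)
  moreover have "card (H #> x) = card H" using card_r_coset[OF subgroup.subset[OF H] x(1)] .
  ultimately have dich: "card (X \<inter> (H #> x)) = card H \<or> (\<exists>b\<in>H. (b \<otimes> x) \<otimes> (b \<otimes> x) = \<one>)"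
    by auto
  \<comment> \<open>The witness \<theta> is conjugation by the involution y = b x. The last two
    clauses pass between \<theta> and conjugation by x: they differ by conjugation with b, so on
    abelian H they coincide as soon as one of them is inversion.\<close>
  have main: "\<exists>\<theta>. (\<forall>a\<in>H. \<theta> a \<in> carrier G) \<and> (\<forall>a\<in>H. \<forall>b\<in>H. \<theta> (a \<otimes> b) = \<theta> a \<otimes> \<theta> b) \<and>
      card H \<le> card {a\<in>H. \<theta> a = inv a} + card (X \<inter> (H #> x)) \<and>
      ((\<forall>a\<in>H. \<theta> a = inv a) \<longrightarrow> (\<forall>a\<in>H. \<forall>b\<in>H. a \<otimes> b = b \<otimes> a) \<longrightarrow>
        (\<forall>a\<in>H. x \<otimes> a \<otimes> inv x = inv a)) \<and>
      ((\<forall>a\<in>H. \<forall>b\<in>H. a \<otimes> b = b \<otimes> a) \<longrightarrow> (\<forall>a\<in>H. x \<otimes> a \<otimes> inv x = inv a) \<longrightarrow>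
        X \<inter> (H #> x) = {})"
    if b: "b \<in> H" "(b \<otimes> x) \<otimes> (b \<otimes> x) = \<one>" for b
  proof -
    let ?y = "b \<otimes> x"
    let ?\<theta> = "\<lambda>a. ?y \<otimes> a \<otimes> ?y"
    have bc: "b \<in> carrier G" using b Hc by blast
    have yc: "?y \<in> carrier G" using bc x by simp
    have iy: "inv ?y = ?y" using inv_equality[OF b(2) yc yc] .
    have hom: "?\<theta> (a \<otimes> c) = ?\<theta> a \<otimes> ?\<theta> c" if "a \<in> H" "c \<in> H" for a c
      using conj_hom[OF yc Hc[OF that(1)] Hc[OF that(2)]] iy by simp
    have sq: "(a \<otimes> x) \<otimes> (a \<otimes> x) = \<one> \<longleftrightarrow> ?\<theta> (a \<otimes> inv b) = inv (a \<otimes> inv b)" if a: "a \<in> H" for a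
    proof -
      have ac: "a \<in> carrier G" using a Hc by blast
      let ?c = "a \<otimes> inv b"
      have cc: "?c \<in> carrier G" using ac bc by simp
      have ax: "a \<otimes> x = ?c \<otimes> ?y"
        using ac bc x by (simp add: m_assoc) (simp add: m_assoc[symmetric])
      have "(a \<otimes> x) \<otimes> (a \<otimes> x) = ?c \<otimes> (?y \<otimes> ?c \<otimes> ?y)"
        unfolding ax using cc yc by (simp only: m_assoc m_closed)
      also have "\<dots> = \<one> \<longleftrightarrow> ?\<theta> ?c = inv ?c"
        using cc yc inv_equality[of "?c" "?\<theta> ?c"] inv_inv
        by (metis inv_closed inv_equality m_closed r_inv)
      finally show ?thesis .
    qed
    have cardA: "card H \<le> card {a\<in>H. ?\<theta> a = inv a} + card (X \<inter> (H #> x))"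
    proof -
      let ?P = "{a\<in>H. (a \<otimes> x) \<otimes> (a \<otimes> x) = \<one>}" and ?Q = "{a\<in>H. (a \<otimes> x) \<otimes> (a \<otimes> x) \<noteq> \<one>}"
      have "H = ?P \<union> ?Q" by blast
      then have "card H \<le> card ?P + card ?Q" using card_Un_le[of ?P ?Q] by simp
      also have "card ?P \<le> card {a\<in>H. ?\<theta> a = inv a}"
      proof (rule card_inj_on_le[where f = "\<lambda>a. a \<otimes> inv b"])
        show "inj_on (\<lambda>a. a \<otimes> inv b) ?P" using Hc bc by (auto intro!: inj_onI)
        show "(\<lambda>a. a \<otimes> inv b) ` ?P \<subseteq> {a\<in>H. ?\<theta> a = inv a}"
        proof
          fix c assume "c \<in> (\<lambda>a. a \<otimes> inv b) ` ?P"
          then obtain a where a: "a \<in> H" "(a \<otimes> x) \<otimes> (a \<otimes> x) = \<one>" "c = a \<otimes> inv b" by blast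
          have "c \<in> H"
            unfolding a(3) by (rule subgroup.m_closed[OF H a(1) subgroup.m_inv_closed[OF H b(1)]])
          then show "c \<in> {a\<in>H. ?\<theta> a = inv a}" using sq[OF a(1)] a(2,3) by blast
        qed
        show "finite {a\<in>H. ?\<theta> a = inv a}" using finH by simp
      qed
      finally show ?thesis using cX by simp
    qed
    have conj: "?\<theta> a = x \<otimes> a \<otimes> inv x" if a: "a \<in> H" and comm: "\<forall>a\<in>H. \<forall>b\<in>H. a \<otimes> b = b \<otimes> a"
      and inv: "(\<forall>a\<in>H. ?\<theta> a = inv a) \<or> (\<forall>a\<in>H. x \<otimes> a \<otimes> inv x = inv a)" for a
    proof -
      have ac: "a \<in> carrier G" using a Hc by blast
      have y2: "?\<theta> a = b \<otimes> (x \<otimes> a \<otimes> inv x) \<otimes> inv b"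
      proof -
        have "?\<theta> a = ?y \<otimes> a \<otimes> inv ?y" by (simp only: iy)
        also have "\<dots> = b \<otimes> (x \<otimes> a \<otimes> inv x) \<otimes> inv b"
          using bc x ac by (simp add: inv_mult_group m_assoc)
        finally show ?thesis .
      qed
      have xy: "x \<otimes> a \<otimes> inv x = inv b \<otimes> ?\<theta> a \<otimes> b"
      proof -
        have "inv b \<otimes> (b \<otimes> z \<otimes> inv b) \<otimes> b = z" if "z \<in> carrier G" for z
        proof -
          have "inv b \<otimes> (b \<otimes> z \<otimes> inv b) \<otimes> b = (inv b \<otimes> b) \<otimes> z \<otimes> (inv b \<otimes> b)"
            using that bc by (simp only: m_assoc inv_closed m_closed)
          then show ?thesis using that bc by simp
        qed
        then show ?thesis unfolding y2 using x ac by simp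
      qed
      have ia: "inv a \<in> H" using subgroup.m_inv_closed[OF H a] .
      have ab: "inv a \<otimes> b = b \<otimes> inv a" using comm ia b(1) by blast
      show ?thesis
        using inv
      proof
        assume "\<forall>a\<in>H. ?\<theta> a = inv a"
        then have t: "?\<theta> a = inv a" using a by blast
        have "x \<otimes> a \<otimes> inv x = inv b \<otimes> (inv a \<otimes> b)" unfolding xy t using ac bc by (simp add: m_assoc)
        also have "\<dots> = inv a" unfolding ab using ac bc by (simp add: m_assoc[symmetric])
        finally show ?thesis using t by simp
      next
        assume "\<forall>a\<in>H. x \<otimes> a \<otimes> inv x = inv a"
        then have t: "x \<otimes> a \<otimes> inv x = inv a" using a by blast
        have "?\<theta> a = inv a \<otimes> b \<otimes> inv b" unfolding y2 t ab ..
        also have "\<dots> = inv a" using ac bc by (simp add: m_assoc)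
        finally show ?thesis using t by simp
      qed
    qed
    have empty: "X \<inter> (H #> x) = {}"
      if comm: "\<forall>a\<in>H. \<forall>b\<in>H. a \<otimes> b = b \<otimes> a" and inv: "\<forall>a\<in>H. x \<otimes> a \<otimes> inv x = inv a"
    proof -
      have "(a \<otimes> x) \<otimes> (a \<otimes> x) = \<one>" if a: "a \<in> H" for a
      proof -
        have "a \<otimes> inv b \<in> H" by (rule subgroup.m_closed[OF H a subgroup.m_inv_closed[OF H b(1)]])
        then show ?thesis using sq[OF a] conj[OF _ comm disjI2[OF inv]] inv by metis
      qed
      then show ?thesis unfolding img by auto
    qed
    show ?thesis
    proof (intro exI[of _ ?\<theta>] conjI impI ballI)
      show "?\<theta> a \<in> carrier G" if "a \<in> H" for a using that Hc yc by simp
      show "x \<otimes> a \<otimes> inv x = inv a"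
        if "\<forall>a\<in>H. ?\<theta> a = inv a" "\<forall>a\<in>H. \<forall>b\<in>H. a \<otimes> b = b \<otimes> a" "a \<in> H" for a
        using conj[OF that(3,2) disjI1[OF that(1)]] that by metis
    qed (use hom cardA empty in auto)
  qed
  show "card H \<le> 4 * card (X \<inter> (H #> x)) \<or>
    (\<forall>a\<in>H. x \<otimes> a \<otimes> inv x = inv a) \<and> (\<forall>a\<in>H. \<forall>b\<in>H. a \<otimes> b = b \<otimes> a)"
  proof (cases "card (X \<inter> (H #> x)) = card H")
    case False
    then obtain b where b: "b \<in> H" "(b \<otimes> x) \<otimes> (b \<otimes> x) = \<one>" using dich by blast
    obtain \<theta> where \<theta>: "\<forall>a\<in>H. \<theta> a \<in> carrier G" "\<forall>a\<in>H. \<forall>b\<in>H. \<theta> (a \<otimes> b) = \<theta> a \<otimes> \<theta> b"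
      "card H \<le> card {a\<in>H. \<theta> a = inv a} + card (X \<inter> (H #> x))"
      "(\<forall>a\<in>H. \<theta> a = inv a) \<longrightarrow> (\<forall>a\<in>H. \<forall>b\<in>H. a \<otimes> b = b \<otimes> a) \<longrightarrow> (\<forall>a\<in>H. x \<otimes> a \<otimes> inv x = inv a)"
      using main[OF b] by blast
    show ?thesis
    proof (cases "3 * card H < 4 * card {a\<in>H. \<theta> a = inv a}")
      case True
      then show ?thesis using hom_inverting_three_quarters[OF H finH, of \<theta>] \<theta> by blast
    next
      case False
      then show ?thesis using \<theta>(3) by linarith
    qed
  qed simp
  show "card H \<le> 2 * card (X \<inter> (H #> x)) \<or> (\<forall>a\<in>H. x \<otimes> a \<otimes> inv x = inv a)"
    if comm: "\<forall>a\<in>H. \<forall>b\<in>H. a \<otimes> b = b \<otimes> a"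
  proof (cases "card (X \<inter> (H #> x)) = card H")
    case False
    then obtain b where b: "b \<in> H" "(b \<otimes> x) \<otimes> (b \<otimes> x) = \<one>" using dich by blast
    obtain \<theta> where \<theta>: "\<forall>a\<in>H. \<theta> a \<in> carrier G" "\<forall>a\<in>H. \<forall>b\<in>H. \<theta> (a \<otimes> b) = \<theta> a \<otimes> \<theta> b"
      "card H \<le> card {a\<in>H. \<theta> a = inv a} + card (X \<inter> (H #> x))"
      "(\<forall>a\<in>H. \<theta> a = inv a) \<longrightarrow> (\<forall>a\<in>H. \<forall>b\<in>H. a \<otimes> b = b \<otimes> a) \<longrightarrow> (\<forall>a\<in>H. x \<otimes> a \<otimes> inv x = inv a)"
      using main[OF b] by blast
    show ?thesis
    proof (cases "card H < 2 * card {a\<in>H. \<theta> a = inv a}")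
      case True
      have "\<forall>a\<in>H. \<theta> a = inv a"
        using hom_inverting_majority_comm[OF H finH, of \<theta>, OF _ _ _ True] \<theta>(1,2) comm by blast
      then show ?thesis using \<theta>(4) comm by blast
    next
      case False
      then show ?thesis using \<theta>(3) by linarith
    qed
  qed simp
  show "card H \<le> card (X \<inter> (H #> x)) \<or> X \<inter> (H #> x) = {}"
    if inv: "\<forall>a\<in>H. x \<otimes> a \<otimes> inv x = inv a"
  proof (cases "card (X \<inter> (H #> x)) = card H")
    case False
    then obtain b where b: "b \<in> H" "(b \<otimes> x) \<otimes> (b \<otimes> x) = \<one>" using dich by blast
    have "\<forall>a\<in>H. \<forall>b\<in>H. a \<otimes> b = b \<otimes> a"
    proof (intro ballI)
      fix a b assume a: "a \<in> H" and b: "b \<in> H"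
      have c: "a \<in> carrier G" "b \<in> carrier G" using a b Hc by auto
      have "inv (a \<otimes> b) = x \<otimes> (a \<otimes> b) \<otimes> inv x" using inv subgroup.m_closed[OF H a b] by simp
      also have "\<dots> = (x \<otimes> a \<otimes> inv x) \<otimes> (x \<otimes> b \<otimes> inv x)"
        using conj_hom[of "inv x" a b] x c by simp
      also have "\<dots> = inv a \<otimes> inv b" using inv a b by simp
      also have "\<dots> = inv (b \<otimes> a)" using c by (simp add: inv_mult_group)
      finally have "inv (inv (a \<otimes> b)) = inv (inv (b \<otimes> a))" by (simp only:)
      then show "a \<otimes> b = b \<otimes> a" using c by simp
    qed
    then show ?thesis using main[OF b] inv by blast
  qed simp
qed

text \<open>The constant 12 comes from abelian H of index at least 3 and exponent above 2: at least
  1 - 1/3 - 1/2 of the elements lie outside H and do not invert H, and in each of their cosets at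
  least half of the elements have nontrivial square. If H has exponent 2, all elements with
  nontrivial square lie outside H. If H is not abelian, each outer coset contributes a quarter. If H
  has index 2, the only outer coset contributes a quarter or nothing.\<close>

lemma noninvolutions_outside_subgroup:
  assumes fin: "finite (carrier G)" and ex: "\<exists>x\<in>carrier G. x \<otimes> x \<noteq> \<one>"
    and H: "subgroup H G" and proper: "H \<noteq> carrier G"
  defines "X \<equiv> {x\<in>carrier G. x \<notin> H \<and> x \<otimes> x \<noteq> \<one>}"
  shows "card (carrier G) \<le> 12 * card X \<or>
    (X = {} \<and> (\<forall>x\<in>carrier G. \<forall>y\<in>carrier G. x \<notin> H \<longrightarrow> y \<notin> H \<longrightarrow> inv y \<otimes> x \<in> H))"
proof -
  have HC: "H \<subseteq> carrier G" using subgroup.subset[OF H] .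
  have finH: "finite H" using fin HC finite_subset by blast
  have finX: "finite X" using fin by (simp add: X_def)
  have posH: "card H > 0" using subgroup.one_closed[OF H] finH card_gt_0_iff by blast
  have half: "2 * card H \<le> card (carrier G)"
    using subgroup_eq_if_majority[OF H subgroup_self HC fin] proper by linarith
  have cW: "card (carrier G) = card (carrier G - H) + card H"
    using card_Diff_subset[OF finH HC] half by linarith
  show ?thesis
  proof (cases "\<forall>h\<in>H. h \<otimes> h = \<one>")
    case True
    then have "X = {x\<in>carrier G. x \<otimes> x \<noteq> \<one>}" by (auto simp: X_def)
    then show ?thesis using card_noninvolutions_ge[OF fin ex] by simp
  next
    case False
    then obtain h0 where h0: "h0 \<in> H" "h0 \<otimes> h0 \<noteq> \<one>" by blast
    have h0c: "h0 \<in> carrier G" using h0 HC by blast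
    show ?thesis
    proof (cases "\<forall>a\<in>H. \<forall>b\<in>H. a \<otimes> b = b \<otimes> a")
      case nc: False
      have "card (carrier G - H) * card H \<le> 4 * card X * card H"
      proof (rule card_coset_intersections_le[OF H fin])
        fix x assume x: "x \<in> carrier G - H"
        show "card H \<le> 4 * card (X \<inter> (H #> x))"
          using card_coset_noninvolutions_ge(1)[OF fin H, of x] x nc unfolding X_def by blast
      qed (auto simp: X_def)
      then have "card (carrier G - H) \<le> 4 * card X" using posH by simp
      then show ?thesis using cW half by linarith
    next
      case comm: True
      let ?I = "{x\<in>carrier G. \<forall>a\<in>H. x \<otimes> a \<otimes> inv x = inv a}"
      \<comment> \<open>A product of two elements of \<open>?I\<close> centralises H, but h0 differs
        from its inverse. So right multiplication by an element of \<open>?I\<close> maps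
        \<open>?I\<close> into its complement.\<close>
      have I2: "2 * card ?I \<le> card (carrier G)"
      proof (cases "?I = {}")
        case False
        then obtain z where z: "z \<in> ?I" by blast
        have "card ?I \<le> card (carrier G - ?I)"
        proof (rule card_inj_on_le[where f = "\<lambda>x. x \<otimes> z"])
          show "inj_on (\<lambda>x. x \<otimes> z) ?I" using z by (auto intro!: inj_onI)
          show "(\<lambda>x. x \<otimes> z) ` ?I \<subseteq> carrier G - ?I"
          proof
            fix w assume "w \<in> (\<lambda>x. x \<otimes> z) ` ?I"
            then obtain x where x: "x \<in> ?I" "w = x \<otimes> z" by blast
            have c: "x \<in> carrier G" "z \<in> carrier G" using x z by auto
            have ih: "inv h0 \<in> H" using subgroup.m_inv_closed[OF H h0(1)] .
            have "w \<otimes> h0 \<otimes> inv w = x \<otimes> (z \<otimes> h0 \<otimes> inv z) \<otimes> inv x"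
              unfolding x(2) using c h0c by (simp add: inv_mult_group m_assoc)
            also have "z \<otimes> h0 \<otimes> inv z = inv h0" using z h0(1) by blast
            also have "x \<otimes> inv h0 \<otimes> inv x = inv (inv h0)" using x(1) ih by blast
            finally have 1: "w \<otimes> h0 \<otimes> inv w = h0" using h0c by simp
            have h0i: "h0 \<noteq> inv h0"
            proof
              assume "h0 = inv h0"
              then have "h0 \<otimes> h0 = h0 \<otimes> inv h0" by simp
              then show False using h0 h0c by simp
            qed
            have "w \<notin> ?I"
            proof
              assume "w \<in> ?I"
              then have "w \<otimes> h0 \<otimes> inv w = inv h0" using h0(1) by blast
              then show False using 1 h0i by simp
            qed
            then show "w \<in> carrier G - ?I" using x(2) c by simp
          qed
        qed (use fin in auto)
        moreover have "card (carrier G - ?I) = card (carrier G) - card ?I"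
          by (rule card_Diff_subset) (use fin in auto)
        moreover have "card ?I \<le> card (carrier G)" by (rule card_mono[OF fin]) auto
        ultimately show ?thesis by linarith
      next
        case True
        show ?thesis by (simp only: True card.empty)
      qed
      show ?thesis
      proof (cases "\<exists>x\<in>carrier G. \<exists>y\<in>carrier G. x \<notin> H \<and> y \<notin> H \<and> inv y \<otimes> x \<notin> H")
        case True
        then obtain x y where xy: "x \<in> carrier G" "y \<in> carrier G" "x \<notin> H" "y \<notin> H" "inv y \<otimes> x \<notin> H"
          by (elim bexE conjE)
        have Hc: "a \<in> carrier G" if "a \<in> H" for a using that HC by blast
        have lc: "card ((\<lambda>a. z \<otimes> a) ` H) = card H" if "z \<in> carrier G" for z
          by (rule card_image) (use that Hc in \<open>auto intro!: inj_onI\<close>)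
        have d1: "H \<inter> (\<lambda>a. z \<otimes> a) ` H = {}" if z: "z \<in> carrier G" "z \<notin> H" for z
        proof (rule ccontr)
          assume "H \<inter> (\<lambda>a. z \<otimes> a) ` H \<noteq> {}"
          then obtain a where a: "a \<in> H" "z \<otimes> a \<in> H" by auto
          have "z \<otimes> a \<otimes> inv a \<in> H"
            by (rule subgroup.m_closed[OF H a(2) subgroup.m_inv_closed[OF H a(1)]])
          moreover have "a \<in> carrier G" by (rule Hc[OF a(1)])
          ultimately show False using z by (simp add: m_assoc)
        qed
        have d2: "(\<lambda>a. x \<otimes> a) ` H \<inter> (\<lambda>a. y \<otimes> a) ` H = {}"
        proof (rule ccontr)
          assume "(\<lambda>a. x \<otimes> a) ` H \<inter> (\<lambda>a. y \<otimes> a) ` H \<noteq> {}"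
          then obtain a b where ab: "a \<in> H" "b \<in> H" "x \<otimes> a = y \<otimes> b" by auto
          have c: "a \<in> carrier G" "b \<in> carrier G" using Hc ab by blast+
          have "inv y \<otimes> x = inv y \<otimes> (x \<otimes> a) \<otimes> inv a" using c xy by (simp add: m_assoc)
          also have "\<dots> = b \<otimes> inv a" unfolding ab(3) using c xy by (simp add: m_assoc[symmetric])
          finally have e: "inv y \<otimes> x = b \<otimes> inv a" .
          have "inv y \<otimes> x \<in> H"
            unfolding e by (rule subgroup.m_closed[OF H ab(2) subgroup.m_inv_closed[OF H ab(1)]])
          then show False using xy(5) by simp
        qed
        have "card ((\<lambda>a. x \<otimes> a) ` H \<union> (\<lambda>a. y \<otimes> a) ` H) = 2 * card H"
          using card_Un_disjoint[OF _ _ d2] finH lc[OF xy(1)] lc[OF xy(2)] by simp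
        then have "card (H \<union> ((\<lambda>a. x \<otimes> a) ` H \<union> (\<lambda>a. y \<otimes> a) ` H)) = 3 * card H"
          using card_Un_disjoint[of H "(\<lambda>a. x \<otimes> a) ` H \<union> (\<lambda>a. y \<otimes> a) ` H"] finH
            d1[OF xy(1,3)] d1[OF xy(2,4)] by (simp add: Int_Un_distrib)
        moreover have "card (H \<union> ((\<lambda>a. x \<otimes> a) ` H \<union> (\<lambda>a. y \<otimes> a) ` H)) \<le> card (carrier G)"
          by (rule card_mono[OF fin]) (use HC xy in auto)
        ultimately have third: "3 * card H \<le> card (carrier G)" by simp
        let ?W = "carrier G - (H \<union> ?I)"
        have "card ?W * card H \<le> 2 * card X * card H"
        proof (rule card_coset_intersections_le[OF H fin])
          fix x assume x: "x \<in> ?W"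
          show "card H \<le> 2 * card (X \<inter> (H #> x))"
            using card_coset_noninvolutions_ge(2)[OF fin H _ _ comm, of x] x unfolding X_def by auto
        qed (auto simp: X_def)
        then have "card ?W \<le> 2 * card X" using posH by simp
        moreover have "card (carrier G) \<le> card ?W + card (H \<union> ?I)"
        proof -
          have "carrier G = ?W \<union> (H \<union> ?I)" using HC by blast
          then show ?thesis using card_Un_le[of ?W "H \<union> ?I"] by simp
        qed
        moreover have "card (H \<union> ?I) \<le> card H + card ?I" by (rule card_Un_le)
        ultimately show ?thesis using third I2 by linarith
      next
        case False
        then have idx: "\<forall>x\<in>carrier G. \<forall>y\<in>carrier G. x \<notin> H \<longrightarrow> y \<notin> H \<longrightarrow> inv y \<otimes> x \<in> H"
          by (simp) metis
        show ?thesis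
        proof (cases "X = {}")
          case False
          then obtain x where x: "x \<in> X" by auto
          have xc: "x \<in> carrier G" "x \<notin> H" using x by (auto simp: X_def)
          have xx: "x \<in> X \<inter> (H #> x)" using x rcos_self[OF xc(1) H] by simp
          have "card H \<le> 4 * card (X \<inter> (H #> x))"
          proof -
            note c1 = card_coset_noninvolutions_ge(1)[OF fin H xc, folded X_def]
            note c3 = card_coset_noninvolutions_ge(3)[OF fin H xc, folded X_def]
            have "X \<inter> (H #> x) \<noteq> {}" using xx by auto
            then show ?thesis using c1 c3 by auto
          qed
          moreover have "card (X \<inter> (H #> x)) \<le> card X" by (rule card_mono[OF finX]) simp
          moreover have "card (carrier G - H) \<le> card H"
          proof (rule card_inj_on_le[where f = "\<lambda>a. inv x \<otimes> a"])
            show "inj_on (\<lambda>a. inv x \<otimes> a) (carrier G - H)" using xc by (auto intro!: inj_onI)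
            show "(\<lambda>a. inv x \<otimes> a) ` (carrier G - H) \<subseteq> H" using idx xc by blast
          qed (rule finH)
          ultimately show ?thesis using cW by linarith
        qed (use idx in blast)
      qed
    qed
  qed
qed

text \<open>A generator outside the subgroup generated so far at least doubles it. The proof takes A
  with 2^|A| bounded by the order of the generated subgroup, and this order as large as
  possible.\<close>

lemma small_generating_set:
  assumes H: "subgroup H G" and fin: "finite H"
  shows "\<exists>A\<subseteq>H. generate G A = H \<and> 2 ^ card A \<le> card H"
proof -
  have HC: "H \<subseteq> carrier G" using subgroup.subset[OF H] .
  let ?P = "\<lambda>A. A \<subseteq> H \<and> 2 ^ card A \<le> card (generate G A)"
  have gen: "subgroup (generate G A) G" "generate G A \<subseteq> H" if "A \<subseteq> H" for A
    using that HC generate_is_subgroup generate_subgroup_incl[OF that H] by auto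
  have e: "?P {}" by (simp add: generate_empty)
  have "\<forall>A. ?P A \<longrightarrow> card (generate G A) < Suc (card H)"
  proof (intro allI impI)
    fix A assume "?P A"
    then have "generate G A \<subseteq> H" using gen(2) by simp
    then show "card (generate G A) < Suc (card H)" using card_mono[OF fin] by (simp add: less_Suc_eq_le)
  qed
  then have "\<exists>A. ?P A \<and> (\<forall>B. ?P B \<longrightarrow> card (generate G B) \<le> card (generate G A))"
    using ex_has_greatest_nat[of ?P "{}" "\<lambda>A. card (generate G A)" "Suc (card H)"] e by simp
  then obtain A where A: "?P A" and mx: "\<And>B. ?P B \<Longrightarrow> card (generate G B) \<le> card (generate G A)"
    by blast
  have "generate G A = H"
  proof (rule ccontr)
    assume "generate G A \<noteq> H"
    moreover have "generate G A \<subseteq> H" using gen(2) A by simp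
    ultimately obtain h where h: "h \<in> H" "h \<notin> generate G A" by auto
    let ?B = "insert h A"
    have BH: "?B \<subseteq> H" using h A by blast
    have finB: "finite (generate G ?B)" by (rule finite_subset[OF gen(2)[OF BH] fin])
    have sub: "generate G A \<subseteq> generate G ?B" by (rule mono_generate) blast
    have ne: "generate G A \<noteq> generate G ?B" using h(2) generate.incl[of h ?B G] by blast
    have "\<not> card (generate G ?B) < 2 * card (generate G A)"
    proof
      assume lt: "card (generate G ?B) < 2 * card (generate G A)"
      have "generate G A = generate G ?B"
        by (rule subgroup_eq_if_majority[OF gen(1) gen(1)[OF BH] sub finB lt]) (use A in simp)
      then show False using ne by simp
    qed
    moreover have "card ?B \<le> Suc (card A)" by (rule card_insert_le_m1) (auto simp: card_insert_if)
    ultimately have "2 ^ card ?B \<le> card (generate G ?B)"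
    proof -
      assume 1: "\<not> card (generate G ?B) < 2 * card (generate G A)" and 2: "card ?B \<le> Suc (card A)"
      have "(2::nat) ^ card ?B \<le> 2 ^ Suc (card A)" by (rule power_increasing[OF 2]) simp
      also have "\<dots> \<le> 2 * card (generate G A)" using A by simp
      finally show ?thesis using 1 by linarith
    qed
    then have "card (generate G ?B) \<le> card (generate G A)" by (intro mx conjI BH)
    moreover have "card (generate G A) < card (generate G ?B)"
      by (rule psubset_card_mono[OF finB]) (use sub ne in blast)
    ultimately show False by linarith
  qed
  then show ?thesis using A by blast
qed

text \<open>A proper subgroup has at most half of the elements, so floor(log |G|) - 1 generators
  suffice. The generator saved pays for the factor |G|, because later a proper subgroup is guessed
  together with one element.\<close>

lemma card_proper_subgroups_le:
  assumes fin: "finite (carrier G)"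
  shows "real (card {H. subgroup H G \<and> H \<noteq> carrier G}) * real (card (carrier G))
    \<le> 2 powr (log 2 (real (card (carrier G))))\<^sup>2"
proof -
  let ?n = "card (carrier G)" and ?\<H> = "{H. subgroup H G \<and> H \<noteq> carrier G}"
  let ?L = "log 2 (real ?n)"
  have n1: "?n \<ge> 1" using fin one_closed by (metis One_nat_def Suc_leI card_gt_0_iff empty_iff)
  have L0: "0 \<le> ?L" using n1 by simp
  have sq: "2 powr ?L\<^sup>2 = real ?n powr ?L"
    using n1 by (simp add: power2_eq_square powr_powr[symmetric])
  show ?thesis
  proof (cases "?\<H> = {}")
    case True
    then show ?thesis by (simp only: card.empty) simp
  next
    case False
    let ?k = "nat \<lfloor>?L\<rfloor> - 1"
    let ?Ls = "{xs. set xs \<subseteq> carrier G \<and> length xs = ?k}"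
    have small: "\<exists>A\<subseteq>H. generate G A = H \<and> card A + 1 \<le> nat \<lfloor>?L\<rfloor>" if H: "H \<in> ?\<H>" for H
    proof -
      have sg: "subgroup H G" and ne: "H \<noteq> carrier G" using H by auto
      have HC: "H \<subseteq> carrier G" using subgroup.subset[OF sg] .
      have finH: "finite H" using HC fin finite_subset by blast
      obtain A where A: "A \<subseteq> H" "generate G A = H" "2 ^ card A \<le> card H"
        using small_generating_set[OF sg finH] by blast
      have "2 * card H \<le> ?n" using subgroup_eq_if_majority[OF sg subgroup_self HC fin] ne by linarith
      then have "2 ^ (card A + 1) \<le> ?n" using A(3) by simp
      then have "real (2 ^ (card A + 1)) \<le> real ?n" by (simp only: of_nat_le_iff)
      then have "2 powr real (card A + 1) \<le> real ?n" using powr_realpow[of 2 "card A + 1"] by simp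
      then have "real (card A + 1) \<le> ?L" using n1 by (subst le_log_iff) auto
      then have "card A + 1 \<le> nat \<lfloor>?L\<rfloor>" by (simp only: le_nat_floor)
      then show ?thesis using A by blast
    qed
    \<comment> \<open>This makes the truncated subtraction in \<open>?k\<close> exact.\<close>
    have fl: "nat \<lfloor>?L\<rfloor> \<ge> 1" using False small by fastforce
    have sub: "?\<H> \<subseteq> (\<lambda>xs. generate G (set xs)) ` ?Ls"
    proof
      fix H assume H: "H \<in> ?\<H>"
      have sg: "subgroup H G" using H by auto
      have HC: "H \<subseteq> carrier G" using subgroup.subset[OF sg] .
      have finH: "finite H" using HC fin finite_subset by blast
      obtain A where A: "A \<subseteq> H" "generate G A = H" "card A + 1 \<le> nat \<lfloor>?L\<rfloor>"
        using small[OF H] by blast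
      have "finite A" using A(1) finH finite_subset by blast
      then obtain as where as: "set as = A" "length as = card A"
        using finite_distinct_list distinct_card by metis
      \<comment> \<open>Padding with the identity gives all generating lists the same length and
        does not change the generated subgroup.\<close>
      let ?xs = "as @ replicate (?k - card A) \<one>"
      have xsH: "set ?xs \<subseteq> H" using as A subgroup.one_closed[OF sg] by auto
      have "generate G (set ?xs) = H"
      proof
        show "generate G (set ?xs) \<subseteq> H" by (rule generate_subgroup_incl[OF xsH sg])
        have "generate G A \<subseteq> generate G (set ?xs)" by (rule mono_generate) (use as in auto)
        then show "H \<subseteq> generate G (set ?xs)" using A by simp
      qed
      moreover have "?xs \<in> ?Ls" using xsH HC as A(3) by auto
      ultimately show "H \<in> (\<lambda>xs. generate G (set xs)) ` ?Ls" by (metis (no_types, lifting) image_eqI)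
    qed
    have "card ?\<H> \<le> card ?Ls"
      by (rule surj_card_le[OF _ sub]) (rule finite_lists_length_eq[OF fin])
    also have "card ?Ls = ?n ^ ?k" by (rule card_lists_length_eq[OF fin])
    finally have "real (card ?\<H>) * real ?n \<le> real ?n ^ ?k * real ?n"
      by (intro mult_right_mono) (simp_all only: of_nat_power[symmetric] of_nat_le_iff of_nat_0_le_iff)
    also have "\<dots> = real ?n ^ (nat \<lfloor>?L\<rfloor>)"
    proof -
      have "nat \<lfloor>?L\<rfloor> = Suc ?k" using fl by simp
      then show ?thesis by (metis power_Suc2)
    qed
    also have "\<dots> = real ?n powr real (nat \<lfloor>?L\<rfloor>)"
      by (rule powr_realpow[symmetric]) (use n1 in linarith)
    also have "\<dots> \<le> real ?n powr ?L"
      by (rule powr_mono) (use n1 L0 in auto)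
    finally show ?thesis using sq by simp
  qed
qed

text \<open>An endomorphism is determined by its values on at most log |G| generators, and |G|^(log
  |G|) = 2^((log |G|)^2). The functions in \<open>E\<close> are extensional, so agreement on the
  group is equality.\<close>

lemma card_endomorphisms_le:
  assumes fin: "finite (carrier G)"
  defines "E \<equiv> {f \<in> carrier G \<rightarrow>\<^sub>E carrier G.
      \<forall>a\<in>carrier G. \<forall>b\<in>carrier G. f (a \<otimes> b) = f a \<otimes> f b}"
  shows "finite E" "real (card E) \<le> 2 powr (log 2 (real (card (carrier G))))\<^sup>2"
proof -
  let ?n = "card (carrier G)"
  let ?L = "log 2 (real ?n)"
  have n1: "?n \<ge> 1" using fin one_closed by (metis One_nat_def Suc_leI card_gt_0_iff empty_iff)
  have finE: "finite (carrier G \<rightarrow>\<^sub>E carrier G)" by (intro finite_PiE fin)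
  show "finite E" by (rule finite_subset[OF _ finE]) (auto simp: E_def)
  obtain A where A: "A \<subseteq> carrier G" "generate G A = carrier G" "2 ^ card A \<le> ?n"
    using small_generating_set[OF subgroup_self fin] by blast
  have finA: "finite A" using A(1) fin finite_subset by blast
  have "inj_on (\<lambda>f. restrict f A) E"
  proof (rule inj_onI)
    fix f g assume f: "f \<in> E" and g: "g \<in> E" and eq: "restrict f A = restrict g A"
    have fh: "f (a \<otimes> b) = f a \<otimes> f b" "f a \<in> carrier G" if "a \<in> carrier G" "b \<in> carrier G" for a b
      using f that by (auto simp: E_def)
    have gh: "g (a \<otimes> b) = g a \<otimes> g b" "g a \<in> carrier G" if "a \<in> carrier G" "b \<in> carrier G" for a b
      using g that by (auto simp: E_def)
    have one: "k \<one> = \<one>" if "k \<one> \<otimes> k \<one> = k \<one>" "k \<one> \<in> carrier G" for k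
      using that by simp
    have f1: "f \<one> = \<one>" and g1: "g \<one> = \<one>" using one fh[of \<one> \<one>] gh[of \<one> \<one>] by simp_all
    have kinv: "k (inv a) = inv (k a)"
      if "k (inv a \<otimes> a) = k (inv a) \<otimes> k a" "k \<one> = \<one>" "k a \<in> carrier G" "k (inv a) \<in> carrier G"
        "a \<in> carrier G" for k a
    proof -
      have "k (inv a) \<otimes> k a = \<one>" using that by simp
      then show ?thesis using inv_equality[of "k (inv a)" "k a"] that by simp
    qed
    have "f x = g x" if "x \<in> generate G A" for x
      using that
    proof (induction rule: generate.induct)
      case one
      then show ?case using f1 g1 by simp
    next
      case (incl h)
      then show ?case using fun_cong[OF eq, of h] by simp
    next
      case (inv h)
      have h: "h \<in> carrier G" using inv A by blast
      have fgh: "f h = g h" using fun_cong[OF eq, of h] inv by simp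
      have ih: "inv h \<in> carrier G" using h by simp
      have "f (inv h) = inv (f h)"
        by (rule kinv[OF fh(1)[OF ih h] f1 fh(2)[OF h h] fh(2)[OF ih ih] h])
      moreover have "g (inv h) = inv (g h)"
        by (rule kinv[OF gh(1)[OF ih h] g1 gh(2)[OF h h] gh(2)[OF ih ih] h])
      ultimately show ?case using fgh by simp
    next
      case (eng h1 h2)
      have "h1 \<in> carrier G" "h2 \<in> carrier G" using eng A by auto
      then show ?case using eng fh gh by simp
    qed
    then have "f x = g x" if "x \<in> carrier G" for x using that A by blast
    moreover have "f \<in> extensional (carrier G)" "g \<in> extensional (carrier G)"
      using f g by (auto simp: E_def PiE_def)
    ultimately show "f = g" by (blast intro: extensionalityI)
  qed
  then have "card E \<le> card (A \<rightarrow>\<^sub>E carrier G)"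
    by (rule card_inj_on_le) (use A(1) finA fin in \<open>auto simp: E_def intro!: finite_PiE\<close>)
  also have "card (A \<rightarrow>\<^sub>E carrier G) = ?n ^ card A" by (simp add: card_PiE finA)
  finally have "real (card E) \<le> real ?n ^ card A" by (simp only: of_nat_power[symmetric] of_nat_le_iff)
  also have "\<dots> = real ?n powr real (card A)" using n1 by (simp add: powr_realpow)
  also have "\<dots> \<le> real ?n powr ?L"
  proof (rule powr_mono)
    have "real (2 ^ card A) \<le> real ?n" using A(3) by (simp only: of_nat_le_iff)
    then have "2 powr real (card A) \<le> real ?n" by (simp add: powr_realpow)
    then show "real (card A) \<le> ?L" using n1 by (subst le_log_iff) auto
  qed (use n1 in simp)
  also have "\<dots> = 2 powr ?L\<^sup>2" using n1 by (simp add: power2_eq_square powr_powr[symmetric])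
  finally show "real (card E) \<le> 2 powr ?L\<^sup>2" .
qed

end

section \<open>Generalised dicyclic groups\<close>

lemma (in group) group_exponent_gt_2_iff:
  assumes fin: "finite (carrier G)"
  shows "group_exponent G > 2 \<longleftrightarrow> (\<exists>x\<in>carrier G. x \<otimes> x \<noteq> \<one>)"
proof
  assume gt: "group_exponent G > 2"
  show "\<exists>x\<in>carrier G. x \<otimes> x \<noteq> \<one>"
  proof (rule ccontr)
    assume "\<not> ?thesis"
    then have sq: "x [^] (2::nat) = \<one>" if "x \<in> carrier G" for x
      using that by (simp add: numeral_2_eq_2)
    have "group_exponent G dvd 2" unfolding group_exponent_def
    proof (rule Lcm_least)
      fix d assume "d \<in> ord ` carrier G"
      then show "d dvd 2" using sq pow_eq_id by auto
    qed
    then show False using gt by (auto dest: dvd_imp_le)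
  qed
next
  assume "\<exists>x\<in>carrier G. x \<otimes> x \<noteq> \<one>"
  then obtain x where x: "x \<in> carrier G" "x \<otimes> x \<noteq> \<one>" by auto
  have "\<not> ord x dvd 2" using pow_eq_id[OF x(1), of 2] x by (simp add: numeral_2_eq_2)
  then have "ord x \<noteq> 1" "ord x \<noteq> 2" by auto
  moreover have pos: "ord x \<ge> 1" using ord_ge_1[OF fin x(1)] .
  ultimately have o2: "ord x > 2" by linarith
  have "ord x dvd group_exponent G" unfolding group_exponent_def using x by (intro dvd_Lcm) auto
  \<comment> \<open>The divisibility bounds \<open>ord x\<close> only if the \<open>Lcm\<close> does
    not vanish, and for a finite set it vanishes only if 0 is among the orders.\<close>
  moreover have "0 \<notin> ord ` carrier G" using ord_ge_1[OF fin] by force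
  then have "group_exponent G \<noteq> 0" unfolding group_exponent_def
    using fin Lcm_0_iff[of "ord ` carrier G"] by simp
  ultimately have "ord x \<le> group_exponent G" by (intro dvd_imp_le) simp_all
  then show "group_exponent G > 2" using o2 by linarith
qed

section \<open>Words modulo a presentation\<close>

lemma pres_rel_words:
  assumes "(u, v) \<in> pres_rel Gs E"
  shows "u \<in> words Gs" "v \<in> words Gs"
proof -
  have "u \<in> words Gs \<and> v \<in> words Gs"
    using assms
  proof (induction rule: pres_rel.induct)
    case (cancel u v g e)
    then show ?case by (simp add: append_in_lists_conv)
  qed (simp_all add: append_in_lists_conv)
  then show "u \<in> words Gs" "v \<in> words Gs" by simp_all
qed

lemma pres_rel_append:
  assumes "(u, v) \<in> pres_rel Gs E" "p \<in> words Gs" "q \<in> words Gs"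
  shows "(p @ u @ q, p @ v @ q) \<in> pres_rel Gs E"
  using assms
proof (induction rule: pres_rel.induct)
  case (refl w)
  then show ?case by (intro pres_rel.refl) (simp add: append_in_lists_conv)
next
  case (sym v w)
  show ?case by (rule pres_rel.sym[OF sym.IH[OF sym.prems]])
next
  case (trans u v w)
  show ?case by (rule pres_rel.trans[OF trans.IH(1)[OF trans.prems] trans.IH(2)[OF trans.prems]])
next
  case (cancel u v g e)
  then show ?case
    using pres_rel.cancel[of "p @ u" Gs "v @ q" g e E] by (simp add: append_in_lists_conv)
next
  case (relation u v l r)
  then show ?case
    using pres_rel.relation[of "p @ u" Gs "v @ q" l r E] by (simp add: append_in_lists_conv)
qed

lemma pres_rel_mult:
  assumes "(u, u') \<in> pres_rel Gs E" "(v, v') \<in> pres_rel Gs E"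
  shows "(u @ v, u' @ v') \<in> pres_rel Gs E"
proof -
  have "(u @ v, u' @ v) \<in> pres_rel Gs E"
    using pres_rel_append[OF assms(1), of "[]" v] pres_rel_words[OF assms(2)] by simp
  moreover have "(u' @ v, u' @ v') \<in> pres_rel Gs E"
    using pres_rel_append[OF assms(2), of u' "[]"] pres_rel_words[OF assms(1)] by simp
  ultimately show ?thesis by (rule pres_rel.trans)
qed

lemma equiv_pres_rel: "equiv (words Gs) (pres_rel Gs E)"
proof (rule equivI)
  show "refl_on (words Gs) (pres_rel Gs E)"
    using pres_rel.refl by (auto simp: refl_on_def)
  show "sym_on UNIV (pres_rel Gs E)" by (rule symI) (rule pres_rel.sym)
  show "trans_on UNIV (pres_rel Gs E)" by (rule transI) (rule pres_rel.trans)
  show "pres_rel Gs E \<subseteq> words Gs \<times> words Gs"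
  proof
    fix p assume p: "p \<in> pres_rel Gs E"
    obtain u v where uv: "p = (u, v)" by (rule prod.exhaust)
    show "p \<in> words Gs \<times> words Gs"
      using pres_rel_words[OF p[unfolded uv]] unfolding uv by (rule SigmaI)
  qed
qed

lemma presented_group_mult:
  assumes "u \<in> words Gs" "v \<in> words Gs"
  shows "pres_rel Gs E `` {u} \<otimes>\<^bsub>presented_group Gs E\<^esub> pres_rel Gs E `` {v} = pres_rel Gs E `` {u @ v}"
proof -
  have u: "(u, u) \<in> pres_rel Gs E" and v: "(v, v) \<in> pres_rel Gs E"
    using assms by (auto intro: pres_rel.refl)
  have "(\<Union>u'\<in>pres_rel Gs E `` {u}. \<Union>v'\<in>pres_rel Gs E `` {v}. pres_rel Gs E `` {u' @ v'})
      = pres_rel Gs E `` {u @ v}"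
    (is "?L = ?R")
  proof (intro equalityI subsetI)
    fix x assume "x \<in> ?L"
    then obtain u' v' where uv: "(u, u') \<in> pres_rel Gs E" "(v, v') \<in> pres_rel Gs E"
      "x \<in> pres_rel Gs E `` {u' @ v'}" by (elim UN_E) simp
    then show "x \<in> ?R"
      using equiv_class_eq[OF equiv_pres_rel pres_rel_mult[OF uv(1,2)]] by simp
  next
    fix x assume x: "x \<in> ?R"
    show "x \<in> ?L"
      by (rule UN_I[of u], simp add: u, rule UN_I[of v], simp add: v, rule x)
  qed
  then show ?thesis by (simp add: presented_group_def)
qed

text \<open>By \<open>rel\<close> the congruence classes of words are exactly the fibres of the
  evaluation \<open>ev\<close>, so sending g to its fibre is an isomorphism.\<close>

lemma (in group) iso_presented_group:
  assumes ev: "\<And>w. w \<in> words Gs \<Longrightarrow> ev w \<in> carrier G"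
    and mult: "\<And>u v. u \<in> words Gs \<Longrightarrow> v \<in> words Gs \<Longrightarrow> ev (u @ v) = ev u \<otimes> ev v"
    and surj: "\<And>g. g \<in> carrier G \<Longrightarrow> \<exists>w\<in>words Gs. ev w = g"
    and rel: "\<And>u v. u \<in> words Gs \<Longrightarrow> v \<in> words Gs \<Longrightarrow> (u, v) \<in> pres_rel Gs E \<longleftrightarrow> ev u = ev v"
  shows "G \<cong> presented_group Gs E"
proof -
  let ?h = "\<lambda>g. {w \<in> words Gs. ev w = g}"
  have cls: "?h (ev w) = pres_rel Gs E `` {w}" if "w \<in> words Gs" for w
  proof (intro equalityI subsetI)
    fix v assume "v \<in> ?h (ev w)"
    then have "(w, v) \<in> pres_rel Gs E" using rel[of w v] that by simp
    then show "v \<in> pres_rel Gs E `` {w}" by simp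
  next
    fix v assume "v \<in> pres_rel Gs E `` {w}"
    then have v: "(w, v) \<in> pres_rel Gs E" by simp
    have "v \<in> words Gs" by (rule pres_rel_words(2)[OF v])
    then show "v \<in> ?h (ev w)" using rel[of w v] that v by simp
  qed
  have hom: "?h \<in> hom G (presented_group Gs E)"
  proof (rule homI)
    fix g assume "g \<in> carrier G"
    then obtain w where w: "w \<in> words Gs" "ev w = g" using surj by blast
    then show "?h g \<in> carrier (presented_group Gs E)"
      using cls[OF w(1)] by (auto simp: presented_group_def intro: quotientI)
  next
    fix g g' assume "g \<in> carrier G" "g' \<in> carrier G"
    then obtain u v where w: "u \<in> words Gs" "ev u = g" "v \<in> words Gs" "ev v = g'" using surj by metis
    have uv: "u @ v \<in> words Gs" using w by auto
    have "?h (g \<otimes> g') = ?h (ev (u @ v))" using mult w by simp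
    also have "\<dots> = pres_rel Gs E `` {u @ v}" by (rule cls[OF uv])
    also have "\<dots> = ?h g \<otimes>\<^bsub>presented_group Gs E\<^esub> ?h g'"
      using presented_group_mult[OF w(1,3), of E] cls[OF w(1)] cls[OF w(3)] w(2,4) by simp
    finally show "?h (g \<otimes> g') = ?h g \<otimes>\<^bsub>presented_group Gs E\<^esub> ?h g'" .
  qed
  have "bij_betw ?h (carrier G) (carrier (presented_group Gs E))"
  proof (rule bij_betwI')
    fix x y assume xy: "x \<in> carrier G" "y \<in> carrier G"
    then obtain u where u: "u \<in> words Gs" "ev u = x" using surj by blast
    show "(?h x = ?h y) = (x = y)"
    proof
      assume "?h x = ?h y"
      moreover have "u \<in> ?h x" using u by simp
      ultimately have "u \<in> ?h y" by simp
      then show "x = y" using u by simp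
    qed simp
  next
    fix x assume "x \<in> carrier G"
    then show "?h x \<in> carrier (presented_group Gs E)" by (rule hom_in_carrier[OF hom])
  next
    fix P assume "P \<in> carrier (presented_group Gs E)"
    then obtain w where w: "w \<in> words Gs" "P = pres_rel Gs E `` {w}"
      by (auto simp: presented_group_def elim!: quotientE)
    then show "\<exists>x\<in>carrier G. P = ?h x" using cls[OF w(1)] ev[OF w(1)] by (intro bexI[of _ "ev w"]) simp_all
  qed
  then show ?thesis using hom unfolding is_iso_def iso_def by blast
qed

section \<open>Structure of the twisted dihedral groups\<close>

context group
begin

text \<open>Conjugation by y both fixes and inverts y^2, so y^2 is an involution. On C inversion
  coincides with this conjugation and is a homomorphism, so C is abelian.\<close>

lemma twisted_dihedral_facts:
  assumes "twisted_dihedral C y"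
  shows "subgroup C G" "y \<in> carrier G" "y \<notin> C" "y \<otimes> y \<in> C" "y \<otimes> y \<noteq> \<one>" "(y \<otimes> y) \<otimes> (y \<otimes> y) = \<one>"
    and "\<And>a. a \<in> C \<Longrightarrow> a \<otimes> y = y \<otimes> inv a"
    and "\<And>a b. a \<in> C \<Longrightarrow> b \<in> C \<Longrightarrow> a \<otimes> b = b \<otimes> a"
    and "\<And>x. x \<in> carrier G \<Longrightarrow> x \<notin> C \<Longrightarrow> inv y \<otimes> x \<in> C"
    and "\<And>a. a \<in> C \<Longrightarrow> y \<otimes> a \<notin> C"
proof -
  show C: "subgroup C G" and y: "y \<in> carrier G" "y \<notin> C" and ne: "y \<otimes> y \<noteq> \<one>"
    and idx: "\<And>x. x \<in> carrier G \<Longrightarrow> x \<notin> C \<Longrightarrow> inv y \<otimes> x \<in> C"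
    using assms unfolding twisted_dihedral_def by auto
  have inv: "inv y \<otimes> a \<otimes> y = inv a" if "a \<in> C" for a
    using assms that unfolding twisted_dihedral_def by auto
  have Cc: "a \<in> carrier G" if "a \<in> C" for a using that subgroup.mem_carrier[OF C] by blast
  show yy: "y \<otimes> y \<in> C"
  proof (rule ccontr)
    assume "y \<otimes> y \<notin> C"
    then have "inv y \<otimes> (y \<otimes> y) \<in> C" using idx y by simp
    then show False using y by (simp add: m_assoc[symmetric])
  qed
  have "inv (y \<otimes> y) = inv y \<otimes> (y \<otimes> y) \<otimes> y" using inv[OF yy] by simp
  also have "\<dots> = y \<otimes> y" using y by (simp add: m_assoc[symmetric])
  finally have "inv (y \<otimes> y) = y \<otimes> y" .
  then show "(y \<otimes> y) \<otimes> (y \<otimes> y) = \<one>" using y r_inv[of "y \<otimes> y"] by simp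
  show "a \<otimes> y = y \<otimes> inv a" if a: "a \<in> C" for a
    using inv[OF a] a Cc y by (metis inv_solve_left m_assoc inv_closed m_closed)
  show "a \<otimes> b = b \<otimes> a" if ab: "a \<in> C" "b \<in> C" for a b
  proof -
    have c: "a \<in> carrier G" "b \<in> carrier G" using ab Cc by auto
    have "inv (a \<otimes> b) = inv y \<otimes> (a \<otimes> b) \<otimes> y" using inv[OF subgroup.m_closed[OF C ab]] by simp
    also have "\<dots> = inv a \<otimes> inv b" using conj_hom[OF y(1) c] inv ab by simp
    also have "\<dots> = inv (b \<otimes> a)" using c by (simp add: inv_mult_group)
    finally have "inv (inv (a \<otimes> b)) = inv (inv (b \<otimes> a))" by (simp only:)
    then show ?thesis using c by simp
  qed
  show "y \<otimes> a \<notin> C" if a: "a \<in> C" for a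
  proof
    assume "y \<otimes> a \<in> C"
    then have "y \<otimes> a \<otimes> inv a \<in> C" by (rule subgroup.m_closed[OF C _ subgroup.m_inv_closed[OF C a]])
    then show False using a Cc y by (simp add: m_assoc)
  qed
qed

text \<open>With z = y^2, the inverse of y c is y z c. So \<theta> is the identity on C and
  multiplies the complement of C by the central involution z; this is multiplicative because C has
  index 2.\<close>

lemma twisted_dihedral_automorphism:
  assumes "twisted_dihedral C y"
  defines "\<theta> \<equiv> \<lambda>x. if x \<in> C then x else inv x"
  shows "\<And>a b. a \<in> carrier G \<Longrightarrow> b \<in> carrier G \<Longrightarrow> \<theta> (a \<otimes> b) = \<theta> a \<otimes> \<theta> b"
    and "\<exists>x\<in>carrier G. \<theta> x \<noteq> x"
proof -
  note td = twisted_dihedral_facts[OF assms(1)]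
  note C = td(1) and y = td(2)
  let ?z = "y \<otimes> y"
  have Cc: "a \<in> carrier G" if "a \<in> C" for a using that subgroup.mem_carrier[OF C] by blast
  have mC: "a \<otimes> b \<in> C" if "a \<in> C" "b \<in> C" for a b using subgroup.m_closed[OF C that] .
  have iC: "inv a \<in> C" if "a \<in> C" for a using subgroup.m_inv_closed[OF C that] .
  have iz: "inv ?z = ?z" using inv_equality[OF td(6)] y by simp
  have iy: "inv y = y \<otimes> ?z"
  proof (rule inv_equality)
    show "y \<otimes> ?z \<otimes> y = \<one>" using td(6) y by (simp add: m_assoc)
  qed (use y in auto)
  have rep: "\<exists>c\<in>C. x = y \<otimes> c" if x: "x \<in> carrier G" "x \<notin> C" for x
  proof
    show "inv y \<otimes> x \<in> C" using td(9) x by blast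
    show "x = y \<otimes> (inv y \<otimes> x)" using x y by (simp add: m_assoc[symmetric])
  qed
  have inv_rep: "inv (y \<otimes> c) = y \<otimes> (?z \<otimes> c)" if c: "c \<in> C" for c
  proof -
    have cc: "c \<in> carrier G" using c Cc by blast
    have "inv (y \<otimes> c) = inv c \<otimes> (y \<otimes> ?z)" using cc y by (simp add: inv_mult_group iy)
    also have "\<dots> = (inv c \<otimes> y) \<otimes> ?z" using cc y by (simp add: m_assoc)
    also have "\<dots> = y \<otimes> c \<otimes> ?z" using td(7)[OF iC[OF c]] cc by simp
    also have "\<dots> = y \<otimes> (c \<otimes> ?z)" using cc y by (simp add: m_assoc)
    also have "c \<otimes> ?z = ?z \<otimes> c" using td(8)[OF c td(4)] .
    finally show ?thesis .
  qed
  show "\<theta> (a \<otimes> b) = \<theta> a \<otimes> \<theta> b" if ab: "a \<in> carrier G" "b \<in> carrier G" for a b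
  proof (cases "a \<in> C"; cases "b \<in> C")
    assume "a \<in> C" "b \<in> C"
    then show ?thesis using mC by (simp add: \<theta>_def)
  next
    assume a: "a \<in> C" and b: "b \<notin> C"
    then obtain c where c: "c \<in> C" "b = y \<otimes> c" using rep ab by blast
    have cc: "c \<in> carrier G" "a \<in> carrier G" using c a Cc by auto
    have e: "a \<otimes> b = y \<otimes> (inv a \<otimes> c)"
      unfolding c(2) using td(7)[OF a] cc y by (simp add: m_assoc[symmetric])
    have ac: "inv a \<otimes> c \<in> C" using mC iC a c by blast
    have "\<theta> (a \<otimes> b) = y \<otimes> (?z \<otimes> (inv a \<otimes> c))"
      unfolding e using td(10)[OF ac] inv_rep[OF ac] by (simp add: \<theta>_def)
    also have "?z \<otimes> (inv a \<otimes> c) = inv a \<otimes> (?z \<otimes> c)"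
    proof -
      have "?z \<otimes> (inv a \<otimes> c) = (?z \<otimes> inv a) \<otimes> c" using cc y by (simp add: m_assoc)
      also have "?z \<otimes> inv a = inv a \<otimes> ?z" using td(8)[OF td(4) iC[OF a]] .
      finally show ?thesis using cc y by (simp add: m_assoc)
    qed
    also have "y \<otimes> (inv a \<otimes> (?z \<otimes> c)) = (y \<otimes> inv a) \<otimes> (?z \<otimes> c)" using cc y by (simp add: m_assoc)
    also have "\<dots> = (a \<otimes> y) \<otimes> (?z \<otimes> c)" using td(7)[OF a] by simp
    also have "\<dots> = a \<otimes> (y \<otimes> (?z \<otimes> c))" using cc y by (simp add: m_assoc)
    also have "\<dots> = \<theta> a \<otimes> \<theta> b" using a b inv_rep[OF c(1)] c(2) by (simp add: \<theta>_def)
    finally show ?thesis .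
  next
    assume a: "a \<notin> C" and b: "b \<in> C"
    then obtain c where c: "c \<in> C" "a = y \<otimes> c" using rep ab by blast
    have cc: "c \<in> carrier G" "b \<in> carrier G" using c b Cc by auto
    have e: "a \<otimes> b = y \<otimes> (c \<otimes> b)" unfolding c(2) using cc y by (simp add: m_assoc)
    have cb: "c \<otimes> b \<in> C" using mC c b by blast
    have "\<theta> (a \<otimes> b) = y \<otimes> (?z \<otimes> (c \<otimes> b))"
      unfolding e using td(10)[OF cb] inv_rep[OF cb] by (simp add: \<theta>_def)
    also have "\<dots> = y \<otimes> (?z \<otimes> c) \<otimes> b" using cc y by (simp add: m_assoc)
    also have "\<dots> = \<theta> a \<otimes> \<theta> b" using a b inv_rep[OF c(1)] c(2) by (simp add: \<theta>_def)
    finally show ?thesis .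
  next
    assume a: "a \<notin> C" and b: "b \<notin> C"
    then obtain c d where c: "c \<in> C" "a = y \<otimes> c" and d: "d \<in> C" "b = y \<otimes> d" using rep ab by metis
    have cc: "c \<in> carrier G" "d \<in> carrier G" using c d Cc by auto
    have prod: "(y \<otimes> c') \<otimes> (y \<otimes> d') = ?z \<otimes> (inv c' \<otimes> d')" if "c' \<in> C" "d' \<in> C" for c' d'
    proof -
      have k: "c' \<in> carrier G" "d' \<in> carrier G" using that Cc by auto
      have "(y \<otimes> c') \<otimes> (y \<otimes> d') = y \<otimes> (c' \<otimes> y) \<otimes> d'" using k y by (simp add: m_assoc)
      also have "\<dots> = y \<otimes> (y \<otimes> inv c') \<otimes> d'" using td(7)[OF that(1)] by simp
      also have "\<dots> = ?z \<otimes> (inv c' \<otimes> d')" using k y by (simp add: m_assoc)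
      finally show ?thesis .
    qed
    have zc: "?z \<otimes> c \<in> C" "?z \<otimes> d \<in> C" using mC td(4) c d by auto
    have ab': "a \<otimes> b = ?z \<otimes> (inv c \<otimes> d)" unfolding c(2) d(2) by (rule prod[OF c(1) d(1)])
    have abC: "a \<otimes> b \<in> C" unfolding ab' using mC iC td(4) c d by blast
    have "\<theta> a \<otimes> \<theta> b = (y \<otimes> (?z \<otimes> c)) \<otimes> (y \<otimes> (?z \<otimes> d))"
      using a b inv_rep[OF c(1)] inv_rep[OF d(1)] c(2) d(2) by (simp add: \<theta>_def)
    also have "\<dots> = ?z \<otimes> (inv (?z \<otimes> c) \<otimes> (?z \<otimes> d))" by (rule prod[OF zc])
    also have "inv (?z \<otimes> c) \<otimes> (?z \<otimes> d) = inv c \<otimes> ((?z \<otimes> ?z) \<otimes> d)"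
    proof -
      have "inv (?z \<otimes> c) = inv c \<otimes> ?z" using inv_mult_group[of ?z c] y cc(1) unfolding iz by simp
      then show ?thesis using cc y by (simp add: m_assoc)
    qed
    also have "\<dots> = inv c \<otimes> d" using td(6) cc by simp
    finally show ?thesis using ab' abC by (simp add: \<theta>_def)
  qed
  have "inv y \<noteq> y"
  proof
    assume "inv y = y"
    then have "y \<otimes> y = \<one>" using y r_inv[OF y] by simp
    then show False using td(5) by simp
  qed
  then show "\<exists>x\<in>carrier G. \<theta> x \<noteq> x" using y td(3) by (auto simp: \<theta>_def)
qed

text \<open>Inversion is trivial on C, so y centralises the abelian group C, and every element lies
  in C or y C.\<close>

lemma twisted_dihedral_comm:
  assumes td: "twisted_dihedral C y" and sq: "\<And>a. a \<in> C \<Longrightarrow> a \<otimes> a = \<one>"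
  shows "comm_group G"
proof (rule group_comm_groupI)
  note td = twisted_dihedral_facts[OF td]
  have Cc: "a \<in> carrier G" if "a \<in> C" for a using that subgroup.mem_carrier[OF td(1)] by blast
  have ii: "inv a = a" if "a \<in> C" for a using inv_equality[OF sq[OF that] Cc[OF that] Cc[OF that]] .
  have ay: "a \<otimes> y = y \<otimes> a" if "a \<in> C" for a using td(7)[OF that] ii[OF that] by simp
  have rep: "\<exists>c\<in>C. x = y \<otimes> c" if x: "x \<in> carrier G" "x \<notin> C" for x
  proof
    show "inv y \<otimes> x \<in> C" using td(9) x by blast
    show "x = y \<otimes> (inv y \<otimes> x)" using x td(2) by (simp add: m_assoc[symmetric])
  qed
  have cx: "a \<otimes> x = x \<otimes> a" if a: "a \<in> C" and x: "x \<in> carrier G" for a x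
  proof (cases "x \<in> C")
    case True
    then show ?thesis using td(8) a by blast
  next
    case False
    then obtain c where c: "c \<in> C" "x = y \<otimes> c" using rep x by blast
    have k: "a \<in> carrier G" "c \<in> carrier G" using a c Cc by auto
    have "a \<otimes> x = (a \<otimes> y) \<otimes> c" using c k td(2) by (simp add: m_assoc)
    also have "\<dots> = y \<otimes> (a \<otimes> c)" using ay[OF a] k td(2) by (simp add: m_assoc)
    also have "a \<otimes> c = c \<otimes> a" using td(8) a c by blast
    finally show ?thesis using c k td(2) by (simp add: m_assoc)
  qed
  fix x x' assume x: "x \<in> carrier G" and x': "x' \<in> carrier G"
  show "x \<otimes> x' = x' \<otimes> x"
  proof (cases "x \<in> C \<or> x' \<in> C")
    case True
    then show ?thesis using cx[of x x'] cx[of x' x] x x' by auto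
  next
    case False
    then obtain c c' where c: "c \<in> C" "x = y \<otimes> c" "c' \<in> C" "x' = y \<otimes> c'" using rep x x' by metis
    have k: "c' \<in> carrier G" "c \<in> carrier G" using c Cc by auto
    have p: "(y \<otimes> a) \<otimes> (y \<otimes> b) = (y \<otimes> y) \<otimes> (a \<otimes> b)" if "a \<in> C" "b \<in> C" for a b
    proof -
      have k: "a \<in> carrier G" "b \<in> carrier G" using that Cc by auto
      have "(y \<otimes> a) \<otimes> (y \<otimes> b) = y \<otimes> (a \<otimes> y) \<otimes> b" using k td(2) by (simp add: m_assoc)
      then show ?thesis using ay[OF that(1)] k td(2) by (simp add: m_assoc)
    qed
    show ?thesis unfolding c(2,4) p[OF c(1,3)] p[OF c(3,1)] using td(8)[OF c(1,3)] by simp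
  qed
qed

text \<open>The isomorphism is with \<open>Dic A (y \<otimes> y)\<close> for A = C. Every element is
  in exactly one way an element of C or y c with c in C, which gives the normal form
  \<open>nf\<close>; a word is brought into it by absorbing its letters from the right end one at a
  time. Words with equal value thus share a normal form, which is the hard half of
  \<open>rel\<close> in \<open>iso_presented_group\<close>.\<close>

lemma twisted_dihedral_generalised_dicyclic:
  assumes fin: "finite (carrier G)" and tdih: "twisted_dihedral C y"
    and ex: "\<exists>a\<in>C. a \<otimes> a \<noteq> \<one>"
  shows "generalised_dicyclic G"
proof -
  note td = twisted_dihedral_facts[OF tdih]
  let ?z = "y \<otimes> y"
  have yc: "y \<in> carrier G" using td(2) .
  have Cc: "a \<in> carrier G" if "a \<in> C" for a using that subgroup.mem_carrier[OF td(1)] by blast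
  have mC: "a \<otimes> b \<in> C" if "a \<in> C" "b \<in> C" for a b using subgroup.m_closed[OF td(1) that] .
  have iC: "inv a \<in> C" if "a \<in> C" for a using subgroup.m_inv_closed[OF td(1) that] .
  have oC: "\<one> \<in> C" using subgroup.one_closed[OF td(1)] .
  have zz: "inv ?z = ?z" using inv_equality[OF td(6)] yc by simp
  \<comment> \<open>C as a plain \<open>monoid\<close> record, the type over which
    \<open>generalised_dicyclic\<close> quantifies.\<close>
  define A :: "'a monoid" where "A = \<lparr>carrier = C, mult = mult G, one = \<one>\<rparr>"
  have A_simps [simp]: "carrier A = C" "mult A = mult G" "one A = \<one>" by (simp_all add: A_def)
  have "comm_group A"
  proof (rule comm_groupI)
    fix a assume "a \<in> carrier A"
    then show "\<exists>b\<in>carrier A. b \<otimes>\<^bsub>A\<^esub> a = \<one>\<^bsub>A\<^esub>" using iC Cc by (intro bexI[of _ "inv a"]) auto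
  next
    fix a b c assume "a \<in> carrier A" "b \<in> carrier A" "c \<in> carrier A"
    then show "a \<otimes>\<^bsub>A\<^esub> b \<otimes>\<^bsub>A\<^esub> c = a \<otimes>\<^bsub>A\<^esub> (b \<otimes>\<^bsub>A\<^esub> c)" using Cc by (simp add: m_assoc)
  qed (use Cc mC oC td(8) in auto)
  then interpret A: comm_group A .
  have finA: "finite (carrier A)"
    using fin subgroup.subset[OF td(1)] finite_subset by simp
  have zA: "?z \<in> carrier A" using td(4) by simp
  have ord2: "A.ord ?z = 2"
  proof -
    have "A.ord ?z dvd 2" using A.pow_eq_id[OF zA, of 2] td(6) zA Cc by (simp add: numeral_2_eq_2 A.nat_pow_Suc)
    moreover have "\<not> A.ord ?z dvd 1" using A.pow_eq_id[OF zA, of 1] td(5) zA Cc by simp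
    ultimately have "A.ord ?z \<le> 2" "A.ord ?z \<noteq> 1" by (auto dest: dvd_imp_le)
    then show ?thesis using A.ord_ge_1[OF finA zA] by linarith
  qed
  have even: "even (order A)" using A.ord_dvd_group_order[OF zA] ord2 by simp
  have exp: "group_exponent A > 2" using A.group_exponent_gt_2_iff[OF finA] ex by simp
  let ?Gs = "insert None (Some ` C)"
  let ?E = "{([(Some a, True), (Some b, True)], [(Some (a \<otimes> b), True)]) | a b. a \<in> C \<and> b \<in> C}
      \<union> {([(None, True), (None, True)], [(Some ?z, True)])}
      \<union> {([(None, False), (Some a, True), (None, True)], [(Some a, False)]) | a. a \<in> C}"
  have Dic: "Dic A ?z = presented_group ?Gs ?E" by (simp add: Dic_def)
  let ?P = "pres_rel ?Gs ?E"
  define val :: "'a option \<times> bool \<Rightarrow> 'a" where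
    "val l = (case fst l of Some a \<Rightarrow> if snd l then a else inv a | None \<Rightarrow> if snd l then y else inv y)" for l
  define ev where "ev w = foldr (\<lambda>l g. val l \<otimes> g) w \<one>" for w
  have ev_simps [simp]: "ev [] = \<one>" "ev (l # w) = val l \<otimes> ev w" for l w by (simp_all add: ev_def)
  have val_simps [simp]: "val (Some a, True) = a" "val (Some a, False) = inv a"
    "val (None, True) = y" "val (None, False) = inv y" for a by (simp_all add: val_def)
  have valc: "val l \<in> carrier G" if "l \<in> ?Gs \<times> UNIV" for l
    using that Cc yc by (cases "snd l") (auto simp: val_def)
  have evc: "ev w \<in> carrier G" if "w \<in> words ?Gs" for w
    using that
  proof (induction w)
    case (Cons l w)
    then show ?case using valc[of l] by simp
  qed simp
  have ev_append: "ev (u @ v) = ev u \<otimes> ev v" if "u \<in> words ?Gs" "v \<in> words ?Gs" for u v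
    using that(1)
  proof (induction u)
    case Nil
    then show ?case using evc[OF that(2)] by simp
  next
    case (Cons l u)
    then have l: "l \<in> ?Gs \<times> UNIV" and u: "u \<in> words ?Gs" by auto
    show ?case using Cons.IH valc[OF l] evc[OF u] evc[OF that(2)] by (simp add: m_assoc)
  qed
  have inv1: "inv y \<otimes> (a \<otimes> y) = inv a" if "a \<in> C" for a
    using td(7)[OF that] Cc[OF that] yc by (simp add: m_assoc[symmetric])
  have sound: "ev u = ev v" if "(u, v) \<in> ?P" for u v
    using that
  proof (induction rule: pres_rel.induct)
    case (cancel u v g e)
    have ge: "[(g, e), (g, \<not> e)] \<in> words ?Gs" using cancel(3) by simp
    have "val (g, e) \<in> carrier G" by (rule valc) (use cancel(3) in simp)
    have "ev [(g, e), (g, \<not> e)] = \<one>"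
      using cancel(3) Cc yc by (cases e; cases g) auto
    then have "ev ([(g, e), (g, \<not> e)] @ v) = ev v" using ev_append[OF ge cancel(2)] evc[OF cancel(2)] by simp
    moreover have "[(g, e), (g, \<not> e)] @ v \<in> words ?Gs" using ge cancel(2) by simp
    ultimately show ?case using ev_append[OF cancel(1)] cancel(2) by simp
  next
    case (relation u v l r)
    have "ev l = ev r" using relation(5) Cc yc inv1 by auto
    then have "ev (l @ v) = ev (r @ v)"
      using ev_append[OF relation(3,2)] ev_append[OF relation(4,2)] by simp
    moreover have "l @ v \<in> words ?Gs" "r @ v \<in> words ?Gs" using relation by simp_all
    ultimately show ?case using ev_append[OF relation(1)] by simp
  qed simp_all
  define nf where "nf g = (if g \<in> C then [(Some g, True)] else [(None, True), (Some (inv y \<otimes> g), True)])" for g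
  have W [simp]: "[(Some a, e)] \<in> words ?Gs" if "a \<in> C" for a e using that by simp
  have relP: "(l, r) \<in> ?P" if "(l, r) \<in> ?E" "l \<in> words ?Gs" "r \<in> words ?Gs" for l r
    using pres_rel.relation[of "[]" ?Gs "[]" l r ?E] that by simp
  have canP: "([(g, e), (g, \<not> e)], []) \<in> ?P" if "g \<in> ?Gs" for g e
    using pres_rel.cancel[of "[]" ?Gs "[]" g e ?E] that by simp
  have rSS: "([(Some a, True), (Some b, True)], [(Some (a \<otimes> b), True)]) \<in> ?P" if "a \<in> C" "b \<in> C" for a b
    by (rule relP) (use that mC in auto)
  have rNN: "([(None, True), (None, True)], [(Some ?z, True)]) \<in> ?P"
    by (rule relP) (use td(4) in auto)
  have rNSN: "([(None, False), (Some a, True), (None, True)], [(Some a, False)]) \<in> ?P" if "a \<in> C" for a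
    by (rule relP) (use that in auto)
  have rflP: "(w, w) \<in> ?P" if "w \<in> words ?Gs" for w using pres_rel.refl[OF that] .
  \<comment> \<open>The letter of the identity is not the empty word, but the multiplication table
    makes it idempotent, and cancelling it against its formal inverse makes it trivial.\<close>
  have one: "([(Some \<one>, True)], []) \<in> ?P"
  proof -
    have "([(Some \<one>, True)], [(Some \<one>, True), (Some \<one>, True)] @ [(Some \<one>, False)]) \<in> ?P"
      using pres_rel.sym[OF pres_rel_mult[OF rflP[of "[(Some \<one>, True)]"] canP[of "Some \<one>" True]]] oC by simp
    moreover have "([(Some \<one>, True), (Some \<one>, True)] @ [(Some \<one>, False)], [(Some \<one>, True)] @ [(Some \<one>, False)]) \<in> ?P"
      using pres_rel_mult[OF rSS[OF oC oC] rflP[OF W[OF oC, of False]]] by simp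
    moreover have "([(Some \<one>, True)] @ [(Some \<one>, False)], []) \<in> ?P"
      using canP[of "Some \<one>" True] oC by simp
    ultimately show ?thesis by (meson pres_rel.trans)
  qed
  have invS: "([(Some a, False)], [(Some (inv a), True)]) \<in> ?P" if a: "a \<in> C" for a
  proof -
    have 1: "([(Some a, False)] @ [(Some a, True), (Some (inv a), True)], [(Some a, False)] @ []) \<in> ?P"
    proof (rule pres_rel_mult[OF rflP[OF W[OF a]]])
      have "([(Some a, True), (Some (inv a), True)], [(Some \<one>, True)]) \<in> ?P"
        using rSS[OF a iC[OF a]] Cc[OF a] by simp
      then show "([(Some a, True), (Some (inv a), True)], []) \<in> ?P" using one by (rule pres_rel.trans)
    qed
    have 2: "([(Some a, False), (Some a, True)] @ [(Some (inv a), True)], [] @ [(Some (inv a), True)]) \<in> ?P"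
      by (rule pres_rel_mult[OF _ rflP[OF W[OF iC[OF a]]]]) (use canP[of "Some a" False] a in simp)
    show ?thesis using pres_rel.trans[OF pres_rel.sym[OF 1]] 2 by simp
  qed
  have WN: "[(None, e)] \<in> words ?Gs" for e by simp
  \<comment> \<open>From x x = z and z z = 1 follows x x z = 1, so x^-1 = x z. This removes the
    formal inverse of x.\<close>
  have invN: "([(None, False)], [(None, True), (Some ?z, True)]) \<in> ?P"
  proof -
    have zzC: "([(Some ?z, True), (Some ?z, True)], []) \<in> ?P"
      using pres_rel.trans[OF rSS[OF td(4) td(4)]] one td(6) by simp
    have "([(None, True), (None, True)] @ [(Some ?z, True)], [(Some ?z, True)] @ [(Some ?z, True)]) \<in> ?P"
      by (rule pres_rel_mult[OF rNN rflP[OF W[OF td(4)]]])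
    then have "([(None, True), (None, True), (Some ?z, True)], []) \<in> ?P"
      using pres_rel.trans[OF _ zzC] by simp
    then have 1: "([(None, False)] @ [(None, True), (None, True), (Some ?z, True)], [(None, False)] @ []) \<in> ?P"
      by (rule pres_rel_mult[OF rflP[OF WN]])
    have "[(None, True), (Some ?z, True)] \<in> words ?Gs" using td(4) by simp
    from pres_rel_mult[OF canP[of None False] rflP[OF this]]
    have 2: "([(None, False), (None, True)] @ [(None, True), (Some ?z, True)], [(None, True), (Some ?z, True)]) \<in> ?P"
      by simp
    show ?thesis using pres_rel.trans[OF pres_rel.sym[OF 1]] 2 by simp
  qed
  \<comment> \<open>The relation x^-1 a x = a^-1, multiplied by x from the left.\<close>
  have SN: "([(Some a, True), (None, True)], [(None, True), (Some (inv a), True)]) \<in> ?P" if a: "a \<in> C" for a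
  proof -
    have w: "[(Some a, True), (None, True)] \<in> words ?Gs" using a by simp
    have 1: "([(None, True), (None, False)] @ [(Some a, True), (None, True)], [] @ [(Some a, True), (None, True)]) \<in> ?P"
      by (rule pres_rel_mult[OF _ rflP[OF w]]) (use canP[of None True] in simp)
    have 2: "([(None, True)] @ [(None, False), (Some a, True), (None, True)], [(None, True)] @ [(Some (inv a), True)]) \<in> ?P"
      by (rule pres_rel_mult[OF rflP[OF WN] pres_rel.trans[OF rNSN[OF a] invS[OF a]]])
    show ?thesis using pres_rel.trans[OF pres_rel.sym[OF 1]] 2 by simp
  qed
  have nfw: "nf g \<in> words ?Gs" if "g \<in> carrier G" for g
    using that td(9) by (auto simp: nf_def)
  have stepS: "((Some a, True) # nf g, nf (a \<otimes> g)) \<in> ?P" if a: "a \<in> C" and g: "g \<in> carrier G" for a g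
  proof (cases "g \<in> C")
    case True
    then show ?thesis using rSS[OF a True] mC[OF a True] by (simp add: nf_def)
  next
    case False
    let ?c = "inv y \<otimes> g"
    have c: "?c \<in> C" using td(9) g False by blast
    have ac: "a \<in> carrier G" using a Cc by blast
    have gy: "g = y \<otimes> ?c" using g yc by (simp add: m_assoc[symmetric])
    have ag: "a \<otimes> g = y \<otimes> (inv a \<otimes> ?c)"
    proof -
      have cc: "?c \<in> carrier G" using g yc by simp
      have "a \<otimes> g = a \<otimes> (y \<otimes> ?c)" by (simp only: gy[symmetric])
      also have "\<dots> = (a \<otimes> y) \<otimes> ?c" using m_assoc[OF ac yc cc] by simp
      also have "\<dots> = y \<otimes> (inv a \<otimes> ?c)" unfolding td(7)[OF a] using g yc ac by (simp add: m_assoc)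
      finally show ?thesis .
    qed
    have iac: "inv a \<otimes> ?c \<in> C" using mC iC a c by blast
    have nfag: "nf (a \<otimes> g) = [(None, True), (Some (inv a \<otimes> ?c), True)]"
      unfolding ag using td(10)[OF iac] iac Cc yc by (simp add: nf_def m_assoc[symmetric])
    have 1: "([(Some a, True), (None, True)] @ [(Some ?c, True)], [(None, True), (Some (inv a), True)] @ [(Some ?c, True)]) \<in> ?P"
      by (rule pres_rel_mult[OF SN[OF a] rflP[OF W[OF c]]])
    have 2: "([(None, True)] @ [(Some (inv a), True), (Some ?c, True)], [(None, True)] @ [(Some (inv a \<otimes> ?c), True)]) \<in> ?P"
      by (rule pres_rel_mult[OF rflP[OF WN] rSS[OF iC[OF a] c]])
    show ?thesis using pres_rel.trans[OF 1] 2 nfag False by (simp add: nf_def)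
  qed
  have stepN: "((None, True) # nf g, nf (y \<otimes> g)) \<in> ?P" if g: "g \<in> carrier G" for g
  proof (cases "g \<in> C")
    case True
    then have "nf (y \<otimes> g) = [(None, True), (Some g, True)]"
      using td(10)[OF True] g yc by (simp add: nf_def m_assoc[symmetric])
    then show ?thesis using True rflP[of "[(None, True), (Some g, True)]"] by (simp add: nf_def)
  next
    case False
    let ?c = "inv y \<otimes> g"
    have c: "?c \<in> C" using td(9) g False by blast
    have yg: "y \<otimes> g = ?z \<otimes> ?c" using g yc by (simp add: m_assoc) (simp add: m_assoc[symmetric])
    have nfyg: "nf (y \<otimes> g) = [(Some (?z \<otimes> ?c), True)]" unfolding yg using mC[OF td(4) c] by (simp add: nf_def)
    have 1: "([(None, True), (None, True)] @ [(Some ?c, True)], [(Some ?z, True)] @ [(Some ?c, True)]) \<in> ?P"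
      by (rule pres_rel_mult[OF rNN rflP[OF W[OF c]]])
    show ?thesis using pres_rel.trans[OF 1] rSS[OF td(4) c] nfyg False by (simp add: nf_def)
  qed
  have step: "(l # nf g, nf (val l \<otimes> g)) \<in> ?P" if l: "l \<in> ?Gs \<times> UNIV" and g: "g \<in> carrier G" for l g
  proof -
    obtain s e where le: "l = (s, e)" by (rule prod.exhaust)
    have s: "s = None \<or> (\<exists>a\<in>C. s = Some a)" using l le by auto
    have main: "((s, True) # nf h, nf (val (s, True) \<otimes> h)) \<in> ?P" if "h \<in> carrier G" for h
      using s stepS stepN that by auto
    show ?thesis
    proof (cases e)
      case True
      then show ?thesis using main[OF g] le by simp
    next
      case False
      show ?thesis
      proof (cases s)
        case None
        have zg: "?z \<otimes> g \<in> carrier G" using g yc by simp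
        have 1: "([(None, False)] @ nf g, [(None, True), (Some ?z, True)] @ nf g) \<in> ?P"
          by (rule pres_rel_mult[OF invN rflP[OF nfw[OF g]]])
        have 2: "([(None, True)] @ ((Some ?z, True) # nf g), [(None, True)] @ nf (?z \<otimes> g)) \<in> ?P"
          by (rule pres_rel_mult[OF rflP[OF WN] stepS[OF td(4) g]])
        have 3: "((None, True) # nf (?z \<otimes> g), nf (y \<otimes> (?z \<otimes> g))) \<in> ?P" by (rule stepN[OF zg])
        have "inv y = y \<otimes> ?z"
          by (rule inv_equality) (use td(6) yc in \<open>auto simp: m_assoc\<close>)
        then have "inv y \<otimes> g = y \<otimes> (?z \<otimes> g)" using g yc by (simp add: m_assoc)
        then show ?thesis
          using pres_rel.trans[OF pres_rel.trans[OF 1]] 2 3 None False le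
          by simp
      next
        case (Some a)
        then have a: "a \<in> C" using s by auto
        have 1: "([(Some a, False)] @ nf g, [(Some (inv a), True)] @ nf g) \<in> ?P"
          by (rule pres_rel_mult[OF invS[OF a] rflP[OF nfw[OF g]]])
        show ?thesis using pres_rel.trans[OF 1] stepS[OF iC[OF a] g] Some False le by simp
      qed
    qed
  qed
  have norm: "(w, nf (ev w)) \<in> ?P" if "w \<in> words ?Gs" for w
    using that
  proof (induction w)
    case Nil
    then show ?case using pres_rel.sym[OF one] oC by (simp add: nf_def)
  next
    case (Cons l w)
    then have l: "l \<in> ?Gs \<times> UNIV" and w: "w \<in> words ?Gs" by auto
    have "[l] \<in> words ?Gs" using l by simp
    from pres_rel_mult[OF rflP[OF this] Cons.IH]
    have "(l # w, l # nf (ev w)) \<in> ?P" by simp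
    then show ?case using pres_rel.trans step[OF l evc[OF w]] by simp
  qed
  have "G \<cong> presented_group ?Gs ?E"
  proof (rule iso_presented_group[of _ ev])
    show "ev w \<in> carrier G" if "w \<in> words ?Gs" for w by (rule evc[OF that])
    show "ev (u @ v) = ev u \<otimes> ev v" if "u \<in> words ?Gs" "v \<in> words ?Gs" for u v
      by (rule ev_append[OF that])
    show "\<exists>w\<in>words ?Gs. ev w = g" if g: "g \<in> carrier G" for g
      using nfw[OF g] g td(9)[OF g] yc Cc by (intro bexI[of _ "nf g"]) (auto simp: nf_def m_assoc[symmetric])
    show "(u, v) \<in> ?P \<longleftrightarrow> ev u = ev v" if "u \<in> words ?Gs" "v \<in> words ?Gs" for u v
    proof
      assume "ev u = ev v"
      then have "(u, nf (ev v)) \<in> ?P" using norm[OF that(1)] by simp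
      then show "(u, v) \<in> ?P" by (rule pres_rel.trans[OF _ pres_rel.sym[OF norm[OF that(2)]]])
    qed (rule sound)
  qed
  then have "G \<cong> Dic A ?z" by (simp only: Dic)
  then show ?thesis unfolding generalised_dicyclic_def
    by (intro exI[of _ A] exI[of _ ?z] conjI A.comm_group_axioms finA even exp zA ord2)
qed

lemma twisted_dihedral_cases:
  assumes fin: "finite (carrier G)" and td: "twisted_dihedral C y"
  shows "(comm_group G \<and> group_exponent G > 2) \<or> generalised_dicyclic G"
proof (cases "\<exists>a\<in>C. a \<otimes> a \<noteq> \<one>")
  case True
  then show ?thesis using twisted_dihedral_generalised_dicyclic[OF fin td] by blast
next
  case False
  then have "comm_group G" using twisted_dihedral_comm[OF td] by blast
  then show ?thesis using group_exponent_gt_2_iff[OF fin] twisted_dihedral_facts(2,5)[OF td] by blast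
qed

end

section \<open>Traces of inverse-closed sets on blocks\<close>

text \<open>Convexity of the exponential function. The inequality exp u >= 1 + u is used at both
  ends of the chord, and averaging with weights 1 - t and t cancels the linear terms.\<close>

lemma powr_chord_le:
  fixes b t :: real
  assumes "0 \<le> t" "t \<le> 1"
  shows "2 powr (t * b) \<le> 1 + t * (2 powr b - 1)"
proof -
  let ?v = "2 powr (t * b)" and ?c = "b * ln 2"
  have "?v * (1 - t * ?c) \<le> ?v * exp (- (t * ?c))"
    using exp_ge_add_one_self[of "- (t * ?c)"] by (intro mult_left_mono) auto
  also have "\<dots> = 1" by (simp add: powr_def exp_minus mult.assoc)
  finally have 1: "?v * (1 - t * ?c) \<le> 1" .
  have "?v * (1 + (1 - t) * ?c) \<le> ?v * exp ((1 - t) * ?c)"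
    using exp_ge_add_one_self[of "(1 - t) * ?c"] by (intro mult_left_mono) auto
  also have "\<dots> = 2 powr b"
    by (simp add: powr_def exp_add[symmetric] algebra_simps)
  finally have 2: "?v * (1 + (1 - t) * ?c) \<le> 2 powr b" .
  have "?v = (1 - t) * (?v * (1 - t * ?c)) + t * (?v * (1 + (1 - t) * ?c))" by (simp add: algebra_simps)
  also have "\<dots> \<le> (1 - t) * 1 + t * 2 powr b"
    using 1 2 assms by (intro add_mono mult_left_mono) auto
  finally show ?thesis by (simp add: algebra_simps)
qed

text \<open>Equality holds at n = 8, where the induction starts. The use is in the form 2 n <=
  2^(n/2).\<close>

lemma four_square_le_two_power:
  assumes "8 \<le> n"
  shows "4 * (n * n) \<le> (2::nat) ^ n"
  using assms
proof (induction n rule: dec_induct)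
  case (step m)
  have "8 * m \<le> m * m" using step.hyps(1) by (rule mult_le_mono1)
  then have h: "2 * m + 1 \<le> m * m" using step.hyps(1) by linarith
  have "4 * (Suc m * Suc m) = 4 * (m * m) + 4 * (2 * m + 1)" by (simp add: algebra_simps)
  also have "\<dots> \<le> 4 * (m * m) + 4 * (m * m)" by (intro add_mono mult_le_mono h order_refl)
  also have "\<dots> \<le> 2 ^ m + 2 ^ m" by (intro add_mono step.IH)
  finally show ?case by simp
qed simp

text \<open>Used with u = 2^(n/4), U = u^2 and N = n; the first hypothesis is (3 u - 4) (u - 4) >= 0
  multiplied out.\<close>

lemma combine_linear_bounds: "N + 2 * (u - 1) \<le> 7 / 8 * U"
  if "16 * u \<le> 3 * U + 16" "2 * N \<le> U" for u U N :: real
proof -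
  have "16 * N + 32 * (u - 1) \<le> 14 * U" using that by simp
  then show ?thesis by simp
qed

text \<open>P stands for the candidate maps on a coset of n = |N| points and s p for the number of
  fixed points of p. Replacing 2^(s/2) by a chord 1 + s d makes the sum linear in s, so that only
  the size of P and the total number of fixed points matter. For n >= 8 the chord extends to s =
  n/2, the largest possible proper divisor, and n = 8 gives exactly 7/8. At n = 6 two maps with
  three fixed points and four maps with none already give a sum above 1; this is the origin of the
  threshold between \<open>card N \<le> 6\<close> and \<open>7 \<le> card N\<close>.\<close>

lemma sum_powr_fixed_points_le:
  fixes s :: "'p \<Rightarrow> nat"
  assumes P: "finite P" "card P \<le> n" and sum: "(\<Sum>p\<in>P. s p) \<le> n"
    and s0: "\<And>p. p \<in> P \<Longrightarrow> s p \<le> k" "k dvd n" "k < n" and n: "7 \<le> n"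
  shows "(\<Sum>p\<in>P. 2 powr (- (real n - real (s p)) / 2)) \<le> 9 / 10"
proof -
  have bound: "(\<Sum>p\<in>P. 2 powr (- (real n - real (s p)) / 2)) \<le> 2 powr (- real n / 2) * (real n + real n * d)"
    if d: "\<And>p. p \<in> P \<Longrightarrow> 2 powr (real (s p) / 2) \<le> 1 + real (s p) * d" and d0: "0 \<le> d" for d
  proof -
    have "(\<Sum>p\<in>P. 2 powr (- (real n - real (s p)) / 2)) = (\<Sum>p\<in>P. 2 powr (- real n / 2) * 2 powr (real (s p) / 2))"
      by (simp add: powr_add[symmetric] diff_divide_distrib)
    also have "\<dots> = 2 powr (- real n / 2) * (\<Sum>p\<in>P. 2 powr (real (s p) / 2))" by (simp add: sum_distrib_left)
    also have "(\<Sum>p\<in>P. 2 powr (real (s p) / 2)) \<le> (\<Sum>p\<in>P. 1 + real (s p) * d)" by (rule sum_mono) (rule d)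
    also have "(\<Sum>p\<in>P. 1 + real (s p) * d) = real (card P) + real (\<Sum>p\<in>P. s p) * d"
      by (simp add: sum.distrib sum_distrib_right)
    also have "\<dots> \<le> real n + real n * d"
      using P(2) sum d0 by (intro add_mono mult_right_mono) (simp_all only: of_nat_le_iff)
    finally show ?thesis by simp
  qed
  show ?thesis
  proof (cases "n = 7")
    case True
    have "k \<noteq> 0" using s0(2) n by (intro notI) simp
    then have "k \<in> {1,2,3,4,5,6}" using s0(3) True by auto
    \<comment> \<open>Since 7 is prime, only s = 0 and s = 1 occur and the chord may end at s = 1;
      its slope is 2^(1/2) - 1, at most 5/12.\<close>
    then have k: "k = 1" using s0(2) True by auto
    have r2: "2 powr (1/2) \<le> (17/12 :: real)"
    proof (rule power2_le_imp_le)
      have "(2 powr (1/2))\<^sup>2 = (2::real)" by (simp add: powr_half_sqrt)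
      then show "(2 powr (1/2))\<^sup>2 \<le> (17/12 :: real)\<^sup>2" by (simp add: power2_eq_square)
    qed simp
    have "(\<Sum>p\<in>P. 2 powr (- (real n - real (s p)) / 2)) \<le> 2 powr (- real n / 2) * (real n + real n * (5/12))"
    proof (rule bound)
      fix p assume "p \<in> P"
      then have "s p = 0 \<or> s p = 1" using s0(1) k by fastforce
      then show "2 powr (real (s p) / 2) \<le> 1 + real (s p) * (5/12)" using r2 by auto
    qed simp
    also have "\<dots> \<le> 9 / 10"
    proof -
      have "(113/10 :: real) \<le> 2 powr (7/2)"
      proof (rule power2_le_imp_le)
        have "(2 powr (7/2))\<^sup>2 = (2 powr 7 :: real)" by (simp add: power2_eq_square powr_add[symmetric])
        also have "(2 powr 7 :: real) = 128" by simp
        finally show "(113/10 :: real)\<^sup>2 \<le> (2 powr (7/2))\<^sup>2" by (simp add: power2_eq_square)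
      qed simp
      then have "inverse (2 powr (7/2)) \<le> (10/113 :: real)"
        using le_imp_inverse_le[of "113/10" "2 powr (7/2)::real"] by simp
      then have "2 powr (- (7/2)) \<le> (10/113 :: real)" by (simp only: powr_minus)
      then show ?thesis using True by simp
    qed
    finally show ?thesis .
  next
    case False
    then have n8: "8 \<le> n" using n by simp
    obtain j where j: "n = k * j" using s0(2) by (rule dvdE)
    have "j \<noteq> 0" "j \<noteq> 1" using j s0(3) n8 by auto
    then have "2 * k \<le> n" using j by (cases j) (auto simp: algebra_simps)
    then have k2: "2 * real k \<le> real n" by linarith
    let ?u = "2 powr (real n / 4)"
    have "2 powr 2 \<le> ?u" using n8 by (intro powr_mono) auto
    then have u4: "4 \<le> ?u" by simp
    have uu: "?u * ?u = 2 powr (real n / 2)" by (simp add: powr_add[symmetric])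
    have n2: "2 * real n \<le> ?u * ?u"
    proof -
      have "real (4 * (n * n)) \<le> real (2 ^ n)" using four_square_le_two_power[OF n8] by (simp only: of_nat_le_iff)
      then have "4 * (real n * real n) \<le> 2 ^ n" by simp
      then have "(2 * real n)\<^sup>2 \<le> 2 ^ n" by (simp add: power2_eq_square)
      also have "(2::real) ^ n = (2 powr (real n / 2))\<^sup>2"
        by (simp add: power2_eq_square powr_add[symmetric] powr_realpow)
      finally show ?thesis unfolding uu by (rule power2_le_imp_le) simp
    qed
    have "(\<Sum>p\<in>P. 2 powr (- (real n - real (s p)) / 2))
      \<le> 2 powr (- real n / 2) * (real n + real n * ((?u - 1) / (real n / 2)))"
    proof (rule bound)
      fix p assume p: "p \<in> P"
      let ?t = "2 * real (s p) / real n"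
      have "2 * real (s p) \<le> real n" using s0(1)[OF p] k2 by linarith
      then have t1: "?t \<le> 1" using n8 by simp
      have "2 powr (?t * (real n / 4)) \<le> 1 + ?t * (?u - 1)"
        by (rule powr_chord_le[OF _ t1]) simp
      moreover have "?t * (real n / 4) = real (s p) / 2" using n8 by simp
      moreover have "?t * (?u - 1) = real (s p) * ((?u - 1) / (real n / 2))" using n8 by (simp add: field_simps)
      ultimately show "2 powr (real (s p) / 2) \<le> 1 + real (s p) * ((?u - 1) / (real n / 2))"
        by (simp only:)
    qed (use u4 in simp)
    also have "real n + real n * ((?u - 1) / (real n / 2)) = real n + 2 * (?u - 1)"
      using n8 by simp
    also have "\<dots> \<le> 7 / 8 * (?u * ?u)"
    proof -
      have "0 \<le> (3 * ?u - 4) * (?u - 4)" using u4 by (intro mult_nonneg_nonneg) auto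
      then have "16 * ?u \<le> 3 * (?u * ?u) + 16" by (simp add: algebra_simps)
      then show ?thesis by (rule combine_linear_bounds[OF _ n2])
    qed
    also have "2 powr (- real n / 2) * (7 / 8 * (?u * ?u)) = 7 / 8"
      unfolding uu by (simp add: powr_add[symmetric])
    finally show ?thesis by simp
  qed
qed

text \<open>Equivalently (5/9) (n - 1) <= 2^(n/4). The proof takes fourth powers, with 625 = 5^4 and
  6561 = 9^4, and inducts on n, since (m / (m - 1))^4 <= (7/6)^4 < 2 for m >= 7.\<close>

lemma translations_powr_le:
  assumes n: "7 \<le> n"
  shows "real (n - 1) / 2 * 2 powr (- real n / 4) \<le> 9 / 10"
proof -
  have nat: "625 * (n - 1) ^ 4 \<le> 6561 * 2 ^ n" using n
  proof (induction n rule: dec_induct)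
    case (step m)
    have "6 * m \<le> 7 * (m - 1)" using step.hyps by simp
    then have "(6 * m) ^ 4 \<le> (7 * (m - 1)) ^ 4" by (rule power_mono) simp
    then have "1296 * m ^ 4 \<le> 2401 * (m - 1) ^ 4" by (simp add: power_mult_distrib)
    then have "m ^ 4 \<le> 2 * (m - 1) ^ 4" by linarith
    then show ?case using step.IH by simp
  qed simp
  let ?x = "5/9 * real (n - 1)" and ?y = "2 powr (real n / 4)"
  have "?x \<le> ?y"
  proof (rule power_le_imp_le_base[of _ 3])
    have "real (625 * (n - 1) ^ 4) \<le> real (6561 * 2 ^ n)" using nat by (simp only: of_nat_le_iff)
    then have "625 * real (n - 1) ^ 4 \<le> 6561 * 2 ^ n" by simp
    then have "?x ^ 4 \<le> 2 ^ n" by (simp add: power_mult_distrib power_divide)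
    also have "(2::real) ^ n = ?y ^ 4" by (simp add: powr_realpow[symmetric] powr_powr)
    finally show "?x ^ Suc 3 \<le> ?y ^ Suc 3" by simp
  qed simp
  then have "?x * 2 powr (- real n / 4) \<le> ?y * 2 powr (- real n / 4)" by (rule mult_right_mono) simp
  also have "\<dots> = 1" by (simp add: powr_add[symmetric])
  finally show ?thesis by simp
qed

text \<open>If m factors \<rho> are worth 1/2, then k factors are worth 2^(-k/m). Here q will be the
  index of N.\<close>

lemma power_le_powr:
  fixes \<rho> :: real
  assumes \<rho>: "0 < \<rho>" "\<rho> ^ m \<le> 1 / 2" and m: "0 < m" and k: "m * q \<le> 192 * k"
  shows "\<rho> ^ k \<le> 2 powr (- real q / 192)"
proof -
  have "\<rho> ^ k = (\<rho> powr real m) powr (real k / real m)"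
    using \<rho>(1) m by (simp add: powr_powr powr_realpow[symmetric])
  also have "\<dots> \<le> (1 / 2) powr (real k / real m)"
    by (rule powr_mono2) (use \<rho> in \<open>auto simp: powr_realpow\<close>)
  also have "\<dots> = 2 powr (- (real k / real m))" by (simp add: powr_minus_divide powr_divide)
  also have "\<dots> \<le> 2 powr (- real q / 192)"
  proof (rule powr_mono)
    have "real (m * q) \<le> real (192 * k)" using k by (simp only: of_nat_le_iff)
    then have "real q / 192 \<le> real k / real m" using m by (simp add: field_simps)
    then show "- (real k / real m) \<le> - real q / 192" by linarith
  qed simp
  finally show ?thesis .
qed

section \<open>Products over a partition into inverse-closed blocks\<close>

lemma card_family_le_prod_blocks:
  assumes fin: "finite X" and un: "\<Union>\<P> = X"
    and sub: "\<S> \<subseteq> Pow X"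
  shows "card \<S> \<le> (\<Prod>B\<in>\<P>. card ((\<lambda>S. S \<inter> B) ` \<S>))"
proof -
  have finP: "finite \<P>" using fin finite_UnionD[of \<P>] by (simp add: un)
  have finS: "finite \<S>" using sub fin by (meson finite_Pow_iff finite_subset)
  have "inj_on (\<lambda>S. \<lambda>B\<in>\<P>. S \<inter> B) \<S>"
  proof (rule inj_onI)
    fix S T assume S: "S \<in> \<S>" and T: "T \<in> \<S>" and eq: "(\<lambda>B\<in>\<P>. S \<inter> B) = (\<lambda>B\<in>\<P>. T \<inter> B)"
    have e: "S \<inter> B = T \<inter> B" if "B \<in> \<P>" for B using fun_cong[OF eq, of B] that by simp
    have "S = (\<Union>B\<in>\<P>. S \<inter> B)" using S sub un by auto
    also have "\<dots> = (\<Union>B\<in>\<P>. T \<inter> B)" using e by simp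
    also have "\<dots> = T" using T sub un by auto
    finally show "S = T" .
  qed
  then have "card \<S> \<le> card (\<Pi>\<^sub>E B\<in>\<P>. (\<lambda>S. S \<inter> B) ` \<S>)"
    by (rule card_inj_on_le) (use finP finS in \<open>auto intro!: finite_PiE\<close>)
  then show ?thesis by (simp add: card_PiE finP)
qed

context group
begin

lemma invol_set_eq:
  assumes "finite (carrier G)"
  shows "invol_set G = {x\<in>carrier G. inv x = x}"
proof -
  have "ord x \<le> 2 \<longleftrightarrow> inv x = x" if x: "x \<in> carrier G" for x
  proof -
    have "ord x \<ge> 1" using ord_ge_1[OF assms x] .
    then have "ord x \<le> 2 \<longleftrightarrow> ord x = 1 \<or> ord x = 2" by linarith
    also have "\<dots> \<longleftrightarrow> ord x dvd 2"
      using \<open>ord x \<ge> 1\<close> by (auto dest!: dvd_imp_le)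
    also have "\<dots> \<longleftrightarrow> x \<otimes> x = \<one>" using pow_eq_id[OF x, of 2] x by (simp add: numeral_2_eq_2)
    also have "\<dots> \<longleftrightarrow> inv x = x"
    proof
      assume "inv x = x"
      then show "x \<otimes> x = \<one>" using r_inv[OF x] by simp
    qed (use inv_equality[of x x] x in simp)
    finally show ?thesis .
  qed
  then show ?thesis by (auto simp: invol_set_def)
qed

text \<open>For inverse-closed B, the number of orbits of inversion on B, so that B has 2 to this
  power inverse-closed subsets. For the whole group it is \<open>c_num\<close>.\<close>

definition inv_orbits :: "'a set \<Rightarrow> real" where
  "inv_orbits B = (real (card B) + real (card {x\<in>B. inv x = x})) / 2"

text \<open>A set is determined by its traces on the blocks. Each block admits at most 2 powr
  \<open>inv_orbits\<close> traces, the blocks in \<P>' only the fraction \<rho> of that number, and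
  the values of \<open>inv_orbits\<close> add up to \<open>c_num\<close>.\<close>

lemma card_inverse_closed_blocks_le:
  assumes fin: "finite (carrier G)" and un: "\<Union>\<P> = carrier G"
    and dis: "\<And>A B. A \<in> \<P> \<Longrightarrow> B \<in> \<P> \<Longrightarrow> A \<noteq> B \<Longrightarrow> A \<inter> B = {}"
    and inv: "\<And>B x. B \<in> \<P> \<Longrightarrow> x \<in> B \<Longrightarrow> inv x \<in> B"
    and S: "\<S> \<subseteq> {S. S \<subseteq> carrier G \<and> (\<forall>x\<in>S. inv x \<in> S)}"
    and P': "\<P>' \<subseteq> \<P>" and \<rho>: "0 \<le> \<rho>"
    and small: "\<And>B. B \<in> \<P>' \<Longrightarrow> real (card ((\<lambda>S. S \<inter> B) ` \<S>)) \<le> \<rho> * 2 powr inv_orbits B"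
  shows "real (card \<S>) \<le> \<rho> ^ card \<P>' * 2 powr c_num G"
proof -
  have finP: "finite \<P>" using fin finite_UnionD[of \<P>] by (simp add: un)
  have Bsub: "B \<subseteq> carrier G" if "B \<in> \<P>" for B using that un by auto
  have finB: "finite B" if "B \<in> \<P>" for B using finite_subset[OF Bsub[OF that] fin] .
  have gen: "real (card ((\<lambda>S. S \<inter> B) ` \<S>)) \<le> 2 powr inv_orbits B" if B: "B \<in> \<P>" for B
  proof -
    have "real (card ((\<lambda>S. S \<inter> B) ` \<S>)) \<le> 2 powr ((real (card B) + real (card {x\<in>B. inv x = x})) / 2 - real (card ({} :: 'a set)) / 4)"
    proof (rule card_involution_invariant_subsets_le[OF finB[OF B]])
      show "inv x \<in> B" if "x \<in> B" for x using inv[OF B that] .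
      show "inv (inv x) = x" if "x \<in> B" for x using that Bsub[OF B] by auto
      show "inv x \<in> T" if "T \<in> (\<lambda>S. S \<inter> B) ` \<S>" "x \<in> T" for x T
        using that S inv[OF B] by auto
    qed auto
    then show ?thesis by (simp add: inv_orbits_def)
  qed
  have "real (card \<S>) \<le> real (\<Prod>B\<in>\<P>. card ((\<lambda>S. S \<inter> B) ` \<S>))"
    by (simp only: of_nat_le_iff, rule card_family_le_prod_blocks[OF fin un]) (use S in auto)
  also have "\<dots> = (\<Prod>B\<in>\<P>. real (card ((\<lambda>S. S \<inter> B) ` \<S>)))" by simp
  also have "\<dots> \<le> (\<Prod>B\<in>\<P>. (if B \<in> \<P>' then \<rho> else 1) * 2 powr inv_orbits B)"
    by (rule prod_mono) (use gen small in auto)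
  also have "\<dots> = (\<Prod>B\<in>\<P>. if B \<in> \<P>' then \<rho> else 1) * (\<Prod>B\<in>\<P>. 2 powr inv_orbits B)"
    by (rule prod.distrib)
  also have "(\<Prod>B\<in>\<P>. if B \<in> \<P>' then \<rho> else 1) = (\<Prod>B\<in>\<P>'. \<rho>)"
    by (rule prod.mono_neutral_cong_right) (use finP P' in auto)
  also have "\<dots> = \<rho> ^ card \<P>'" by simp
  also have "(\<Prod>B\<in>\<P>. 2 powr inv_orbits B) = 2 powr (\<Sum>B\<in>\<P>. inv_orbits B)"
    by (rule powr_sum[symmetric]) simp
  also have "(\<Sum>B\<in>\<P>. inv_orbits B) = c_num G"
  proof -
    have "(\<Sum>B\<in>\<P>. card B) = card (\<Union>\<P>)"
      by (rule card_Union_disjoint[symmetric]) (use finB dis in \<open>auto simp: pairwise_def disjnt_def\<close>)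
    then have 1: "(\<Sum>B\<in>\<P>. card B) = order G" by (simp add: un order_def)
    have "(\<Sum>B\<in>\<P>. card {x\<in>B. inv x = x}) = card (\<Union>B\<in>\<P>. {x\<in>B. inv x = x})"
      by (rule card_UN_disjoint[symmetric]) (use finP finB dis in fastforce)+
    also have "(\<Union>B\<in>\<P>. {x\<in>B. inv x = x}) = {x\<in>\<Union>\<P>. inv x = x}" by blast
    finally have 2: "(\<Sum>B\<in>\<P>. card {x\<in>B. inv x = x}) = card (invol_set G)"
      by (simp add: un invol_set_eq[OF fin])
    have "(\<Sum>B\<in>\<P>. inv_orbits B) = (\<Sum>B\<in>\<P>. real (card B) + real (card {x\<in>B. inv x = x})) / 2"
      by (simp add: inv_orbits_def sum_divide_distrib)
    also have "\<dots> = (real (\<Sum>B\<in>\<P>. card B) + real (\<Sum>B\<in>\<P>. card {x\<in>B. inv x = x})) / 2"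
      by (simp add: sum.distrib)
    finally show ?thesis unfolding 1 2 c_num_def .
  qed
  finally show ?thesis .
qed

end

section \<open>Graph automorphisms fixing the cosets of a normal subgroup\<close>

lemma even_card_without_fixed_points:
  assumes fin: "finite X" and inv: "\<And>x. x \<in> X \<Longrightarrow> t x \<in> X" "\<And>x. x \<in> X \<Longrightarrow> t (t x) = x"
    and nofix: "\<And>x. x \<in> X \<Longrightarrow> t x \<noteq> x"
  shows "even (card X)"
proof -
  let ?C = "(\<lambda>x. {x, t x}) ` X"
  have "2 * card ?C = card (\<Union>?C)"
  proof (rule card_partition)
    show "finite ?C" using fin by simp
    have u: "\<Union>?C = X" using inv(1) by auto
    show "finite (\<Union>?C)" unfolding u by (rule fin)
    show "card c = 2" if "c \<in> ?C" for c
    proof -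
      from that obtain x where x: "c = {x, t x}" "x \<in> X" by (rule imageE)
      have "x \<noteq> t x" using nofix[OF x(2)] by simp
      then show ?thesis using x(1) by simp
    qed
    show "c1 \<inter> c2 = {}" if c: "c1 \<in> ?C" "c2 \<in> ?C" "c1 \<noteq> c2" for c1 c2
    proof (rule ccontr)
      assume "c1 \<inter> c2 \<noteq> {}"
      then obtain z where z: "z \<in> c1" "z \<in> c2" by auto
      have e: "c = {z, t z}" if cz: "c \<in> ?C" "z \<in> c" for c
      proof -
        from cz(1) obtain x where x: "c = {x, t x}" "x \<in> X" by (rule imageE)
        then have "z = x \<or> z = t x" using cz(2) by simp
        then show ?thesis using inv(2)[OF x(2)] x(1) by auto
      qed
      have "c1 = c2" using e[OF c(1) z(1)] e[OF c(2) z(2)] by simp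
      then show False using c(3) by simp
    qed
  qed
  moreover have "\<Union>?C = X" using inv(1) by auto
  ultimately have "card X = 2 * card ?C" by simp
  then show ?thesis by simp
qed

lemma even_card_involution_iff:
  assumes fin: "finite X" and inv: "\<And>x. x \<in> X \<Longrightarrow> t x \<in> X" "\<And>x. x \<in> X \<Longrightarrow> t (t x) = x"
  shows "even (card {x\<in>X. t x = x}) \<longleftrightarrow> even (card X)"
proof -
  let ?F = "{x\<in>X. t x = x}" and ?M = "{x\<in>X. t x \<noteq> x}"
  have "even (card ?M)"
  proof (rule even_card_without_fixed_points)
    show "t x \<in> ?M" if "x \<in> ?M" for x
    proof -
      have x: "x \<in> X" "t x \<noteq> x" using that by auto
      then show ?thesis using inv(1)[OF x(1)] inv(2)[OF x(1)] by simp
    qed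
    show "t (t x) = x" if "x \<in> ?M" for x using that inv(2) by simp
  qed (use fin in auto)
  moreover have "card X = card ?F + card ?M"
  proof -
    have "X = ?F \<union> ?M" by auto
    then have "card X = card (?F \<union> ?M)" by simp
    also have "\<dots> = card ?F + card ?M" by (rule card_Un_disjoint) (use fin in auto)
    finally show ?thesis .
  qed
  ultimately show ?thesis by simp
qed

locale coset_setting = group R for R (structure) +
  fixes N :: "'a set"
  assumes normalN: "N \<lhd> R" and fin: "finite (carrier R)"
begin

section \<open>Cosets of the normal subgroup\<close>

lemma N_subgroup: "subgroup N R"
  using normalN by (simp add: normal_def)

lemma N_carrier: "n \<in> N \<Longrightarrow> n \<in> carrier R"
  using subgroup.mem_carrier[OF N_subgroup] .

lemma N_subset: "N \<subseteq> carrier R"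
  using subgroup.subset[OF N_subgroup] .

lemma N_mult: "a \<in> N \<Longrightarrow> b \<in> N \<Longrightarrow> a \<otimes> b \<in> N"
  using subgroup.m_closed[OF N_subgroup] .

lemma N_inv: "a \<in> N \<Longrightarrow> inv a \<in> N"
  using subgroup.m_inv_closed[OF N_subgroup] .

lemma N_one: "\<one> \<in> N"
  using subgroup.one_closed[OF N_subgroup] .

lemma N_finite: "finite N"
  using finite_subset[OF N_subset fin] .

lemma N_conj: "x \<in> carrier R \<Longrightarrow> n \<in> N \<Longrightarrow> inv x \<otimes> n \<otimes> x \<in> N"
  using normal.inv_op_closed1[OF normalN] .

lemma N_conj': "x \<in> carrier R \<Longrightarrow> n \<in> N \<Longrightarrow> x \<otimes> n \<otimes> inv x \<in> N"
  using normal.inv_op_closed2[OF normalN] .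

lemma N_past:
  assumes "x \<in> carrier R" "n \<in> N"
  shows "n \<otimes> x = x \<otimes> (inv x \<otimes> n \<otimes> x)"
proof -
  have n: "n \<in> carrier R" using N_carrier[OF assms(2)] .
  have "x \<otimes> (inv x \<otimes> n \<otimes> x) = (x \<otimes> inv x) \<otimes> (n \<otimes> x)"
    using assms(1) n by (simp only: m_assoc m_closed inv_closed)
  then show ?thesis using assms(1) n by simp
qed

lemma coset_iff:
  assumes x: "x \<in> carrier R" and y: "y \<in> carrier R"
  shows "y \<in> N #> x \<longleftrightarrow> inv x \<otimes> y \<in> N" "y \<in> N #> x \<longleftrightarrow> y \<otimes> inv x \<in> N"
proof -
  show 2: "y \<in> N #> x \<longleftrightarrow> y \<otimes> inv x \<in> N"
  proof
    assume "y \<in> N #> x"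
    then obtain n where n: "n \<in> N" "y = n \<otimes> x" by (auto simp: r_coset_def)
    then show "y \<otimes> inv x \<in> N" using x N_carrier by (simp add: m_assoc)
  next
    assume n: "y \<otimes> inv x \<in> N"
    have "y = (y \<otimes> inv x) \<otimes> x" using x y by (simp add: m_assoc)
    then show "y \<in> N #> x" using n by (auto simp: r_coset_def)
  qed
  have "y \<otimes> inv x \<in> N \<longleftrightarrow> inv x \<otimes> y \<in> N"
  proof
    assume "y \<otimes> inv x \<in> N"
    then have "inv x \<otimes> (y \<otimes> inv x) \<otimes> x \<in> N" by (rule N_conj[OF x])
    then show "inv x \<otimes> y \<in> N" using x y by (simp add: m_assoc)
  next
    assume "inv x \<otimes> y \<in> N"
    then have "x \<otimes> (inv x \<otimes> y) \<otimes> inv x \<in> N" by (rule N_conj'[OF x])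
    then show "y \<otimes> inv x \<in> N" using x y by (simp add: m_assoc[symmetric])
  qed
  then show "y \<in> N #> x \<longleftrightarrow> inv x \<otimes> y \<in> N" using 2 by simp
qed

lemma coset_carrier: "x \<in> carrier R \<Longrightarrow> N #> x \<subseteq> carrier R"
  by (rule r_coset_subset_G[OF N_subset])

lemma coset_self: "x \<in> carrier R \<Longrightarrow> x \<in> N #> x"
  by (rule rcos_self[OF _ N_subgroup])

lemma coset_eq: "x \<in> carrier R \<Longrightarrow> y \<in> N #> x \<Longrightarrow> N #> y = N #> x"
  using repr_independence[OF _ _ N_subgroup] by simp

lemma coset_mult: "x \<in> carrier R \<Longrightarrow> y \<in> N #> x \<Longrightarrow> n \<in> N \<Longrightarrow> y \<otimes> n \<in> N #> x"
proof -
  assume x: "x \<in> carrier R" and y: "y \<in> N #> x" and n: "n \<in> N"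
  have yc: "y \<in> carrier R" using coset_carrier[OF x] y by blast
  have "inv x \<otimes> (y \<otimes> n) = (inv x \<otimes> y) \<otimes> n" using x yc N_carrier[OF n] by (simp add: m_assoc)
  moreover have "inv x \<otimes> y \<in> N" using coset_iff(1)[OF x yc] y by simp
  ultimately show ?thesis using coset_iff(1)[OF x, of "y \<otimes> n"] N_mult n yc N_carrier[OF n] by simp
qed

lemma coset_lmult: "x \<in> carrier R \<Longrightarrow> y \<in> N #> x \<Longrightarrow> n \<in> N \<Longrightarrow> n \<otimes> y \<in> N #> x"
proof -
  assume x: "x \<in> carrier R" and y: "y \<in> N #> x" and n: "n \<in> N"
  have yc: "y \<in> carrier R" using coset_carrier[OF x] y by blast
  have "n \<otimes> y \<otimes> inv x = n \<otimes> (y \<otimes> inv x)" using x yc N_carrier[OF n] by (simp add: m_assoc)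
  moreover have "y \<otimes> inv x \<in> N" using coset_iff(2)[OF x yc] y by simp
  ultimately show ?thesis using coset_iff(2)[OF x, of "n \<otimes> y"] N_mult n yc N_carrier[OF n] by simp
qed

lemma coset_rep: "x \<in> carrier R \<Longrightarrow> y \<in> N #> x \<Longrightarrow> \<exists>n\<in>N. y = x \<otimes> n"
proof -
  assume x: "x \<in> carrier R" and y: "y \<in> N #> x"
  have yc: "y \<in> carrier R" using coset_carrier[OF x] y by blast
  have "inv x \<otimes> y \<in> N" using coset_iff(1)[OF x yc] y by simp
  moreover have "y = x \<otimes> (inv x \<otimes> y)" using x yc by (simp add: m_assoc[symmetric])
  ultimately show ?thesis by blast
qed

lemma card_coset: "x \<in> carrier R \<Longrightarrow> card (N #> x) = card N"
  by (rule card_r_coset[OF N_subset])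

lemma finite_coset: "x \<in> carrier R \<Longrightarrow> finite (N #> x)"
  using finite_subset[OF coset_carrier fin] .

text \<open>The automorphisms of the Cayley graph that normalise \<open>N\<close>, fix \<open>\<one>\<close> and fix every coset of
  \<open>N\<close>; normalising \<open>N\<close> amounts to \<open>f (x n) = f x (f n)\<close> because \<open>f \<one> = \<one>\<close>.\<close>

definition coset_auts :: "'a set \<Rightarrow> ('a \<Rightarrow> 'a) set" where
  "coset_auts S = {f \<in> Bij (carrier R). f \<one> = \<one> \<and> (\<forall>x\<in>carrier R. f x \<in> N #> x) \<and>
     (\<forall>x\<in>carrier R. \<forall>n\<in>N. f (x \<otimes> n) = f x \<otimes> f n) \<and>
     (\<forall>x\<in>carrier R. \<forall>y\<in>carrier R. f y \<otimes> inv (f x) \<in> S \<longleftrightarrow> y \<otimes> inv x \<in> S)}"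

text \<open>The conjugate of \<open>f\<close> by right translations, normalised to fix \<open>\<one>\<close>.\<close>

definition shift :: "'a \<Rightarrow> ('a \<Rightarrow> 'a) \<Rightarrow> 'a \<Rightarrow> 'a" where
  "shift u f = (\<lambda>y\<in>carrier R. f (y \<otimes> u) \<otimes> inv (f u))"

section \<open>The group of coset automorphisms and its shifts\<close>

lemma coset_auts_facts:
  assumes "f \<in> coset_auts S"
  shows "f \<in> Bij (carrier R)" "f \<one> = \<one>" "\<And>x. x \<in> carrier R \<Longrightarrow> f x \<in> N #> x"
    "\<And>x. x \<in> carrier R \<Longrightarrow> f x \<in> carrier R"
    "\<And>x n. x \<in> carrier R \<Longrightarrow> n \<in> N \<Longrightarrow> f (x \<otimes> n) = f x \<otimes> f n"
    "\<And>x y. x \<in> carrier R \<Longrightarrow> y \<in> carrier R \<Longrightarrow> f y \<otimes> inv (f x) \<in> S \<longleftrightarrow> y \<otimes> inv x \<in> S"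
    "\<And>n. n \<in> N \<Longrightarrow> f n \<in> N"
    "inj_on f (carrier R)" "f ` carrier R = carrier R" "f \<in> extensional (carrier R)"
    "\<And>y. y \<in> carrier R \<Longrightarrow> f y \<in> S \<longleftrightarrow> y \<in> S"
proof -
  show f: "f \<in> Bij (carrier R)" and f1: "f \<one> = \<one>" and fc: "\<And>x. x \<in> carrier R \<Longrightarrow> f x \<in> N #> x"
    and "\<And>x n. x \<in> carrier R \<Longrightarrow> n \<in> N \<Longrightarrow> f (x \<otimes> n) = f x \<otimes> f n"
    and S: "\<And>x y. x \<in> carrier R \<Longrightarrow> y \<in> carrier R \<Longrightarrow> f y \<otimes> inv (f x) \<in> S \<longleftrightarrow> y \<otimes> inv x \<in> S"
    using assms unfolding coset_auts_def by auto
  show fcar: "f x \<in> carrier R" if "x \<in> carrier R" for x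
    using fc[OF that] coset_carrier[OF that] by blast
  show "f n \<in> N" if n: "n \<in> N" for n
  proof -
    have nc: "n \<in> carrier R" using N_carrier[OF n] .
    have "inv n \<otimes> f n \<in> N" using coset_iff(1)[OF nc fcar[OF nc]] fc[OF nc] by simp
    then have "n \<otimes> (inv n \<otimes> f n) \<in> N" by (rule N_mult[OF n])
    then show ?thesis using nc fcar[OF nc] by (simp add: m_assoc[symmetric])
  qed
  show "inj_on f (carrier R)" "f ` carrier R = carrier R" "f \<in> extensional (carrier R)"
    using f by (auto simp: Bij_def bij_betw_def)
  show "f y \<in> S \<longleftrightarrow> y \<in> S" if y: "y \<in> carrier R" for y
    using S[OF one_closed y] f1 y fcar[OF y] by simp
qed

lemma BijI:
  assumes "\<And>x. x \<in> carrier R \<Longrightarrow> f x \<in> carrier R" "inj_on f (carrier R)" "f \<in> extensional (carrier R)"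
  shows "f \<in> Bij (carrier R)"
proof -
  have "f ` carrier R = carrier R" by (rule endo_inj_surj[OF fin _ assms(2)]) (use assms(1) in auto)
  then show ?thesis using assms by (simp add: Bij_def bij_betw_def)
qed

text \<open>Right translations are automorphisms of the Cayley graph and normalise N, so conjugation
  by them preserves all conditions except f \<one> = \<one>; the factor inv (f u), itself a right
  translation, restores this one.\<close>

lemma shift_coset_auts:
  assumes f: "f \<in> coset_auts S" and u: "u \<in> carrier R"
  shows "shift u f \<in> coset_auts S"
proof -
  note F = coset_auts_facts[OF f]
  have fu: "f u \<in> carrier R" using F(4)[OF u] .
  have val: "shift u f y = f (y \<otimes> u) \<otimes> inv (f u)" if "y \<in> carrier R" for y using that by (simp add: shift_def)
  have fyu: "f (y \<otimes> u) \<in> carrier R" if "y \<in> carrier R" for y using that u by (intro F(4)) simp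
  have c: "shift u f y \<in> carrier R" if "y \<in> carrier R" for y using val[OF that] fyu[OF that] fu by simp
  have "shift u f \<in> Bij (carrier R)"
  proof (rule BijI[OF c])
    show "inj_on (shift u f) (carrier R)"
    proof (rule inj_onI)
      fix x y assume xy: "x \<in> carrier R" "y \<in> carrier R" "shift u f x = shift u f y"
      then have "f (x \<otimes> u) \<otimes> inv (f u) = f (y \<otimes> u) \<otimes> inv (f u)" using val by simp
      then have "f (x \<otimes> u) = f (y \<otimes> u)" using fyu xy fu by simp
      then have "x \<otimes> u = y \<otimes> u" using inj_onD[OF F(8)] xy u by simp
      then show "x = y" using xy u by simp
    qed
    show "shift u f \<in> extensional (carrier R)" unfolding shift_def by (rule restrict_extensional)
  qed
  moreover have "shift u f \<one> = \<one>" using val[OF one_closed] u fu by simp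
  moreover have "shift u f x \<in> N #> x" if x: "x \<in> carrier R" for x
  proof -
    obtain n where n: "n \<in> N" "f (x \<otimes> u) = x \<otimes> u \<otimes> n" using coset_rep[of "x \<otimes> u"] F(3)[of "x \<otimes> u"] x u by auto
    obtain m where m: "m \<in> N" "f u = u \<otimes> m" using coset_rep[OF u F(3)[OF u]] by auto
    have nm: "n \<in> carrier R" "m \<in> carrier R" using n m N_carrier by auto
    have "inv x \<otimes> shift u f x = u \<otimes> (n \<otimes> inv m) \<otimes> inv u"
      using val[OF x] n(2) m(2) nm x u by (simp add: inv_mult_group m_assoc) (simp add: m_assoc[symmetric])
    also have "\<dots> \<in> N" by (intro N_conj'[OF u] N_mult N_inv n m)
    finally show ?thesis using coset_iff(1)[OF x c[OF x]] by simp
  qed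
  moreover have "shift u f (x \<otimes> n) = shift u f x \<otimes> shift u f n" if x: "x \<in> carrier R" and n: "n \<in> N" for x n
  proof -
    let ?n = "inv u \<otimes> n \<otimes> u"
    have nc: "n \<in> carrier R" using N_carrier[OF n] .
    have n': "?n \<in> N" by (rule N_conj[OF u n])
    have fn': "f ?n \<in> carrier R" using F(4)[OF N_carrier[OF n']] .
    have xu: "x \<otimes> u \<in> carrier R" using x u by simp
    have e1: "x \<otimes> n \<otimes> u = (x \<otimes> u) \<otimes> ?n"
    proof -
      have "x \<otimes> n \<otimes> u = x \<otimes> (n \<otimes> u)" using x nc u by (simp add: m_assoc)
      also have "\<dots> = x \<otimes> (u \<otimes> ?n)" using N_past[OF u n] by simp
      finally show ?thesis using x u N_carrier[OF n'] by (simp add: m_assoc)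
    qed
    have "shift u f (x \<otimes> n) = f (x \<otimes> u) \<otimes> f ?n \<otimes> inv (f u)"
      using val[of "x \<otimes> n"] x nc e1 F(5)[OF xu n'] by simp
    moreover have "shift u f n = f u \<otimes> f ?n \<otimes> inv (f u)"
      using val[OF nc] N_past[OF u n] F(5)[OF u n'] by simp
    moreover have "f (x \<otimes> u) \<otimes> inv (f u) \<otimes> (f u \<otimes> f ?n \<otimes> inv (f u)) = f (x \<otimes> u) \<otimes> f ?n \<otimes> inv (f u)"
    proof -
      have "inv (f u) \<otimes> (f u \<otimes> f ?n \<otimes> inv (f u)) = f ?n \<otimes> inv (f u)"
        using fu fn' by (simp add: m_assoc[symmetric])
      then show ?thesis using fyu[OF x] fu fn' by (simp add: m_assoc)
    qed
    ultimately show ?thesis using val[OF x] by simp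
  qed
  moreover have "shift u f y \<otimes> inv (shift u f x) \<in> S \<longleftrightarrow> y \<otimes> inv x \<in> S"
    if x: "x \<in> carrier R" and y: "y \<in> carrier R" for x y
  proof -
    have "shift u f y \<otimes> inv (shift u f x) = f (y \<otimes> u) \<otimes> inv (f (x \<otimes> u))"
    proof -
      have "inv (f u) \<otimes> (f u \<otimes> inv (f (x \<otimes> u))) = inv (f (x \<otimes> u))"
        using fu fyu[OF x] by (simp add: m_assoc[symmetric])
      then show ?thesis using val x y fyu fu by (simp add: inv_mult_group m_assoc)
    qed
    moreover have "(y \<otimes> u) \<otimes> inv (x \<otimes> u) = y \<otimes> inv x"
    proof -
      have "u \<otimes> (inv u \<otimes> inv x) = inv x" using u x by (simp add: m_assoc[symmetric])
      then show ?thesis using x y u by (simp add: inv_mult_group m_assoc)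
    qed
    ultimately show ?thesis using F(6)[of "x \<otimes> u" "y \<otimes> u"] x y u by simp
  qed
  ultimately show ?thesis unfolding coset_auts_def by simp
qed

text \<open>Together with \<open>shift_coset\<close> and \<open>shift_one\<close> this makes the
  shifts an action of R / N on \<open>coset_auts S\<close>.\<close>

lemma shift_shift:
  assumes f: "f \<in> coset_auts S" and u: "u \<in> carrier R" and v: "v \<in> carrier R"
  shows "shift v (shift u f) = shift (v \<otimes> u) f"
proof
  fix y
  note F = coset_auts_facts[OF f]
  show "shift v (shift u f) y = shift (v \<otimes> u) f y"
  proof (cases "y \<in> carrier R")
    case y: True
    have c: "f (y \<otimes> v \<otimes> u) \<in> carrier R" "f (v \<otimes> u) \<in> carrier R" "f u \<in> carrier R"
      using F(4) u v y by auto
    have "shift v (shift u f) y = f (y \<otimes> v \<otimes> u) \<otimes> inv (f u) \<otimes> inv (f (v \<otimes> u) \<otimes> inv (f u))"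
      using y u v by (simp add: shift_def)
    also have "\<dots> = f (y \<otimes> v \<otimes> u) \<otimes> inv (f (v \<otimes> u))"
    proof -
      have "inv (f u) \<otimes> (f u \<otimes> inv (f (v \<otimes> u))) = inv (f (v \<otimes> u))" using c by (simp add: m_assoc[symmetric])
      then show ?thesis using c by (simp add: inv_mult_group m_assoc)
    qed
    finally show ?thesis using y u v by (simp add: shift_def m_assoc)
  qed (simp add: shift_def)
qed

text \<open>For v = u n the factor f n appears both in f (y v) and in f v, and cancels.\<close>

lemma shift_coset:
  assumes f: "f \<in> coset_auts S" and u: "u \<in> carrier R" and v: "v \<in> N #> u"
  shows "shift v f = shift u f"
proof
  fix y
  note F = coset_auts_facts[OF f]
  obtain n where n: "n \<in> N" "v = u \<otimes> n" using coset_rep[OF u v] by auto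
  show "shift v f y = shift u f y"
  proof (cases "y \<in> carrier R")
    case y: True
    have nc: "n \<in> carrier R" using N_carrier[OF n(1)] .
    have c: "f (y \<otimes> u) \<in> carrier R" "f n \<in> carrier R" "f u \<in> carrier R" using F(4) u y nc by auto
    have "f (y \<otimes> v) = f (y \<otimes> u) \<otimes> f n" using F(5)[OF _ n(1), of "y \<otimes> u"] y u nc n(2) by (simp add: m_assoc)
    moreover have "f v = f u \<otimes> f n" using F(5)[OF u n(1)] n(2) by simp
    moreover have "f n \<otimes> (inv (f n) \<otimes> inv (f u)) = inv (f u)" using c by (simp add: m_assoc[symmetric])
    ultimately show ?thesis using y c by (simp add: shift_def inv_mult_group m_assoc)
  qed (simp add: shift_def)
qed

lemma shift_one:
  assumes f: "f \<in> coset_auts S"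
  shows "shift \<one> f = f"
proof
  fix y
  note F = coset_auts_facts[OF f]
  show "shift \<one> f y = f y"
  proof (cases "y \<in> carrier R")
    case True
    then show ?thesis using F(2) F(4)[OF True] by (simp add: shift_def)
  next
    case False
    then show ?thesis using extensional_arb[OF F(10) False] by (simp add: shift_def)
  qed
qed

lemma compose_coset_auts:
  assumes f: "f \<in> coset_auts S" and g: "g \<in> coset_auts S"
  shows "compose (carrier R) f g \<in> coset_auts S"
proof -
  note F = coset_auts_facts[OF f] and G = coset_auts_facts[OF g]
  have v: "compose (carrier R) f g x = f (g x)" if "x \<in> carrier R" for x using that by (simp add: compose_def)
  have "compose (carrier R) f g \<in> Bij (carrier R)" by (rule compose_Bij[OF F(1) G(1)])
  moreover have "f (g x) \<in> N #> x" if x: "x \<in> carrier R" for x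
    using F(3)[OF G(4)[OF x]] coset_eq[OF x G(3)[OF x]] by simp
  moreover have "f (g (x \<otimes> n)) = f (g x) \<otimes> f (g n)" if x: "x \<in> carrier R" and n: "n \<in> N" for x n
    using G(5)[OF x n] F(5)[OF G(4)[OF x] G(7)[OF n]] by simp
  moreover have "f (g y) \<otimes> inv (f (g x)) \<in> S \<longleftrightarrow> y \<otimes> inv x \<in> S"
    if x: "x \<in> carrier R" and y: "y \<in> carrier R" for x y
    using F(6)[OF G(4)[OF x] G(4)[OF y]] G(6)[OF x y] by simp
  ultimately show ?thesis unfolding coset_auts_def using v F(2) G(2) N_carrier by simp
qed

lemma inverse_coset_auts:
  assumes f: "f \<in> coset_auts S"
  obtains g where "g \<in> coset_auts S" "\<And>x. x \<in> carrier R \<Longrightarrow> g (f x) = x" "\<And>x. x \<in> carrier R \<Longrightarrow> f (g x) = x"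
proof -
  note F = coset_auts_facts[OF f]
  let ?g = "\<lambda>x\<in>carrier R. inv_into (carrier R) f x"
  have gB: "?g \<in> Bij (carrier R)" by (rule restrict_inv_into_Bij[OF F(1)])
  have gc: "?g x \<in> carrier R" if "x \<in> carrier R" for x using that inv_into_into[of x f "carrier R"] F(9) by simp
  have fg: "f (?g x) = x" if "x \<in> carrier R" for x using that f_inv_into_f[of x f "carrier R"] F(9) by simp
  have gf: "?g (f x) = x" if "x \<in> carrier R" for x using that inv_into_f_f[OF F(8) that] F(4)[OF that] by simp
  have gN: "?g x \<in> N #> x" if x: "x \<in> carrier R" for x
  proof -
    have "x \<in> N #> ?g x" using F(3)[OF gc[OF x]] fg[OF x] by simp
    then have "N #> x = N #> ?g x" by (rule coset_eq[OF gc[OF x]])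
    then show ?thesis using coset_self[OF gc[OF x]] by simp
  qed
  have gNN: "?g n \<in> N" if n: "n \<in> N" for n
  proof -
    have nc: "n \<in> carrier R" using N_carrier[OF n] .
    have "inv n \<otimes> ?g n \<in> N" using coset_iff(1)[OF nc gc[OF nc]] gN[OF nc] by simp
    then have "n \<otimes> (inv n \<otimes> ?g n) \<in> N" by (rule N_mult[OF n])
    then show ?thesis using nc gc[OF nc] by (simp add: m_assoc[symmetric])
  qed
  have "?g \<in> coset_auts S"
    unfolding coset_auts_def
  proof (intro CollectI conjI ballI gB gN)
    show "?g \<one> = \<one>" using gf[OF one_closed] F(2) by simp
    fix x assume x: "x \<in> carrier R"
    { fix n assume n: "n \<in> N"
      have nc: "n \<in> carrier R" using N_carrier[OF n] .
      have "f (?g x \<otimes> ?g n) = x \<otimes> n" using F(5)[OF gc[OF x] gNN[OF n]] fg x nc by simp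
      then show "?g (x \<otimes> n) = ?g x \<otimes> ?g n" using gf[of "?g x \<otimes> ?g n"] gc x nc by simp }
    { fix y assume y: "y \<in> carrier R"
      show "?g y \<otimes> inv (?g x) \<in> S \<longleftrightarrow> y \<otimes> inv x \<in> S"
        using F(6)[OF gc[OF x] gc[OF y]] fg x y by simp }
  qed
  then show ?thesis using that gf fg by blast
qed

lemma finite_coset_auts: "finite (coset_auts S)"
proof (rule finite_subset)
  show "coset_auts S \<subseteq> carrier R \<rightarrow>\<^sub>E carrier R"
    using coset_auts_facts(4,10) by (auto simp: PiE_def)
  show "finite (carrier R \<rightarrow>\<^sub>E carrier R)" by (intro finite_PiE fin)
qed

lemma id_coset_auts: "(\<lambda>x\<in>carrier R. x) \<in> coset_auts S"
  unfolding coset_auts_def using id_Bij[of "carrier R"] coset_self N_carrier by auto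

text \<open>Since f (f x) = x, every odd power of f sends x to f x; but the power of f to the order
  of the group, which is odd, is the identity.\<close>

lemma odd_coset_auts_no_swap:
  assumes odd: "odd (card (coset_auts S))" and f: "f \<in> coset_auts S"
    and x: "x \<in> carrier R" and ff: "f (f x) = x"
  shows "f x = x"
proof -
  let ?B = "BijGroup (carrier R)"
  interpret B: group ?B by (rule group_BijGroup)
  have mult: "g \<otimes>\<^bsub>?B\<^esub> h = compose (carrier R) g h" if "g \<in> coset_auts S" "h \<in> coset_auts S" for g h
    using coset_auts_facts(1)[OF that(1)] coset_auts_facts(1)[OF that(2)] by (simp add: BijGroup_def)
  have sub: "coset_auts S \<subseteq> carrier ?B" using coset_auts_facts(1) by (auto simp: BijGroup_def)
  have sg: "subgroup (coset_auts S) ?B"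
  proof (rule B.subgroupI[OF sub])
    show "coset_auts S \<noteq> {}" using id_coset_auts by auto
    show "g \<otimes>\<^bsub>?B\<^esub> h \<in> coset_auts S" if "g \<in> coset_auts S" "h \<in> coset_auts S" for g h
      using mult[OF that] compose_coset_auts[OF that] by simp
    show "inv\<^bsub>?B\<^esub> g \<in> coset_auts S" if g: "g \<in> coset_auts S" for g
    proof (rule inverse_coset_auts[OF g])
      fix h assume h: "h \<in> coset_auts S" "\<And>x. x \<in> carrier R \<Longrightarrow> h (g x) = x"
      have "h \<otimes>\<^bsub>?B\<^esub> g = \<one>\<^bsub>?B\<^esub>"
        using mult[OF h(1) g] h(2) by (auto simp: BijGroup_def compose_def)
      then have "inv\<^bsub>?B\<^esub> g = h" by (rule B.inv_equality) (use sub g h(1) in auto)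
      then show ?thesis using h(1) by simp
    qed
  qed
  interpret FG: group "?B\<lparr>carrier := coset_auts S\<rparr>" by (rule B.subgroup_imp_group[OF sg])
  have "f [^]\<^bsub>?B\<lparr>carrier := coset_auts S\<rparr>\<^esub> order (?B\<lparr>carrier := coset_auts S\<rparr>) = \<one>\<^bsub>?B\<^esub>"
    using FG.pow_order_eq_1[of f] f by simp
  moreover have pw: "(f [^]\<^bsub>?B\<lparr>carrier := coset_auts S\<rparr>\<^esub> (2 * j)) x = x \<and>
    (f [^]\<^bsub>?B\<lparr>carrier := coset_auts S\<rparr>\<^esub> Suc (2 * j)) x = f x" for j :: nat
  proof -
    have cl: "f [^]\<^bsub>?B\<lparr>carrier := coset_auts S\<rparr>\<^esub> k \<in> coset_auts S" for k :: nat
      using FG.nat_pow_closed[of f k] f by simp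
    have suc: "(f [^]\<^bsub>?B\<lparr>carrier := coset_auts S\<rparr>\<^esub> Suc k) z = (f [^]\<^bsub>?B\<lparr>carrier := coset_auts S\<rparr>\<^esub> k) (f z)"
      if "z \<in> carrier R" for k :: nat and z
      using mult[OF cl f] that by (simp add: compose_def)
    have e: "(f [^]\<^bsub>?B\<lparr>carrier := coset_auts S\<rparr>\<^esub> (2 * j)) x = x \<and>
      (f [^]\<^bsub>?B\<lparr>carrier := coset_auts S\<rparr>\<^esub> (2 * j)) (f x) = f x" for j :: nat
    proof (induction j)
      case 0
      then show ?case using x coset_auts_facts(4)[OF f x] by (simp add: BijGroup_def)
    next
      case (Suc j)
      have "2 * Suc j = Suc (Suc (2 * j))" by simp
      then show ?case
        using suc[OF x, of "Suc (2 * j)"] suc[OF coset_auts_facts(4)[OF f x], of "Suc (2 * j)"]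
          suc[OF x, of "2 * j"] suc[OF coset_auts_facts(4)[OF f x], of "2 * j"] ff Suc
        by (simp only: simp_thms)
    qed
    then show ?thesis using suc[OF x, of "2 * j"] by simp
  qed
  moreover obtain j where "order (?B\<lparr>carrier := coset_auts S\<rparr>) = Suc (2 * j)"
    using odd by (auto simp: order_def elim!: oddE)
  ultimately have "f x = \<one>\<^bsub>?B\<^esub> x" using pw[of j] by simp
  then show ?thesis using x by (simp add: BijGroup_def)
qed

text \<open>A group with trivial squares is abelian. Explicitly, v u (u v)^-1 is the product of (v
  u)^2, the conjugate of v^-2 by u, and u^-2.\<close>

lemma commutator_in_N:
  assumes sq: "\<And>x. x \<in> carrier R \<Longrightarrow> x \<otimes> x \<in> N" and u: "u \<in> carrier R" and v: "v \<in> carrier R"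
  shows "v \<otimes> u \<in> N #> (u \<otimes> v)"
proof -
  have e: "v \<otimes> u \<otimes> inv (u \<otimes> v) = ((v \<otimes> u) \<otimes> (v \<otimes> u)) \<otimes> ((inv u \<otimes> (inv v \<otimes> inv v) \<otimes> u) \<otimes> (inv u \<otimes> inv u))"
  proof -
    have "((v \<otimes> u) \<otimes> (v \<otimes> u)) \<otimes> ((inv u \<otimes> (inv v \<otimes> inv v) \<otimes> u) \<otimes> (inv u \<otimes> inv u))
      = v \<otimes> u \<otimes> v \<otimes> (u \<otimes> inv u) \<otimes> inv v \<otimes> inv v \<otimes> (u \<otimes> inv u) \<otimes> inv u"
      using u v by (simp only: m_assoc inv_closed m_closed)
    also have "\<dots> = v \<otimes> u \<otimes> (v \<otimes> inv v) \<otimes> inv v \<otimes> inv u"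
      using u v by (simp only: m_assoc inv_closed m_closed r_inv r_one l_one one_closed)
    also have "\<dots> = v \<otimes> u \<otimes> inv (u \<otimes> v)" using u v by (simp add: inv_mult_group m_assoc)
    finally show ?thesis by simp
  qed
  have "v \<otimes> u \<otimes> inv (u \<otimes> v) \<in> N"
    unfolding e by (intro N_mult sq N_conj) (use u v in auto)
  then show ?thesis using coset_iff(2)[of "u \<otimes> v" "v \<otimes> u"] u v by simp
qed

lemma N_coset_one: "x \<in> N \<Longrightarrow> x \<in> N #> \<one>"
  using coset_iff(2)[OF one_closed, of x] N_carrier[of x] by simp

text \<open>The members fixed by all shifts are those that are automorphisms of R. As R / N is
  elementary abelian, the shifts commute and have order at most 2, so imposing invariance under one
  u after another never changes the parity of the number of survivors. An even number of survivors
  that includes the identity includes another one.\<close>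

lemma even_coset_auts_automorphism:
  assumes sq: "\<And>x. x \<in> carrier R \<Longrightarrow> x \<otimes> x \<in> N" and even: "even (card (coset_auts S))"
  shows "\<exists>f\<in>coset_auts S. f \<noteq> (\<lambda>x\<in>carrier R. x) \<and>
    (\<forall>a\<in>carrier R. \<forall>b\<in>carrier R. f (a \<otimes> b) = f a \<otimes> f b)"
proof -
  let ?X = "\<lambda>U. {f\<in>coset_auts S. \<forall>u\<in>U. shift u f = f}"
  have finX: "finite (?X U)" for U using finite_coset_auts by simp
  have "even (card (?X U))" if "finite U" "U \<subseteq> carrier R" for U
    using that
  proof (induction U rule: finite_induct)
    case empty
    then show ?case using even by simp
  next
    case (insert u U)
    have u: "u \<in> carrier R" and U: "U \<subseteq> carrier R" using insert by auto
    have "even (card {f\<in>?X U. shift u f = f}) \<longleftrightarrow> even (card (?X U))"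
    proof (rule even_card_involution_iff[OF finX])
      fix f assume f: "f \<in> ?X U"
      have fF: "f \<in> coset_auts S" using f by simp
      have uu: "u \<otimes> u \<in> N #> \<one>" by (rule N_coset_one[OF sq[OF u]])
      show "shift u (shift u f) = f"
        using shift_shift[OF fF u u] shift_coset[OF fF one_closed uu] shift_one[OF fF] by simp
      have "shift v (shift u f) = shift u f" if v: "v \<in> U" for v
      proof -
        have vc: "v \<in> carrier R" using v U by auto
        have "shift v (shift u f) = shift (v \<otimes> u) f" by (rule shift_shift[OF fF u vc])
        also have "\<dots> = shift (u \<otimes> v) f"
          by (rule shift_coset[OF fF _ commutator_in_N[OF sq u vc]]) (use u vc in simp)
        also have "\<dots> = shift u (shift v f)" by (rule shift_shift[OF fF vc u, symmetric])
        also have "shift v f = f" using f v by simp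
        finally show ?thesis .
      qed
      then show "shift u f \<in> ?X U" using shift_coset_auts[OF fF u] by simp
    qed
    moreover have "{f\<in>?X U. shift u f = f} = ?X (insert u U)" by auto
    ultimately show ?case using insert.IH[OF U] by simp
  qed
  from this[OF fin subset_refl] have ev: "even (card (?X (carrier R)))" .
  let ?id = "\<lambda>x\<in>carrier R. x"
  have "shift u ?id = ?id" if u: "u \<in> carrier R" for u
    using u by (auto simp: shift_def m_assoc intro!: restrict_ext)
  then have idX: "?id \<in> ?X (carrier R)" using id_coset_auts by simp
  have "?X (carrier R) \<noteq> {?id}" using ev by auto
  then obtain f where f: "f \<in> ?X (carrier R)" "f \<noteq> ?id" using idX by auto
  have fF: "f \<in> coset_auts S" using f by simp
  have "f (a \<otimes> b) = f a \<otimes> f b" if a: "a \<in> carrier R" and b: "b \<in> carrier R" for a b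
  proof -
    have sh: "shift b f = f" using f(1) b by simp
    have "f a = shift b f a" by (simp only: sh)
    also have "\<dots> = f (a \<otimes> b) \<otimes> inv (f b)" using a by (simp add: shift_def)
    finally show ?thesis using coset_auts_facts(4)[OF fF] a b by (simp add: m_assoc)
  qed
  then show ?thesis using f(2) fF by blast
qed

text \<open>The vertices fixed by every shift of f, because shift u f y = y means f (y u) = y f u.
  In this form it is visibly a subgroup, and it is proper for nontrivial f because f \<one> =
  \<one>.\<close>

definition left_commutant :: "('a \<Rightarrow> 'a) \<Rightarrow> 'a set" where
  "left_commutant f = {y\<in>carrier R. \<forall>u\<in>carrier R. f (y \<otimes> u) = y \<otimes> f u}"

lemma left_commutant_subgroup:
  assumes fc: "\<And>x. x \<in> carrier R \<Longrightarrow> f x \<in> carrier R"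
  shows "subgroup (left_commutant f) R"
proof (rule subgroupI)
  show "left_commutant f \<subseteq> carrier R" by (auto simp: left_commutant_def)
  have "\<one> \<in> left_commutant f" using fc by (simp add: left_commutant_def)
  then show "left_commutant f \<noteq> {}" by auto
  fix a assume "a \<in> left_commutant f"
  then have a: "a \<in> carrier R" "\<And>u. u \<in> carrier R \<Longrightarrow> f (a \<otimes> u) = a \<otimes> f u"
    by (auto simp: left_commutant_def)
  have "f (inv a \<otimes> u) = inv a \<otimes> f u" if u: "u \<in> carrier R" for u
  proof -
    have "a \<otimes> (inv a \<otimes> u) = u" using a(1) u by (simp add: m_assoc[symmetric])
    then have "a \<otimes> f (inv a \<otimes> u) = f u" using a(2)[of "inv a \<otimes> u"] a(1) u by simp
    then have "inv a \<otimes> (a \<otimes> f (inv a \<otimes> u)) = inv a \<otimes> f u" by simp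
    then show ?thesis using fc[of "inv a \<otimes> u"] a(1) u by (simp add: m_assoc[symmetric])
  qed
  then show "inv a \<in> left_commutant f" using a(1) by (simp add: left_commutant_def)
  fix b assume "b \<in> left_commutant f"
  then have b: "b \<in> carrier R" "\<And>u. u \<in> carrier R \<Longrightarrow> f (b \<otimes> u) = b \<otimes> f u"
    by (auto simp: left_commutant_def)
  have "f (a \<otimes> b \<otimes> u) = a \<otimes> b \<otimes> f u" if u: "u \<in> carrier R" for u
    using a(2)[of "b \<otimes> u"] b(2)[OF u] a(1) b(1) u fc[OF u] by (simp add: m_assoc)
  then show "a \<otimes> b \<in> left_commutant f" using a(1) b(1) by (simp add: left_commutant_def)
qed

lemma left_commutant_proper:
  assumes f: "f \<in> coset_auts S" and ne: "f \<noteq> (\<lambda>x\<in>carrier R. x)"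
  shows "left_commutant f \<noteq> carrier R"
proof
  note F = coset_auts_facts[OF f]
  assume J: "left_commutant f = carrier R"
  have "f = (\<lambda>x\<in>carrier R. x)"
  proof
    fix y
    show "f y = (\<lambda>x\<in>carrier R. x) y"
    proof (cases "y \<in> carrier R")
      case True
      then have "y \<in> left_commutant f" using J by simp
      then have "\<forall>u\<in>carrier R. f (y \<otimes> u) = y \<otimes> f u" by (simp add: left_commutant_def)
      then have "f (y \<otimes> \<one>) = y \<otimes> f \<one>" using one_closed by (rule bspec)
      then show ?thesis using F(2) True by simp
    qed (simp add: extensional_arb[OF F(10)])
  qed
  then show False using ne by simp
qed

lemma left_commutantI:
  assumes f: "f \<in> coset_auts S" and y: "y \<in> carrier R"
    and fixed: "\<And>g. g \<in> coset_auts S \<Longrightarrow> g \<in> (\<lambda>u. shift u f) ` carrier R \<Longrightarrow> g y = y"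
  shows "y \<in> left_commutant f"
proof -
  note F = coset_auts_facts[OF f]
  have "f (y \<otimes> u) = y \<otimes> f u" if u: "u \<in> carrier R" for u
  proof -
    have "shift u f y = y" using fixed shift_coset_auts[OF f u] u by blast
    then have "f (y \<otimes> u) \<otimes> inv (f u) = y" using y by (simp add: shift_def)
    then have "f (y \<otimes> u) \<otimes> inv (f u) \<otimes> f u = y \<otimes> f u" by simp
    then show ?thesis using F(4)[OF u] F(4)[of "y \<otimes> u"] y u by (simp add: m_assoc)
  qed
  then show ?thesis using y by (simp add: left_commutant_def)
qed

lemma coset_auts_preserve:
  assumes g: "g \<in> coset_auts S" and y: "y \<in> carrier R" and w: "w \<in> S \<inter> (N #> y)"
  shows "g w \<in> S \<inter> (N #> y)"
proof -
  note G = coset_auts_facts[OF g]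
  have wc: "w \<in> carrier R" using w coset_carrier[OF y] by blast
  have "g w \<in> N #> y" using G(3)[OF wc] coset_eq[OF y] w by simp
  then show ?thesis using G(11)[OF wc] w by simp
qed

text \<open>All shifts of f preserve S and the coset, so they fix the only point of the
  trace.\<close>

lemma singleton_coset_left_commutant:
  assumes f: "f \<in> coset_auts S" and y: "y \<in> carrier R" and S: "S \<inter> (N #> y) = {y}"
  shows "y \<in> left_commutant f"
proof (rule left_commutantI[OF f y])
  fix g assume "g \<in> coset_auts S"
  from coset_auts_preserve[OF this y, of y] show "g y = y" using S by simp
qed

text \<open>On a coset closed under inversion S contains inv y together with y, so the pair takes
  the place of the singleton. Its two points could only be swapped, which the odd order
  excludes.\<close>

lemma inverse_pair_coset_left_commutant:
  assumes odd: "odd (card (coset_auts S))"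
    and f: "f \<in> coset_auts S" and y: "y \<in> carrier R" and S: "S \<inter> (N #> y) = {y, inv y}"
  shows "y \<in> left_commutant f"
proof (rule left_commutantI[OF f y])
  fix g assume g: "g \<in> coset_auts S"
  note G = coset_auts_facts[OF g]
  have 1: "g y \<in> {y, inv y}" using coset_auts_preserve[OF g y, of y] S by simp
  have 2: "g (inv y) \<in> {y, inv y}" using coset_auts_preserve[OF g y, of "inv y"] S by simp
  show "g y = y"
  proof (rule ccontr)
    assume ne: "g y \<noteq> y"
    then have gy: "g y = inv y" using 1 by simp
    have "inv y \<noteq> y" using gy ne by simp
    then have "g (inv y) \<noteq> g y" using inj_onD[OF G(8)] y by auto
    then have "g (g y) = y" using 2 gy by auto
    then show False using odd_coset_auts_no_swap[OF odd g y] ne by simp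
  qed
qed

text \<open>A map g that is trivial on N acts on \<open>N #> y\<close> as left multiplication by e =
  g y \<otimes> inv y, an element of N, and the trace of S is invariant under e. A trace without
  periods forces e = \<one>.\<close>

lemma aperiodic_coset_left_commutant:
  assumes triv: "\<And>g n. g \<in> coset_auts S \<Longrightarrow> n \<in> N \<Longrightarrow> g n = n"
    and f: "f \<in> coset_auts S" and y: "y \<in> carrier R"
    and ap: "\<And>z. z \<in> N \<Longrightarrow> z \<noteq> \<one> \<Longrightarrow> \<exists>w\<in>S \<inter> (N #> y). z \<otimes> w \<notin> S"
  shows "y \<in> left_commutant f"
proof (rule left_commutantI[OF f y])
  fix g assume g: "g \<in> coset_auts S"
  note G = coset_auts_facts[OF g]
  let ?e = "g y \<otimes> inv y"
  have e: "?e \<in> N" using coset_iff(2)[OF y G(4)[OF y]] G(3)[OF y] by simp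
  have "?e \<otimes> w \<in> S" if w: "w \<in> S \<inter> (N #> y)" for w
  proof -
    obtain n where n: "n \<in> N" "w = y \<otimes> n" using coset_rep[OF y] w by auto
    have "g w = g y \<otimes> n" using G(5)[OF y n(1)] triv[OF g n(1)] n(2) by simp
    also have "\<dots> = ?e \<otimes> w"
    proof -
      have "inv y \<otimes> (y \<otimes> n) = n" using y N_carrier[OF n(1)] by (simp add: m_assoc[symmetric])
      then show ?thesis using y N_carrier[OF n(1)] G(4)[OF y] n(2) by (simp add: m_assoc)
    qed
    finally show ?thesis using coset_auts_preserve[OF g y w] by simp
  qed
  then have "?e = \<one>" using ap[OF e] by blast
  then have "?e \<otimes> y = y" using y by simp
  then show "g y = y" using y G(4)[OF y] by (simp add: m_assoc)
qed

text \<open>The stabiliser, under left multiplication, of the set of fixed points of f. It replaces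
  \<open>left_commutant\<close> where only f itself is known to be trivial on N: the argument that
  \<open>shift u f\<close> is then trivial on N uses f u = u.\<close>

definition fix_translators :: "('a \<Rightarrow> 'a) \<Rightarrow> 'a set" where
  "fix_translators f = {y\<in>carrier R. \<forall>u\<in>carrier R. f u = u \<longrightarrow> f (y \<otimes> u) = y \<otimes> u}"

lemma fix_translators_subgroup: "subgroup (fix_translators f) R"
proof (rule subgroupI)
  let ?D = "{u\<in>carrier R. f u = u}"
  show "fix_translators f \<subseteq> carrier R" by (auto simp: fix_translators_def)
  have "\<one> \<in> fix_translators f" by (simp add: fix_translators_def)
  then show "fix_translators f \<noteq> {}" by auto
  fix a assume "a \<in> fix_translators f"
  then have a: "a \<in> carrier R" "\<And>u. u \<in> carrier R \<Longrightarrow> f u = u \<Longrightarrow> f (a \<otimes> u) = a \<otimes> u"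
    by (auto simp: fix_translators_def)
  have surj: "(\<lambda>u. a \<otimes> u) ` ?D = ?D"
  proof (rule endo_inj_surj)
    show "finite ?D" using fin by simp
    show "(\<lambda>u. a \<otimes> u) ` ?D \<subseteq> ?D" using a by auto
    show "inj_on (\<lambda>u. a \<otimes> u) ?D" using a(1) by (auto intro!: inj_onI)
  qed
  have "f (inv a \<otimes> u) = inv a \<otimes> u" if u: "u \<in> carrier R" "f u = u" for u
  proof -
    have "u \<in> (\<lambda>u. a \<otimes> u) ` ?D" unfolding surj using u by simp
    then obtain v where v: "v \<in> carrier R" "f v = v" "u = a \<otimes> v" by auto
    then have "inv a \<otimes> u = v" using a(1) by (simp add: m_assoc[symmetric])
    then show ?thesis using v by simp
  qed
  then show "inv a \<in> fix_translators f" using a(1) by (simp add: fix_translators_def)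
  fix b assume "b \<in> fix_translators f"
  then have b: "b \<in> carrier R" "\<And>u. u \<in> carrier R \<Longrightarrow> f u = u \<Longrightarrow> f (b \<otimes> u) = b \<otimes> u"
    by (auto simp: fix_translators_def)
  have "f (a \<otimes> b \<otimes> u) = a \<otimes> b \<otimes> u" if u: "u \<in> carrier R" "f u = u" for u
    using a(2)[of "b \<otimes> u"] b(2)[OF u] a(1) b(1) u by (simp add: m_assoc)
  then show "a \<otimes> b \<in> fix_translators f" using a(1) b(1) by (simp add: fix_translators_def)
qed

lemma fix_translators_proper:
  assumes f: "f \<in> coset_auts S" and ne: "f \<noteq> (\<lambda>x\<in>carrier R. x)"
  shows "fix_translators f \<noteq> carrier R"
proof
  note F = coset_auts_facts[OF f]
  assume J: "fix_translators f = carrier R"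
  have "f = (\<lambda>x\<in>carrier R. x)"
  proof
    fix y
    show "f y = (\<lambda>x\<in>carrier R. x) y"
    proof (cases "y \<in> carrier R")
      case True
      then have "y \<in> fix_translators f" using J by simp
      then have "\<forall>u\<in>carrier R. f u = u \<longrightarrow> f (y \<otimes> u) = y \<otimes> u" by (simp add: fix_translators_def)
      then have "f \<one> = \<one> \<longrightarrow> f (y \<otimes> \<one>) = y \<otimes> \<one>" using one_closed by (rule bspec)
      then show ?thesis using F(2) True by simp
    qed (simp add: extensional_arb[OF F(10)])
  qed
  then show False using ne by simp
qed

text \<open>For a fixed point u, \<open>shift u f\<close> acts on \<open>N #> y\<close> as left
  multiplication by some e in N. If e^2 = 1, it would swap y and e y unless e = \<one>, and the odd
  order excludes swaps. So only periods z with z \<otimes> z \<noteq> \<one> have to be ruled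
  out.\<close>

lemma odd_aperiodic_coset_fix_translators:
  assumes odd: "odd (card (coset_auts S))"
    and f: "f \<in> coset_auts S" and triv: "\<And>n. n \<in> N \<Longrightarrow> f n = n" and y: "y \<in> carrier R"
    and ap: "\<And>z. z \<in> N \<Longrightarrow> z \<otimes> z \<noteq> \<one> \<Longrightarrow> \<exists>w\<in>S \<inter> (N #> y). z \<otimes> w \<notin> S"
  shows "y \<in> fix_translators f"
proof -
  note F = coset_auts_facts[OF f]
  have "f (y \<otimes> u) = y \<otimes> u" if u: "u \<in> carrier R" "f u = u" for u
  proof -
    let ?g = "shift u f"
    have g: "?g \<in> coset_auts S" by (rule shift_coset_auts[OF f u(1)])
    note G = coset_auts_facts[OF g]
    have val: "?g v = f (v \<otimes> u) \<otimes> inv u" if "v \<in> carrier R" for v using that u by (simp add: shift_def)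
    have gn: "?g n = n" if n: "n \<in> N" for n
    proof -
      have nc: "n \<in> carrier R" using N_carrier[OF n] .
      have n': "inv u \<otimes> n \<otimes> u \<in> N" by (rule N_conj[OF u(1) n])
      have "f (n \<otimes> u) = u \<otimes> (inv u \<otimes> n \<otimes> u)"
        using N_past[OF u(1) n] F(5)[OF u(1) n'] triv[OF n'] u(2) by simp
      also have "\<dots> = n \<otimes> u" using N_past[OF u(1) n] by simp
      finally show ?thesis using val[OF nc] nc u(1) by (simp add: m_assoc)
    qed
    let ?e = "?g y \<otimes> inv y"
    have e: "?e \<in> N" using coset_iff(2)[OF y G(4)[OF y]] G(3)[OF y] by simp
    have ec: "?e \<in> carrier R" using N_carrier[OF e] .
    have ge: "?g w = ?e \<otimes> w" if w: "w \<in> N #> y" for w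
    proof -
      obtain n where n: "n \<in> N" "w = y \<otimes> n" using coset_rep[OF y w] by auto
      have "?g w = ?g y \<otimes> n" using G(5)[OF y n(1)] gn[OF n(1)] n(2) by simp
      also have "\<dots> = ?e \<otimes> w"
      proof -
        have "inv y \<otimes> (y \<otimes> n) = n" using y N_carrier[OF n(1)] by (simp add: m_assoc[symmetric])
        then show ?thesis using y N_carrier[OF n(1)] G(4)[OF y] n(2) by (simp add: m_assoc)
      qed
      finally show ?thesis .
    qed
    have "?e \<otimes> w \<in> S" if w: "w \<in> S \<inter> (N #> y)" for w
      using ge[of w] coset_auts_preserve[OF g y w] w by simp
    then have ee: "?e \<otimes> ?e = \<one>" using ap[OF e] by blast
    have gy: "?g y = ?e \<otimes> y" by (rule ge[OF coset_self[OF y]])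
    have "?g (?g y) = ?e \<otimes> (?e \<otimes> y)" using ge[OF G(3)[OF y]] gy by simp
    also have "\<dots> = y" using ee ec y by (simp only: m_assoc[symmetric] l_one)
    finally have "?g y = y" by (rule odd_coset_auts_no_swap[OF odd g y])
    then have "f (y \<otimes> u) \<otimes> inv u = y" using val[OF y] by simp
    then have "f (y \<otimes> u) \<otimes> inv u \<otimes> u = y \<otimes> u" by simp
    then show ?thesis using F(4)[of "y \<otimes> u"] y u(1) by (simp add: m_assoc)
  qed
  then show ?thesis using y by (simp add: fix_translators_def)
qed

text \<open>Here h is f^-1 composed with \<open>shift x f\<close>. As x \<otimes> x lies in N,
  shifting twice by x returns f, so shifting h by x interchanges the roles of f and
  \<open>shift x f\<close> and yields h^-1. The last conclusion is this identity, evaluated at h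
  y.\<close>

lemma shift_anti_invariant:
  assumes sq: "\<And>x. x \<in> carrier R \<Longrightarrow> x \<otimes> x \<in> N"
    and f: "f \<in> coset_auts S" and x: "x \<in> carrier R"
  obtains h where "h \<in> coset_auts S" "\<And>y. y \<in> carrier R \<Longrightarrow> f (h y) = shift x f y"
    "\<And>y. y \<in> carrier R \<Longrightarrow> h (h y \<otimes> x) = y \<otimes> h x"
proof -
  note F = coset_auts_facts[OF f]
  have sx: "shift x f \<in> coset_auts S" by (rule shift_coset_auts[OF f x])
  note SX = coset_auts_facts[OF sx]
  obtain k where k: "k \<in> coset_auts S" "\<And>y. y \<in> carrier R \<Longrightarrow> k (f y) = y" "\<And>y. y \<in> carrier R \<Longrightarrow> f (k y) = y"
    using inverse_coset_auts[OF f] by metis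
  let ?h = "compose (carrier R) k (shift x f)"
  have h: "?h \<in> coset_auts S" by (rule compose_coset_auts[OF k(1) sx])
  note H = coset_auts_facts[OF h]
  have fh: "f (?h y) = shift x f y" if "y \<in> carrier R" for y
    using that k(3) SX(4)[OF that] by (simp add: compose_def)
  have xx: "x \<otimes> x \<in> N #> \<one>" by (rule N_coset_one[OF sq[OF x]])
  have ss: "shift x (shift x f) = f"
    using shift_shift[OF f x x] shift_coset[OF f one_closed xx] shift_one[OF f] by simp
  have hx: "?h x \<in> carrier R" by (rule H(4)[OF x])
  have main: "?h (?h y \<otimes> x) = y \<otimes> ?h x" if y: "y \<in> carrier R" for y
  proof -
    let ?w = "?h y"
    have w: "?w \<in> carrier R" by (rule H(4)[OF y])
    have hxN: "?h x \<in> N #> x" by (rule H(3)[OF x])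
    have yh: "y \<otimes> ?h x \<in> carrier R" "?w \<otimes> x \<in> carrier R" using y hx w x by auto
    have "f (y \<otimes> ?h x) = shift (?h x) f y \<otimes> f (?h x)"
      using y F(4)[OF hx] F(4)[OF yh(1)] by (simp add: shift_def m_assoc)
    also have "shift (?h x) f = shift x f" by (rule shift_coset[OF f x hxN])
    also have "shift x f y \<otimes> f (?h x) = f ?w \<otimes> f (?h x)" using fh[OF y] by simp
    also have "f ?w = shift x (shift x f) ?w" using ss by simp
    also have "\<dots> = shift x f (?w \<otimes> x) \<otimes> inv (shift x f x)"
      using w by (simp add: shift_def[of x "shift x f"])
    also have "\<dots> \<otimes> f (?h x) = shift x f (?w \<otimes> x)"
      using fh[OF x] SX(4)[OF x] SX(4)[OF yh(2)] by (simp add: m_assoc)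
    also have "\<dots> = f (?h (?w \<otimes> x))" using fh[OF yh(2)] by simp
    finally have "f (y \<otimes> ?h x) = f (?h (?w \<otimes> x))" .
    then show ?thesis using inj_onD[OF F(8) _ yh(1) H(4)[OF yh(2)]] by simp
  qed
  show ?thesis by (rule that[OF h fh main])
qed

end

section \<open>Local estimates\<close>

context coset_setting
begin

definition inverse_closed :: "'a set set" where
  "inverse_closed = {S. S \<subseteq> carrier R \<and> (\<forall>x\<in>S. inv x \<in> S)}"

text \<open>The smallest union of cosets that contains x and is closed under inversion: one coset if
  x \<otimes> x \<in> N, two disjoint ones otherwise.\<close>

definition block :: "'a \<Rightarrow> 'a set" where
  "block x = (N #> x) \<union> (N #> inv x)"

text \<open>The bound for a single guess. The number of guesses and of families accounts for the
  remaining summands in the exponent of the theorem.\<close>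

definition count_bound :: real where
  "count_bound = 2 powr (c_num R - real (order R) / (192 * real (card N)))"

lemma card_N_pos: "0 < card N"
  using N_one N_finite card_gt_0_iff by blast

text \<open>Blocks with at most b elements that cover X number at least |X| / b. By
  \<open>enough\<close>, |\<P>'| / m is then at least |R| / (192 |N|), and this is the exponent
  saved when m factors \<rho> are worth 1/2.\<close>

lemma card_family_partition_le:
  assumes un: "\<Union>\<P> = carrier R"
    and dis: "\<And>A B. A \<in> \<P> \<Longrightarrow> B \<in> \<P> \<Longrightarrow> A \<noteq> B \<Longrightarrow> A \<inter> B = {}"
    and inv: "\<And>B x. B \<in> \<P> \<Longrightarrow> x \<in> B \<Longrightarrow> inv x \<in> B"
    and S: "\<S> \<subseteq> inverse_closed" and P': "\<P>' \<subseteq> \<P>"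
    and \<rho>: "0 < \<rho>" "\<rho> ^ m \<le> 1 / 2" "0 < m" and bp: "0 < b"
    and small: "\<And>B. B \<in> \<P>' \<Longrightarrow> real (card ((\<lambda>S. S \<inter> B) ` \<S>)) \<le> \<rho> * 2 powr inv_orbits B"
    and b: "\<And>B. B \<in> \<P>' \<Longrightarrow> card B \<le> b" and X: "X \<subseteq> \<Union>\<P>'"
    and enough: "m * card (carrier R) * b \<le> 192 * card X * card N"
  shows "real (card \<S>) \<le> count_bound"
proof -
  let ?k = "card \<P>'" and ?q = "card (rcosets N)"
  have finP': "finite \<P>'"
    using fin finite_UnionD[of \<P>] P' finite_subset by (simp add: un)
  have fB: "finite B" if "B \<in> \<P>'" for B
  proof -
    have "B \<subseteq> \<Union>\<P>" using that P' by auto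
    then show ?thesis unfolding un by (rule finite_subset[OF _ fin])
  qed
  have "card X \<le> card (\<Union>\<P>')" by (rule card_mono[OF _ X]) (use finP' fB in auto)
  also have "\<dots> \<le> (\<Sum>B\<in>\<P>'. card B)" using card_Union_le_sum_card[of \<P>'] by simp
  also have "\<dots> \<le> ?k * b" using sum_bounded_above[of \<P>' card b] b by simp
  finally have kX: "card X \<le> ?k * b" .
  have qn: "?q * card N = card (carrier R)" using lagrange[OF N_subgroup] by (simp add: order_def)
  have "(m * ?q) * (card N * b) = m * card (carrier R) * b" using qn by (simp add: algebra_simps)
  also have "\<dots> \<le> 192 * card X * card N" by (rule enough)
  also have "\<dots> \<le> 192 * (?k * b) * card N" by (intro mult_le_mono kX order_refl)
  also have "\<dots> = (192 * ?k) * (card N * b)" by (simp add: algebra_simps)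
  finally have bpos: "m * ?q \<le> 192 * ?k" using bp card_N_pos by simp
  have "real (card \<S>) \<le> \<rho> ^ ?k * 2 powr c_num R"
    by (rule card_inverse_closed_blocks_le[OF fin un dis inv _ P' _ small])
      (use S \<rho> in \<open>auto simp: inverse_closed_def\<close>)
  also have "\<dots> \<le> 2 powr (- real ?q / 192) * 2 powr c_num R"
    by (intro mult_right_mono power_le_powr[OF \<rho>(1,2,3) bpos]) simp
  also have "\<dots> = count_bound"
  proof -
    have "real (order R) / (192 * real (card N)) = real ?q / 192"
      using card_N_pos unfolding order_def qn[symmetric] by (simp add: mult.commute)
    then show ?thesis unfolding count_bound_def by (simp only: powr_add[symmetric]) simp
  qed
  finally show ?thesis .
qed

section \<open>Blocks made of a coset and its inverse\<close>

lemma inv_coset_iff: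
  assumes x: "x \<in> carrier R" and y: "y \<in> N #> x"
  shows "inv y \<in> N #> inv x"
proof -
  have yc: "y \<in> carrier R" using y coset_carrier[OF x] by blast
  have "inv x \<otimes> y \<in> N" using coset_iff(1)[OF x yc] y by simp
  then have "inv (inv x \<otimes> y) \<in> N" by (rule N_inv)
  then show ?thesis using coset_iff(2)[of "inv x" "inv y"] x yc by (simp add: inv_mult_group)
qed

lemma block_inv: "x \<in> carrier R \<Longrightarrow> y \<in> block x \<Longrightarrow> inv y \<in> block x"
  using inv_coset_iff[of x y] inv_coset_iff[of "inv x" y] unfolding block_def by auto

lemma block_self: "x \<in> carrier R \<Longrightarrow> x \<in> block x"
  using coset_self by (simp add: block_def)

lemma block_carrier: "x \<in> carrier R \<Longrightarrow> block x \<subseteq> carrier R"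
  using coset_carrier[of x] coset_carrier[of "inv x"] by (simp add: block_def)

lemma block_eq:
  assumes x: "x \<in> carrier R" and y: "y \<in> block x"
  shows "block y = block x"
proof (cases "y \<in> N #> x")
  case True
  then show ?thesis
    using coset_eq[OF x True] coset_eq[OF _ inv_coset_iff[OF x True]] x by (simp add: block_def)
next
  case False
  then have y: "y \<in> N #> inv x" using y by (simp add: block_def)
  have ix: "inv x \<in> carrier R" using x by simp
  have "inv y \<in> N #> x" using inv_coset_iff[OF ix y] x by simp
  then show ?thesis using coset_eq[OF ix y] coset_eq[OF x] by (auto simp: block_def)
qed

lemma card_block_le: "x \<in> carrier R \<Longrightarrow> card (block x) \<le> 2 * card N"
  using card_Un_le[of "N #> x" "N #> inv x"] card_coset[of x] card_coset[of "inv x"]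
  by (simp add: block_def)

lemma block_involutory: "x \<in> carrier R \<Longrightarrow> x \<otimes> x \<in> N \<Longrightarrow> block x = N #> x"
proof -
  assume x: "x \<in> carrier R" and xx: "x \<otimes> x \<in> N"
  have "x \<in> N #> inv x" using coset_iff(2)[of "inv x" x] x xx by simp
  then show "block x = N #> x" using coset_eq[of "inv x" x] x by (simp add: block_def)
qed

lemma card_family_block_le:
  assumes S: "\<S> \<subseteq> inverse_closed" and X: "X \<subseteq> carrier R"
    and \<rho>: "0 < \<rho>" "\<rho> ^ m \<le> 1 / 2" "0 < m" and bp: "0 < b" and b: "\<And>x. x \<in> X \<Longrightarrow> card (block x) \<le> b"
    and small: "\<And>x. x \<in> X \<Longrightarrow> real (card ((\<lambda>S. S \<inter> block x) ` \<S>)) \<le> \<rho> * 2 powr inv_orbits (block x)"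
    and enough: "m * card (carrier R) * b \<le> 192 * card X * card N"
  shows "real (card \<S>) \<le> count_bound"
proof (rule card_family_partition_le[OF _ _ _ S _ \<rho> bp _ _ _ enough])
  show "\<Union>(block ` carrier R) = carrier R" using block_self block_carrier by auto
  show "A \<inter> B = {}" if AB: "A \<in> block ` carrier R" "B \<in> block ` carrier R" "A \<noteq> B" for A B
  proof (rule ccontr)
    assume "A \<inter> B \<noteq> {}"
    then obtain z where z: "z \<in> A" "z \<in> B" by auto
    obtain x where x: "x \<in> carrier R" "A = block x" using AB(1) by auto
    obtain y where y: "y \<in> carrier R" "B = block y" using AB(2) by auto
    show False using block_eq[OF x(1), of z] block_eq[OF y(1), of z] z x y AB(3) by simp
  qed
  show "inv x \<in> B" if "B \<in> block ` carrier R" "x \<in> B" for B x using that block_inv by auto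
  show "block ` X \<subseteq> block ` carrier R" using X by auto
  show "real (card ((\<lambda>S. S \<inter> B) ` \<S>)) \<le> \<rho> * 2 powr inv_orbits B" if "B \<in> block ` X" for B
    using that small by auto
  show "card B \<le> b" if "B \<in> block ` X" for B using that b by auto
  show "X \<subseteq> \<Union>(block ` X)" using X block_self by auto
qed

lemma inv_orbits_le: "finite B \<Longrightarrow> inv_orbits B \<le> real (card B)"
proof -
  assume "finite B"
  then have "card {x\<in>B. inv x = x} \<le> card B" by (intro card_mono) auto
  then show ?thesis by (simp add: inv_orbits_def)
qed

text \<open>A coset of at most six points has at most 2^6 inverse-closed subsets, and one of them,
  {y, inv y}, is missing.\<close>

lemma inverse_pair_estimate:
  assumes S: "\<S> \<subseteq> inverse_closed" and y: "y \<in> carrier R" "y \<otimes> y \<in> N" and n: "card N \<le> 6"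
    and ne: "\<And>S. S \<in> \<S> \<Longrightarrow> S \<inter> (N #> y) \<noteq> {y, inv y}"
  shows "real (card ((\<lambda>S. S \<inter> block y) ` \<S>)) \<le> 63 / 64 * 2 powr inv_orbits (block y)"
proof -
  let ?B = "block y"
  have B: "?B = N #> y" by (rule block_involutory[OF y])
  have finB: "finite ?B" unfolding B by (rule finite_coset[OF y(1)])
  let ?W = "{T. T \<subseteq> ?B \<and> (\<forall>x\<in>T. inv x \<in> T)}"
  have "real (card ?W) \<le> 2 powr ((real (card ?B) + real (card {x\<in>?B. inv x = x})) / 2 - real (card ({}::'a set)) / 4)"
  proof (rule card_involution_invariant_subsets_le[OF finB])
    show "inv x \<in> ?B" if "x \<in> ?B" for x using block_inv[OF y(1) that] .
    show "inv (inv x) = x" if "x \<in> ?B" for x using that block_carrier[OF y(1)] by auto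
  qed auto
  then have W: "real (card ?W) \<le> 2 powr inv_orbits ?B" by (simp add: inv_orbits_def)
  have finW: "finite ?W" using finB by simp
  have p: "{y, inv y} \<in> ?W" using block_self[OF y(1)] block_inv[OF y(1)] y(1) by auto
  have "(\<lambda>S. S \<inter> ?B) ` \<S> \<subseteq> ?W - {{y, inv y}}"
  proof
    fix T assume "T \<in> (\<lambda>S. S \<inter> ?B) ` \<S>"
    then obtain S' where S': "S' \<in> \<S>" "T = S' \<inter> ?B" by auto
    then have "T \<in> ?W" using S block_inv[OF y(1)] by (auto simp: inverse_closed_def)
    moreover have "T \<noteq> {y, inv y}" using ne[OF S'(1)] S'(2) B by simp
    ultimately show "T \<in> ?W - {{y, inv y}}" by simp
  qed
  then have "card ((\<lambda>S. S \<inter> ?B) ` \<S>) \<le> card (?W - {{y, inv y}})" by (rule card_mono[rotated]) (use finW in simp)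
  also have "\<dots> = card ?W - 1" using p finW by simp
  finally have "real (card ((\<lambda>S. S \<inter> ?B) ` \<S>)) \<le> real (card ?W) - 1"
    using p finW card_gt_0_iff[of ?W] by (auto simp: of_nat_diff Suc_leI)
  also have "\<dots> \<le> 2 powr inv_orbits ?B - 1" using W by simp
  also have "\<dots> \<le> 63 / 64 * 2 powr inv_orbits ?B"
  proof -
    have "inv_orbits ?B \<le> 6" using inv_orbits_le[OF finB] card_coset[OF y(1)] n B by simp
    then have "2 powr inv_orbits ?B \<le> 2 powr 6" by (intro powr_mono) auto
    then show ?thesis by simp
  qed
  finally show ?thesis .
qed

text \<open>The cosets of y and inv y are disjoint and interchanged by inversion. So no element of
  the block equals its inverse, and an inverse-closed set is arbitrary on one coset and determined
  by it on the other. Estimates on one coset therefore need not take inversion into account.\<close>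

lemma noninvolutory_block:
  assumes S: "\<S> \<subseteq> inverse_closed" and y: "y \<in> carrier R" "y \<otimes> y \<notin> N"
  shows "inv_orbits (block y) = real (card N)"
    and "card ((\<lambda>S. S \<inter> block y) ` \<S>) \<le> card ((\<lambda>S. S \<inter> (N #> y)) ` \<S>)"
proof -
  let ?g = "N #> y" and ?g' = "N #> inv y"
  have iy: "inv y \<in> carrier R" using y by simp
  have dis: "?g \<inter> ?g' = {}"
  proof (rule ccontr)
    assume "?g \<inter> ?g' \<noteq> {}"
    then obtain z where z: "z \<in> ?g" "z \<in> ?g'" by auto
    have "?g = ?g'" using coset_eq[OF y(1) z(1)] coset_eq[OF iy z(2)] by simp
    then have "y \<in> ?g'" using coset_self[OF y(1)] by simp
    then show False using coset_iff(2)[OF iy y(1)] y by simp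
  qed
  have "{x\<in>block y. inv x = x} = {}"
  proof (rule ccontr)
    assume "{x\<in>block y. inv x = x} \<noteq> {}"
    then obtain x where x: "x \<in> block y" "inv x = x" by auto
    have "x \<in> ?g \<inter> ?g'"
      using x inv_coset_iff[OF y(1), of x] inv_coset_iff[OF iy, of x] y(1) by (auto simp: block_def)
    then show False using dis by simp
  qed
  then have fix0: "card {x\<in>block y. inv x = x} = 0" by (simp only: card.empty)
  have "card (block y) = 2 * card N"
    unfolding block_def using card_Un_disjoint[OF finite_coset[OF y(1)] finite_coset[OF iy] dis]
      card_coset[OF y(1)] card_coset[OF iy] by simp
  then show "inv_orbits (block y) = real (card N)" unfolding inv_orbits_def fix0 by simp
  have finS: "finite \<S>"
    by (rule finite_subset[of _ "Pow (carrier R)"]) (use S fin in \<open>auto simp: inverse_closed_def\<close>)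
  have "inj_on (\<lambda>T. T \<inter> ?g) ((\<lambda>S. S \<inter> block y) ` \<S>)"
  proof (rule inj_onI)
    fix T T' assume T: "T \<in> (\<lambda>S. S \<inter> block y) ` \<S>" and T': "T' \<in> (\<lambda>S. S \<inter> block y) ` \<S>"
      and eq: "T \<inter> ?g = T' \<inter> ?g"
    have icl: "inv x \<in> A" if "A \<in> (\<lambda>S. S \<inter> block y) ` \<S>" "x \<in> A" for A x
      using that S block_inv[OF y(1)] by (auto simp: inverse_closed_def)
    have sub: "A \<subseteq> B" if A: "A \<in> (\<lambda>S. S \<inter> block y) ` \<S>" and B: "B \<in> (\<lambda>S. S \<inter> block y) ` \<S>"
      and e: "A \<inter> ?g = B \<inter> ?g" for A B
    proof
      fix x assume x: "x \<in> A"
      have xb: "x \<in> block y" using A x by auto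
      have xc: "x \<in> carrier R" using xb block_carrier[OF y(1)] by auto
      show "x \<in> B"
      proof (cases "x \<in> ?g")
        case True
        then show ?thesis using x e by auto
      next
        case False
        then have "x \<in> ?g'" using xb by (simp add: block_def)
        then have "inv x \<in> ?g" using inv_coset_iff[OF iy, of x] y(1) by simp
        then have "inv x \<in> B" using icl[OF A x] e by auto
        then have "inv (inv x) \<in> B" by (rule icl[OF B])
        then show ?thesis using xc by simp
      qed
    qed
    show "T = T'" using sub[OF T T' eq] sub[OF T' T eq[symmetric]] by simp
  qed
  then have "card ((\<lambda>S. S \<inter> block y) ` \<S>) = card ((\<lambda>T. T \<inter> ?g) ` (\<lambda>S. S \<inter> block y) ` \<S>)"
    by (rule card_image[symmetric])
  also have "(\<lambda>T. T \<inter> ?g) ` (\<lambda>S. S \<inter> block y) ` \<S> = (\<lambda>S. S \<inter> ?g) ` \<S>"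
    by (auto simp: image_image block_def Int_assoc)
  finally show "card ((\<lambda>S. S \<inter> block y) ` \<S>) \<le> card ((\<lambda>S. S \<inter> ?g) ` \<S>)" by simp
qed

lemma singleton_estimate:
  assumes y: "y \<in> carrier R" and L: "L \<subseteq> N #> y"
    and ne: "\<And>S w. S \<in> \<S> \<Longrightarrow> w \<in> L \<Longrightarrow> S \<inter> (N #> y) \<noteq> {w}"
  shows "real (card ((\<lambda>S. S \<inter> (N #> y)) ` \<S>)) \<le> 2 ^ card N - real (card L)"
proof -
  let ?g = "N #> y" and ?L = "(\<lambda>w. {w}) ` L"
  have fing: "finite ?g" by (rule finite_coset[OF y])
  have "card ?L = card L" by (rule card_image) simp
  have sub: "?L \<subseteq> Pow ?g" using L by auto
  have "(\<lambda>S. S \<inter> ?g) ` \<S> \<subseteq> Pow ?g - ?L" using ne by auto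
  then have "card ((\<lambda>S. S \<inter> ?g) ` \<S>) \<le> card (Pow ?g - ?L)"
    by (rule card_mono[rotated]) (use fing in simp)
  also have "\<dots> = card (Pow ?g) - card ?L" by (rule card_Diff_subset[OF finite_subset[OF sub] sub]) (use fing in simp)
  finally have "card ((\<lambda>S. S \<inter> ?g) ` \<S>) \<le> 2 ^ card N - card L"
    using \<open>card ?L = card L\<close> card_Pow[OF fing] card_coset[OF y] by simp
  moreover have "card L \<le> 2 ^ card N"
    using card_mono[OF _ sub] fing \<open>card ?L = card L\<close> card_Pow[OF fing] card_coset[OF y] by simp
  ultimately have "real (card ((\<lambda>S. S \<inter> ?g) ` \<S>)) \<le> real (2 ^ card N - card L)" by (simp only: of_nat_le_iff)
  also have "\<dots> = 2 ^ card N - real (card L)" using \<open>card L \<le> 2 ^ card N\<close> by (simp add: of_nat_diff)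
  finally show ?thesis .
qed

text \<open>Left multiplication by z maps the finite set T injectively into itself, hence onto
  itself.\<close>

lemma translation_invariant_iff:
  assumes T: "finite T" "T \<subseteq> carrier R" and z: "z \<in> carrier R" and inv: "\<And>w. w \<in> T \<Longrightarrow> z \<otimes> w \<in> T"
    and w: "w \<in> carrier R"
  shows "z \<otimes> w \<in> T \<longleftrightarrow> w \<in> T"
proof
  assume zw: "z \<otimes> w \<in> T"
  have "(\<lambda>w. z \<otimes> w) ` T = T"
  proof (rule endo_inj_surj[OF T(1)])
    show "(\<lambda>w. z \<otimes> w) ` T \<subseteq> T" using inv by auto
    have "w \<in> carrier R" if "w \<in> T" for w using that T(2) by auto
    then show "inj_on (\<lambda>w. z \<otimes> w) T" using z by (auto intro!: inj_onI)
  qed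
  then obtain w' where w': "w' \<in> T" "z \<otimes> w = z \<otimes> w'" using zw by auto
  have "w' \<in> carrier R" using w' T(2) by auto
  then show "w \<in> T" using w' z w by simp
qed (rule inv)

text \<open>Union bound over the possible periods z: left multiplication by z has no fixed points,
  so at most 2^(n/2) traces are invariant under it.\<close>

lemma periodic_estimate:
  assumes y: "y \<in> carrier R" and n: "7 \<le> card N"
    and per: "\<And>S. S \<in> \<S> \<Longrightarrow> \<exists>z\<in>N. z \<noteq> \<one> \<and> (\<forall>w\<in>S \<inter> (N #> y). z \<otimes> w \<in> S)"
  shows "real (card ((\<lambda>S. S \<inter> (N #> y)) ` \<S>)) \<le> 9 / 10 * 2 ^ card N"
proof -
  let ?g = "N #> y" and ?n = "real (card N)"
  have fing: "finite ?g" by (rule finite_coset[OF y])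
  have gc: "?g \<subseteq> carrier R" by (rule coset_carrier[OF y])
  let ?V = "\<lambda>z. {T. T \<subseteq> ?g \<and> (\<forall>w\<in>T. z \<otimes> w \<in> T)}"
  have V: "real (card (?V z)) \<le> 2 powr (?n / 2)" if z: "z \<in> N - {\<one>}" for z
  proof -
    have zc: "z \<in> carrier R" and zN: "z \<in> N" using z N_carrier by auto
    have "real (card (?V z)) \<le> 2 powr (real (card ?g) - real (card ?g) / 2)"
    proof (rule card_invariant_subsets_le[OF fing _ subset_refl])
      fix x assume x: "x \<in> ?g"
      have xc: "x \<in> carrier R" using x gc by auto
      have "z \<otimes> x \<in> ?g" by (rule coset_lmult[OF y x zN])
      moreover have "z \<otimes> x \<noteq> x" using z zc xc by simp
      moreover have "z \<otimes> x \<in> T \<longleftrightarrow> x \<in> T" if "T \<in> ?V z" for T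
        by (rule translation_invariant_iff[OF _ _ zc _ xc]) (use that finite_subset[OF _ fing] gc in auto)
      ultimately show "\<exists>y\<in>?g. y \<noteq> x \<and> (\<forall>T\<in>?V z. (y \<in> T) = (x \<in> T))" by blast
    qed auto
    then show ?thesis using card_coset[OF y] by simp
  qed
  have "(\<lambda>S. S \<inter> ?g) ` \<S> \<subseteq> (\<Union>z\<in>N - {\<one>}. ?V z)"
  proof
    fix T assume "T \<in> (\<lambda>S. S \<inter> ?g) ` \<S>"
    then obtain S where S: "S \<in> \<S>" "T = S \<inter> ?g" by auto
    obtain z where z: "z \<in> N" "z \<noteq> \<one>" "\<forall>w\<in>S \<inter> ?g. z \<otimes> w \<in> S" using per[OF S(1)] by auto
    have "z \<otimes> w \<in> T" if "w \<in> T" for w using that z(3) coset_lmult[OF y _ z(1)] S(2) by simp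
    then show "T \<in> (\<Union>z\<in>N - {\<one>}. ?V z)" using z(1,2) S(2) by auto
  qed
  then have "card ((\<lambda>S. S \<inter> ?g) ` \<S>) \<le> card (\<Union>z\<in>N - {\<one>}. ?V z)"
    by (rule card_mono[rotated]) (use N_finite fing in auto)
  also have "\<dots> \<le> (\<Sum>z\<in>N - {\<one>}. card (?V z))" by (rule card_UN_le) (use N_finite in simp)
  finally have "real (card ((\<lambda>S. S \<inter> ?g) ` \<S>)) \<le> (\<Sum>z\<in>N - {\<one>}. real (card (?V z)))"
    by (simp only: of_nat_sum[symmetric] of_nat_le_iff)
  also have "\<dots> \<le> real (card (N - {\<one>})) * 2 powr (?n / 2)" by (rule sum_bounded_above[OF V])
  also have "card (N - {\<one>}) = card N - 1" using N_one N_finite by simp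
  also have "real (card N - 1) * 2 powr (?n / 2) \<le> 9 / 10 * 2 ^ card N"
  proof -
    \<comment> \<open>The bound for (n - 1) / 2 * 2^(-n/4) is reused: multiplied by 2 * 2^(3n/4) it
      bounds (n - 1) 2^(n/2), and the factor 2 is at most 2^(n/4).\<close>
    have "2 powr 1 \<le> 2 powr (?n / 4)" using n by (intro powr_mono) auto
    then have "2 \<le> 2 powr (?n / 4)" by simp
    have "real (card N - 1) / 2 * 2 powr (- ?n / 4) * (2 * 2 powr (?n / 4 * 3))
      \<le> 9 / 10 * (2 * 2 powr (?n / 4 * 3))"
      by (rule mult_right_mono[OF translations_powr_le[OF n]]) simp
    moreover have "real (card N - 1) / 2 * 2 powr (- ?n / 4) * (2 * 2 powr (?n / 4 * 3)) = real (card N - 1) * 2 powr (?n / 2)"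
      by (simp add: powr_add[symmetric])
    moreover have "2 * 2 powr (?n / 4 * 3) \<le> 2 powr (?n / 4) * 2 powr (?n / 4 * 3)"
      using \<open>2 \<le> 2 powr (?n / 4)\<close> by (rule mult_right_mono) simp
    moreover have "2 powr (?n / 4) * 2 powr (?n / 4 * 3) = 2 ^ card N"
      by (simp add: powr_add[symmetric] powr_realpow)
    ultimately show ?thesis by linarith
  qed
  finally show ?thesis .
qed

text \<open>The block is one coset, closed under inversion. If z^2 is nontrivial, one of z x and z^2
  x differs from both x and inv x, so every point is moved and a period saves n/4. The union bound
  over the periods is halved, because a trace with period z also has the different period inv
  z.\<close>

lemma odd_periodic_estimate:
  assumes S: "\<S> \<subseteq> inverse_closed" and y: "y \<in> carrier R" "y \<otimes> y \<in> N" and n: "7 \<le> card N"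
    and per: "\<And>S. S \<in> \<S> \<Longrightarrow> \<exists>z\<in>N. z \<otimes> z \<noteq> \<one> \<and> (\<forall>w\<in>S \<inter> (N #> y). z \<otimes> w \<in> S)"
  shows "real (card ((\<lambda>S. S \<inter> block y) ` \<S>)) \<le> 9 / 10 * 2 powr inv_orbits (block y)"
proof -
  let ?g = "block y" and ?n = "real (card N)" and ?Z = "{z\<in>N. z \<otimes> z \<noteq> \<one>}"
  have g: "?g = N #> y" by (rule block_involutory[OF y])
  have fing: "finite ?g" unfolding g by (rule finite_coset[OF y(1)])
  have gc: "?g \<subseteq> carrier R" by (rule block_carrier[OF y(1)])
  let ?V = "\<lambda>z. {T. T \<subseteq> ?g \<and> (\<forall>w\<in>T. z \<otimes> w \<in> T) \<and> (\<forall>w\<in>T. inv w \<in> T)}"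
  have finV: "finite (?V z)" for z using fing by simp
  have V: "real (card (?V z)) \<le> 2 powr (inv_orbits ?g - ?n / 4)" if z: "z \<in> ?Z" for z
  proof -
    have zc: "z \<in> carrier R" and zN: "z \<in> N" and zz: "z \<otimes> z \<noteq> \<one>" using z N_carrier by auto
    have "real (card (?V z)) \<le> 2 powr ((real (card ?g) + real (card {x\<in>?g. inv x = x})) / 2 - real (card ?g) / 4)"
    proof (rule card_involution_invariant_subsets_le[OF fing _ subset_refl])
      show "inv x \<in> ?g" if "x \<in> ?g" for x using block_inv[OF y(1) that] .
      show "inv (inv x) = x" if "x \<in> ?g" for x using that gc by auto
      fix x assume x: "x \<in> ?g"
      have xc: "x \<in> carrier R" using x gc by auto
      have m1: "z \<otimes> x \<in> ?g" using coset_lmult[OF y(1) _ zN] x g by simp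
      have m2: "z \<otimes> (z \<otimes> x) \<in> ?g" using coset_lmult[OF y(1) _ zN] m1 g by simp
      have z1: "z \<noteq> \<one>" using zz by auto
      have n1: "z \<otimes> x \<noteq> x" using z1 zc xc by simp
      have n2: "z \<otimes> (z \<otimes> x) \<noteq> x"
      proof
        assume "z \<otimes> (z \<otimes> x) = x"
        then have "(z \<otimes> z) \<otimes> x = x" using zc xc by (simp add: m_assoc)
        then show False using zz zc xc by simp
      qed
      have n3: "z \<otimes> (z \<otimes> x) \<noteq> z \<otimes> x"
      proof
        assume "z \<otimes> (z \<otimes> x) = z \<otimes> x"
        then have "z \<otimes> x = x" using zc xc by simp
        then show False using n1 by simp
      qed
      have i1: "z \<otimes> w \<in> T \<longleftrightarrow> w \<in> T" if "T \<in> ?V z" "w \<in> carrier R" for T w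
        by (rule translation_invariant_iff[OF _ _ zc _ that(2)]) (use that finite_subset[OF _ fing] gc in auto)
      have i2: "z \<otimes> (z \<otimes> x) \<in> T \<longleftrightarrow> x \<in> T" if "T \<in> ?V z" for T
        using i1[OF that, of x] i1[OF that, of "z \<otimes> x"] zc xc by simp
      show "\<exists>y\<in>?g. y \<noteq> x \<and> y \<noteq> inv x \<and> (\<forall>T\<in>?V z. (y \<in> T) = (x \<in> T))"
      proof (cases "z \<otimes> x = inv x")
        case True
        show ?thesis
        proof (rule bexI[OF _ m2], intro conjI ballI)
          show "z \<otimes> (z \<otimes> x) \<noteq> inv x" using n3 True by simp
        qed (use n2 i2 in auto)
      next
        case False
        show ?thesis
        proof (rule bexI[OF _ m1], intro conjI ballI)
          show "(z \<otimes> x \<in> T) = (x \<in> T)" if "T \<in> ?V z" for T by (rule i1[OF that xc])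
        qed (use n1 False in auto)
      qed
    qed auto
    then show ?thesis using card_coset[OF y(1)] g by (simp add: inv_orbits_def)
  qed
  let ?U = "(\<lambda>S. S \<inter> ?g) ` \<S>"
  have finS: "finite \<S>"
    by (rule finite_subset[of _ "Pow (carrier R)"]) (use S fin in \<open>auto simp: inverse_closed_def\<close>)
  have finU: "finite ?U" using finS by simp
  have finZ: "finite ?Z" using N_finite by simp
  have two: "2 \<le> card {z\<in>?Z. T \<in> ?V z}" if T: "T \<in> ?U" for T
  proof -
    obtain S' where S': "S' \<in> \<S>" "T = S' \<inter> ?g" using T by auto
    obtain z where z: "z \<in> N" "z \<otimes> z \<noteq> \<one>" "\<forall>w\<in>S' \<inter> (N #> y). z \<otimes> w \<in> S'" using per[OF S'(1)] by auto
    have zc: "z \<in> carrier R" using z(1) N_carrier by simp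
    have Tg: "T \<subseteq> ?g" using S'(2) by simp
    have inv: "\<forall>w\<in>T. inv w \<in> T" using S'(1,2) S block_inv[OF y(1)] by (auto simp: inverse_closed_def)
    have cl: "z \<otimes> w \<in> T" if "w \<in> T" for w
      using that z(3) coset_lmult[OF y(1) _ z(1)] S'(2) g by simp
    have "inv z \<otimes> w \<in> T" if w: "w \<in> T" for w
    proof -
      have wc: "w \<in> carrier R" using w Tg gc by auto
      have "z \<otimes> (inv z \<otimes> w) \<in> T" using w wc zc by (simp add: m_assoc[symmetric])
      then show ?thesis
        using translation_invariant_iff[OF finite_subset[OF Tg fing] _ zc cl, of "inv z \<otimes> w"] Tg gc wc zc by auto
    qed
    then have 2: "inv z \<in> {z\<in>?Z. T \<in> ?V z}"
    proof -
      assume *: "\<And>w. w \<in> T \<Longrightarrow> inv z \<otimes> w \<in> T"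
      have "inv z \<otimes> inv z \<noteq> \<one>"
      proof
        assume "inv z \<otimes> inv z = \<one>"
        then have "inv (z \<otimes> z) = \<one>" using zc by (simp add: inv_mult_group)
        then have "inv (inv (z \<otimes> z)) = inv \<one>" by (simp only:)
        then show False using z(2) zc by simp
      qed
      then show ?thesis using * N_inv[OF z(1)] Tg inv by simp
    qed
    have 1: "z \<in> {z\<in>?Z. T \<in> ?V z}" using z(1,2) cl Tg inv by simp
    have "z \<noteq> inv z"
    proof
      assume "z = inv z"
      then have "z \<otimes> z = z \<otimes> inv z" by simp
      then show False using z(2) zc by simp
    qed
    then have "card {z, inv z} = 2" by simp
    moreover have "{z, inv z} \<subseteq> {z\<in>?Z. T \<in> ?V z}" using 1 2 by blast
    then have "card {z, inv z} \<le> card {z\<in>?Z. T \<in> ?V z}" by (rule card_mono[rotated]) (use N_finite in auto)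
    ultimately show ?thesis by simp
  qed
  have "card ?U * 2 = (\<Sum>T\<in>?U. 2)" by simp
  also have "\<dots> \<le> (\<Sum>T\<in>?U. card {z\<in>?Z. T \<in> ?V z})" by (rule sum_mono) (rule two)
  also have "\<dots> = (\<Sum>T\<in>?U. \<Sum>z\<in>?Z. if T \<in> ?V z then 1 else 0)"
    using finZ by (simp add: sum.If_cases Int_def)
  also have "\<dots> = (\<Sum>z\<in>?Z. \<Sum>T\<in>?U. if T \<in> ?V z then 1 else 0)" by (rule sum.swap)
  also have "\<dots> = (\<Sum>z\<in>?Z. card (?U \<inter> ?V z))"
    using finU by (simp add: sum.If_cases Int_def)
  also have "\<dots> \<le> (\<Sum>z\<in>?Z. card (?V z))" by (rule sum_mono, rule card_mono[OF finV]) simp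
  finally have "real (card ?U * 2) \<le> (\<Sum>z\<in>?Z. real (card (?V z)))"
    by (simp only: of_nat_sum[symmetric] of_nat_le_iff)
  also have "\<dots> \<le> real (card ?Z) * 2 powr (inv_orbits ?g - ?n / 4)" by (rule sum_bounded_above[OF V])
  also have "\<dots> \<le> real (card N - 1) * 2 powr (inv_orbits ?g - ?n / 4)"
  proof (rule mult_right_mono)
    have "?Z \<subseteq> N - {\<one>}" by auto
    then have "card ?Z \<le> card (N - {\<one>})" by (rule card_mono[rotated]) (use N_finite in simp)
    then show "real (card ?Z) \<le> real (card N - 1)" using N_one N_finite by simp
  qed simp
  also have "2 powr (inv_orbits ?g - ?n / 4) = 2 powr (- ?n / 4) * 2 powr inv_orbits ?g"
    by (simp add: powr_add[symmetric])
  finally have "real (card ?U) \<le> (real (card N - 1) / 2 * 2 powr (- ?n / 4)) * 2 powr inv_orbits ?g"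
    by simp
  also have "\<dots> \<le> 9 / 10 * 2 powr inv_orbits ?g"
    by (rule mult_right_mono[OF translations_powr_le[OF n]]) simp
  finally show ?thesis .
qed

text \<open>The maps in P are affine over the same \<alpha> and determined by one value. Hence P has
  at most n members and each point is fixed by at most one of them. The fixed points of p lie in one
  left coset of the fixed subgroup of \<alpha>, whose order is a proper divisor of n. These are the
  hypotheses of \<open>sum_powr_fixed_points_le\<close>.\<close>

lemma affine_family_sum:
  assumes y: "y \<in> carrier R" and n: "7 \<le> card N" and finP: "finite P"
    and \<alpha>N: "\<And>n. n \<in> N \<Longrightarrow> \<alpha> n \<in> N"
    and \<alpha>m: "\<And>m n. m \<in> N \<Longrightarrow> n \<in> N \<Longrightarrow> \<alpha> (m \<otimes> n) = \<alpha> m \<otimes> \<alpha> n"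
    and nontriv: "\<exists>n\<in>N. \<alpha> n \<noteq> n"
    and pg: "\<And>p x. p \<in> P \<Longrightarrow> x \<in> N #> y \<Longrightarrow> p x \<in> N #> y"
    and pa: "\<And>p x n. p \<in> P \<Longrightarrow> x \<in> N #> y \<Longrightarrow> n \<in> N \<Longrightarrow> p (x \<otimes> n) = p x \<otimes> \<alpha> n"
    and det: "\<And>p q x. p \<in> P \<Longrightarrow> q \<in> P \<Longrightarrow> x \<in> N #> y \<Longrightarrow> p x = q x \<Longrightarrow> p = q"
  shows "(\<Sum>p\<in>P. 2 powr (- (real (card N) - real (card {x\<in>N #> y. p x = x})) / 2)) \<le> 9 / 10"
proof -
  let ?g = "N #> y" and ?K = "{n\<in>N. \<alpha> n = n}"
  have fing: "finite ?g" by (rule finite_coset[OF y])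
  have gc: "?g \<subseteq> carrier R" by (rule coset_carrier[OF y])
  have K: "subgroup ?K R"
  proof (rule subgroupI)
    show "?K \<subseteq> carrier R" using N_carrier by auto
    have "\<alpha> \<one> \<otimes> \<alpha> \<one> = \<alpha> \<one>" using \<alpha>m[OF N_one N_one] by simp
    then have a1: "\<alpha> \<one> = \<one>" using N_carrier[OF \<alpha>N[OF N_one]] by simp
    then show "?K \<noteq> {}" using N_one by auto
    fix a assume a: "a \<in> ?K"
    have ia: "inv a \<in> N" using a N_inv by simp
    have "\<alpha> (inv a) \<otimes> \<alpha> a = \<one>" using \<alpha>m[OF ia, of a] a a1 N_carrier by simp
    then have "\<alpha> (inv a) \<otimes> a = \<one>" using a by simp
    then have "inv a = \<alpha> (inv a)" by (rule inv_equality) (use a N_carrier \<alpha>N[OF ia] in auto)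
    then show "inv a \<in> ?K" using ia by simp
    fix b assume b: "b \<in> ?K"
    show "a \<otimes> b \<in> ?K" using a b \<alpha>m[of a b] N_mult[of a b] by simp
  qed
  have KN: "?K \<subseteq> N" by auto
  have dvd: "card ?K dvd card N"
  proof -
    interpret NG: group "R\<lparr>carrier := N\<rparr>" by (rule subgroup_imp_group[OF N_subgroup])
    have "subgroup ?K (R\<lparr>carrier := N\<rparr>)" by (rule subgroup_incl[OF K N_subgroup KN])
    from NG.lagrange[OF this] have "card N = card ?K * card (rcosets\<^bsub>R\<lparr>carrier := N\<rparr>\<^esub> ?K)"
      by (simp add: order_def mult.commute)
    then show ?thesis by (rule dvdI)
  qed
  have less: "card ?K < card N" by (rule psubset_card_mono[OF N_finite]) (use nontriv in auto)
  have cP: "card P \<le> card N"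
  proof -
    have "card P \<le> card ?g"
    proof (rule card_inj_on_le[where f = "\<lambda>p. p y"])
      show "inj_on (\<lambda>p. p y) P" using det coset_self[OF y] by (auto intro!: inj_onI)
      show "(\<lambda>p. p y) ` P \<subseteq> ?g" using pg coset_self[OF y] by auto
    qed (rule fing)
    then show ?thesis using card_coset[OF y] by simp
  qed
  have fixK: "card {x\<in>?g. p x = x} \<le> card ?K" if p: "p \<in> P" for p
  proof (cases "{x\<in>?g. p x = x} = {}")
    case True
    show ?thesis unfolding True by simp
  next
    case False
    then obtain x0 where x0: "x0 \<in> ?g" "p x0 = x0" by auto
    have x0c: "x0 \<in> carrier R" using x0 gc by auto
    have "{x\<in>?g. p x = x} \<subseteq> (\<lambda>n. x0 \<otimes> n) ` ?K"
    proof
      fix x assume x: "x \<in> {x\<in>?g. p x = x}"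
      have "x \<in> N #> x0" using x coset_eq[OF y x0(1)] by simp
      then obtain n where n: "n \<in> N" "x = x0 \<otimes> n" using coset_rep[OF x0c] by auto
      have "x0 \<otimes> \<alpha> n = x0 \<otimes> n" using pa[OF p x0(1) n(1)] x0(2) x n(2) by simp
      then have "\<alpha> n = n" using x0c N_carrier n(1) \<alpha>N by simp
      then show "x \<in> (\<lambda>n. x0 \<otimes> n) ` ?K" using n by auto
    qed
    then have "card {x\<in>?g. p x = x} \<le> card ((\<lambda>n. x0 \<otimes> n) ` ?K)" by (rule card_mono[rotated]) (use N_finite in simp)
    also have "\<dots> \<le> card ?K" by (rule card_image_le) (use N_finite in simp)
    finally show ?thesis .
  qed
  have sum: "(\<Sum>p\<in>P. card {x\<in>?g. p x = x}) \<le> card N"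
  proof -
    have "(\<Sum>p\<in>P. card {x\<in>?g. p x = x}) = (\<Sum>p\<in>P. \<Sum>x\<in>?g. if p x = x then 1 else 0)"
      using fing by (simp add: sum.If_cases Int_def)
    also have "\<dots> = (\<Sum>x\<in>?g. \<Sum>p\<in>P. if p x = x then 1 else 0)" by (rule sum.swap)
    also have "\<dots> = (\<Sum>x\<in>?g. card {p\<in>P. p x = x})" using finP by (simp add: sum.If_cases Int_def)
    also have "\<dots> \<le> (\<Sum>x\<in>?g. 1)"
    proof (rule sum_mono)
      fix x assume x: "x \<in> ?g"
      have "p = q" if "p \<in> {p\<in>P. p x = x}" "q \<in> {p\<in>P. p x = x}" for p q
        using that det[of p q x] x by simp
      then show "card {p\<in>P. p x = x} \<le> 1" using finP by (simp add: card_le_Suc0_iff_eq)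
    qed
    finally show ?thesis using card_coset[OF y] by simp
  qed
  show ?thesis by (rule sum_powr_fixed_points_le[OF finP cP sum fixK dvd less n])
qed

text \<open>Union bound over the possible restrictions p of f to the coset: a p-invariant trace
  loses half a bit for each point that p moves. Inversion is ignored, which suits the cosets whose
  squares lie outside N.\<close>

lemma affine_estimate:
  assumes y: "y \<in> carrier R" and n: "7 \<le> card N"
    and \<alpha>N: "\<And>n. n \<in> N \<Longrightarrow> \<alpha> n \<in> N"
    and \<alpha>m: "\<And>m n. m \<in> N \<Longrightarrow> n \<in> N \<Longrightarrow> \<alpha> (m \<otimes> n) = \<alpha> m \<otimes> \<alpha> n"
    and nontriv: "\<exists>n\<in>N. \<alpha> n \<noteq> n"
    and S: "\<And>S. S \<in> \<S> \<Longrightarrow> \<exists>f\<in>coset_auts S. \<forall>n\<in>N. f n = \<alpha> n"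
  shows "real (card ((\<lambda>S. S \<inter> (N #> y)) ` \<S>)) \<le> 9 / 10 * 2 ^ card N"
proof -
  let ?g = "N #> y" and ?n = "real (card N)"
  have fing: "finite ?g" by (rule finite_coset[OF y])
  have gc: "?g \<subseteq> carrier R" by (rule coset_carrier[OF y])
  let ?P = "{p \<in> ?g \<rightarrow>\<^sub>E ?g. \<forall>x\<in>?g. \<forall>n\<in>N. p (x \<otimes> n) = p x \<otimes> \<alpha> n}"
  have finP: "finite ?P"
    by (rule finite_subset[of _ "?g \<rightarrow>\<^sub>E ?g"]) (auto intro!: finite_PiE fing)
  let ?V = "\<lambda>p. {T. T \<subseteq> ?g \<and> (\<forall>x\<in>?g. p x \<in> T \<longleftrightarrow> x \<in> T)}"
  have V: "real (card (?V p)) \<le> 2 powr ?n * 2 powr (- (?n - real (card {x\<in>?g. p x = x})) / 2)"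
    if p: "p \<in> ?P" for p
  proof -
    let ?D = "{x\<in>?g. p x \<noteq> x}"
    have "real (card (?V p)) \<le> 2 powr (real (card ?g) - real (card ?D) / 2)"
    proof (rule card_invariant_subsets_le[OF fing])
      fix x assume x: "x \<in> ?D"
      have "p x \<in> ?g" using p x by auto
      then show "\<exists>y\<in>?g. y \<noteq> x \<and> (\<forall>T\<in>?V p. (y \<in> T) = (x \<in> T))" using x by auto
    qed auto
    moreover have "card ?g = card ?D + card {x\<in>?g. p x = x}"
    proof -
      have "?g = ?D \<union> {x\<in>?g. p x = x}" by auto
      then have "card ?g = card (?D \<union> {x\<in>?g. p x = x})" by simp
      also have "\<dots> = card ?D + card {x\<in>?g. p x = x}" by (rule card_Un_disjoint) (use fing in auto)
      finally show ?thesis .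
    qed
    ultimately show ?thesis using card_coset[OF y] by (simp add: powr_add[symmetric] field_simps)
  qed
  have "(\<lambda>S. S \<inter> ?g) ` \<S> \<subseteq> (\<Union>p\<in>?P. ?V p)"
  proof
    fix T assume "T \<in> (\<lambda>S. S \<inter> ?g) ` \<S>"
    then obtain S' where S': "S' \<in> \<S>" "T = S' \<inter> ?g" by auto
    obtain f where f: "f \<in> coset_auts S'" "\<forall>n\<in>N. f n = \<alpha> n" using S[OF S'(1)] by auto
    note F = coset_auts_facts[OF f(1)]
    have fg: "f x \<in> ?g" if x: "x \<in> ?g" for x
    proof -
      have xc: "x \<in> carrier R" using x gc by auto
      show ?thesis using F(3)[OF xc] coset_eq[OF y x] by simp
    qed
    have "restrict f ?g \<in> ?P"
    proof (intro CollectI conjI ballI)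
      show "restrict f ?g \<in> ?g \<rightarrow>\<^sub>E ?g" using fg by auto
      fix x n assume x: "x \<in> ?g" and n: "n \<in> N"
      have "f (x \<otimes> n) = f x \<otimes> \<alpha> n" using F(5)[of x n] x gc n f(2) by auto
      then show "restrict f ?g (x \<otimes> n) = restrict f ?g x \<otimes> \<alpha> n" using x coset_mult[OF y x n] by simp
    qed
    moreover have "T \<in> ?V (restrict f ?g)"
    proof -
      have "f x \<in> T \<longleftrightarrow> x \<in> T" if x: "x \<in> ?g" for x
        using F(11)[of x] x gc fg[OF x] S'(2) by auto
      then show ?thesis using S'(2) by simp
    qed
    ultimately show "T \<in> (\<Union>p\<in>?P. ?V p)" by blast
  qed
  then have "card ((\<lambda>S. S \<inter> ?g) ` \<S>) \<le> card (\<Union>p\<in>?P. ?V p)"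
    by (rule card_mono[rotated]) (use finP fing in auto)
  also have "\<dots> \<le> (\<Sum>p\<in>?P. card (?V p))" by (rule card_UN_le[OF finP])
  finally have "real (card ((\<lambda>S. S \<inter> ?g) ` \<S>)) \<le> (\<Sum>p\<in>?P. real (card (?V p)))"
    by (simp only: of_nat_sum[symmetric] of_nat_le_iff)
  also have "\<dots> \<le> (\<Sum>p\<in>?P. 2 powr ?n * 2 powr (- (?n - real (card {x\<in>?g. p x = x})) / 2))"
    by (rule sum_mono) (rule V)
  also have "\<dots> = 2 powr ?n * (\<Sum>p\<in>?P. 2 powr (- (?n - real (card {x\<in>?g. p x = x})) / 2))"
    by (rule sum_distrib_left[symmetric])
  also have "\<dots> \<le> 2 powr ?n * (9 / 10)"
  proof (rule mult_left_mono)
    show "(\<Sum>p\<in>?P. 2 powr (- (?n - real (card {x\<in>?g. p x = x})) / 2)) \<le> 9 / 10"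
    proof (rule affine_family_sum[OF y n finP \<alpha>N \<alpha>m nontriv])
      fix p q x assume p: "p \<in> ?P" and q: "q \<in> ?P" and x: "x \<in> ?g" and e: "p x = q x"
      have xc: "x \<in> carrier R" using x gc by auto
      have "p z = q z" if z: "z \<in> ?g" for z
      proof -
        have "z \<in> N #> x" using z coset_eq[OF y x] by simp
        then obtain n where "n \<in> N" "z = x \<otimes> n" using coset_rep[OF xc] by auto
        then show ?thesis using p q x e by simp
      qed
      moreover have "p \<in> extensional ?g" "q \<in> extensional ?g" using p q by (auto simp: PiE_def)
      ultimately show "p = q" by (intro extensionalityI)
    qed auto
  qed simp
  finally show ?thesis by (simp add: powr_realpow mult.commute)
qed

text \<open>If all squares lie in N, a coset of the subgroup generated by N and x. On it a map h
  with h (h y \<otimes> x) = y \<otimes> h x is determined by one value, once h x and the action on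
  N are known.\<close>

definition pair_block :: "'a \<Rightarrow> 'a \<Rightarrow> 'a set" where
  "pair_block x y = (N #> y) \<union> (N #> (y \<otimes> x))"

section \<open>Pairs of cosets linked by right multiplication with x\<close>

lemma coset_shift:
  assumes "y \<in> carrier R" "w \<in> N #> y" "x \<in> carrier R"
  shows "w \<otimes> x \<in> N #> (y \<otimes> x)"
proof -
  have wc: "w \<in> carrier R" using assms coset_carrier by blast
  have "(w \<otimes> x) \<otimes> inv (y \<otimes> x) = w \<otimes> inv y"
  proof -
    have "x \<otimes> (inv x \<otimes> inv y) = inv y" using assms by (simp add: m_assoc[symmetric])
    then show ?thesis using assms wc by (simp add: inv_mult_group m_assoc)
  qed
  then show ?thesis using coset_iff(2)[of "y \<otimes> x" "w \<otimes> x"] coset_iff(2)[OF assms(1) wc] assms wc by simp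
qed

lemma pair_block_eq:
  assumes sq: "\<And>x. x \<in> carrier R \<Longrightarrow> x \<otimes> x \<in> N"
    and x: "x \<in> carrier R" and y: "y \<in> carrier R" and z: "z \<in> pair_block x y"
  shows "pair_block x z = pair_block x y"
proof -
  have yx: "y \<otimes> x \<in> carrier R" using x y by simp
  have yxx: "y \<otimes> x \<otimes> x \<in> N #> y"
    using coset_mult[OF y coset_self[OF y] sq[OF x]] x y by (simp add: m_assoc)
  consider "z \<in> N #> y" | "z \<in> N #> (y \<otimes> x)" using z by (auto simp: pair_block_def)
  then show ?thesis
  proof cases
    case 1
    have "N #> z = N #> y" by (rule coset_eq[OF y 1])
    moreover have "N #> (z \<otimes> x) = N #> (y \<otimes> x)" by (rule coset_eq[OF yx coset_shift[OF y 1 x]])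
    ultimately show ?thesis by (simp add: pair_block_def)
  next
    case 2
    have "N #> z = N #> (y \<otimes> x)" by (rule coset_eq[OF yx 2])
    moreover have "N #> (z \<otimes> x) = N #> y"
    proof -
      have "z \<otimes> x \<in> N #> (y \<otimes> x \<otimes> x)" by (rule coset_shift[OF yx 2 x])
      then have "z \<otimes> x \<in> N #> y" using coset_eq[OF y yxx] by simp
      then show ?thesis by (rule coset_eq[OF y])
    qed
    ultimately show ?thesis by (auto simp: pair_block_def)
  qed
qed

lemma coset_inv_involutory:
  assumes y: "y \<in> carrier R" "y \<otimes> y \<in> N" and w: "w \<in> N #> y"
  shows "inv w \<in> N #> y"
  using block_inv[OF y(1), of w] block_involutory[OF y] w by simp

text \<open>Both cosets are closed under inversion, so a moved point saves only 1/4. The relation h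
  (h y \<otimes> x) = y \<otimes> h x transfers the values on \<open>N #> y\<close> to
  \<open>N #> (y \<otimes> x)\<close>: there are still at most n maps, but the moved points of two
  cosets count. The product of the two savings is bounded by the mean of their squares, and
  \<open>affine_family_sum\<close> bounds each of these on its own coset.\<close>

lemma pair_estimate:
  assumes sq: "\<And>x. x \<in> carrier R \<Longrightarrow> x \<otimes> x \<in> N" and S: "\<S> \<subseteq> inverse_closed"
    and x: "x \<in> carrier R" "x \<notin> N" and v: "v \<in> carrier R" and y: "y \<in> carrier R" and n: "7 \<le> card N"
    and \<alpha>N: "\<And>n. n \<in> N \<Longrightarrow> \<alpha> n \<in> N"
    and \<alpha>m: "\<And>m n. m \<in> N \<Longrightarrow> n \<in> N \<Longrightarrow> \<alpha> (m \<otimes> n) = \<alpha> m \<otimes> \<alpha> n"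
    and \<alpha>i: "inj_on \<alpha> N" and nontriv: "\<exists>n\<in>N. \<alpha> n \<noteq> n"
    and aut: "\<And>S. S \<in> \<S> \<Longrightarrow> \<exists>h\<in>coset_auts S. (\<forall>n\<in>N. h n = \<alpha> n) \<and> h x = v \<and>
      (\<forall>y\<in>carrier R. h (h y \<otimes> x) = y \<otimes> h x) \<and> (\<forall>y\<in>carrier R. h (h y) = y \<longrightarrow> h y = y)"
  shows "real (card ((\<lambda>S. S \<inter> pair_block x y) ` \<S>)) \<le> 9 / 10 * 2 powr inv_orbits (pair_block x y)"
proof -
  let ?g = "N #> y" and ?h = "N #> (y \<otimes> x)" and ?B = "pair_block x y" and ?n = "real (card N)"
  have yx: "y \<otimes> x \<in> carrier R" using x y by simp
  have B: "?B = ?g \<union> ?h" by (simp add: pair_block_def)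
  have fing: "finite ?g" "finite ?h" using finite_coset y yx by auto
  have finB: "finite ?B" unfolding B using fing by simp
  have gc: "?g \<subseteq> carrier R" "?h \<subseteq> carrier R" using coset_carrier y yx by auto
  have Bc: "?B \<subseteq> carrier R" unfolding B using gc by simp
  have dis: "?g \<inter> ?h = {}"
  proof (rule ccontr)
    assume "?g \<inter> ?h \<noteq> {}"
    then obtain z where z: "z \<in> ?g" "z \<in> ?h" by auto
    have "?g = ?h" using coset_eq[OF y z(1)] coset_eq[OF yx z(2)] by simp
    then have "y \<otimes> x \<in> ?g" using coset_self[OF yx] by simp
    then have "inv y \<otimes> (y \<otimes> x) \<in> N" using coset_iff(1)[OF y yx] by simp
    then show False using x y by (simp add: m_assoc[symmetric])
  qed
  have Binv: "inv w \<in> ?B" if "w \<in> ?B" for w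
    using that coset_inv_involutory[OF y sq[OF y]] coset_inv_involutory[OF yx sq[OF yx]] unfolding B by auto
  \<comment> \<open>The last clause forbids swaps: if p moves w to inv w, then p (p w) is a further
    point tied to w.\<close>
  let ?P = "{p \<in> ?B \<rightarrow>\<^sub>E ?B. (\<forall>w\<in>?g. p w \<in> ?g) \<and> (\<forall>w\<in>?h. p w \<in> ?h) \<and>
    (\<forall>w\<in>?B. \<forall>n\<in>N. p (w \<otimes> n) = p w \<otimes> \<alpha> n) \<and> (\<forall>w\<in>?g. p (p w \<otimes> x) = w \<otimes> v) \<and>
    (\<forall>w\<in>?B. p (p w) = w \<longrightarrow> p w = w)}"
  have finP: "finite ?P"
    by (rule finite_subset[of _ "?B \<rightarrow>\<^sub>E ?B"]) (auto intro!: finite_PiE finB)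
  have Pg: "p w \<in> ?g" if "p \<in> ?P" "w \<in> ?g" for p w using that by auto
  have Ph: "p w \<in> ?h" if "p \<in> ?P" "w \<in> ?h" for p w using that by auto
  have Pa: "p (w \<otimes> n) = p w \<otimes> \<alpha> n" if "p \<in> ?P" "w \<in> ?B" "n \<in> N" for p w n using that by auto
  have Px: "p (p w \<otimes> x) = w \<otimes> v" if "p \<in> ?P" "w \<in> ?g" for p w using that by auto
  have Pn: "p w = w" if "p \<in> ?P" "w \<in> ?B" "p (p w) = w" for p w using that by auto
  have \<alpha>1: "n = \<one>" if n: "n \<in> N" "\<alpha> n = \<one>" for n
  proof -
    have "\<alpha> \<one> \<otimes> \<alpha> \<one> = \<alpha> \<one>" using \<alpha>m[OF N_one N_one] by simp
    then have "\<alpha> \<one> = \<one>" using N_carrier[OF \<alpha>N[OF N_one]] by simp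
    then show ?thesis using inj_onD[OF \<alpha>i, of n \<one>] n N_one by simp
  qed
  have inj_c: "w = w'" if p: "p \<in> ?P" and c: "c \<in> carrier R" "N #> c \<subseteq> ?B" and w: "w \<in> N #> c" "w' \<in> N #> c" and e: "p w = p w'"
    for p c w w'
  proof -
    have wc: "w \<in> carrier R" using w(1) c Bc by auto
    have "w' \<in> N #> w" using w(2) coset_eq[OF c(1) w(1)] by simp
    then obtain n where n: "n \<in> N" "w' = w \<otimes> n" using coset_rep[OF wc] by auto
    have wB: "w \<in> ?B" using w(1) c(2) by auto
    have pc: "p w \<in> carrier R" using p wB Bc by auto
    have "p w \<otimes> \<alpha> n = p w" using Pa[OF p wB n(1)] n(2) e by simp
    then have "\<alpha> n = \<one>" using pc N_carrier[OF \<alpha>N[OF n(1)]] by simp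
    then show ?thesis using \<alpha>1[OF n(1)] n(2) wc by simp
  qed
  have inj: "w = w'" if p: "p \<in> ?P" and w: "w \<in> ?B" "w' \<in> ?B" and e: "p w = p w'" for p w w'
  proof -
    have gB: "?g \<subseteq> ?B" "?h \<subseteq> ?B" unfolding B by auto
    consider "w \<in> ?g" "w' \<in> ?g" | "w \<in> ?h" "w' \<in> ?h" | "w \<in> ?g" "w' \<in> ?h" | "w \<in> ?h" "w' \<in> ?g"
      using w unfolding B by auto
    then show ?thesis
    proof cases
      case 1
      then show ?thesis using inj_c[OF p y gB(1) _ _ e] by simp
    next
      case 2
      then show ?thesis using inj_c[OF p yx gB(2) _ _ e] by simp
    next
      case 3
      then show ?thesis using Pg[OF p, of w] Ph[OF p, of w'] e dis by auto
    next
      case 4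
      then show ?thesis using Ph[OF p, of w] Pg[OF p, of w'] e dis by auto
    qed
  qed
  have surj: "\<exists>w\<in>?g. z = p w" if p: "p \<in> ?P" and z: "z \<in> ?g" for p z
  proof -
    have "p ` ?g = ?g"
    proof (rule endo_inj_surj[OF fing(1)])
      show "p ` ?g \<subseteq> ?g" using Pg[OF p] by auto
      show "inj_on p ?g" using inj[OF p] unfolding B by (auto intro!: inj_onI)
    qed
    then show ?thesis using z by auto
  qed
  \<comment> \<open>Every point of the second coset is p w \<otimes> x for some w in the first, and
    p maps it to w \<otimes> v.\<close>
  have hx: "\<exists>w\<in>?g. z = p w \<otimes> x" if p: "p \<in> ?P" and z: "z \<in> ?h" for p z
  proof -
    have zc: "z \<in> carrier R" using z gc by auto
    have "z \<otimes> inv x \<in> N #> (y \<otimes> x \<otimes> inv x)" by (rule coset_shift[OF yx z]) (use x in simp)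
    then have "z \<otimes> inv x \<in> ?g" using x y by (simp add: m_assoc)
    then obtain w where w: "w \<in> ?g" "z \<otimes> inv x = p w" using surj[OF p] by auto
    have "z = z \<otimes> inv x \<otimes> x" using zc x by (simp add: m_assoc)
    then show ?thesis using w by auto
  qed
  have detg: "p = q" if p: "p \<in> ?P" and q: "q \<in> ?P" and w: "w \<in> ?g" and e: "p w = q w" for p q w
  proof -
    have wc: "w \<in> carrier R" using w gc by auto
    have g: "p z = q z" if z: "z \<in> ?g" for z
    proof -
      have "z \<in> N #> w" using z coset_eq[OF y w] by simp
      then obtain n where n: "n \<in> N" "z = w \<otimes> n" using coset_rep[OF wc] by auto
      have wB: "w \<in> ?B" using w unfolding B by simp
      show ?thesis using Pa[OF p wB n(1)] Pa[OF q wB n(1)] e n(2) by simp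
    qed
    have h: "p z = q z" if z: "z \<in> ?h" for z
    proof -
      obtain t where t: "t \<in> ?g" "z = p t \<otimes> x" using hx[OF p z] by auto
      have "p z = t \<otimes> v" using Px[OF p t(1)] t(2) by simp
      moreover have "q z = t \<otimes> v" using Px[OF q t(1)] t(2) g[OF t(1)] by simp
      ultimately show ?thesis by simp
    qed
    have "p z = q z" if "z \<in> ?B" for z using that g h unfolding B by auto
    moreover have "p \<in> extensional ?B" "q \<in> extensional ?B" using p q by (auto simp: PiE_def)
    ultimately show ?thesis by (intro extensionalityI)
  qed
  \<comment> \<open>Conversely, the value t \<otimes> v at the point w = p t \<otimes> x reveals t,
    and then p t; so p is known at a point of the first coset.\<close>
  have deth: "p = q" if p: "p \<in> ?P" and q: "q \<in> ?P" and w: "w \<in> ?h" and e: "p w = q w" for p q w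
  proof -
    obtain t where t: "t \<in> ?g" "w = p t \<otimes> x" using hx[OF p w] by auto
    obtain t' where t': "t' \<in> ?g" "w = q t' \<otimes> x" using hx[OF q w] by auto
    have tc: "t \<in> carrier R" "t' \<in> carrier R" using t t' gc by auto
    have "t \<otimes> v = t' \<otimes> v" using Px[OF p t(1)] Px[OF q t'(1)] t(2) t'(2) e by simp
    then have tt: "t = t'" using tc v by simp
    have c: "p t \<in> carrier R" "q t' \<in> carrier R" using Pg[OF p t(1)] Pg[OF q t'(1)] gc by auto
    have "p t \<otimes> x = q t' \<otimes> x" using t(2) t'(2) by simp
    then have "p t = q t" using c x tt by simp
    then show ?thesis by (rule detg[OF p q t(1)])
  qed
  let ?s = "\<lambda>p. real (card {w\<in>?g. p w = w})" and ?t = "\<lambda>p. real (card {w\<in>?h. p w = w})"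
  let ?V = "\<lambda>p. {T. T \<subseteq> ?B \<and> (\<forall>w\<in>T. inv w \<in> T) \<and> (\<forall>w\<in>?B. p w \<in> T \<longleftrightarrow> w \<in> T)}"
  have V: "real (card (?V p)) \<le> 2 powr inv_orbits ?B *
      ((2 powr (- (?n - ?s p) / 2) + 2 powr (- (?n - ?t p) / 2)) / 2)" if p: "p \<in> ?P" for p
  proof -
    let ?D = "{w\<in>?B. p w \<noteq> w}"
    have pB: "p w \<in> ?B" if "w \<in> ?B" for w using p that by auto
    have "real (card (?V p)) \<le> 2 powr ((real (card ?B) + real (card {w\<in>?B. inv w = w})) / 2 - real (card ?D) / 4)"
    proof (rule card_involution_invariant_subsets_le[OF finB _ _ Binv])
      show "inv (inv w) = w" if "w \<in> ?B" for w using that Bc by auto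
      fix w assume w: "w \<in> ?D"
      have wB: "w \<in> ?B" and ne: "p w \<noteq> w" using w by auto
      have Tp: "p u \<in> T \<longleftrightarrow> u \<in> T" if "T \<in> ?V p" "u \<in> ?B" for T u using that by auto
      show "\<exists>u\<in>?B. u \<noteq> w \<and> u \<noteq> inv w \<and> (\<forall>T\<in>?V p. (u \<in> T) = (w \<in> T))"
      proof (cases "p w = inv w")
        case False
        show ?thesis
          by (rule bexI[OF _ pB[OF wB]]) (use ne False Tp[OF _ wB] in simp)
      next
        case True
        have n1: "p (p w) \<noteq> w" using Pn[OF p wB] ne by auto
        have n2: "p (p w) \<noteq> p w" using inj[OF p pB[OF wB] wB] ne by auto
        show ?thesis
        proof (rule bexI[OF _ pB[OF pB[OF wB]]], intro conjI ballI n1)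
          show "p (p w) \<noteq> inv w" using n2 True by simp
          show "(p (p w) \<in> T) = (w \<in> T)" if "T \<in> ?V p" for T
            using Tp[OF that wB] Tp[OF that pB[OF wB]] by simp
        qed
      qed
    qed auto
    also have "(real (card ?B) + real (card {w\<in>?B. inv w = w})) / 2 - real (card ?D) / 4
      = inv_orbits ?B - (?n - ?s p) / 4 - (?n - ?t p) / 4"
    proof -
      have "?B = ?D \<union> ({w\<in>?g. p w = w} \<union> {w\<in>?h. p w = w})" unfolding B by auto
      then have "card ?B = card (?D \<union> ({w\<in>?g. p w = w} \<union> {w\<in>?h. p w = w}))" by simp
      also have "\<dots> = card ?D + card ({w\<in>?g. p w = w} \<union> {w\<in>?h. p w = w})"
        by (rule card_Un_disjoint) (use finB fing in auto)
      also have "card ({w\<in>?g. p w = w} \<union> {w\<in>?h. p w = w}) = card {w\<in>?g. p w = w} + card {w\<in>?h. p w = w}"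
        by (rule card_Un_disjoint) (use dis fing in auto)
      finally have 1: "card ?B = card ?D + (card {w\<in>?g. p w = w} + card {w\<in>?h. p w = w})" .
      have "card ?B = 2 * card N"
        unfolding B using card_Un_disjoint[OF fing dis] card_coset[OF y] card_coset[OF yx] by simp
      then have "real (card ?D) = 2 * ?n - ?s p - ?t p" using 1 by linarith
      then show ?thesis unfolding inv_orbits_def by (simp add: field_simps)
    qed
    also have "2 powr (inv_orbits ?B - (?n - ?s p) / 4 - (?n - ?t p) / 4)
      = 2 powr inv_orbits ?B * (2 powr (- (?n - ?s p) / 4) * 2 powr (- (?n - ?t p) / 4))"
    proof -
      have "inv_orbits ?B - (?n - ?s p) / 4 - (?n - ?t p) / 4
        = inv_orbits ?B + (- (?n - ?s p) / 4 + - (?n - ?t p) / 4)" by (simp add: field_simps)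
      then show ?thesis by (simp only: powr_add)
    qed
    also have "\<dots> \<le> 2 powr inv_orbits ?B *
      ((2 powr (- (?n - ?s p) / 2) + 2 powr (- (?n - ?t p) / 2)) / 2)"
    proof (rule mult_left_mono)
      let ?a = "2 powr (- (?n - ?s p) / 4)" and ?b = "2 powr (- (?n - ?t p) / 4)"
      \<comment> \<open>This separates the two cosets and turns the quarters in the exponents into
        the halves that \<open>affine_family_sum\<close> requires.\<close>
      have "2 * (?a * ?b) \<le> ?a * ?a + ?b * ?b"
        using sum_squares_bound[of ?a ?b] by (simp add: power2_eq_square)
      moreover have sq4: "2 powr (c / 4) * 2 powr (c / 4) = 2 powr (c / 2)" for c :: real
        by (simp add: powr_add[symmetric])
      have "?a * ?a = 2 powr (- (?n - ?s p) / 2)" "?b * ?b = 2 powr (- (?n - ?t p) / 2)"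
        by (rule sq4)+
      ultimately show "?a * ?b \<le> (2 powr (- (?n - ?s p) / 2) + 2 powr (- (?n - ?t p) / 2)) / 2" by simp
    qed simp
    finally show ?thesis .
  qed
  have "(\<lambda>S. S \<inter> ?B) ` \<S> \<subseteq> (\<Union>p\<in>?P. ?V p)"
  proof
    fix T assume "T \<in> (\<lambda>S. S \<inter> ?B) ` \<S>"
    then obtain S' where S': "S' \<in> \<S>" "T = S' \<inter> ?B" by auto
    obtain f where f: "f \<in> coset_auts S'" "\<forall>n\<in>N. f n = \<alpha> n" "f x = v"
      "\<forall>y\<in>carrier R. f (f y \<otimes> x) = y \<otimes> f x" "\<forall>y\<in>carrier R. f (f y) = y \<longrightarrow> f y = y"
      using aut[OF S'(1)] by auto
    note F = coset_auts_facts[OF f(1)]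
    have fg: "f w \<in> N #> c" if c: "c \<in> carrier R" and w: "w \<in> N #> c" for c w
    proof -
      have wc: "w \<in> carrier R" using w coset_carrier[OF c] by auto
      show ?thesis using F(3)[OF wc] coset_eq[OF c w] by simp
    qed
    have fB: "f w \<in> ?B" if "w \<in> ?B" for w using that fg[OF y] fg[OF yx] unfolding B by auto
    let ?p = "restrict f ?B"
    have pv: "?p w = f w" if "w \<in> ?B" for w using that by simp
    have gB: "w \<in> ?B" if "w \<in> ?g" for w using that unfolding B by simp
    have hB: "w \<in> ?B" if "w \<in> ?h" for w using that unfolding B by simp
    have "?p \<in> ?P"
    proof (intro CollectI conjI ballI impI)
      show "?p \<in> ?B \<rightarrow>\<^sub>E ?B" using fB by auto
      show "?p w \<in> ?g" if "w \<in> ?g" for w using fg[OF y that] pv[OF gB[OF that]] by simp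
      show "?p w \<in> ?h" if "w \<in> ?h" for w using fg[OF yx that] pv[OF hB[OF that]] by simp
      show "?p (w \<otimes> n) = ?p w \<otimes> \<alpha> n" if w: "w \<in> ?B" and n: "n \<in> N" for w n
      proof -
        have "w \<otimes> n \<in> ?B" using w coset_mult[OF y _ n] coset_mult[OF yx _ n] unfolding B by auto
        moreover have "f (w \<otimes> n) = f w \<otimes> \<alpha> n" using F(5)[of w n] w Bc n f(2) by auto
        ultimately show ?thesis using w by simp
      qed
      show "?p (?p w \<otimes> x) = w \<otimes> v" if w: "w \<in> ?g" for w
      proof -
        have "f w \<otimes> x \<in> ?h" by (rule coset_shift[OF y fg[OF y w] x(1)])
        then have "?p (?p w \<otimes> x) = f (f w \<otimes> x)" using pv[OF gB[OF w]] pv[OF hB] by simp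
        then show ?thesis using f(3,4) w gc by auto
      qed
      show "?p w = w" if w: "w \<in> ?B" and e: "?p (?p w) = w" for w
        using f(5) pv[OF w] pv[OF fB[OF w]] e w Bc by auto
    qed
    moreover have "T \<in> ?V ?p"
    proof -
      have "f w \<in> T \<longleftrightarrow> w \<in> T" if w: "w \<in> ?B" for w
        using F(11)[of w] w Bc fB[OF w] S'(2) by auto
      moreover have "inv w \<in> T" if "w \<in> T" for w
        using that S S' Binv by (auto simp: inverse_closed_def)
      ultimately show ?thesis using S'(2) by simp
    qed
    ultimately show "T \<in> (\<Union>p\<in>?P. ?V p)" by blast
  qed
  then have "card ((\<lambda>S. S \<inter> ?B) ` \<S>) \<le> card (\<Union>p\<in>?P. ?V p)"
    by (rule card_mono[rotated]) (use finP finB in auto)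
  also have "\<dots> \<le> (\<Sum>p\<in>?P. card (?V p))" by (rule card_UN_le[OF finP])
  finally have "real (card ((\<lambda>S. S \<inter> ?B) ` \<S>)) \<le> (\<Sum>p\<in>?P. real (card (?V p)))"
    by (simp only: of_nat_sum[symmetric] of_nat_le_iff)
  also have "\<dots> \<le> (\<Sum>p\<in>?P. 2 powr inv_orbits ?B *
      ((2 powr (- (?n - ?s p) / 2) + 2 powr (- (?n - ?t p) / 2)) / 2))"
    by (rule sum_mono) (rule V)
  also have "\<dots> = 2 powr inv_orbits ?B *
      (((\<Sum>p\<in>?P. 2 powr (- (?n - ?s p) / 2)) + (\<Sum>p\<in>?P. 2 powr (- (?n - ?t p) / 2))) / 2)"
    by (simp only: sum_distrib_left[symmetric] sum_divide_distrib[symmetric] sum.distrib)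
  also have "\<dots> \<le> 2 powr inv_orbits ?B * ((9 / 10 + 9 / 10) / 2)"
  proof (intro mult_left_mono divide_right_mono add_mono)
    show "(\<Sum>p\<in>?P. 2 powr (- (?n - ?s p) / 2)) \<le> 9 / 10"
    proof (rule affine_family_sum[where P = ?P and \<alpha> = \<alpha>, OF y n finP \<alpha>N \<alpha>m nontriv])
      show "p w \<in> ?g" if "p \<in> ?P" "w \<in> ?g" for p w by (rule Pg[OF that])
      show "p = q" if "p \<in> ?P" "q \<in> ?P" "w \<in> ?g" "p w = q w" for p q w by (rule detg[OF that])
      show "p (w \<otimes> n) = p w \<otimes> \<alpha> n" if "p \<in> ?P" "w \<in> ?g" "n \<in> N" for p w n
        by (rule Pa[OF that(1) _ that(3)]) (use that(2) in \<open>simp add: B\<close>)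
    qed
    show "(\<Sum>p\<in>?P. 2 powr (- (?n - ?t p) / 2)) \<le> 9 / 10"
    proof (rule affine_family_sum[where P = ?P and \<alpha> = \<alpha>, OF yx n finP \<alpha>N \<alpha>m nontriv])
      show "p w \<in> ?h" if "p \<in> ?P" "w \<in> ?h" for p w by (rule Ph[OF that])
      show "p = q" if "p \<in> ?P" "q \<in> ?P" "w \<in> ?h" "p w = q w" for p q w by (rule deth[OF that])
      show "p (w \<otimes> n) = p w \<otimes> \<alpha> n" if "p \<in> ?P" "w \<in> ?h" "n \<in> N" for p w n
        by (rule Pa[OF that(1) _ that(3)]) (use that(2) in \<open>simp add: B\<close>)
    qed
  qed simp_all
  finally show ?thesis by simp
qed

end

section \<open>Bounds for the families of connection sets\<close>

lemma card_UN_le_real: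
  assumes "finite I" "\<And>i. i \<in> I \<Longrightarrow> real (card (F i)) \<le> M"
  shows "real (card (\<Union>i\<in>I. F i)) \<le> real (card I) * M"
proof -
  have "real (card (\<Union>i\<in>I. F i)) \<le> real (\<Sum>i\<in>I. card (F i))"
    using card_UN_le[OF assms(1), of F] by (simp only: of_nat_le_iff)
  also have "\<dots> = (\<Sum>i\<in>I. real (card (F i)))" by simp
  also have "\<dots> \<le> real (card I) * M" by (rule sum_bounded_above) (rule assms(2))
  finally show ?thesis .
qed

context coset_setting
begin

text \<open>The groups with a nontrivial automorphism that preserves every inverse-closed set.\<close>

definition exceptional :: bool where
  "exceptional \<longleftrightarrow> (comm_group R \<and> (\<exists>x\<in>carrier R. x \<otimes> x \<noteq> \<one>)) \<or> (\<exists>C y. twisted_dihedral C y)"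

abbreviation guess_bound :: real where
  "guess_bound \<equiv> 2 powr (log 2 (real (order R)))\<^sup>2"

lemma finite_inverse_closed: "finite inverse_closed"
  by (rule finite_subset[of _ "Pow (carrier R)"]) (use fin in \<open>auto simp: inverse_closed_def\<close>)

lemma order_pos: "0 < order R"
  using fin one_closed card_gt_0_iff unfolding order_def by blast

text \<open>The saving |D| / 4 is at least |R| / 384, which suffices because |N| >= 2. This is the
  origin of the factor 96.\<close>

lemma card_invariant_family_le:
  assumes fc: "\<And>x. x \<in> carrier R \<Longrightarrow> f x \<in> carrier R" and n2: "2 \<le> card N"
    and bad: "card (carrier R) \<le> 96 * card {x\<in>carrier R. f x \<noteq> x \<and> f x \<noteq> inv x}"
  shows "real (card {S\<in>inverse_closed. \<forall>x\<in>carrier R. f x \<in> S \<longleftrightarrow> x \<in> S}) \<le> count_bound"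
proof -
  let ?D = "{x\<in>carrier R. f x \<noteq> x \<and> f x \<noteq> inv x}"
  let ?V = "{S\<in>inverse_closed. \<forall>x\<in>carrier R. f x \<in> S \<longleftrightarrow> x \<in> S}"
  have "real (card ?V)
    \<le> 2 powr ((real (card (carrier R)) + real (card {x\<in>carrier R. inv x = x})) / 2 - real (card ?D) / 4)"
  proof (rule card_involution_invariant_subsets_le[OF fin])
    show "?V \<subseteq> Pow (carrier R)" by (auto simp: inverse_closed_def)
    show "inv x \<in> T" if "T \<in> ?V" "x \<in> T" for x T using that by (auto simp: inverse_closed_def)
    fix x assume x: "x \<in> ?D"
    have "f x \<in> carrier R" using x fc by auto
    then show "\<exists>y\<in>carrier R. y \<noteq> x \<and> y \<noteq> inv x \<and> (\<forall>T\<in>?V. (y \<in> T) = (x \<in> T))"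
      using x by (intro bexI[of _ "f x"]) auto
  qed auto
  also have "\<dots> = 2 powr (c_num R - real (card ?D) / 4)"
    by (simp add: c_num_def order_def invol_set_eq[OF fin])
  also have "\<dots> \<le> count_bound"
    unfolding count_bound_def
  proof (rule powr_mono)
    have "real (order R) \<le> 96 * real (card ?D)"
    proof -
      have "real (card (carrier R)) \<le> real (96 * card ?D)" using bad by (simp only: of_nat_le_iff)
      then show ?thesis by (simp add: order_def)
    qed
    moreover have "real (order R) / (192 * real (card N)) \<le> real (order R) / 384"
      by (rule divide_left_mono) (use n2 card_N_pos in auto)
    ultimately show "c_num R - real (card ?D) / 4 \<le> c_num R - real (order R) / (192 * real (card N))" by linarith
  qed simp
  finally show ?thesis .
qed

text \<open>The guess is f. Outside the exceptional groups a nontrivial endomorphism sends enough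
  elements x to neither x nor inv x.\<close>

lemma automorphism_family_le:
  assumes ne: "\<not> exceptional" and n2: "2 \<le> card N"
  shows "real (card {S\<in>inverse_closed. \<exists>f\<in>carrier R \<rightarrow>\<^sub>E carrier R.
      (\<forall>a\<in>carrier R. \<forall>b\<in>carrier R. f (a \<otimes> b) = f a \<otimes> f b) \<and> (\<exists>x\<in>carrier R. f x \<noteq> x) \<and>
      (\<forall>x\<in>carrier R. f x \<in> S \<longleftrightarrow> x \<in> S)}) \<le> guess_bound * count_bound"
    (is "real (card ?F) \<le> _")
proof -
  let ?E = "{f \<in> carrier R \<rightarrow>\<^sub>E carrier R. \<forall>a\<in>carrier R. \<forall>b\<in>carrier R. f (a \<otimes> b) = f a \<otimes> f b}"
  let ?E' = "{f\<in>?E. \<exists>x\<in>carrier R. f x \<noteq> x}"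
  let ?V = "\<lambda>f. {S\<in>inverse_closed. \<forall>x\<in>carrier R. f x \<in> S \<longleftrightarrow> x \<in> S}"
  have finE: "finite ?E" by (rule card_endomorphisms_le(1)[OF fin])
  have finE': "finite ?E'" by (rule finite_subset[OF _ finE]) auto
  have "?F \<subseteq> (\<Union>f\<in>?E'. ?V f)" by auto
  then have "card ?F \<le> card (\<Union>f\<in>?E'. ?V f)"
    by (rule card_mono[rotated]) (use finE' finite_inverse_closed in auto)
  then have "real (card ?F) \<le> real (card (\<Union>f\<in>?E'. ?V f))" by simp
  also have "\<dots> \<le> real (card ?E') * count_bound"
  proof (rule card_UN_le_real[OF finE'])
    fix f assume f: "f \<in> ?E'"
    have fc: "f x \<in> carrier R" if "x \<in> carrier R" for x using f that by auto
    have hom: "f (a \<otimes> b) = f a \<otimes> f b" if "a \<in> carrier R" "b \<in> carrier R" for a b using f that by auto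
    have nt: "\<exists>x\<in>carrier R. f x \<noteq> x" using f by auto
    have "\<not> 96 * card {x\<in>carrier R. f x \<noteq> x \<and> f x \<noteq> inv x} < card (carrier R)"
    proof
      assume bad: "96 * card {x\<in>carrier R. f x \<noteq> x \<and> f x \<noteq> inv x} < card (carrier R)"
      show False
        using aut_mostly_fixing_or_inverting[where f = f, OF fin _ _ nt bad] hom fc ne
        unfolding exceptional_def by simp
    qed
    then show "real (card (?V f)) \<le> count_bound"
      by (intro card_invariant_family_le[OF fc n2]) simp_all
  qed
  also have "\<dots> \<le> guess_bound * count_bound"
  proof (rule mult_right_mono)
    have "card ?E' \<le> card ?E" by (rule card_mono[OF finE]) auto
    then have "real (card ?E') \<le> real (card ?E)" by simp
    also have "\<dots> \<le> guess_bound" using card_endomorphisms_le(2)[OF fin] by (simp add: order_def)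
    finally show "real (card ?E') \<le> guess_bound" .
  qed (simp add: count_bound_def)
  finally show ?thesis .
qed

lemma proper_subgroups_finite: "finite {H. subgroup H R \<and> H \<noteq> carrier R}"
  by (rule finite_subset[of _ "Pow (carrier R)"]) (use subgroup.subset fin in auto)

lemma card_proper_subgroups_guess:
  "real (card {H. subgroup H R \<and> H \<noteq> carrier R}) * real (order R) \<le> guess_bound"
  "real (card {H. subgroup H R \<and> H \<noteq> carrier R}) \<le> guess_bound"
proof -
  let ?h = "real (card {H. subgroup H R \<and> H \<noteq> carrier R})"
  show 1: "?h * real (order R) \<le> guess_bound"
    using card_proper_subgroups_le[OF fin] by (simp add: order_def)
  have "?h * 1 \<le> ?h * real (order R)" by (rule mult_left_mono) (use order_pos in auto)
  then show "?h \<le> guess_bound" using 1 by simp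
qed

lemma proper_subgroup_half:
  assumes "subgroup H R" "H \<noteq> carrier R"
  shows "card (carrier R) \<le> 2 * card (carrier R - H)"
proof -
  have HC: "H \<subseteq> carrier R" using subgroup.subset[OF assms(1)] .
  have "2 * card H \<le> card (carrier R)"
    using subgroup_eq_if_majority[OF assms(1) subgroup_self HC fin] assms(2) by linarith
  moreover have "card (carrier R - H) = card (carrier R) - card H"
    by (rule card_Diff_subset[OF finite_subset[OF HC fin] HC])
  ultimately show ?thesis by linarith
qed

lemma subgroup_family_le:
  assumes "\<And>H. H \<in> \<H> \<Longrightarrow> subgroup H R \<and> H \<noteq> carrier R"
    and "\<And>H. H \<in> \<H> \<Longrightarrow> real (card (F H)) \<le> count_bound"
  shows "real (card (\<Union>H\<in>\<H>. F H)) \<le> guess_bound * count_bound"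
proof -
  have sub: "\<H> \<subseteq> {H. subgroup H R \<and> H \<noteq> carrier R}" using assms(1) by auto
  have fH: "finite \<H>" by (rule finite_subset[OF sub proper_subgroups_finite])
  have "real (card (\<Union>H\<in>\<H>. F H)) \<le> real (card \<H>) * count_bound" by (rule card_UN_le_real[OF fH assms(2)])
  also have "\<dots> \<le> guess_bound * count_bound"
  proof (rule mult_right_mono)
    have "card \<H> \<le> card {H. subgroup H R \<and> H \<noteq> carrier R}" by (rule card_mono[OF proper_subgroups_finite sub])
    then have "real (card \<H>) \<le> real (card {H. subgroup H R \<and> H \<noteq> carrier R})" by simp
    then show "real (card \<H>) \<le> guess_bound" using card_proper_subgroups_guess(2) by linarith
  qed (simp add: count_bound_def)
  finally show ?thesis .
qed

text \<open>At least half of R lies outside H, and a block is one coset. That leaves m = 192 / 2 =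
  96 blocks for each factor 1/2.\<close>

lemma involutory_small_family:
  assumes sq: "\<And>x. x \<in> carrier R \<Longrightarrow> x \<otimes> x \<in> N" and n: "card N \<le> 6"
    and H: "subgroup H R" "H \<noteq> carrier R"
  shows "real (card {S\<in>inverse_closed. \<forall>y\<in>carrier R. y \<notin> H \<longrightarrow> S \<inter> (N #> y) \<noteq> {y, inv y}}) \<le> count_bound"
    (is "real (card ?F) \<le> _")
proof (rule card_family_block_le[where X = "carrier R - H" and \<rho> = "63/64" and m = 96 and b = "card N"])
  show "(63 / 64 :: real) ^ 96 \<le> 1 / 2" by (simp add: power_divide)
  show "0 < card N" by (rule card_N_pos)
  show "card (block y) \<le> card N" if "y \<in> carrier R - H" for y
    using that block_involutory[OF _ sq] card_coset by simp
  show "real (card ((\<lambda>S. S \<inter> block y) ` ?F)) \<le> 63 / 64 * 2 powr inv_orbits (block y)"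
    if "y \<in> carrier R - H" for y
    by (rule inverse_pair_estimate[OF _ _ sq n]) (use that in auto)
  show "96 * card (carrier R) * card N \<le> 192 * card (carrier R - H) * card N"
    using proper_subgroup_half[OF H] by (intro mult_le_mono1) simp
qed auto

lemma involutory_periodic_family:
  assumes sq: "\<And>x. x \<in> carrier R \<Longrightarrow> x \<otimes> x \<in> N" and n: "7 \<le> card N"
    and H: "subgroup H R" "H \<noteq> carrier R"
  shows "real (card {S\<in>inverse_closed. \<forall>y\<in>carrier R. y \<notin> H \<longrightarrow>
      (\<exists>z\<in>N. z \<otimes> z \<noteq> \<one> \<and> (\<forall>w\<in>S \<inter> (N #> y). z \<otimes> w \<in> S))}) \<le> count_bound"
    (is "real (card ?F) \<le> _")
proof (rule card_family_block_le[where X = "carrier R - H" and \<rho> = "9/10" and m = 96 and b = "card N"])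
  show "(9 / 10 :: real) ^ 96 \<le> 1 / 2" by (simp add: power_divide)
  show "0 < card N" by (rule card_N_pos)
  show "card (block y) \<le> card N" if "y \<in> carrier R - H" for y
    using that block_involutory[OF _ sq] card_coset by simp
  show "real (card ((\<lambda>S. S \<inter> block y) ` ?F)) \<le> 9 / 10 * 2 powr inv_orbits (block y)"
    if y: "y \<in> carrier R - H" for y
    by (rule odd_periodic_estimate[OF _ _ sq n]) (use y in auto)
  show "96 * card (carrier R) * card N \<le> 192 * card (carrier R - H) * card N"
    using proper_subgroup_half[OF H] by (intro mult_le_mono1) simp
qed auto

section \<open>Guessing the action on N\<close>

definition N_endos :: "('a \<Rightarrow> 'a) set" where
  "N_endos = {\<alpha> \<in> N \<rightarrow>\<^sub>E N. \<forall>a\<in>N. \<forall>b\<in>N. \<alpha> (a \<otimes> b) = \<alpha> a \<otimes> \<alpha> b}"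

lemma N_endos_bound: "finite N_endos" "real (card N_endos) \<le> 2 powr (log 2 (real (card N)))\<^sup>2"
proof -
  interpret NG: group "R\<lparr>carrier := N\<rparr>" by (rule subgroup_imp_group[OF N_subgroup])
  have f: "finite (carrier (R\<lparr>carrier := N\<rparr>))" using N_finite by simp
  show "finite N_endos" "real (card N_endos) \<le> 2 powr (log 2 (real (card N)))\<^sup>2"
    using NG.card_endomorphisms_le[OF f] by (simp_all add: N_endos_def)
qed

lemma card_N_half:
  assumes "N \<noteq> carrier R"
  shows "2 * card N \<le> order R"
proof (rule ccontr)
  assume "\<not> 2 * card N \<le> order R"
  then have "card (carrier R) < 2 * card N" by (simp add: order_def)
  then have "N = carrier R" by (rule subgroup_eq_if_majority[OF N_subgroup subgroup_self N_subset fin])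
  then show False using assms by simp
qed

text \<open>With L = log |R|, the logarithm l of |N| is at most L - 1, so l^2 + l + L <= (L - 1) L +
  L = L^2. Thus an endomorphism of N may be guessed together with an element of R and an element of
  N.\<close>

lemma guess_triples_le:
  assumes "N \<noteq> carrier R"
  shows "real (card N_endos) * (real (order R) * real (card N)) \<le> guess_bound"
    and "real (card N_endos) \<le> guess_bound"
proof -
  let ?l = "log 2 (real (card N))" and ?L = "log 2 (real (order R))"
  have l0: "0 \<le> ?l" using card_N_pos by simp
  have "log 2 (2 * real (card N)) \<le> ?L"
  proof (rule log_mono)
    have "real (2 * card N) \<le> real (order R)" using card_N_half[OF assms] by (simp only: of_nat_le_iff)
    then show "2 * real (card N) \<le> real (order R)" by simp
  qed (use card_N_pos in auto)
  moreover have "log 2 (2 * real (card N)) = 1 + ?l" using card_N_pos by (simp add: log_mult)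
  ultimately have lL: "?l \<le> ?L - 1" by simp
  have R: "real (order R) = 2 powr ?L" using order_pos by simp
  have N: "real (card N) = 2 powr ?l" using card_N_pos by simp
  have "?l\<^sup>2 + ?l = ?l * (?l + 1)" by (simp add: power2_eq_square algebra_simps)
  also have "\<dots> \<le> (?L - 1) * ?L" by (rule mult_mono) (use lL l0 in auto)
  finally have sq: "?l\<^sup>2 + (?L + ?l) \<le> ?L\<^sup>2" by (simp add: power2_eq_square algebra_simps)
  have "real (card N_endos) * (real (order R) * real (card N)) \<le> 2 powr ?l\<^sup>2 * (real (order R) * real (card N))"
    by (rule mult_right_mono[OF N_endos_bound(2)]) simp
  also have "\<dots> = 2 powr ?l\<^sup>2 * (2 powr ?L * 2 powr ?l)" using R N by simp
  also have "\<dots> = 2 powr (?l\<^sup>2 + (?L + ?l))" by (simp only: powr_add)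
  also have "\<dots> \<le> guess_bound" by (rule powr_mono[OF sq]) simp
  finally show 1: "real (card N_endos) * (real (order R) * real (card N)) \<le> guess_bound" .
  have "1 * 1 \<le> real (order R) * real (card N)"
    by (rule mult_mono) (use order_pos card_N_pos in auto)
  then have "real (card N_endos) * 1 \<le> real (card N_endos) * (real (order R) * real (card N))"
    by (intro mult_left_mono) auto
  then show "real (card N_endos) \<le> guess_bound" using 1 by simp
qed

text \<open>The guess consists of \<alpha> = h on N, of x, and of m = inv x \<otimes> h x, which
  lies in N. Every pair of cosets is usable, so X is all of R.\<close>

lemma involutory_pair_family_le:
  assumes sq: "\<And>x. x \<in> carrier R \<Longrightarrow> x \<otimes> x \<in> N" and n: "7 \<le> card N" and NR: "N \<noteq> carrier R"
  shows "real (card {S\<in>inverse_closed. \<exists>h\<in>coset_auts S. \<exists>x\<in>carrier R. x \<notin> N \<and> (\<exists>n\<in>N. h n \<noteq> n) \<and>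
      (\<forall>y\<in>carrier R. h (h y \<otimes> x) = y \<otimes> h x) \<and> (\<forall>y\<in>carrier R. h (h y) = y \<longrightarrow> h y = y)})
    \<le> guess_bound * count_bound" (is "real (card ?F) \<le> _")
proof -
  let ?I = "{\<alpha>\<in>N_endos. inj_on \<alpha> N \<and> (\<exists>n\<in>N. \<alpha> n \<noteq> n)} \<times> ({x\<in>carrier R. x \<notin> N} \<times> N)"
  let ?G = "\<lambda>(\<alpha>, x, m). {S\<in>inverse_closed. \<exists>h\<in>coset_auts S. (\<forall>n\<in>N. h n = \<alpha> n) \<and> h x = x \<otimes> m \<and>
      (\<forall>y\<in>carrier R. h (h y \<otimes> x) = y \<otimes> h x) \<and> (\<forall>y\<in>carrier R. h (h y) = y \<longrightarrow> h y = y)}"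
  have finI: "finite ?I" using N_endos_bound(1) fin N_finite by simp
  have "?F \<subseteq> (\<Union>i\<in>?I. ?G i)"
  proof
    fix S assume "S \<in> ?F"
    then obtain h x where S: "S \<in> inverse_closed" and h: "h \<in> coset_auts S" and x: "x \<in> carrier R" "x \<notin> N"
      and hn: "\<exists>n\<in>N. h n \<noteq> n" and h1: "\<forall>y\<in>carrier R. h (h y \<otimes> x) = y \<otimes> h x"
      and h2: "\<forall>y\<in>carrier R. h (h y) = y \<longrightarrow> h y = y" by auto
    note Hf = coset_auts_facts[OF h]
    obtain m where m: "m \<in> N" "h x = x \<otimes> m" using coset_rep[OF x(1) Hf(3)[OF x(1)]] by auto
    let ?\<alpha> = "restrict h N"
    have "?\<alpha> \<in> N_endos"
      unfolding N_endos_def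
    proof (intro CollectI conjI ballI)
      show "?\<alpha> \<in> N \<rightarrow>\<^sub>E N" using Hf(7) by auto
      show "?\<alpha> (a \<otimes> b) = ?\<alpha> a \<otimes> ?\<alpha> b" if "a \<in> N" "b \<in> N" for a b
        using Hf(5)[OF N_carrier[OF that(1)] that(2)] N_mult[OF that] that by simp
    qed
    moreover have "inj_on ?\<alpha> N"
      using inj_on_subset[OF Hf(8) N_subset] by (simp add: inj_on_def)
    moreover have "\<exists>n\<in>N. ?\<alpha> n \<noteq> n" using hn by auto
    ultimately have "(?\<alpha>, x, m) \<in> ?I" using x m by simp
    moreover have "S \<in> ?G (?\<alpha>, x, m)" using S h m(2) h1 h2 by auto
    ultimately show "S \<in> (\<Union>i\<in>?I. ?G i)" by (rule UN_I)
  qed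
  then have "card ?F \<le> card (\<Union>i\<in>?I. ?G i)"
    by (rule card_mono[rotated]) (use finI finite_inverse_closed in auto)
  then have "real (card ?F) \<le> real (card (\<Union>i\<in>?I. ?G i))" by simp
  also have "\<dots> \<le> real (card ?I) * count_bound"
  proof (rule card_UN_le_real[OF finI])
    fix i assume i: "i \<in> ?I"
    obtain \<alpha> x m where e: "i = (\<alpha>, x, m)" by (rule prod_cases3)
    have \<alpha>: "\<alpha> \<in> N_endos" "inj_on \<alpha> N" "\<exists>n\<in>N. \<alpha> n \<noteq> n" and x: "x \<in> carrier R" "x \<notin> N" and m: "m \<in> N"
      using i e by auto
    let ?S = "?G (\<alpha>, x, m)"
    have "real (card ?S) \<le> count_bound"
    proof (rule card_family_partition_le[where \<P> = "pair_block x ` carrier R" and \<P>' = "pair_block x ` carrier R"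
          and X = "carrier R" and \<rho> = "9/10" and m = 96 and b = "2 * card N"])
      have yx: "y \<otimes> x \<in> carrier R" if "y \<in> carrier R" for y using that x by simp
      have self: "y \<in> pair_block x y" if "y \<in> carrier R" for y using coset_self[OF that] by (simp add: pair_block_def)
      have sub: "pair_block x y \<subseteq> carrier R" if "y \<in> carrier R" for y
        using coset_carrier[OF that] coset_carrier[OF yx[OF that]] by (simp add: pair_block_def)
      show "\<Union>(pair_block x ` carrier R) = carrier R" using self sub by auto
      then show "carrier R \<subseteq> \<Union>(pair_block x ` carrier R)" by simp
      show "A \<inter> B = {}" if AB: "A \<in> pair_block x ` carrier R" "B \<in> pair_block x ` carrier R" "A \<noteq> B" for A B
      proof (rule ccontr)
        assume "A \<inter> B \<noteq> {}"
        then obtain z where z: "z \<in> A" "z \<in> B" by auto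
        obtain a where a: "a \<in> carrier R" "A = pair_block x a" using AB(1) by auto
        obtain b where b: "b \<in> carrier R" "B = pair_block x b" using AB(2) by auto
        show False using pair_block_eq[OF sq x(1) a(1), of z] pair_block_eq[OF sq x(1) b(1), of z] z a b AB(3) by simp
      qed
      show "inv z \<in> B" if zB: "B \<in> pair_block x ` carrier R" "z \<in> B" for B z
      proof -
        obtain y where y: "y \<in> carrier R" "B = pair_block x y" using zB(1) by auto
        show ?thesis
          using zB(2) coset_inv_involutory[OF y(1) sq[OF y(1)], of z]
            coset_inv_involutory[OF yx[OF y(1)] sq[OF yx[OF y(1)]], of z] unfolding y(2) pair_block_def by auto
      qed
      show "?S \<subseteq> inverse_closed" by auto
      show "(9 / 10 :: real) ^ 96 \<le> 1 / 2" by (simp add: power_divide)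
      show "card B \<le> 2 * card N" if B: "B \<in> pair_block x ` carrier R" for B
      proof -
        obtain y where y: "y \<in> carrier R" "B = pair_block x y" using B by auto
        show ?thesis
          using card_Un_le[of "N #> y" "N #> (y \<otimes> x)"] card_coset[OF y(1)] card_coset[OF yx[OF y(1)]]
          unfolding y(2) pair_block_def by simp
      qed
      show "96 * card (carrier R) * (2 * card N) \<le> 192 * card (carrier R) * card N" by simp
      show "0 < 2 * card N" using card_N_pos by simp
      show "real (card ((\<lambda>S. S \<inter> B) ` ?S)) \<le> 9 / 10 * 2 powr inv_orbits B"
        if B: "B \<in> pair_block x ` carrier R" for B
      proof -
        obtain y where y: "y \<in> carrier R" "B = pair_block x y" using B by auto
        show ?thesis unfolding y(2)
        proof (rule pair_estimate[OF sq _ x _ y(1) n, where \<alpha> = \<alpha> and v = "x \<otimes> m"])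
          show "\<alpha> n \<in> N" if "n \<in> N" for n using \<alpha>(1) that by (auto simp: N_endos_def)
          show "\<alpha> (a \<otimes> b) = \<alpha> a \<otimes> \<alpha> b" if "a \<in> N" "b \<in> N" for a b using \<alpha>(1) that by (auto simp: N_endos_def)
          show "x \<otimes> m \<in> carrier R" using x m N_carrier by simp
        qed (use \<alpha>(2,3) in auto)
      qed
    qed auto
    then show "real (card (?G i)) \<le> count_bound" by (simp only: e)
  qed
  also have "\<dots> \<le> guess_bound * count_bound"
  proof (rule mult_right_mono)
    have "card ?I = card {\<alpha>\<in>N_endos. inj_on \<alpha> N \<and> (\<exists>n\<in>N. \<alpha> n \<noteq> n)} * (card {x\<in>carrier R. x \<notin> N} * card N)"
      by (simp only: card_cartesian_product)
    also have "\<dots> \<le> card N_endos * (order R * card N)"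
      unfolding order_def by (intro mult_le_mono card_mono order_refl) (use N_endos_bound(1) fin in auto)
    finally have "real (card ?I) \<le> real (card N_endos * (order R * card N))" by (simp only: of_nat_le_iff)
    also have "\<dots> = real (card N_endos) * (real (order R) * real (card N))" by simp
    also have "\<dots> \<le> guess_bound" by (rule guess_triples_le(1)[OF NR])
    finally show "real (card ?I) \<le> guess_bound" .
  qed (simp add: count_bound_def)
  finally show ?thesis .
qed

section \<open>Elements whose square lies outside N\<close>

lemma rcoset_in: "x \<in> carrier R \<Longrightarrow> N #> x \<in> rcosets N"
  by (rule rcosetsI[OF N_subset])

lemma rcoset_cases:
  assumes "\<gamma> \<in> rcosets N"
  shows "\<exists>x\<in>carrier R. \<gamma> = N #> x"
  using assms by (auto simp: RCOSETS_def)

lemma card_coset_preimage: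
  assumes C: "\<C> \<subseteq> rcosets N"
  shows "card {x\<in>carrier R. N #> x \<in> \<C>} = card N * card \<C>"
proof -
  have finQ: "finite (rcosets N)"
    by (rule finite_subset[of _ "Pow (carrier R)"]) (use fin rcosets_part_G[OF N_subgroup] in auto)
  have un: "\<Union>\<C> = {x\<in>carrier R. N #> x \<in> \<C>}"
  proof (intro equalityI subsetI)
    fix x assume "x \<in> \<Union>\<C>"
    then obtain \<gamma> where g: "\<gamma> \<in> \<C>" "x \<in> \<gamma>" by auto
    obtain y where y: "y \<in> carrier R" "\<gamma> = N #> y" using rcoset_cases[OF subsetD[OF C g(1)]] by auto
    have "N #> x = \<gamma>" using coset_eq[OF y(1)] g(2) y(2) by simp
    moreover have "x \<in> carrier R" using coset_carrier[OF y(1)] g(2) y(2) by auto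
    ultimately show "x \<in> {x\<in>carrier R. N #> x \<in> \<C>}" using g(1) by simp
  next
    fix x assume "x \<in> {x\<in>carrier R. N #> x \<in> \<C>}"
    then show "x \<in> \<Union>\<C>" using coset_self[of x] by auto
  qed
  have "card N * card \<C> = card (\<Union>\<C>)"
  proof (rule card_partition)
    show "finite \<C>" by (rule finite_subset[OF C finQ])
    show "finite (\<Union>\<C>)" unfolding un using fin by simp
    show "card c = card N" if c: "c \<in> \<C>" for c
      using rcoset_cases[OF subsetD[OF C c]] card_coset by auto
    show "c1 \<inter> c2 = {}" if c: "c1 \<in> \<C>" "c2 \<in> \<C>" "c1 \<noteq> c2" for c1 c2
    proof (rule ccontr)
      assume "c1 \<inter> c2 \<noteq> {}"
      then obtain z where z: "z \<in> c1" "z \<in> c2" by auto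
      have e: "N #> z = c" if cz: "c \<in> \<C>" "z \<in> c" for c
      proof -
        obtain x where x: "x \<in> carrier R" "c = N #> x" using rcoset_cases[OF subsetD[OF C cz(1)]] by auto
        then show ?thesis using coset_eq[OF x(1)] cz(2) by simp
      qed
      show False using e[OF c(1) z(1)] e[OF c(2) z(2)] c(3) by simp
    qed
  qed
  then show ?thesis unfolding un by simp
qed

lemma coset_prod: "x \<in> carrier R \<Longrightarrow> y \<in> carrier R \<Longrightarrow> (N #> x) <#> (N #> y) = N #> (x \<otimes> y)"
  by (rule normal.rcos_sum[OF normalN])

lemma coset_eq_N_iff: "x \<in> carrier R \<Longrightarrow> N #> x = N \<longleftrightarrow> x \<in> N"
  using coset_self[of x] coset_join2[OF _ N_subgroup, of x] by auto

text \<open>The counts of elements with nontrivial square, applied to the quotient by N and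
  multiplied by |N|.\<close>

lemma card_nonsquare_ge:
  assumes ex: "\<exists>x\<in>carrier R. x \<otimes> x \<notin> N"
  shows "card (carrier R) \<le> 4 * card {x\<in>carrier R. x \<otimes> x \<notin> N}"
    and "subgroup H R \<Longrightarrow> N \<subseteq> H \<Longrightarrow> H \<noteq> carrier R \<Longrightarrow>
      card (carrier R) \<le> 12 * card {x\<in>carrier R. x \<notin> H \<and> x \<otimes> x \<notin> N} \<or>
      ({x\<in>carrier R. x \<notin> H \<and> x \<otimes> x \<notin> N} = {} \<and>
        (\<forall>x\<in>carrier R. \<forall>y\<in>carrier R. x \<notin> H \<longrightarrow> y \<notin> H \<longrightarrow> inv y \<otimes> x \<in> H))"
proof -
  let ?Q = "R Mod N"
  interpret Q: group ?Q by (rule normal.factorgroup_is_group[OF normalN])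
  have cQ: "carrier ?Q = rcosets N" by (simp add: FactGroup_def)
  have oQ: "\<one>\<^bsub>?Q\<^esub> = N" by simp
  have finQ: "finite (carrier ?Q)" unfolding cQ
    by (rule finite_subset[of _ "Pow (carrier R)"]) (use fin rcosets_part_G[OF N_subgroup] in auto)
  have sqQ: "(N #> x) \<otimes>\<^bsub>?Q\<^esub> (N #> x) = \<one>\<^bsub>?Q\<^esub> \<longleftrightarrow> x \<otimes> x \<in> N" if "x \<in> carrier R" for x
    using coset_prod[OF that that] coset_eq_N_iff[of "x \<otimes> x"] that by simp
  have exQ: "\<exists>\<gamma>\<in>carrier ?Q. \<gamma> \<otimes>\<^bsub>?Q\<^esub> \<gamma> \<noteq> \<one>\<^bsub>?Q\<^esub>"
  proof -
    obtain x where x: "x \<in> carrier R" "x \<otimes> x \<notin> N" using ex by auto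
    show ?thesis
    proof (rule bexI)
      show "(N #> x) \<otimes>\<^bsub>?Q\<^esub> (N #> x) \<noteq> \<one>\<^bsub>?Q\<^esub>" using sqQ[OF x(1)] x(2) by simp
      show "N #> x \<in> carrier ?Q" unfolding cQ by (rule rcoset_in[OF x(1)])
    qed
  qed
  have cR: "card (carrier R) = card N * card (carrier ?Q)"
    unfolding cQ using lagrange[OF N_subgroup] by (simp add: order_def mult.commute)
  let ?C = "{\<gamma>\<in>carrier ?Q. \<gamma> \<otimes>\<^bsub>?Q\<^esub> \<gamma> \<noteq> \<one>\<^bsub>?Q\<^esub>}"
  have C: "card {x\<in>carrier R. x \<otimes> x \<notin> N} = card N * card ?C"
  proof -
    have "{x\<in>carrier R. x \<otimes> x \<notin> N} = {x\<in>carrier R. N #> x \<in> ?C}"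
      using sqQ rcoset_in cQ by auto
    moreover have "card {x\<in>carrier R. N #> x \<in> ?C} = card N * card ?C"
      by (rule card_coset_preimage) (use cQ in auto)
    ultimately show ?thesis by simp
  qed
  show "card (carrier R) \<le> 4 * card {x\<in>carrier R. x \<otimes> x \<notin> N}"
    unfolding C cR using Q.card_noninvolutions_ge[OF finQ exQ] by simp
  assume H: "subgroup H R" and NH: "N \<subseteq> H" and proper: "H \<noteq> carrier R"
  let ?H = "(\<lambda>x. N #> x) ` H"
  have Hc: "x \<in> carrier R" if "x \<in> H" for x using that subgroup.mem_carrier[OF H] by blast
  have memH: "N #> x \<in> ?H \<longleftrightarrow> x \<in> H" if x: "x \<in> carrier R" for x
  proof
    assume "N #> x \<in> ?H"
    then obtain h where h: "h \<in> H" "N #> x = N #> h" by auto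
    have "x \<in> N #> h" using coset_self[OF x] h(2) by simp
    then obtain m where m: "m \<in> N" "x = h \<otimes> m" using coset_rep[OF Hc[OF h(1)]] by auto
    have "m \<in> H" using m(1) NH by auto
    then show "x \<in> H" unfolding m(2) by (rule subgroup.m_closed[OF H h(1)])
  qed simp
  have sgH: "subgroup ?H ?Q"
  proof (rule Q.subgroupI)
    show "?H \<subseteq> carrier ?Q" unfolding cQ using rcoset_in Hc by auto
    show "?H \<noteq> {}" using subgroup.one_closed[OF H] by auto
    fix a assume "a \<in> ?H"
    then obtain x where x: "x \<in> H" "a = N #> x" by auto
    have ix: "inv x \<in> H" using subgroup.m_inv_closed[OF H x(1)] .
    have "(N #> inv x) \<otimes>\<^bsub>?Q\<^esub> a = \<one>\<^bsub>?Q\<^esub>"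
      using coset_prod[OF Hc[OF ix] Hc[OF x(1)]] x(2) Hc[OF x(1)] coset_eq_N_iff[OF one_closed] N_one by simp
    then have "inv\<^bsub>?Q\<^esub> a = N #> inv x"
      by (rule Q.inv_equality) (use x rcoset_in Hc ix cQ in auto)
    then show "inv\<^bsub>?Q\<^esub> a \<in> ?H" using ix by simp
    fix b assume "b \<in> ?H"
    then obtain y where y: "y \<in> H" "b = N #> y" by auto
    have "a \<otimes>\<^bsub>?Q\<^esub> b = N #> (x \<otimes> y)" using coset_prod[OF Hc[OF x(1)] Hc[OF y(1)]] x(2) y(2) by simp
    then show "a \<otimes>\<^bsub>?Q\<^esub> b \<in> ?H" using subgroup.m_closed[OF H x(1) y(1)] by simp
  qed
  have propQ: "?H \<noteq> carrier ?Q"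
  proof
    assume e: "?H = carrier ?Q"
    have "x \<in> H" if x: "x \<in> carrier R" for x
      using memH[OF x] rcoset_in[OF x] e cQ by simp
    then have "H = carrier R" using Hc by auto
    then show False using proper by simp
  qed
  let ?X = "{\<gamma>\<in>carrier ?Q. \<gamma> \<notin> ?H \<and> \<gamma> \<otimes>\<^bsub>?Q\<^esub> \<gamma> \<noteq> \<one>\<^bsub>?Q\<^esub>}"
  have Xeq: "{x\<in>carrier R. x \<notin> H \<and> x \<otimes> x \<notin> N} = {x\<in>carrier R. N #> x \<in> ?X}"
  proof -
    have "N #> x \<in> ?X \<longleftrightarrow> x \<notin> H \<and> x \<otimes> x \<notin> N" if x: "x \<in> carrier R" for x
      using sqQ[OF x] memH[OF x] rcoset_in[OF x] cQ by simp
    then show ?thesis by (intro Collect_cong) auto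
  qed
  have "card {x\<in>carrier R. N #> x \<in> ?X} = card N * card ?X"
    by (rule card_coset_preimage) (use cQ in auto)
  then have X: "card {x\<in>carrier R. x \<notin> H \<and> x \<otimes> x \<notin> N} = card N * card ?X" unfolding Xeq .
  from Q.noninvolutions_outside_subgroup[OF finQ exQ sgH propQ]
  show "card (carrier R) \<le> 12 * card {x\<in>carrier R. x \<notin> H \<and> x \<otimes> x \<notin> N} \<or>
      ({x\<in>carrier R. x \<notin> H \<and> x \<otimes> x \<notin> N} = {} \<and>
        (\<forall>x\<in>carrier R. \<forall>y\<in>carrier R. x \<notin> H \<longrightarrow> y \<notin> H \<longrightarrow> inv y \<otimes> x \<in> H))"
  proof
    assume "card (carrier ?Q) \<le> 12 * card ?X"
    then show ?thesis unfolding X cR by simp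
  next
    assume *: "?X = {} \<and> (\<forall>x\<in>carrier ?Q. \<forall>y\<in>carrier ?Q. x \<notin> ?H \<longrightarrow> y \<notin> ?H \<longrightarrow> inv\<^bsub>?Q\<^esub> y \<otimes>\<^bsub>?Q\<^esub> x \<in> ?H)"
    have e: "{x\<in>carrier R. x \<notin> H \<and> x \<otimes> x \<notin> N} = {}" unfolding Xeq using * by simp
    have "inv y \<otimes> x \<in> H" if xy: "x \<in> carrier R" "y \<in> carrier R" "x \<notin> H" "y \<notin> H" for x y
    proof -
      have iy: "inv y \<in> carrier R" using xy by simp
      have "(N #> inv y) \<otimes>\<^bsub>?Q\<^esub> (N #> y) = \<one>\<^bsub>?Q\<^esub>"
        using coset_prod[OF iy xy(2)] xy(2) coset_eq_N_iff[OF one_closed] N_one by simp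
      then have i: "inv\<^bsub>?Q\<^esub> (N #> y) = N #> inv y"
        by (rule Q.inv_equality) (use xy iy rcoset_in cQ in auto)
      have "inv\<^bsub>?Q\<^esub> (N #> y) \<otimes>\<^bsub>?Q\<^esub> (N #> x) \<in> ?H"
        using * memH[OF xy(1)] memH[OF xy(2)] xy rcoset_in cQ by simp
      then have "N #> (inv y \<otimes> x) \<in> ?H" unfolding i using coset_prod[OF iy xy(1)] by simp
      then show ?thesis using memH[of "inv y \<otimes> x"] iy xy(1) by simp
    qed
    then show ?thesis using e by simp
  qed
qed

text \<open>The negation of the conditions on \<open>S\<close> that force \<open>y\<close> into \<^term>\<open>left_commutant f\<close>.\<close>

definition unconfined :: "'a set \<Rightarrow> 'a \<Rightarrow> bool" where
  "unconfined S y \<longleftrightarrow> (if card N \<le> 6 then S \<inter> (N #> y) \<noteq> {y}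
     else \<exists>z\<in>N. z \<noteq> \<one> \<and> (\<forall>w\<in>S \<inter> (N #> y). z \<otimes> w \<in> S))"

lemma nonsquare_coset:
  assumes y: "y \<in> carrier R" "y \<otimes> y \<notin> N" and w: "w \<in> N #> y"
  shows "w \<otimes> w \<notin> N"
proof
  assume ww: "w \<otimes> w \<in> N"
  have wc: "w \<in> carrier R" using w coset_carrier[OF y(1)] by auto
  have "N #> (y \<otimes> y) = N #> (w \<otimes> w)"
    using coset_prod[OF y(1) y(1)] coset_prod[OF wc wc] coset_eq[OF y(1) w] by simp
  then have "N #> (y \<otimes> y) = N" using coset_eq_N_iff[of "w \<otimes> w"] ww wc by simp
  then show False using coset_eq_N_iff[of "y \<otimes> y"] y by simp
qed

text \<open>If N \<subseteq> H, whole cosets lie outside H, so for |N| <= 6 all |N| singletons are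
  excluded as traces; the worst ratio is 6/64 = 3/32, and 8 is the least m with (29/32)^m <= 1/2.
  Otherwise right multiplication by an element of N outside H carries the part of a coset in H out
  of H; so at least half of the singletons are excluded, and the worst ratio is 3/64.\<close>

lemma noninvolutory_family_le:
  assumes ex: "\<exists>x\<in>carrier R. x \<otimes> x \<notin> N" and n2: "2 \<le> card N"
    and H: "subgroup H R" "H \<noteq> carrier R"
    and big: "N \<subseteq> H \<Longrightarrow> card (carrier R) \<le> 12 * card {x\<in>carrier R. x \<notin> H \<and> x \<otimes> x \<notin> N}"
  shows "real (card {S\<in>inverse_closed. \<forall>y\<in>carrier R. y \<notin> H \<longrightarrow> y \<otimes> y \<notin> N \<longrightarrow> unconfined S y}) \<le> count_bound"
    (is "real (card ?F) \<le> _")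
proof -
  have icl: "?F \<subseteq> inverse_closed" by auto
  have Hc: "x \<in> carrier R" if "x \<in> H" for x using that subgroup.mem_carrier[OF H(1)] by blast
  have step: "real (card ((\<lambda>S. S \<inter> block y) ` ?F)) \<le> \<rho> * 2 powr inv_orbits (block y)"
    if y: "y \<in> carrier R" "y \<otimes> y \<notin> N" and out: "\<exists>w\<in>N #> y. w \<notin> H"
      and small: "card N \<le> 6 \<Longrightarrow> (1 - \<rho>) * 2 ^ card N \<le> real (card ((N #> y) - H))" and \<rho>: "9 / 10 \<le> \<rho>" for y \<rho>
  proof -
    have gc: "w \<in> carrier R" if "w \<in> N #> y" for w using that coset_carrier[OF y(1)] by auto
    have "real (card ((\<lambda>S. S \<inter> (N #> y)) ` ?F)) \<le> \<rho> * 2 ^ card N"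
    proof (cases "card N \<le> 6")
      case True
      have "real (card ((\<lambda>S. S \<inter> (N #> y)) ` ?F)) \<le> 2 ^ card N - real (card ((N #> y) - H))"
      proof (rule singleton_estimate[OF y(1)])
        fix S w assume S: "S \<in> ?F" and w: "w \<in> (N #> y) - H"
        have "unconfined S w" using S w gc nonsquare_coset[OF y] by auto
        then show "S \<inter> (N #> y) \<noteq> {w}" using coset_eq[OF y(1)] w True by (simp add: unconfined_def)
      qed auto
      then show ?thesis using small[OF True] by (simp add: algebra_simps)
    next
      case False
      obtain w where w: "w \<in> N #> y" "w \<notin> H" using out by auto
      have "real (card ((\<lambda>S. S \<inter> (N #> y)) ` ?F)) \<le> 9 / 10 * 2 ^ card N"
      proof (rule periodic_estimate[OF y(1)])
        fix S assume S: "S \<in> ?F"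
        have "unconfined S w" using S w gc nonsquare_coset[OF y] by auto
        then show "\<exists>z\<in>N. z \<noteq> \<one> \<and> (\<forall>w\<in>S \<inter> (N #> y). z \<otimes> w \<in> S)"
          using coset_eq[OF y(1) w(1)] False by (simp add: unconfined_def)
      qed (use False in simp)
      also have "\<dots> \<le> \<rho> * 2 ^ card N" by (rule mult_right_mono[OF \<rho>]) simp
      finally show ?thesis .
    qed
    moreover have "real (card ((\<lambda>S. S \<inter> block y) ` ?F)) \<le> real (card ((\<lambda>S. S \<inter> (N #> y)) ` ?F))"
      using noninvolutory_block(2)[OF icl y] by simp
    moreover have "2 powr inv_orbits (block y) = 2 ^ card N"
      unfolding noninvolutory_block(1)[OF icl y] by (simp add: powr_realpow)
    ultimately show ?thesis by simp
  qed
  have b: "card (block y) \<le> 2 * card N" if "y \<in> carrier R" for y by (rule card_block_le[OF that])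
  show ?thesis
  proof (cases "N \<subseteq> H")
    case True
    let ?X = "{x\<in>carrier R. x \<notin> H \<and> x \<otimes> x \<notin> N}"
    show ?thesis
    proof (rule card_family_block_le[OF icl, where X = ?X and \<rho> = "29/32" and m = 8 and b = "2 * card N"])
      show "(29 / 32 :: real) ^ 8 \<le> 1 / 2" by (simp add: power_divide)
      show "0 < 2 * card N" using card_N_pos by simp
      show "8 * card (carrier R) * (2 * card N) \<le> 192 * card ?X * card N" using big[OF True] by simp
      fix y assume y: "y \<in> ?X"
      show "card (block y) \<le> 2 * card N" using b y by simp
      have out: "w \<notin> H" if w: "w \<in> N #> y" for w
      proof
        assume wH: "w \<in> H"
        have yw: "y \<in> N #> w" using coset_self[of y] coset_eq[of y w] w y by simp
        then obtain m where m: "m \<in> N" "y = w \<otimes> m" using coset_rep[of w y] Hc[OF wH] by auto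
        have "m \<in> H" using m(1) True by auto
        then have "y \<in> H" unfolding m(2) by (rule subgroup.m_closed[OF H(1) wH])
        then show False using y by simp
      qed
      show "real (card ((\<lambda>S. S \<inter> block y) ` ?F)) \<le> 29 / 32 * 2 powr inv_orbits (block y)"
      proof (rule step)
        show "\<exists>w\<in>N #> y. w \<notin> H" using out coset_self y by auto
        assume n6: "card N \<le> 6"
        have "(N #> y) - H = N #> y" using out by auto
        moreover have "(1 - 29 / 32) * 2 ^ card N \<le> real (card N)"
        proof -
          have "card N \<in> {2,3,4,5,6}" using n2 n6 by auto
          then show ?thesis by auto
        qed
        ultimately show "(1 - 29 / 32) * 2 ^ card N \<le> real (card ((N #> y) - H))"
          using card_coset[of y] y by simp
      qed (use y in auto)
    qed auto
  next
    case False
    then obtain n0 where n0: "n0 \<in> N" "n0 \<notin> H" by auto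
    let ?X = "{x\<in>carrier R. x \<otimes> x \<notin> N}"
    show ?thesis
    proof (rule card_family_block_le[OF icl, where X = ?X and \<rho> = "61/64" and m = 24 and b = "2 * card N"])
      show "(61 / 64 :: real) ^ 24 \<le> 1 / 2" by (simp add: power_divide)
      show "0 < 2 * card N" using card_N_pos by simp
      \<comment> \<open>As 24 * 2 * 4 = 192, density 1/4 of X and two cosets in a block leave m =
        24.\<close>
      show "24 * card (carrier R) * (2 * card N) \<le> 192 * card ?X * card N" using card_nonsquare_ge(1)[OF ex] by simp
      fix y assume y: "y \<in> ?X"
      have yc: "y \<in> carrier R" using y by simp
      show "card (block y) \<le> 2 * card N" using b yc by simp
      have fg: "finite (N #> y)" by (rule finite_coset[OF yc])
      have "card ((N #> y) \<inter> H) \<le> card ((N #> y) - H)"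
      proof (rule card_inj_on_le[where f = "\<lambda>w. w \<otimes> n0"])
        show "inj_on (\<lambda>w. w \<otimes> n0) ((N #> y) \<inter> H)"
          using Hc N_carrier[OF n0(1)] by (auto intro!: inj_onI)
        show "(\<lambda>w. w \<otimes> n0) ` ((N #> y) \<inter> H) \<subseteq> (N #> y) - H"
        proof
          fix v assume "v \<in> (\<lambda>w. w \<otimes> n0) ` ((N #> y) \<inter> H)"
          then obtain w where w: "w \<in> N #> y" "w \<in> H" "v = w \<otimes> n0" by auto
          have "v \<notin> H"
          proof
            assume "v \<in> H"
            then have "inv w \<otimes> v \<in> H" by (rule subgroup.m_closed[OF H(1) subgroup.m_inv_closed[OF H(1) w(2)]])
            moreover have "inv w \<otimes> v = n0" unfolding w(3) using Hc[OF w(2)] N_carrier[OF n0(1)] by (simp add: m_assoc[symmetric])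
            ultimately show False using n0(2) by simp
          qed
          then show "v \<in> (N #> y) - H" using coset_mult[OF yc w(1) n0(1)] w(3) by simp
        qed
        show "finite ((N #> y) - H)" using fg by simp
      qed
      moreover have "card ((N #> y) \<inter> H) + card ((N #> y) - H) = card N"
        using card_Int_Diff[OF fg, of H] card_coset[OF yc] by simp
      ultimately have half: "card N \<le> 2 * card ((N #> y) - H)" by linarith
      show "real (card ((\<lambda>S. S \<inter> block y) ` ?F)) \<le> 61 / 64 * 2 powr inv_orbits (block y)"
      proof (rule step)
        have "(N #> y) - H \<noteq> {}"
        proof
          assume "(N #> y) - H = {}"
          then have "card ((N #> y) - H) = 0" by (simp only: card.empty)
          then show False using half n2 by linarith
        qed
        then show "\<exists>w\<in>N #> y. w \<notin> H" by auto
        assume n6: "card N \<le> 6"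
        have "card N \<in> {2,3,4,5,6}" using n2 n6 by auto
        then show "(1 - 61 / 64) * 2 ^ card N \<le> real (card ((N #> y) - H))" using half by auto
      qed (use y in auto)
    qed auto
  qed
qed

text \<open>Only \<alpha> = f on N is guessed. At least a quarter of the elements have their square
  outside N, and on each of their cosets f is one of the maps that are affine over \<alpha>.\<close>

lemma nontrivial_action_family_le:
  assumes ex: "\<exists>x\<in>carrier R. x \<otimes> x \<notin> N" and n: "7 \<le> card N" and NR: "N \<noteq> carrier R"
  shows "real (card {S\<in>inverse_closed. \<exists>f\<in>coset_auts S. \<exists>n\<in>N. f n \<noteq> n}) \<le> guess_bound * count_bound"
    (is "real (card ?F) \<le> _")
proof -
  let ?I = "{\<alpha>\<in>N_endos. \<exists>n\<in>N. \<alpha> n \<noteq> n}"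
  let ?G = "\<lambda>\<alpha>. {S\<in>inverse_closed. \<exists>f\<in>coset_auts S. \<forall>n\<in>N. f n = \<alpha> n}"
  have finI: "finite ?I" using N_endos_bound(1) by simp
  have "?F \<subseteq> (\<Union>\<alpha>\<in>?I. ?G \<alpha>)"
  proof
    fix S assume "S \<in> ?F"
    then obtain f where S: "S \<in> inverse_closed" and f: "f \<in> coset_auts S" "\<exists>n\<in>N. f n \<noteq> n" by auto
    note F = coset_auts_facts[OF f(1)]
    have "restrict f N \<in> N_endos"
      unfolding N_endos_def
    proof (intro CollectI conjI ballI)
      show "restrict f N \<in> N \<rightarrow>\<^sub>E N" using F(7) by auto
      show "restrict f N (a \<otimes> b) = restrict f N a \<otimes> restrict f N b" if "a \<in> N" "b \<in> N" for a b
        using F(5)[OF N_carrier[OF that(1)] that(2)] N_mult[OF that] that by simp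
    qed
    then have i: "restrict f N \<in> ?I" using f(2) by auto
    have g: "S \<in> ?G (restrict f N)" using S f(1) by auto
    show "S \<in> (\<Union>\<alpha>\<in>?I. ?G \<alpha>)"
    proof (rule UN_I)
      show "restrict f N \<in> ?I" by (rule i)
      show "S \<in> ?G (restrict f N)" by (rule g)
    qed
  qed
  then have "card ?F \<le> card (\<Union>\<alpha>\<in>?I. ?G \<alpha>)"
    by (rule card_mono[rotated]) (use finI finite_inverse_closed in auto)
  then have "real (card ?F) \<le> real (card (\<Union>\<alpha>\<in>?I. ?G \<alpha>))" by simp
  also have "\<dots> \<le> real (card ?I) * count_bound"
  proof (rule card_UN_le_real[OF finI])
    fix \<alpha> assume \<alpha>: "\<alpha> \<in> ?I"
    let ?X = "{x\<in>carrier R. x \<otimes> x \<notin> N}"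
    have icl: "?G \<alpha> \<subseteq> inverse_closed" by auto
    show "real (card (?G \<alpha>)) \<le> count_bound"
    proof (rule card_family_block_le[OF icl, where X = ?X and \<rho> = "9/10" and m = 24 and b = "2 * card N"])
      show "(9 / 10 :: real) ^ 24 \<le> 1 / 2" by (simp add: power_divide)
      show "0 < 2 * card N" using card_N_pos by simp
      show "24 * card (carrier R) * (2 * card N) \<le> 192 * card ?X * card N" using card_nonsquare_ge(1)[OF ex] by simp
      fix y assume y: "y \<in> ?X"
      have yc: "y \<in> carrier R" "y \<otimes> y \<notin> N" using y by auto
      show "card (block y) \<le> 2 * card N" by (rule card_block_le[OF yc(1)])
      have "real (card ((\<lambda>S. S \<inter> (N #> y)) ` ?G \<alpha>)) \<le> 9 / 10 * 2 ^ card N"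
      proof (rule affine_estimate[OF yc(1) n, where \<alpha> = \<alpha>])
        show "\<alpha> n \<in> N" if "n \<in> N" for n using \<alpha> that by (auto simp: N_endos_def)
        show "\<alpha> (a \<otimes> b) = \<alpha> a \<otimes> \<alpha> b" if "a \<in> N" "b \<in> N" for a b using \<alpha> that by (auto simp: N_endos_def)
      qed (use \<alpha> in auto)
      moreover have "real (card ((\<lambda>S. S \<inter> block y) ` ?G \<alpha>)) \<le> real (card ((\<lambda>S. S \<inter> (N #> y)) ` ?G \<alpha>))"
        using noninvolutory_block(2)[OF icl yc] by simp
      moreover have "2 powr inv_orbits (block y) = 2 ^ card N"
        unfolding noninvolutory_block(1)[OF icl yc] by (simp add: powr_realpow)
      ultimately show "real (card ((\<lambda>S. S \<inter> block y) ` ?G \<alpha>)) \<le> 9 / 10 * 2 powr inv_orbits (block y)" by simp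
    qed auto
  qed
  also have "\<dots> \<le> guess_bound * count_bound"
  proof (rule mult_right_mono)
    have "card ?I \<le> card N_endos" by (rule card_mono[OF N_endos_bound(1)]) auto
    then show "real (card ?I) \<le> guess_bound" using guess_triples_le(2)[OF NR] by linarith
  qed (simp add: count_bound_def)
  finally show ?thesis .
qed

text \<open>The form that f takes if J = \<open>left_commutant f\<close> has index 2: on the other
  coset of J it is a fixed right translation.\<close>

definition half_translation :: "'a set \<Rightarrow> 'a \<Rightarrow> 'a \<Rightarrow> 'a" where
  "half_translation J c y = (if y \<in> J then y else y \<otimes> c)"

text \<open>The guess is J and c. An element y outside J goes to inv y only if y^2 = inv c, which
  outside the exceptional groups holds for at most 3/4 |J| elements. So at least |R| / 2 - 3/8 |R| =
  |R| / 8 elements are sent to neither themselves nor their inverses.\<close>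

lemma half_translation_family_le:
  assumes ne: "\<not> exceptional" and n2: "2 \<le> card N"
  shows "real (card {S\<in>inverse_closed. \<exists>J c. subgroup J R \<and> J \<noteq> carrier R \<and> c \<in> N \<and> c \<noteq> \<one> \<and>
      (\<forall>x\<in>carrier R. \<forall>y\<in>carrier R. x \<notin> J \<longrightarrow> y \<notin> J \<longrightarrow> inv y \<otimes> x \<in> J) \<and>
      (\<forall>x\<in>carrier R. half_translation J c x \<in> S \<longleftrightarrow> x \<in> S)}) \<le> guess_bound * count_bound"
    (is "real (card ?F) \<le> _")
proof -
  let ?I = "{J. subgroup J R \<and> J \<noteq> carrier R \<and>
      (\<forall>x\<in>carrier R. \<forall>y\<in>carrier R. x \<notin> J \<longrightarrow> y \<notin> J \<longrightarrow> inv y \<otimes> x \<in> J)} \<times> (N - {\<one>})"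
  let ?G = "\<lambda>(J, c). {S\<in>inverse_closed. \<forall>x\<in>carrier R. half_translation J c x \<in> S \<longleftrightarrow> x \<in> S}"
  have finI: "finite ?I"
    by (rule finite_cartesian_product[OF finite_subset[OF _ proper_subgroups_finite]]) (use N_finite in auto)
  have "?F \<subseteq> (\<Union>i\<in>?I. ?G i)"
  proof
    fix S assume "S \<in> ?F"
    then obtain J c where S: "S \<in> inverse_closed" "\<forall>x\<in>carrier R. half_translation J c x \<in> S \<longleftrightarrow> x \<in> S"
      and J: "(J, c) \<in> ?I" by auto
    show "S \<in> (\<Union>i\<in>?I. ?G i)" by (rule UN_I[OF J]) (use S in simp)
  qed
  then have "card ?F \<le> card (\<Union>i\<in>?I. ?G i)"
    by (rule card_mono[rotated]) (use finI finite_inverse_closed in auto)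
  then have "real (card ?F) \<le> real (card (\<Union>i\<in>?I. ?G i))" by simp
  also have "\<dots> \<le> real (card ?I) * count_bound"
  proof (rule card_UN_le_real[OF finI])
    fix i assume i: "i \<in> ?I"
    obtain J c where e: "i = (J, c)" by (rule prod.exhaust)
    have J: "subgroup J R" "J \<noteq> carrier R" and c: "c \<in> N" "c \<noteq> \<one>" using i e by auto
    have idx: "inv y \<otimes> x \<in> J" if "x \<in> carrier R" "y \<in> carrier R" "x \<notin> J" "y \<notin> J" for x y
      using i e that by auto
    have cc: "c \<in> carrier R" using N_carrier[OF c(1)] .
    have ic: "inv c \<noteq> \<one>"
    proof
      assume "inv c = \<one>"
      then have "inv (inv c) = inv \<one>" by (simp only:)
      then show False using c cc by simp
    qed
    let ?f = "half_translation J c"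
    let ?E = "{y\<in>carrier R. y \<notin> J \<and> y \<otimes> y = inv c}" and ?D = "{x\<in>carrier R. ?f x \<noteq> x \<and> ?f x \<noteq> inv x}"
    have "carrier R - J \<subseteq> ?E \<union> ?D"
    proof
      fix y assume y: "y \<in> carrier R - J"
      have yc: "y \<in> carrier R" using y by simp
      have fy: "?f y = y \<otimes> c" using y by (simp add: half_translation_def)
      have "y \<otimes> c \<noteq> y" using c(2) cc yc by simp
      moreover have "y \<otimes> y = inv c" if "y \<otimes> c = inv y"
      proof -
        have "y \<otimes> (y \<otimes> c) = \<one>" using that yc by simp
        then have "(y \<otimes> y) \<otimes> c = \<one>" using yc cc by (simp add: m_assoc)
        then show ?thesis using inv_equality[of "y \<otimes> y" c] yc cc by simp
      qed
      ultimately show "y \<in> ?E \<union> ?D" using y fy by auto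
    qed
    then have "card (carrier R - J) \<le> card (?E \<union> ?D)" by (rule card_mono[rotated]) (use fin in auto)
    then have 1: "card (carrier R - J) \<le> card ?E + card ?D" using card_Un_le[of ?E ?D] by linarith
    have 2: "4 * card ?E \<le> 3 * card J"
    proof (rule ccontr)
      assume "\<not> 4 * card ?E \<le> 3 * card J"
      then have "3 * card J < 4 * card ?E" by simp
      then have "\<exists>C y. twisted_dihedral C y"
        using constant_square_coset_twisted_dihedral[OF fin J(1) idx ic] by auto
      then show False using ne unfolding exceptional_def by auto
    qed
    have JC: "J \<subseteq> carrier R" using subgroup.subset[OF J(1)] .
    have "card (carrier R - J) = card (carrier R) - card J"
      by (rule card_Diff_subset[OF finite_subset[OF JC fin] JC])
    then have "card (carrier R) \<le> 96 * card ?D"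
      using 1 2 proper_subgroup_half[OF J] card_mono[OF fin JC] by linarith
    then have "real (card (?G (J, c))) \<le> count_bound"
      by (simp only: prod.case, intro card_invariant_family_le[OF _ n2]) (use cc in \<open>auto simp: half_translation_def\<close>)
    then show "real (card (?G i)) \<le> count_bound" by (simp only: e)
  qed
  also have "\<dots> \<le> guess_bound * count_bound"
  proof (rule mult_right_mono)
    have "card ?I \<le> card {H. subgroup H R \<and> H \<noteq> carrier R} * order R"
      unfolding card_cartesian_product order_def
      by (intro mult_le_mono card_mono proper_subgroups_finite fin) (use N_carrier in auto)
    then have "real (card ?I) \<le> real (card {H. subgroup H R \<and> H \<noteq> carrier R} * order R)" by (simp only: of_nat_le_iff)
    also have "\<dots> \<le> guess_bound" using card_proper_subgroups_guess(1) by simp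
    finally show "real (card ?I) \<le> guess_bound" .
  qed (simp add: count_bound_def)
  finally show ?thesis .
qed

section \<open>Assembling the families\<close>

abbreviation proper_subgroups :: "'a set set" where
  "proper_subgroups \<equiv> {H. subgroup H R \<and> H \<noteq> carrier R}"

abbreviation automorphism_family :: "'a set set" where
  "automorphism_family \<equiv> {S\<in>inverse_closed. \<exists>f\<in>carrier R \<rightarrow>\<^sub>E carrier R.
      (\<forall>a\<in>carrier R. \<forall>b\<in>carrier R. f (a \<otimes> b) = f a \<otimes> f b) \<and> (\<exists>x\<in>carrier R. f x \<noteq> x) \<and>
      (\<forall>x\<in>carrier R. f x \<in> S \<longleftrightarrow> x \<in> S)}"

lemma coset_auts_nontrivial_point:
  assumes f: "f \<in> coset_auts S" and ne: "f \<noteq> (\<lambda>x\<in>carrier R. x)"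
  shows "\<exists>x\<in>carrier R. f x \<noteq> x"
proof (rule ccontr)
  assume *: "\<not> (\<exists>x\<in>carrier R. f x \<noteq> x)"
  have "f = (\<lambda>x\<in>carrier R. x)"
    by (rule extensionalityI[OF coset_auts_facts(10)[OF f] restrict_extensional]) (use * in auto)
  then show False using ne by simp
qed

lemma automorphism_familyI:
  assumes S: "S \<in> inverse_closed" and f: "f \<in> coset_auts S" and ne: "f \<noteq> (\<lambda>x\<in>carrier R. x)"
    and hom: "\<And>a b. a \<in> carrier R \<Longrightarrow> b \<in> carrier R \<Longrightarrow> f (a \<otimes> b) = f a \<otimes> f b"
  shows "S \<in> automorphism_family"
proof -
  note F = coset_auts_facts[OF f]
  have "f \<in> carrier R \<rightarrow>\<^sub>E carrier R" using F(4) F(10) by (auto simp: PiE_def)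
  moreover have "\<exists>x\<in>carrier R. f x \<noteq> x" by (rule coset_auts_nontrivial_point[OF f ne])
  ultimately show ?thesis using S hom F(11) by (intro CollectI conjI bexI[of _ f] ballI) simp_all
qed

lemma card_three_families_le:
  assumes U: "U \<subseteq> A \<union> B \<union> C" and fin3: "A \<subseteq> inverse_closed" "B \<subseteq> inverse_closed" "C \<subseteq> inverse_closed"
    and "real (card A) \<le> M" "real (card B) \<le> M" "real (card C) \<le> M"
  shows "real (card U) \<le> 3 * M"
proof -
  have f: "finite A" "finite B" "finite C" using fin3 finite_subset[OF _ finite_inverse_closed] by auto
  have "card U \<le> card (A \<union> B \<union> C)" by (rule card_mono[OF _ U]) (use f in simp)
  also have "\<dots> \<le> card A + card B + card C"
    using card_Un_le[of "A \<union> B" C] card_Un_le[of A B] by linarith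
  finally show ?thesis using assms(5-7) by linarith
qed

lemma bound_nonneg: "0 \<le> guess_bound * count_bound"
  by (simp add: count_bound_def)

text \<open>The main case is odd order with |N| >= 7; suppose that S avoids all three families. A
  member g of \<open>coset_auts S\<close> that is trivial on N is the identity, since otherwise the
  proper subgroup \<open>fix_translators g\<close> would put S into the periodic family. For each x,
  the composite h of f^-1 with \<open>shift x f\<close> is trivial on N, since otherwise S would lie
  in the pair family. So h is the identity, f equals all its shifts, and f is an automorphism, a
  contradiction.\<close>

lemma involutory_bound:
  assumes sq: "\<And>x. x \<in> carrier R \<Longrightarrow> x \<otimes> x \<in> N" and ne: "\<not> exceptional"
    and n2: "2 \<le> card N" and NR: "N \<noteq> carrier R"
  shows "real (card {S\<in>inverse_closed. \<exists>f\<in>coset_auts S. f \<noteq> (\<lambda>x\<in>carrier R. x)}) \<le> 3 * (guess_bound * count_bound)"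
    (is "real (card ?U) \<le> _")
proof (cases "card N \<le> 6")
  case n6: True
  let ?G = "\<lambda>H. {S\<in>inverse_closed. \<forall>y\<in>carrier R. y \<notin> H \<longrightarrow> S \<inter> (N #> y) \<noteq> {y, inv y}}"
  have "?U \<subseteq> automorphism_family \<union> (\<Union>H\<in>proper_subgroups. ?G H) \<union> {}"
  proof
    fix S assume "S \<in> ?U"
    then obtain f where S: "S \<in> inverse_closed" and f: "f \<in> coset_auts S" "f \<noteq> (\<lambda>x\<in>carrier R. x)" by auto
    show "S \<in> automorphism_family \<union> (\<Union>H\<in>proper_subgroups. ?G H) \<union> {}"
    proof (cases "even (card (coset_auts S))")
      case True
      obtain g where g: "g \<in> coset_auts S" "g \<noteq> (\<lambda>x\<in>carrier R. x)"
        "\<forall>a\<in>carrier R. \<forall>b\<in>carrier R. g (a \<otimes> b) = g a \<otimes> g b"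
        using even_coset_auts_automorphism[OF sq True] by auto
      have "S \<in> automorphism_family" by (rule automorphism_familyI[OF S g(1,2)]) (use g(3) in simp)
      then show ?thesis by (simp only: Un_iff simp_thms)
    next
      case odd: False
      have J: "left_commutant f \<in> proper_subgroups"
        using left_commutant_subgroup[OF coset_auts_facts(4)[OF f(1)]] left_commutant_proper[OF f] by simp
      have "S \<in> ?G (left_commutant f)"
        using S inverse_pair_coset_left_commutant[OF odd f(1)] by auto
      then have "S \<in> (\<Union>H\<in>proper_subgroups. ?G H)" by (rule UN_I[OF J])
      then show ?thesis by (simp only: Un_iff simp_thms)
    qed
  qed
  then show ?thesis
  proof (rule card_three_families_le)
    show "real (card automorphism_family) \<le> guess_bound * count_bound" by (rule automorphism_family_le[OF ne n2])
    show "real (card (\<Union>H\<in>proper_subgroups. ?G H)) \<le> guess_bound * count_bound"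
      by (rule subgroup_family_le) (use involutory_small_family[OF sq n6] in auto)
  qed (use bound_nonneg in auto)
next
  case False
  then have n7: "7 \<le> card N" by simp
  let ?G = "\<lambda>H. {S\<in>inverse_closed. \<forall>y\<in>carrier R. y \<notin> H \<longrightarrow>
      (\<exists>z\<in>N. z \<otimes> z \<noteq> \<one> \<and> (\<forall>w\<in>S \<inter> (N #> y). z \<otimes> w \<in> S))}"
  let ?P = "{S\<in>inverse_closed. \<exists>h\<in>coset_auts S. \<exists>x\<in>carrier R. x \<notin> N \<and> (\<exists>n\<in>N. h n \<noteq> n) \<and>
      (\<forall>y\<in>carrier R. h (h y \<otimes> x) = y \<otimes> h x) \<and> (\<forall>y\<in>carrier R. h (h y) = y \<longrightarrow> h y = y)}"
  have "?U \<subseteq> automorphism_family \<union> (\<Union>H\<in>proper_subgroups. ?G H) \<union> ?P"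
  proof
    fix S assume "S \<in> ?U"
    then obtain f where S: "S \<in> inverse_closed" and f: "f \<in> coset_auts S" "f \<noteq> (\<lambda>x\<in>carrier R. x)" by auto
    show "S \<in> automorphism_family \<union> (\<Union>H\<in>proper_subgroups. ?G H) \<union> ?P"
    proof (cases "even (card (coset_auts S))")
      case True
      obtain g where g: "g \<in> coset_auts S" "g \<noteq> (\<lambda>x\<in>carrier R. x)"
        "\<forall>a\<in>carrier R. \<forall>b\<in>carrier R. g (a \<otimes> b) = g a \<otimes> g b"
        using even_coset_auts_automorphism[OF sq True] by auto
      have "S \<in> automorphism_family" by (rule automorphism_familyI[OF S g(1,2)]) (use g(3) in simp)
      then show ?thesis by (simp only: Un_iff simp_thms)
    next
      case odd: False
      show ?thesis
      proof (rule ccontr)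
        assume nin: "S \<notin> automorphism_family \<union> (\<Union>H\<in>proper_subgroups. ?G H) \<union> ?P"
        have nA: "S \<notin> automorphism_family" and nG: "S \<notin> (\<Union>H\<in>proper_subgroups. ?G H)" and nP: "S \<notin> ?P"
          using nin by (simp_all only: Un_iff simp_thms de_Morgan_disj)
        have triv_id: "g = (\<lambda>x\<in>carrier R. x)" if g: "g \<in> coset_auts S" and gN: "\<And>n. n \<in> N \<Longrightarrow> g n = n" for g
        proof (rule ccontr)
          assume gne: "g \<noteq> (\<lambda>x\<in>carrier R. x)"
          have J: "fix_translators g \<in> proper_subgroups"
            using fix_translators_subgroup[of g] fix_translators_proper[OF g gne] by simp
          have "\<exists>z\<in>N. z \<otimes> z \<noteq> \<one> \<and> (\<forall>w\<in>S \<inter> (N #> y). z \<otimes> w \<in> S)"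
            if y: "y \<in> carrier R" "y \<notin> fix_translators g" for y
          proof (rule ccontr)
            assume "\<not> (\<exists>z\<in>N. z \<otimes> z \<noteq> \<one> \<and> (\<forall>w\<in>S \<inter> (N #> y). z \<otimes> w \<in> S))"
            then have w: "\<exists>w\<in>S \<inter> (N #> y). z \<otimes> w \<notin> S" if "z \<in> N" "z \<otimes> z \<noteq> \<one>" for z using that by auto
            have "y \<in> fix_translators g"
              by (rule odd_aperiodic_coset_fix_translators[OF odd g gN y(1)], assumption, rule w)
            then show False using y(2) by simp
          qed
          then have "S \<in> ?G (fix_translators g)" using S by simp
          then have "S \<in> (\<Union>H\<in>proper_subgroups. ?G H)" by (rule UN_I[OF J])
          then show False using nG by (rule notE[rotated])
        qed
        note F = coset_auts_facts[OF f(1)]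
        have "f (y \<otimes> x) = f y \<otimes> f x" if y: "y \<in> carrier R" and x: "x \<in> carrier R" for y x
        proof -
          obtain h where h: "h \<in> coset_auts S" "\<And>y. y \<in> carrier R \<Longrightarrow> f (h y) = shift x f y"
            "\<And>y. y \<in> carrier R \<Longrightarrow> h (h y \<otimes> x) = y \<otimes> h x"
            using shift_anti_invariant[OF sq f(1) x] by metis
          note H = coset_auts_facts[OF h(1)]
          have hN: "h n = n" if n: "n \<in> N" for n
          proof (rule ccontr)
            assume hn: "h n \<noteq> n"
            \<comment> \<open>The pair family needs two different cosets; for x in N the shift by x
              does nothing and h is the identity.\<close>
            have "x \<notin> N"
            proof
              assume "x \<in> N"
              then have "shift x f = f"
                using shift_coset[OF f(1) one_closed N_coset_one] shift_one[OF f(1)] by simp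
              then have "f (h n) = f n" using h(2) N_carrier[OF n] by simp
              then have "h n = n" using inj_onD[OF F(8)] H(4) N_carrier[OF n] by simp
              then show False using hn by simp
            qed
            then have "x \<notin> N \<and> (\<exists>n\<in>N. h n \<noteq> n) \<and> (\<forall>y\<in>carrier R. h (h y \<otimes> x) = y \<otimes> h x) \<and>
                (\<forall>y\<in>carrier R. h (h y) = y \<longrightarrow> h y = y)"
              using n hn h(3) odd_coset_auts_no_swap[OF odd h(1)] by (intro conjI ballI impI bexI[of _ n]) simp_all
            then have "\<exists>h\<in>coset_auts S. \<exists>x\<in>carrier R. x \<notin> N \<and> (\<exists>n\<in>N. h n \<noteq> n) \<and>
                (\<forall>y\<in>carrier R. h (h y \<otimes> x) = y \<otimes> h x) \<and> (\<forall>y\<in>carrier R. h (h y) = y \<longrightarrow> h y = y)"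
              by (intro bexI[of _ h] bexI[of _ x] h(1) x)
            then have "S \<in> ?P" using S by (simp only: mem_Collect_eq simp_thms)
            then show False using nP by (rule notE[rotated])
          qed
          have "h = (\<lambda>x\<in>carrier R. x)" by (rule triv_id[OF h(1) hN])
          then have "shift x f y = f y" using h(2)[OF y] y by simp
          then have "f y \<otimes> f x = f (y \<otimes> x) \<otimes> inv (f x) \<otimes> f x" using y by (simp add: shift_def)
          then show ?thesis using F(4)[of "y \<otimes> x"] F(4)[OF x] x y by (simp add: m_assoc)
        qed
        then have "S \<in> automorphism_family" by (rule automorphism_familyI[OF S f])
        then show False using nA by (rule notE[rotated])
      qed
    qed
  qed
  then show ?thesis
  proof (rule card_three_families_le)
    show "real (card automorphism_family) \<le> guess_bound * count_bound" by (rule automorphism_family_le[OF ne n2])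
    show "real (card (\<Union>H\<in>proper_subgroups. ?G H)) \<le> guess_bound * count_bound"
      by (rule subgroup_family_le) (use involutory_periodic_family[OF sq n7] in auto)
    show "real (card ?P) \<le> guess_bound * count_bound" by (rule involutory_pair_family_le[OF sq n7 NR])
  qed auto
qed

text \<open>Let J = \<open>left_commutant f\<close>. If |N| >= 7 and some coset automorphism acts
  nontrivially on N, then S lies in \<open>?A\<close>. Otherwise every y outside J is unconfined, so
  J is an admissible guess unless N \<subseteq> J and too few elements outside J have their square
  outside N. In that case J has index 2, and f, which commutes with left multiplication by J, is a
  half translation.\<close>

lemma noninvolutory_bound:
  assumes ex: "\<exists>x\<in>carrier R. x \<otimes> x \<notin> N" and ne: "\<not> exceptional"
    and n2: "2 \<le> card N" and NR: "N \<noteq> carrier R"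
  shows "real (card {S\<in>inverse_closed. \<exists>f\<in>coset_auts S. f \<noteq> (\<lambda>x\<in>carrier R. x)}) \<le> 3 * (guess_bound * count_bound)"
    (is "real (card ?U) \<le> _")
proof -
  \<comment> \<open>The proper subgroups to which \<open>noninvolutory_family_le\<close>
    applies.\<close>
  let ?\<H> = "{H\<in>proper_subgroups. N \<subseteq> H \<longrightarrow> card (carrier R) \<le> 12 * card {x\<in>carrier R. x \<notin> H \<and> x \<otimes> x \<notin> N}}"
  let ?G = "\<lambda>H. {S\<in>inverse_closed. \<forall>y\<in>carrier R. y \<notin> H \<longrightarrow> y \<otimes> y \<notin> N \<longrightarrow> unconfined S y}"
  let ?A = "{S\<in>inverse_closed. 7 \<le> card N \<and> (\<exists>f\<in>coset_auts S. \<exists>n\<in>N. f n \<noteq> n)}"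
  let ?T = "{S\<in>inverse_closed. \<exists>J c. subgroup J R \<and> J \<noteq> carrier R \<and> c \<in> N \<and> c \<noteq> \<one> \<and>
      (\<forall>x\<in>carrier R. \<forall>y\<in>carrier R. x \<notin> J \<longrightarrow> y \<notin> J \<longrightarrow> inv y \<otimes> x \<in> J) \<and>
      (\<forall>x\<in>carrier R. half_translation J c x \<in> S \<longleftrightarrow> x \<in> S)}"
  have "?U \<subseteq> ?A \<union> (\<Union>H\<in>?\<H>. ?G H) \<union> ?T"
  proof
    fix S assume "S \<in> ?U"
    then obtain f where S: "S \<in> inverse_closed" and f: "f \<in> coset_auts S" "f \<noteq> (\<lambda>x\<in>carrier R. x)" by auto
    note F = coset_auts_facts[OF f(1)]
    let ?J = "left_commutant f"
    have J: "subgroup ?J R" "?J \<noteq> carrier R"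
      using left_commutant_subgroup[OF F(4)] left_commutant_proper[OF f] by simp_all
    show "S \<in> ?A \<union> (\<Union>H\<in>?\<H>. ?G H) \<union> ?T"
    proof (rule ccontr)
      assume nin: "S \<notin> ?A \<union> (\<Union>H\<in>?\<H>. ?G H) \<union> ?T"
      have nA: "S \<notin> ?A" and nG: "S \<notin> (\<Union>H\<in>?\<H>. ?G H)" and nT: "S \<notin> ?T"
        using nin by (simp_all only: Un_iff simp_thms de_Morgan_disj)
      have "unconfined S y" if y: "y \<in> carrier R" "y \<notin> ?J" for y
      proof (cases "card N \<le> 6")
        case True
        then show ?thesis using singleton_coset_left_commutant[OF f(1) y(1)] y(2) by (auto simp: unconfined_def)
      next
        case False
        then have triv: "g n = n" if "g \<in> coset_auts S" "n \<in> N" for g n using nA S that by auto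
        have "\<exists>z\<in>N. z \<noteq> \<one> \<and> (\<forall>w\<in>S \<inter> (N #> y). z \<otimes> w \<in> S)"
        proof (rule ccontr)
          assume "\<not> (\<exists>z\<in>N. z \<noteq> \<one> \<and> (\<forall>w\<in>S \<inter> (N #> y). z \<otimes> w \<in> S))"
          then have w: "\<exists>w\<in>S \<inter> (N #> y). z \<otimes> w \<notin> S" if "z \<in> N" "z \<noteq> \<one>" for z using that by auto
          have "y \<in> ?J" by (rule aperiodic_coset_left_commutant[OF _ f(1) y(1)], rule triv, assumption+, rule w)
          then show False using y(2) by simp
        qed
        then show ?thesis using False by (simp add: unconfined_def)
      qed
      then have SG: "S \<in> ?G ?J" using S by simp
      have nH: "?J \<notin> ?\<H>"
      proof
        assume "?J \<in> ?\<H>"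
        then have "S \<in> (\<Union>H\<in>?\<H>. ?G H)" using SG by (rule UN_I)
        then show False using nG by (rule notE[rotated])
      qed
      have NJ: "N \<subseteq> ?J" and few: "\<not> card (carrier R) \<le> 12 * card {x\<in>carrier R. x \<notin> ?J \<and> x \<otimes> x \<notin> N}"
        using nH J by auto
      have idx: "inv y \<otimes> x \<in> ?J" if "x \<in> carrier R" "y \<in> carrier R" "x \<notin> ?J" "y \<notin> ?J" for x y
        using card_nonsquare_ge(2)[OF ex J(1) NJ J(2)] few that by auto
      have comm: "f (y \<otimes> u) = y \<otimes> f u" if "y \<in> ?J" "u \<in> carrier R" for y u
        using that by (simp add: left_commutant_def)
      have Jc: "y \<in> carrier R" if "y \<in> ?J" for y using that by (simp add: left_commutant_def)
      have fJ: "f y = y" if "y \<in> ?J" for y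
        using comm[OF that one_closed] F(2) Jc[OF that] by simp
      obtain x0 where x0: "x0 \<in> carrier R" "x0 \<notin> ?J" using J(2) subgroup.subset[OF J(1)] by auto
      let ?c = "inv x0 \<otimes> f x0"
      have fx0: "f x0 \<in> carrier R" by (rule F(4)[OF x0(1)])
      have cN: "?c \<in> N" using coset_iff(1)[OF x0(1) fx0] F(3)[OF x0(1)] by simp
      have x0c: "x0 \<otimes> ?c = f x0" using x0(1) fx0 by (simp add: m_assoc[symmetric])
      have cc: "?c \<in> carrier R" using x0(1) fx0 by simp
      \<comment> \<open>Index 2 gives y = j x0 with j in J, and f (j x0) = j f x0.\<close>
      have fout: "f y = y \<otimes> ?c" if y: "y \<in> carrier R" "y \<notin> ?J" for y
      proof -
        have ix: "inv x0 \<notin> ?J"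
          using subgroup.m_inv_closed[OF J(1), of "inv x0"] x0 by auto
        have iy: "inv y \<notin> ?J"
          using subgroup.m_inv_closed[OF J(1), of "inv y"] y by auto
        have "inv (inv y) \<otimes> inv x0 \<in> ?J" by (rule idx) (use ix iy x0 y in auto)
        then have a: "y \<otimes> inv x0 \<in> ?J" using y by simp
        have e: "y = (y \<otimes> inv x0) \<otimes> x0" using y(1) x0(1) by (simp add: m_assoc)
        have "f y = f ((y \<otimes> inv x0) \<otimes> x0)" using e by simp
        also have "\<dots> = (y \<otimes> inv x0) \<otimes> f x0" by (rule comm[OF a x0(1)])
        also have "\<dots> = y \<otimes> ?c" using y(1) x0(1) fx0 by (simp add: m_assoc)
        finally show ?thesis .
      qed
      have half: "half_translation ?J ?c x = f x" if "x \<in> carrier R" for x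
        using fJ fout that by (simp add: half_translation_def)
      have c1: "?c \<noteq> \<one>"
      proof
        assume c: "?c = \<one>"
        have "f x = x" if "x \<in> carrier R" for x
          using fJ fout[unfolded c] that by (cases "x \<in> ?J") simp_all
        then show False using coset_auts_nontrivial_point[OF f] by auto
      qed
      have "S \<in> ?T"
        by (intro CollectI conjI exI[of _ ?J] exI[of _ ?c] ballI impI S J cN c1 idx) (simp_all add: half F(11))
      then show False using nT by (rule notE[rotated])
    qed
  qed
  then show ?thesis
  proof (rule card_three_families_le)
    show "real (card ?A) \<le> guess_bound * count_bound"
    proof (cases "7 \<le> card N")
      case True
      then show ?thesis using nontrivial_action_family_le[OF ex True NR] by simp
    next
      case False
      then show ?thesis using bound_nonneg by (simp add: count_bound_def)
    qed
    show "real (card (\<Union>H\<in>?\<H>. ?G H)) \<le> guess_bound * count_bound"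
    proof (rule subgroup_family_le)
      fix H assume H: "H \<in> ?\<H>"
      then show "subgroup H R \<and> H \<noteq> carrier R" by simp
      show "real (card (?G H)) \<le> count_bound"
        by (rule noninvolutory_family_le[OF ex n2]) (use H in auto)
    qed
    show "real (card ?T) \<le> guess_bound * count_bound" by (rule half_translation_family_le[OF ne n2])
  qed auto
qed

lemma nontrivial_coset_auts_bound:
  assumes ne: "\<not> exceptional" and N1: "N \<noteq> {\<one>}" and NR: "N \<noteq> carrier R"
  shows "real (card {S\<in>inverse_closed. \<exists>f\<in>coset_auts S. f \<noteq> (\<lambda>x\<in>carrier R. x)})
    \<le> 2 powr (c_num R - real (order R) / (192 * real (card N)) + (log 2 (real (order R)))\<^sup>2 + 3)"
    (is "real (card ?U) \<le> _")
proof -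
  have "card N \<noteq> 1"
  proof
    assume "card N = 1"
    then obtain a where "N = {a}" using card_1_singletonE by auto
    then show False using N_one N1 by simp
  qed
  then have n2: "2 \<le> card N" using card_N_pos by simp
  have "real (card ?U) \<le> 3 * (guess_bound * count_bound)"
  proof (cases "\<exists>x\<in>carrier R. x \<otimes> x \<notin> N")
    case True
    show ?thesis by (rule noninvolutory_bound[OF True ne n2 NR])
  next
    case False
    show ?thesis by (rule involutory_bound[OF _ ne n2 NR]) (use False in auto)
  qed
  also have "\<dots> \<le> 8 * (guess_bound * count_bound)" by (rule mult_right_mono[OF _ bound_nonneg]) simp
  also have "\<dots> = 2 powr (c_num R - real (order R) / (192 * real (card N)) + (log 2 (real (order R)))\<^sup>2 + 3)"
    unfolding count_bound_def by (simp add: powr_add)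
  finally show ?thesis .
qed

end

section \<open>Normalisers in the automorphism group of a Cayley graph\<close>

context group
begin

lemma cayley_aut_simps:
  "one (cayley_aut G S) = (\<lambda>x\<in>carrier G. x)"
  "f \<in> carrier (cayley_aut G S) \<longleftrightarrow> f \<in> Bij (carrier G) \<and> (`) f ` cayley_edges G S = cayley_edges G S"
  "f \<in> Bij (carrier G) \<Longrightarrow> g \<in> Bij (carrier G) \<Longrightarrow> mult (cayley_aut G S) f g = compose (carrier G) f g"
  by (simp_all add: cayley_aut_def BijGroup_def)

lemma cayley_edges_subset: "e \<in> cayley_edges G S \<Longrightarrow> e \<subseteq> carrier G"
  by (auto simp: cayley_edges_def)

text \<open>An edge is unordered, so it may be presented with r and t exchanged; closure of S under
  inversion makes both readings agree.\<close>

lemma cayley_edge_iff: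
  assumes S: "\<forall>x\<in>S. inv x \<in> S" and r: "r \<in> carrier G" and t: "t \<in> carrier G"
  shows "{r, t} \<in> cayley_edges G S \<longleftrightarrow> t \<otimes> inv r \<in> S"
proof
  assume "{r, t} \<in> cayley_edges G S"
  then obtain r' t' where e: "{r, t} = {r', t'}" and rt: "r' \<in> carrier G" "t' \<in> carrier G" "t' \<otimes> inv r' \<in> S"
    by (auto simp: cayley_edges_def)
  have i: "inv (t' \<otimes> inv r') \<in> S" using S rt(3) by simp
  then have "r' \<otimes> inv t' \<in> S" using rt(1,2) by (simp add: inv_mult_group)
  then show "t \<otimes> inv r \<in> S" using e rt(3) unfolding doubleton_eq_iff by auto
next
  assume "t \<otimes> inv r \<in> S"
  then show "{r, t} \<in> cayley_edges G S" using r t by (auto simp: cayley_edges_def)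
qed

text \<open>The edge condition in the form used by \<open>coset_auts\<close>. Surjectivity of f
  provides preimages of the end points of an edge, so preserving edges in both directions amounts to
  equality of the edge sets.\<close>

lemma cayley_aut_iff:
  assumes S: "\<forall>x\<in>S. inv x \<in> S" and f: "f \<in> Bij (carrier G)"
  shows "f \<in> carrier (cayley_aut G S) \<longleftrightarrow>
    (\<forall>x\<in>carrier G. \<forall>y\<in>carrier G. f y \<otimes> inv (f x) \<in> S \<longleftrightarrow> y \<otimes> inv x \<in> S)"
proof -
  let ?E = "cayley_edges G S"
  have fi: "inj_on f (carrier G)" and fs: "f ` carrier G = carrier G" using f by (auto simp: Bij_def bij_betw_def)
  have fc: "f x \<in> carrier G" if "x \<in> carrier G" for x using that fs by auto
  have im: "f ` {x, y} = {f x, f y}" for x y by simp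
  have "(`) f ` ?E = ?E \<longleftrightarrow> (\<forall>x\<in>carrier G. \<forall>y\<in>carrier G. {f x, f y} \<in> ?E \<longleftrightarrow> {x, y} \<in> ?E)"
  proof
    assume e: "(`) f ` ?E = ?E"
    show "\<forall>x\<in>carrier G. \<forall>y\<in>carrier G. {f x, f y} \<in> ?E \<longleftrightarrow> {x, y} \<in> ?E"
    proof (intro ballI)
      fix x y assume xy: "x \<in> carrier G" "y \<in> carrier G"
      show "{f x, f y} \<in> ?E \<longleftrightarrow> {x, y} \<in> ?E"
      proof
        assume "{x, y} \<in> ?E"
        then have "f ` {x, y} \<in> (`) f ` ?E" by (rule imageI)
        then show "{f x, f y} \<in> ?E" unfolding e im .
      next
        assume "{f x, f y} \<in> ?E"
        then have "f ` {x, y} \<in> (`) f ` ?E" unfolding e im .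
        then obtain d where d: "d \<in> ?E" "f ` {x, y} = f ` d" by (rule imageE)
        have "{x, y} = d"
          using inj_on_image_eq_iff[OF fi, of "{x, y}" d] xy cayley_edges_subset[OF d(1)] d(2) by simp
        then show "{x, y} \<in> ?E" using d(1) by simp
      qed
    qed
  next
    assume *: "\<forall>x\<in>carrier G. \<forall>y\<in>carrier G. {f x, f y} \<in> ?E \<longleftrightarrow> {x, y} \<in> ?E"
    have rep: "\<exists>x\<in>carrier G. \<exists>y\<in>carrier G. d = {x, y}" if "d \<in> ?E" for d
    proof -
      obtain x y where "d = {x, y}" "x \<in> carrier G" "y \<in> carrier G" using \<open>d \<in> ?E\<close> by (auto simp: cayley_edges_def)
      then show ?thesis by (intro bexI[of _ x] bexI[of _ y])
    qed
    show "(`) f ` ?E = ?E"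
    proof (intro equalityI subsetI)
      fix d assume "d \<in> (`) f ` ?E"
      then obtain e where e: "d = f ` e" "e \<in> ?E" by (rule imageE)
      obtain x y where xy: "x \<in> carrier G" "y \<in> carrier G" "e = {x, y}" using rep[OF e(2)] by (elim bexE)
      show "d \<in> ?E" unfolding e(1) xy(3) im using * xy e(2) by simp
    next
      fix d assume d: "d \<in> ?E"
      obtain x y where xy: "x \<in> carrier G" "y \<in> carrier G" "d = {x, y}" using rep[OF d] by (elim bexE)
      obtain u where u: "u \<in> carrier G" "x = f u" using xy(1) fs by (metis imageE)
      obtain v where v: "v \<in> carrier G" "y = f v" using xy(2) fs by (metis imageE)
      have "{u, v} \<in> ?E" using * u v d xy(3) by simp
      then have "f ` {u, v} \<in> (`) f ` ?E" by (rule imageI)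
      then show "d \<in> (`) f ` ?E" unfolding im xy(3) u(2) v(2) .
    qed
  qed
  then show ?thesis using f cayley_edge_iff[OF S] fc by (simp add: cayley_aut_simps(2))
qed

lemma group_cayley_aut:
  assumes S: "\<forall>x\<in>S. inv x \<in> S"
  shows "group (cayley_aut G S)"
proof -
  let ?B = "BijGroup (carrier G)" and ?X = "carrier (cayley_aut G S)"
  let ?P = "\<lambda>f. \<forall>x\<in>carrier G. \<forall>y\<in>carrier G. f y \<otimes> inv (f x) \<in> S \<longleftrightarrow> y \<otimes> inv x \<in> S"
  interpret B: group ?B by (rule group_BijGroup)
  have B: "carrier ?B = Bij (carrier G)" by (simp add: BijGroup_def)
  have memX: "f \<in> ?X \<longleftrightarrow> f \<in> Bij (carrier G) \<and> ?P f" for f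
    using cayley_aut_iff[OF S, of f] cayley_aut_simps(2)[of f S] by auto
  have "subgroup ?X ?B"
  proof (rule B.subgroupI)
    show "?X \<subseteq> carrier ?B" unfolding B using memX by auto
    have "(\<lambda>x\<in>carrier G. x) \<in> ?X" unfolding memX using id_Bij by simp
    then show "?X \<noteq> {}" by (metis empty_iff)
    fix f assume "f \<in> ?X"
    then have f: "f \<in> Bij (carrier G)" "?P f" unfolding memX by simp_all
    let ?g = "\<lambda>x\<in>carrier G. inv_into (carrier G) f x"
    have gB: "?g \<in> Bij (carrier G)" by (rule restrict_inv_into_Bij[OF f(1)])
    have fs: "f ` carrier G = carrier G" using f(1) by (simp add: Bij_def bij_betw_def)
    have fg: "f (?g x) = x" if "x \<in> carrier G" for x
      using f_inv_into_f[of x f "carrier G"] fs that by simp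
    have gc: "?g x \<in> carrier G" if "x \<in> carrier G" for x using Bij_imp_funcset[OF gB] that by (rule funcset_mem)
    have "?P ?g"
    proof (intro ballI)
      fix x y assume xy: "x \<in> carrier G" "y \<in> carrier G"
      show "?g y \<otimes> inv (?g x) \<in> S \<longleftrightarrow> y \<otimes> inv x \<in> S"
        by (rule HOL.sym[OF bspec[OF bspec[OF f(2) gc[OF xy(1)]] gc[OF xy(2)], unfolded fg[OF xy(1)] fg[OF xy(2)]]])
    qed
    then show "inv\<^bsub>?B\<^esub> f \<in> ?X"
      unfolding inv_BijGroup[OF f(1)] memX using gB by (simp only: simp_thms)
    fix h assume "h \<in> ?X"
    then have h: "h \<in> Bij (carrier G)" "?P h" unfolding memX by simp_all
    have hc: "h x \<in> carrier G" if "x \<in> carrier G" for x using Bij_imp_funcset[OF h(1)] that by (rule funcset_mem)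
    have "?P (compose (carrier G) f h)"
    proof (intro ballI)
      fix x y assume xy: "x \<in> carrier G" "y \<in> carrier G"
      show "compose (carrier G) f h y \<otimes> inv (compose (carrier G) f h x) \<in> S \<longleftrightarrow> y \<otimes> inv x \<in> S"
        unfolding compose_eq[OF xy(1)] compose_eq[OF xy(2)]
        using bspec[OF bspec[OF f(2) hc[OF xy(1)]] hc[OF xy(2)]] bspec[OF bspec[OF h(2) xy(1)] xy(2)] by (simp only:)
    qed
    then have "compose (carrier G) f h \<in> ?X" unfolding memX using compose_Bij[OF f(1) h(1)] by (simp only: simp_thms)
    moreover have "f \<otimes>\<^bsub>?B\<^esub> h = compose (carrier G) f h" using f(1) h(1) by (simp add: BijGroup_def)
    ultimately show "f \<otimes>\<^bsub>?B\<^esub> h \<in> ?X" by (simp only:)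
  qed
  then have "group (?B\<lparr>carrier := ?X\<rparr>)" by (rule B.subgroup_imp_group)
  then show ?thesis by (simp add: cayley_aut_def)
qed

lemma translation_Bij:
  assumes g: "g \<in> carrier G"
  shows "(\<lambda>x\<in>carrier G. x \<otimes> g) \<in> Bij (carrier G)"
proof -
  have "bij_betw (\<lambda>x. x \<otimes> g) (carrier G) (carrier G)"
    by (rule bij_betw_byWitness[where f' = "\<lambda>x. x \<otimes> inv g"]) (use g in \<open>auto simp: m_assoc\<close>)
  then have "bij_betw (\<lambda>x\<in>carrier G. x \<otimes> g) (carrier G) (carrier G)"
    by (subst bij_betw_cong[of _ _ "\<lambda>x. x \<otimes> g"]) auto
  then show ?thesis by (simp add: Bij_def)
qed

text \<open>A right translation leaves y \<otimes> inv x unchanged.\<close>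

lemma right_regular_cayley_aut:
  assumes S: "\<forall>x\<in>S. inv x \<in> S" and H: "H \<subseteq> carrier G"
  shows "right_regular G H \<subseteq> carrier (cayley_aut G S)"
proof
  fix f assume "f \<in> right_regular G H"
  then obtain g where g: "g \<in> carrier G" "f = (\<lambda>x\<in>carrier G. x \<otimes> g)" using H by (auto simp: right_regular_def)
  have "(y \<otimes> g) \<otimes> inv (x \<otimes> g) = y \<otimes> inv x" if "x \<in> carrier G" "y \<in> carrier G" for x y
  proof -
    have "g \<otimes> (inv g \<otimes> inv x) = inv x" using g(1) that by (simp add: m_assoc[symmetric])
    then show ?thesis using that g(1) by (simp add: inv_mult_group m_assoc)
  qed
  then show "f \<in> carrier (cayley_aut G S)"
    unfolding g(2) cayley_aut_iff[OF S translation_Bij[OF g(1)]] by simp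
qed

lemma normalizer_right_regular_iff:
  assumes S: "\<forall>x\<in>S. inv x \<in> S" and H: "H \<subseteq> carrier G"
  shows "f \<in> normalizer (cayley_aut G S) (right_regular G H) \<longleftrightarrow>
    f \<in> carrier (cayley_aut G S) \<and>
    f <#\<^bsub>cayley_aut G S\<^esub> right_regular G H #>\<^bsub>cayley_aut G S\<^esub> (inv\<^bsub>cayley_aut G S\<^esub> f) = right_regular G H"
  using right_regular_cayley_aut[OF S H] by (simp add: normalizer_def stabilizer_def)

text \<open>f conjugates the translation by n into the translation by some m in H, that is, f (y n)
  = f y m for all y; taking y = \<one> gives m = f n.\<close>

lemma normalizer_right_regular_mult:
  assumes S: "\<forall>x\<in>S. inv x \<in> S" and H: "H \<subseteq> carrier G"
    and f: "f \<in> normalizer (cayley_aut G S) (right_regular G H)" and f1: "f \<one> = \<one>"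
    and x: "x \<in> carrier G" and n: "n \<in> H"
  shows "f (x \<otimes> n) = f x \<otimes> f n"
proof -
  let ?A = "cayley_aut G S"
  interpret A: group ?A by (rule group_cayley_aut[OF S])
  have fA: "f \<in> carrier ?A" and e: "f <#\<^bsub>?A\<^esub> right_regular G H #>\<^bsub>?A\<^esub> (inv\<^bsub>?A\<^esub> f) = right_regular G H"
    using f unfolding normalizer_right_regular_iff[OF S H] by simp_all
  have fB: "f \<in> Bij (carrier G)" using fA by (simp add: cayley_aut_simps)
  have fc: "f y \<in> carrier G" if "y \<in> carrier G" for y using Bij_imp_funcset[OF fB] that by auto
  have nc: "n \<in> carrier G" using n H by auto
  let ?r = "\<lambda>x\<in>carrier G. x \<otimes> n"
  have rn: "?r \<in> right_regular G H" using n unfolding right_regular_def by (rule imageI)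
  have rA: "?r \<in> carrier ?A" using right_regular_cayley_aut[OF S H] rn by auto
  have "f \<otimes>\<^bsub>?A\<^esub> ?r \<otimes>\<^bsub>?A\<^esub> inv\<^bsub>?A\<^esub> f \<in> f <#\<^bsub>?A\<^esub> right_regular G H #>\<^bsub>?A\<^esub> (inv\<^bsub>?A\<^esub> f)"
    unfolding r_coset_def l_coset_def using rn by auto
  then have "f \<otimes>\<^bsub>?A\<^esub> ?r \<otimes>\<^bsub>?A\<^esub> inv\<^bsub>?A\<^esub> f \<in> right_regular G H" by (simp only: e)
  then obtain m where m: "f \<otimes>\<^bsub>?A\<^esub> ?r \<otimes>\<^bsub>?A\<^esub> inv\<^bsub>?A\<^esub> f = (\<lambda>x\<in>carrier G. x \<otimes> m)" "m \<in> H"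
    unfolding right_regular_def by (rule imageE)
  let ?s = "\<lambda>x\<in>carrier G. x \<otimes> m"
  have mc: "m \<in> carrier G" using m(2) H by auto
  have "f \<otimes>\<^bsub>?A\<^esub> ?r = f \<otimes>\<^bsub>?A\<^esub> ?r \<otimes>\<^bsub>?A\<^esub> inv\<^bsub>?A\<^esub> f \<otimes>\<^bsub>?A\<^esub> f" using fA rA by (simp add: A.m_assoc)
  then have "f \<otimes>\<^bsub>?A\<^esub> ?r = ?s \<otimes>\<^bsub>?A\<^esub> f" using m(1) by simp
  then have c: "compose (carrier G) f ?r = compose (carrier G) ?s f"
    using fB translation_Bij[OF nc] translation_Bij[OF mc] by (simp add: cayley_aut_simps)
  have fm: "f (y \<otimes> n) = f y \<otimes> m" if "y \<in> carrier G" for y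
    using fun_cong[OF c, of y] that fc by (simp add: compose_def)
  have "f n = m" using fm[OF one_closed] f1 nc mc by simp
  then show ?thesis using fm[OF x] by simp
qed

text \<open>An automorphism mapping every element to itself or to its inverse normalises the regular
  representation in the automorphism group of every Cayley graph.\<close>

lemma elementwise_inverting_automorphism_normalizer:
  assumes S: "\<forall>x\<in>S. inv x \<in> S" and fin: "finite (carrier G)"
    and \<theta>: "\<And>x. x \<in> carrier G \<Longrightarrow> \<theta> x = x \<or> \<theta> x = inv x"
    and hom: "\<And>a b. a \<in> carrier G \<Longrightarrow> b \<in> carrier G \<Longrightarrow> \<theta> (a \<otimes> b) = \<theta> a \<otimes> \<theta> b"
    and nontriv: "\<exists>x\<in>carrier G. \<theta> x \<noteq> x"
  shows "right_regular G (carrier G) \<noteq> normalizer (cayley_aut G S) (right_regular G (carrier G))"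
proof
  assume eq: "right_regular G (carrier G) = normalizer (cayley_aut G S) (right_regular G (carrier G))"
  let ?A = "cayley_aut G S" and ?t = "\<lambda>x\<in>carrier G. \<theta> x"
  interpret A: group ?A by (rule group_cayley_aut[OF S])
  have \<theta>c: "\<theta> x \<in> carrier G" if "x \<in> carrier G" for x using \<theta>[OF that] that by auto
  have \<theta>1: "\<theta> \<one> = \<one>" using \<theta>[OF one_closed] by auto
  have \<theta>i: "\<theta> (inv x) = inv (\<theta> x)" if x: "x \<in> carrier G" for x
  proof -
    have "\<theta> (inv x) \<otimes> \<theta> x = \<one>" using hom[of "inv x" x] x \<theta>1 by simp
    then show ?thesis using inv_equality[of "\<theta> (inv x)" "\<theta> x"] \<theta>c x by simp
  qed
  have inj: "inj_on \<theta> (carrier G)"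
  proof (rule inj_onI)
    fix x y assume xy: "x \<in> carrier G" "y \<in> carrier G" "\<theta> x = \<theta> y"
    have "\<theta> (x \<otimes> inv y) = \<one>" using hom[of x "inv y"] \<theta>i xy \<theta>c by simp
    moreover have d: "x \<otimes> inv y \<in> carrier G" using xy by simp
    ultimately have "x \<otimes> inv y = \<one>" using \<theta>[OF d] inv_eq_1_iff[OF d] by metis
    then show "x = y" using inv_equality[of x "inv y"] xy by simp
  qed
  have surj: "\<theta> ` carrier G = carrier G" by (rule endo_inj_surj[OF fin _ inj]) (use \<theta>c in auto)
  have "bij_betw ?t (carrier G) (carrier G)"
    using inj surj by (subst bij_betw_cong[of _ _ \<theta>]) (auto simp: bij_betw_def)
  then have tB: "?t \<in> Bij (carrier G)" by (simp add: Bij_def)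
  have \<theta>S: "\<theta> x \<in> S \<longleftrightarrow> x \<in> S" if x: "x \<in> carrier G" for x
    using \<theta>[OF x] bspec[OF S, of x] bspec[OF S, of "inv x"] x by auto
  have tA: "?t \<in> carrier ?A"
    unfolding cayley_aut_iff[OF S tB]
  proof (intro ballI)
    fix x y assume xy: "x \<in> carrier G" "y \<in> carrier G"
    have "\<theta> y \<otimes> inv (\<theta> x) = \<theta> (y \<otimes> inv x)" using hom[of y "inv x"] \<theta>i xy by simp
    then show "?t y \<otimes> inv (?t x) \<in> S \<longleftrightarrow> y \<otimes> inv x \<in> S" using \<theta>S[of "y \<otimes> inv x"] xy by simp
  qed
  let ?r = "\<lambda>g. \<lambda>x\<in>carrier G. x \<otimes> g"
  have rA: "?r g \<in> carrier ?A" if "g \<in> carrier G" for g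
    using right_regular_cayley_aut[OF S subset_refl] that unfolding right_regular_def by auto
  have conj: "?t \<otimes>\<^bsub>?A\<^esub> ?r g \<otimes>\<^bsub>?A\<^esub> inv\<^bsub>?A\<^esub> ?t = ?r (\<theta> g)" if g: "g \<in> carrier G" for g
  proof -
    have "compose (carrier G) ?t (?r g) = compose (carrier G) (?r (\<theta> g)) ?t"
      unfolding compose_def by (rule restrict_ext) (use g \<theta>c hom in simp)
    then have "?t \<otimes>\<^bsub>?A\<^esub> ?r g = ?r (\<theta> g) \<otimes>\<^bsub>?A\<^esub> ?t"
      using tB translation_Bij[OF g] translation_Bij[OF \<theta>c[OF g]] by (simp add: cayley_aut_simps)
    then show ?thesis using tA rA[OF \<theta>c[OF g]] by (simp add: A.m_assoc)
  qed
  have "?t <#\<^bsub>?A\<^esub> right_regular G (carrier G) #>\<^bsub>?A\<^esub> (inv\<^bsub>?A\<^esub> ?t)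
      = (\<lambda>g. ?t \<otimes>\<^bsub>?A\<^esub> ?r g \<otimes>\<^bsub>?A\<^esub> inv\<^bsub>?A\<^esub> ?t) ` carrier G"
    unfolding r_coset_def l_coset_def right_regular_def by auto
  also have "\<dots> = (\<lambda>g. ?r (\<theta> g)) ` carrier G" by (rule image_cong[OF HOL.refl conj])
  also have "\<dots> = ?r ` (\<theta> ` carrier G)" by (simp only: image_image)
  also have "\<dots> = right_regular G (carrier G)" unfolding surj right_regular_def ..
  \<comment> \<open>If the normaliser were the regular representation itself, \<theta> would be a
    right translation that fixes \<one>, hence trivial.\<close>
  finally have "?t \<in> normalizer ?A (right_regular G (carrier G))"
    unfolding normalizer_right_regular_iff[OF S subset_refl] using tA by simp
  then have "?t \<in> right_regular G (carrier G)" using eq by simp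
  then obtain g where g: "?t = ?r g" "g \<in> carrier G" unfolding right_regular_def by (rule imageE)
  have "g = \<one>" using fun_cong[OF g(1), of \<one>] g(2) \<theta>1 by simp
  then have "\<theta> x = x" if "x \<in> carrier G" for x using fun_cong[OF g(1), of x] that by simp
  then show False using nontriv by simp
qed

end

section \<open>Translation of the statement into coset automorphisms\<close>

context coset_setting
begin

lemma inverse_closed_iff: "S \<in> inverse_closed \<longleftrightarrow> S \<subseteq> carrier R \<and> S = set_inv S"
proof
  assume S: "S \<in> inverse_closed"
  then have sub: "S \<subseteq> carrier R" and i: "\<And>x. x \<in> S \<Longrightarrow> inv x \<in> S" by (auto simp: inverse_closed_def)
  have "S = set_inv S"
  proof (intro equalityI subsetI)
    fix x assume x: "x \<in> S"
    have "x = inv (inv x)" using x sub by auto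
    then show "x \<in> set_inv S" using i[OF x] unfolding SET_INV_def by auto
  qed (use i in \<open>auto simp: SET_INV_def\<close>)
  then show "S \<subseteq> carrier R \<and> S = set_inv S" using sub by simp
next
  assume *: "S \<subseteq> carrier R \<and> S = set_inv S"
  have "inv x \<in> S" if "x \<in> S" for x
  proof -
    have "inv x \<in> set_inv S" using that unfolding SET_INV_def by auto
    then show ?thesis using * by simp
  qed
  then show "S \<in> inverse_closed" using * by (simp add: inverse_closed_def)
qed

text \<open>The orbit of x under N is the left coset x N, which is \<open>N #> x\<close> by
  normality; so fixing it setwise gives f x \<in> N #> x.\<close>

lemma nontrivial_normalising_aut_coset_auts:
  assumes S: "S \<in> inverse_closed" and ex: "has_nontrivial_normalising_aut R N S"
  shows "\<exists>f\<in>coset_auts S. f \<noteq> (\<lambda>x\<in>carrier R. x)"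
proof -
  have Si: "\<forall>x\<in>S. inv x \<in> S" using S by (simp add: inverse_closed_def)
  obtain f where f: "f \<in> normalizer (cayley_aut R S) (right_regular R N)"
    and ne: "f \<noteq> one (cayley_aut R S)" and f1: "f \<one> = \<one>"
    and orb: "\<forall>B\<in>right_orbits R N. f ` B = B"
    using ex unfolding has_nontrivial_normalising_aut_def by auto
  have fA: "f \<in> carrier (cayley_aut R S)"
    using f unfolding normalizer_right_regular_iff[OF Si N_subset] by simp
  have fB: "f \<in> Bij (carrier R)" using fA by (simp add: cayley_aut_simps)
  have "f x \<in> N #> x" if x: "x \<in> carrier R" for x
  proof -
    let ?O = "orbit (BijGroup (carrier R)\<lparr>carrier := right_regular R N\<rparr>) (\<lambda>f. f) x"
    have "?O = (\<lambda>f. f x) ` right_regular R N" by (auto simp: orbit_def image_def)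
    then have O: "?O = (\<lambda>n. x \<otimes> n) ` N" unfolding right_regular_def image_image using x by simp
    have "?O \<in> right_orbits R N" using x unfolding right_orbits_def orbits_def by auto
    then have "f ` ((\<lambda>n. x \<otimes> n) ` N) = (\<lambda>n. x \<otimes> n) ` N" using orb O by simp
    moreover have "x \<in> (\<lambda>n. x \<otimes> n) ` N" using N_one x by (intro image_eqI[of _ _ \<one>]) simp_all
    ultimately have "f x \<in> (\<lambda>n. x \<otimes> n) ` N" by (metis imageI)
    then obtain n where "n \<in> N" "f x = x \<otimes> n" by auto
    then show ?thesis using coset_mult[OF x coset_self[OF x]] by simp
  qed
  then have "f \<in> coset_auts S"
    unfolding coset_auts_def
    using fB f1 normalizer_right_regular_mult[OF Si N_subset f f1] fA[unfolded cayley_aut_iff[OF Si fB]] by simp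
  then show ?thesis using ne by (intro bexI[of _ f]) (simp_all add: cayley_aut_simps)
qed

text \<open>The automorphism is inversion in the abelian case, and in the other case the map that
  fixes C pointwise and inverts its complement.\<close>

lemma exceptional_not_normal:
  assumes exc: exceptional and S: "S \<in> inverse_closed"
  shows "right_regular R (carrier R) \<noteq> normalizer (cayley_aut R S) (right_regular R (carrier R))"
proof -
  have Si: "\<forall>x\<in>S. inv x \<in> S" using S by (simp add: inverse_closed_def)
  from exc[unfolded exceptional_def] show ?thesis
  proof
    assume c: "comm_group R \<and> (\<exists>x\<in>carrier R. x \<otimes> x \<noteq> \<one>)"
    interpret C: comm_group R using c by simp
    obtain x where x: "x \<in> carrier R" "x \<otimes> x \<noteq> \<one>" using c by auto
    have "inv x \<noteq> x"
    proof
      assume "inv x = x"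
      then have "x \<otimes> x = inv x \<otimes> x" by simp
      then show False using x by simp
    qed
    then show ?thesis
      by (intro elementwise_inverting_automorphism_normalizer[OF Si fin, of "\<lambda>x. inv x"])
        (use x in \<open>auto simp: C.inv_mult\<close>)
  next
    assume "\<exists>C y. twisted_dihedral C y"
    then obtain C y where td: "twisted_dihedral C y" by auto
    show ?thesis
      by (rule elementwise_inverting_automorphism_normalizer[OF Si fin, of "\<lambda>x. if x \<in> C then x else inv x"])
        (use twisted_dihedral_automorphism[OF td] in auto)
  qed
qed

lemma exceptional_cases: "exceptional \<Longrightarrow> (comm_group R \<and> group_exponent R > 2) \<or> generalised_dicyclic R"
  unfolding exceptional_def using group_exponent_gt_2_iff[OF fin] twisted_dihedral_cases[OF fin] by auto

end

theorem theorem1p6: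
  fixes R :: "('a, 'b) monoid_scheme" and N :: "'a set"
  assumes "group R" and "finite (carrier R)"
    and "N \<lhd> R" and "N \<noteq> {\<one>\<^bsub>R\<^esub>}" and "N \<noteq> carrier R"
  shows "real (card {S. S \<subseteq> carrier R \<and> S = set_inv\<^bsub>R\<^esub> S \<and>
             right_regular R (carrier R)
               = normalizer (cayley_aut R S) (right_regular R (carrier R)) \<and>
             has_nontrivial_normalising_aut R N S})
           \<le> 2 powr (c_num R - real (order R) / (192 * real (card N))
                      + (log 2 (real (order R)))\<^sup>2 + 3)
         \<and> (\<not> (comm_group R \<and> group_exponent R > 2) \<and> \<not> generalised_dicyclic R \<longrightarrow>
           real (card {S. S \<subseteq> carrier R \<and> S = set_inv\<^bsub>R\<^esub> S \<and>
             has_nontrivial_normalising_aut R N S})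
           \<le> 2 powr (c_num R - real (order R) / (192 * real (card N))
                      + (log 2 (real (order R)))\<^sup>2 + 3))"
proof -
  interpret R: coset_setting R N
    using assms(1-3) by (intro coset_setting.intro coset_setting_axioms.intro)
  let ?bound = "2 powr (c_num R - real (order R) / (192 * real (card N)) + (log 2 (real (order R)))\<^sup>2 + 3)"
  let ?F = "{S. S \<subseteq> carrier R \<and> S = set_inv\<^bsub>R\<^esub> S \<and> has_nontrivial_normalising_aut R N S}"
  let ?F' = "{S. S \<subseteq> carrier R \<and> S = set_inv\<^bsub>R\<^esub> S \<and>
    right_regular R (carrier R) = normalizer (cayley_aut R S) (right_regular R (carrier R)) \<and>
    has_nontrivial_normalising_aut R N S}"
  let ?U = "{S\<in>R.inverse_closed. \<exists>f\<in>R.coset_auts S. f \<noteq> (\<lambda>x\<in>carrier R. x)}"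
  have sub: "?F \<subseteq> ?U"
  proof
    fix S assume S: "S \<in> ?F"
    then have "S \<in> R.inverse_closed" using R.inverse_closed_iff by simp
    then show "S \<in> ?U" using R.nontrivial_normalising_aut_coset_auts S by simp
  qed
  have finU: "finite ?U" by (rule finite_subset[OF _ R.finite_inverse_closed]) simp
  have le: "real (card \<F>) \<le> ?bound" if "\<not> R.exceptional" "\<F> \<subseteq> ?F" for \<F>
  proof -
    have "card \<F> \<le> card ?U" by (rule card_mono[OF finU]) (use that(2) sub in \<open>rule subset_trans\<close>)
    also have "real (card ?U) \<le> ?bound" by (rule R.nontrivial_coset_auts_bound[OF that(1) assms(4,5)])
    finally show ?thesis by simp
  qed
  have "real (card ?F') \<le> ?bound"
  proof (cases R.exceptional)
    case True
    have "?F' = {}" using R.exceptional_not_normal[OF True] R.inverse_closed_iff by auto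
    then show ?thesis by (simp only: card.empty) simp
  next
    case False
    show ?thesis by (rule le[OF False]) auto
  qed
  moreover have "real (card ?F) \<le> ?bound"
    if "\<not> (comm_group R \<and> group_exponent R > 2) \<and> \<not> generalised_dicyclic R"
    using le[OF _ subset_refl] R.exceptional_cases that by auto
  ultimately show ?thesis by simp
qed

end
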